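(* Let $G$ be a multigraph (no loops) with maximum degree $\Delta$, multiplicity $\mu$ and chromatic index $\chi'>\Delta+1$. If \[ \chi'\ge \Delta+\min\left\{2\sqrt{\mu\left(\log\log\tfrac{\Delta}{2}+\log 2\mu\right)},\ \sqrt[3]{\mu\log\tfrac{\Delta}{2}}\right\}, \] then $G$ is elementary, i.e. $\chi'(G)=\omega(G)$.
   Context: $\log$ denotes the natural logarithm. The multiplicity $\mu$ is the maximum number of edges joining a pair of vertices. The density of $G$ is $\omega(G)=\max_{H\subseteq G,\,|V(H)|\ge 2}\left\lceil \frac{|E(H)|}{\lfloor |V(H)|/2\rfloor}\right\rceil$; $G$ is elementary if $\chi'(G)=\omega(G)$. *)

theory Defs
  imports Complex_Main
begin

text \<open>A loopless multigraph: finite vertex set V, finite set E of edge identifiers,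
  and an endpoint map ends assigning to each edge a 2-element subset of V.
  Parallel edges are distinct identifiers with the same endpoint set.\<close>

definition multigraph :: "'a set \<Rightarrow> 'e set \<Rightarrow> ('e \<Rightarrow> 'a set) \<Rightarrow> bool" where
  "multigraph V E ends \<longleftrightarrow> finite V \<and> finite E \<and>
     (\<forall>e\<in>E. ends e \<subseteq> V \<and> card (ends e) = 2)"

definition degree :: "'e set \<Rightarrow> ('e \<Rightarrow> 'a set) \<Rightarrow> 'a \<Rightarrow> nat" where
  "degree E ends v = card {e\<in>E. v \<in> ends e}"

definition max_degree :: "'a set \<Rightarrow> 'e set \<Rightarrow> ('e \<Rightarrow> 'a set) \<Rightarrow> nat" where
  "max_degree V E ends = Max (insert 0 (degree E ends ` V))"

definition multiplicity :: "'a set \<Rightarrow> 'e set \<Rightarrow> ('e \<Rightarrow> 'a set) \<Rightarrow> nat" where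
  "multiplicity V E ends =
     Max (insert 0 {card {e\<in>E. ends e = {u, v}} | u v. u \<in> V \<and> v \<in> V \<and> u \<noteq> v})"

definition proper_edge_colouring ::
  "'e set \<Rightarrow> ('e \<Rightarrow> 'a set) \<Rightarrow> nat \<Rightarrow> ('e \<Rightarrow> nat) \<Rightarrow> bool" where
  "proper_edge_colouring E ends k c \<longleftrightarrow>
     (\<forall>e\<in>E. c e < k) \<and>
     (\<forall>e\<in>E. \<forall>f\<in>E. e \<noteq> f \<and> ends e \<inter> ends f \<noteq> {} \<longrightarrow> c e \<noteq> c f)"

definition chromatic_index :: "'e set \<Rightarrow> ('e \<Rightarrow> 'a set) \<Rightarrow> nat" where
  "chromatic_index E ends = (LEAST k. \<exists>c. proper_edge_colouring E ends k c)"

definition density :: "'a set \<Rightarrow> 'e set \<Rightarrow> ('e \<Rightarrow> 'a set) \<Rightarrow> int" where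
  "density V E ends =
     Max {\<lceil>real (card F) / real (card W div 2)\<rceil> | W F.
            W \<subseteq> V \<and> F \<subseteq> E \<and> (\<forall>e\<in>F. ends e \<subseteq> W) \<and> card W \<ge> 2}"

definition elementary :: "'a set \<Rightarrow> 'e set \<Rightarrow> ('e \<Rightarrow> 'a set) \<Rightarrow> bool" where
  "elementary V E ends \<longleftrightarrow> int (chromatic_index E ends) = density V E ends"

end

(* Write chi' = Delta + s + 1 and let k = chi' - 1.  In a minimal subgraph that is not k-edge-colourable, delete
   one edge and colour the rest.  Vertex-Tashkinov closures of the uncoloured edge, taken maximal over all such
   colourings, are elementary; when such a closure is also tight (every colour not missing in it leaves it at most
   once) it is a dense subgraph, and the density equals chi'.

   Otherwise the closure W is contracted to a "fat root".  A Tashkinov-type theorem still holds for tails starting at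
   an exit vertex of W, provided that the recolourings keep the exit paths of W intact: every exit colour d is
   paired with two reserved colours G d that the tail may only use once d itself is missing on it.  Iterating
   (a maximal tail, made closed, is the next fat root) gives a sequence of vertex sets n_0 < n_1 < ... whose growth is
   exponential, because all non-reserved missing colours of one set are present at the first new vertex and lead to
   the new part, so that their number is at most mu times its size.  Since a set of size n has at least n s + 2
   missing colours, the sizes are bounded by Delta / s.  Comparing the two bounds contradicts the hypothesis
   on chi'. *)

theory Submission
  imports Defs
begin

section \<open>Components of graphs of maximum degree two\<close>

text \<open>Two growths compound. Inside the maximal closure an exit vertex cannot spare a single
  one of its at least \<open>s\<close> missing colours; forbidding all of them and releasing them
  one by one enlarges the closure each time by a factor of about \<open>1 + s/\<mu>\<close> or more.
  So its size \<open>n\<close> is at least exponential in \<open>s^2/\<mu>\<close>, and at least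
  \<open>2 * s + 3\<close> by parity. The iteration of fat roots can be run for a number of rounds
  of order \<open>n * s\<close>, because a round merely gives up one colour kept off the tails or
  protects one more exit colour; each round again multiplies by about \<open>1 + s/\<mu>\<close>.
  Hence \<open>ln (\<Delta>/2)\<close> exceeds roughly \<open>n * s^2/\<mu>\<close>: the exponential
  bound on \<open>n\<close> yields the square root in the hypothesis, the linear bound the cube
  root. The obstacle is that recolourings must not alter how exit colours cross \<open>W\<close>, so
  a protected colour may not be swapped along chains through \<open>W\<close>. It can still become
  missing on the tail, and is then exchanged only against a colour missing in \<open>W\<close>. The
  reserved colours guarantee such a partner; two are needed because one of them may be the colour of
  the tail edge at hand.\<close>

definition adj_via :: "('e \<Rightarrow> 'a set) \<Rightarrow> 'e set \<Rightarrow> ('a \<times> 'a) set" where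
  "adj_via ends H = {(u, v). \<exists>e\<in>H. ends e = {u, v}}"

lemma adj_via_sym: "(u, v) \<in> adj_via ends H \<Longrightarrow> (v, u) \<in> adj_via ends H"
  by (auto simp: adj_via_def insert_commute)

lemma adj_via_rtrancl_sym: "(u, v) \<in> (adj_via ends H)\<^sup>* \<Longrightarrow> (v, u) \<in> (adj_via ends H)\<^sup>*"
  by (metis adj_via_sym symI sym_rtrancl symD)

lemma adj_via_mono: "H \<subseteq> H' \<Longrightarrow> adj_via ends H \<subseteq> adj_via ends H'"
  by (auto simp: adj_via_def)

definition deg_in :: "('e \<Rightarrow> 'a set) \<Rightarrow> 'e set \<Rightarrow> 'a \<Rightarrow> nat" where
  "deg_in ends H v = card {e\<in>H. v \<in> ends e}"

lemma component_closed:
  assumes "e \<in> H" "card (ends e) = 2" "C = (adj_via ends H)\<^sup>* `` {u}" "ends e \<inter> C \<noteq> {}"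
  shows "ends e \<subseteq> C"
proof -
  obtain p q where pq: "ends e = {p, q}" using assms(2) by (meson card_2_iff)
  have a: "(p, q) \<in> adj_via ends H" "(q, p) \<in> adj_via ends H"
    using assms(1) pq by (auto simp: adj_via_def insert_commute)
  show ?thesis using assms(3,4) pq a by (auto intro: rtrancl.rtrancl_into_rtrancl)
qed

lemma finite_component:
  assumes "finite H" "\<And>e. e \<in> H \<Longrightarrow> card (ends e) = 2"
  shows "finite ((adj_via ends H)\<^sup>* `` {u})"
proof -
  have "(adj_via ends H)\<^sup>* `` {u} \<subseteq> insert u (\<Union>(ends ` H))"
  proof
    fix v assume "v \<in> (adj_via ends H)\<^sup>* `` {u}"
    then have "(u, v) \<in> (adj_via ends H)\<^sup>*" by simp
    then show "v \<in> insert u (\<Union>(ends ` H))"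
      by (cases rule: rtranclE) (auto simp: adj_via_def)
  qed
  moreover have "finite (insert u (\<Union>(ends ` H)))"
    using assms by (metis (no_types, lifting) card.infinite finite.insertI finite_UN_I zero_neq_numeral)
  ultimately show ?thesis by (rule finite_subset)
qed

lemma handshake:
  assumes H: "finite H" "\<And>e. e \<in> H \<Longrightarrow> card (ends e) = 2" and C: "finite C"
    and cl: "\<And>e. e \<in> H \<Longrightarrow> ends e \<inter> C \<noteq> {} \<Longrightarrow> ends e \<subseteq> C"
  shows "(\<Sum>v\<in>C. deg_in ends H v) = 2 * card {e\<in>H. ends e \<subseteq> C}"
proof -
  have "(\<Sum>v\<in>C. deg_in ends H v) = (\<Sum>v\<in>C. \<Sum>e\<in>H. if v \<in> ends e then 1 else 0)"
    unfolding deg_in_def using H(1) by (intro sum.cong refl) (simp add: sum.If_cases Int_def)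
  also have "\<dots> = (\<Sum>e\<in>H. \<Sum>v\<in>C. if v \<in> ends e then 1 else 0)" by (rule sum.swap)
  also have "\<dots> = (\<Sum>e\<in>H. card (C \<inter> ends e))"
    using C by (intro sum.cong refl) (simp add: sum.If_cases Int_def)
  also have "\<dots> = (\<Sum>e\<in>H. if ends e \<subseteq> C then 2 else 0)"
  proof (rule sum.cong[OF refl])
    fix e assume e: "e \<in> H"
    show "card (C \<inter> ends e) = (if ends e \<subseteq> C then 2 else 0)"
    proof (cases "ends e \<subseteq> C")
      case True then show ?thesis using H(2)[OF e] by (simp add: Int_absorb1)
    next
      case False then have "C \<inter> ends e = {}" using cl[OF e] by blast
      then show ?thesis using False by simp
    qed
  qed
  also have "\<dots> = 2 * card {e\<in>H. ends e \<subseteq> C}"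
    using H(1) by (simp add: sum.If_cases Int_def)
  finally show ?thesis .
qed

text \<open>A largest subset of \<open>C\<close> that contains \<open>u\<close> and spans enough
  edges must be all of \<open>C\<close>: otherwise some edge leaves it, and adding the outer end of
  that edge also adds the edge. This replaces a spanning tree.\<close>

lemma component_edges:
  assumes H: "finite H" "\<And>e. e \<in> H \<Longrightarrow> card (ends e) = 2"
    and C: "C = (adj_via ends H)\<^sup>* `` {u}"
  shows "card C \<le> card {e\<in>H. ends e \<subseteq> C} + 1"
proof -
  have fC: "finite C" using finite_component[OF H] C by simp
  define good where "good X \<longleftrightarrow> u \<in> X \<and> X \<subseteq> C \<and> card X \<le> card {e\<in>H. ends e \<subseteq> X} + 1" for X
  have g0: "good {u}" using C by (auto simp: good_def)
  define n where "n = Max (card ` {X. good X})"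
  have fin: "finite {X. good X}" by (rule finite_subset[of _ "Pow C"]) (auto simp: good_def fC)
  obtain X where X: "good X" "\<And>Y. good Y \<Longrightarrow> card Y \<le> card X"
  proof -
    have "n \<in> card ` {X. good X}" unfolding n_def using fin g0 by (intro Max_in) auto
    then obtain X where "good X" "card X = n" by auto
    moreover have "card Y \<le> n" if "good Y" for Y unfolding n_def using fin that by (intro Max_ge) auto
    ultimately show ?thesis using that by auto
  qed
  have "X = C"
  proof (rule ccontr)
    assume "X \<noteq> C"
    then obtain v where v: "v \<in> C" "v \<notin> X" using X(1) by (auto simp: good_def)
    have "(u, v) \<in> (adj_via ends H)\<^sup>*" using v C by simp
    moreover have "\<forall>v. (u, v) \<in> (adj_via ends H)\<^sup>* \<longrightarrow> v \<notin> X \<longrightarrow> (\<exists>p q. (p, q) \<in> adj_via ends H \<and> p \<in> X \<and> q \<notin> X)"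
    proof (intro allI impI)
      fix v assume "(u, v) \<in> (adj_via ends H)\<^sup>*" "v \<notin> X"
      then show "\<exists>p q. (p, q) \<in> adj_via ends H \<and> p \<in> X \<and> q \<notin> X"
      proof (induction rule: rtrancl_induct)
        case base then show ?case using X(1) by (auto simp: good_def)
      next
        case (step p q) then show ?case by (cases "p \<in> X") auto
      qed
    qed
    ultimately obtain p q where pq: "(p, q) \<in> adj_via ends H" "p \<in> X" "q \<notin> X" using v by blast
    then obtain e where e: "e \<in> H" "ends e = {p, q}" by (auto simp: adj_via_def)
    have qC: "q \<in> C" using component_closed[OF e(1) H(2)[OF e(1)] C] e pq X(1) by (auto simp: good_def)
    have fX: "finite X" using X(1) fC by (auto simp: good_def intro: finite_subset)
    have "insert e {e\<in>H. ends e \<subseteq> X} \<subseteq> {e\<in>H. ends e \<subseteq> insert q X}" using e pq by auto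
    then have "card (insert e {e\<in>H. ends e \<subseteq> X}) \<le> card {e\<in>H. ends e \<subseteq> insert q X}"
      using H(1) by (intro card_mono) auto
    moreover have "card (insert e {e\<in>H. ends e \<subseteq> X}) = card {e\<in>H. ends e \<subseteq> X} + 1"
      using e pq H(1) by (subst card_insert_disjoint) auto
    ultimately have "good (insert q X)" using X(1) fX pq qC by (auto simp: good_def)
    then show False using X(2) fX pq by fastforce
  qed
  then show ?thesis using X(1) by (simp add: good_def)
qed

text \<open>Three vertices of degree at most 1 push the degree sum down to
  \<open>2 * card C - 3\<close>, while connectedness forces at least \<open>2 * card C - 2\<close>.
  This count stands in for the fact that Kempe components are paths or cycles.\<close>

lemma component_three_ends:
  assumes H: "finite H" "\<And>e. e \<in> H \<Longrightarrow> card (ends e) = 2"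
    and C: "C = (adj_via ends H)\<^sup>* `` {p}" and d2: "\<And>v. v \<in> C \<Longrightarrow> deg_in ends H v \<le> 2"
    and uvw: "u \<in> C" "v \<in> C" "w \<in> C" "u \<noteq> v" "u \<noteq> w" "v \<noteq> w"
    and d1: "deg_in ends H u \<le> 1" "deg_in ends H v \<le> 1" "deg_in ends H w \<le> 1"
  shows False
proof -
  have fC: "finite C" using finite_component[OF H] C by simp
  have hs: "(\<Sum>v\<in>C. deg_in ends H v) = 2 * card {e\<in>H. ends e \<subseteq> C}"
    by (rule handshake[where ends = ends, OF H fC component_closed[OF _ _ C]]) (use H in auto)
  have sub: "{u, v, w} \<subseteq> C" using uvw by simp
  have "(\<Sum>v\<in>C. deg_in ends H v) = (\<Sum>v\<in>{u, v, w}. deg_in ends H v) + (\<Sum>v\<in>C - {u, v, w}. deg_in ends H v)"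
    by (metis (no_types, lifting) add.commute fC sub sum.subset_diff)
  also have "(\<Sum>v\<in>{u, v, w}. deg_in ends H v) \<le> 3" using uvw d1 by simp
  also have "(\<Sum>v\<in>C - {u, v, w}. deg_in ends H v) \<le> (\<Sum>v\<in>C - {u, v, w}. 2)"
    by (rule sum_mono) (use d2 in auto)
  also have "\<dots> = 2 * (card C - 3)" using uvw sub fC by (simp add: card_Diff_subset)
  finally have "2 * card {e\<in>H. ends e \<subseteq> C} \<le> 3 + 2 * (card C - 3)" using hs by simp
  moreover have "card C \<ge> 3" using card_mono[OF fC sub] uvw by simp
  moreover have "card C \<le> card {e\<in>H. ends e \<subseteq> C} + 1" using component_edges[OF H C] by simp
  ultimately show False by arith
qed

lemma component_even_odd_ends:
  assumes H: "finite H" "\<And>e. e \<in> H \<Longrightarrow> card (ends e) = 2"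
    and C: "C = (adj_via ends H)\<^sup>* `` {p}"
  shows "even (card {v\<in>C. odd (deg_in ends H v)})"
proof -
  have fC: "finite C" using finite_component[OF H] C by simp
  have hs: "(\<Sum>v\<in>C. deg_in ends H v) = 2 * card {e\<in>H. ends e \<subseteq> C}"
    by (rule handshake[where ends = ends, OF H fC component_closed[OF _ _ C]]) (use H in auto)
  then have "even (\<Sum>v\<in>C. deg_in ends H v)" by simp
  then show ?thesis using even_sum_iff[OF fC, of "deg_in ends H"] by simp
qed

lemma component_other_end:
  assumes H: "finite H" "\<And>e. e \<in> H \<Longrightarrow> card (ends e) = 2"
    and C: "C = (adj_via ends H)\<^sup>* `` {p}" and u: "u \<in> C" "odd (deg_in ends H u)"
  obtains v where "v \<in> C" "v \<noteq> u" "odd (deg_in ends H v)"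
proof -
  have fC: "finite C" using finite_component[OF H] C by simp
  have ev: "even (card {v\<in>C. odd (deg_in ends H v)})" by (rule component_even_odd_ends[OF H C])
  have "{v\<in>C. odd (deg_in ends H v)} \<noteq> {u}"
  proof
    assume "{v\<in>C. odd (deg_in ends H v)} = {u}"
    then have "card {v\<in>C. odd (deg_in ends H v)} = 1" by simp
    then show False using ev by simp
  qed
  then show ?thesis using u that by blast
qed

text \<open>Before it first enters \<open>W\<close>, a walk uses only edges disjoint from
  \<open>W\<close>. Exactly these edges are under control when two colours are exchanged outside
  \<open>W\<close>.\<close>

lemma first_hit:
  assumes "(z, w) \<in> (adj_via ends H)\<^sup>*" "z \<notin> W" "w \<in> W"
  obtains p q where "(p, q) \<in> adj_via ends H" "p \<notin> W" "q \<in> W"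
    "(z, p) \<in> (adj_via ends {e\<in>H. ends e \<inter> W = {}})\<^sup>*"
proof -
  have "w \<in> W \<longrightarrow> (\<exists>p q. (p, q) \<in> adj_via ends H \<and> p \<notin> W \<and> q \<in> W \<and>
     (z, p) \<in> (adj_via ends {e\<in>H. ends e \<inter> W = {}})\<^sup>*)" (is "?P w")
  proof -
    have "(\<exists>p q. (p, q) \<in> adj_via ends H \<and> p \<notin> W \<and> q \<in> W \<and>
     (z, p) \<in> (adj_via ends {e\<in>H. ends e \<inter> W = {}})\<^sup>*) \<or> 
     (w \<notin> W \<and> (z, w) \<in> (adj_via ends {e\<in>H. ends e \<inter> W = {}})\<^sup>*)"
      using assms(1)
    proof (induction rule: rtrancl_induct)
      case base then show ?case using assms by auto
    next
      case (step p q)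
      show ?case
      proof (cases "p \<notin> W \<and> (z, p) \<in> (adj_via ends {e\<in>H. ends e \<inter> W = {}})\<^sup>*")
        case True
        show ?thesis
        proof (cases "q \<in> W")
          case True then show ?thesis using step \<open>p \<notin> W \<and> _\<close> by blast
        next
          case False
          then have "(p, q) \<in> adj_via ends {e\<in>H. ends e \<inter> W = {}}"
            using step(2) True by (auto simp: adj_via_def)
          then show ?thesis using True False by (meson rtrancl.rtrancl_into_rtrancl)
        qed
      next
        case False then show ?thesis using step by blast
      qed
    qed
    then show ?thesis by blast
  qed
  then show ?thesis using assms that by blast
qed

section \<open>Kempe changes\<close>

text \<open>A simple path that leaves \<open>X\<close> with its first edge and never returns, listed
  as pairs of an edge and its far end. This is the format of tails, so such a path can be appended
  to a tail.\<close>

inductive apath :: "('e \<Rightarrow> 'a set) \<Rightarrow> 'e set \<Rightarrow> 'a set \<Rightarrow> ('e \<times> 'a) list \<Rightarrow> bool"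
  for ends :: "'e \<Rightarrow> 'a set" and H :: "'e set" and X :: "'a set" where
  start: "e \<in> H \<Longrightarrow> ends e = {t, z} \<Longrightarrow> t \<in> X \<Longrightarrow> z \<notin> X \<Longrightarrow> apath ends H X [(e, z)]"
| step: "apath ends H X ps \<Longrightarrow> e \<in> H \<Longrightarrow> ends e = {snd (last ps), z} \<Longrightarrow> z \<notin> X \<Longrightarrow>
    z \<notin> snd ` set ps \<Longrightarrow> apath ends H X (ps @ [(e, z)])"

lemma apath_props:
  assumes "apath ends H X ps"
  shows "ps \<noteq> []" "distinct (map snd ps)" "snd ` set ps \<inter> X = {}" "fst ` set ps \<subseteq> H"
    "\<exists>t\<in>X. ends (fst (ps ! 0)) = {t, snd (ps ! 0)}"
    "\<And>i. Suc i < length ps \<Longrightarrow> ends (fst (ps ! Suc i)) = {snd (ps ! i), snd (ps ! Suc i)}"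
proof -
  have "ps \<noteq> [] \<and> distinct (map snd ps) \<and> snd ` set ps \<inter> X = {} \<and> fst ` set ps \<subseteq> H \<and>
    (\<exists>t\<in>X. ends (fst (ps ! 0)) = {t, snd (ps ! 0)}) \<and>
    (\<forall>i. Suc i < length ps \<longrightarrow> ends (fst (ps ! Suc i)) = {snd (ps ! i), snd (ps ! Suc i)})"
    using assms
  proof (induction)
    case (start e t z) then show ?case by auto
  next
    case (step ps e z)
    have "ends (fst ((ps @ [(e, z)]) ! Suc i)) = {snd ((ps @ [(e, z)]) ! i), snd ((ps @ [(e, z)]) ! Suc i)}"
      if "Suc i < length (ps @ [(e, z)])" for i
    proof (cases "Suc i < length ps")
      case True then show ?thesis using step.IH by (simp add: nth_append)
    next
      case False
      then have i: "Suc i = length ps" using that by simp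
      then have "last ps = ps ! i" using step.IH by (metis diff_Suc_1 last_conv_nth)
      moreover have "(ps @ [(e, z)]) ! Suc i = (e, z)" using i by (metis nth_append_length)
      moreover have "(ps @ [(e, z)]) ! i = ps ! i" using i by (simp add: nth_append)
      ultimately show ?thesis using step.hyps(3) by simp
    qed
    moreover have "\<exists>t\<in>X. ends (fst ((ps @ [(e, z)]) ! 0)) = {t, snd ((ps @ [(e, z)]) ! 0)}"
    proof -
      have "(ps @ [(e, z)]) ! 0 = ps ! 0" using step.IH by (simp add: nth_append)
      then show ?thesis using step.IH by metis
    qed
    moreover have "distinct (map snd (ps @ [(e, z)]))" "snd ` set (ps @ [(e, z)]) \<inter> X = {}"
      "fst ` set (ps @ [(e, z)]) \<subseteq> H" using step.IH step.hyps by auto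
    ultimately show ?case by blast
  qed
  then show "ps \<noteq> []" "distinct (map snd ps)" "snd ` set ps \<inter> X = {}" "fst ` set ps \<subseteq> H"
    "\<exists>t\<in>X. ends (fst (ps ! 0)) = {t, snd (ps ! 0)}"
    "\<And>i. Suc i < length ps \<Longrightarrow> ends (fst (ps ! Suc i)) = {snd (ps ! i), snd (ps ! Suc i)}" by auto
qed

lemma apath_prefix:
  assumes "apath ends H X ps" "z \<in> snd ` set ps"
  shows "\<exists>ps'. apath ends H X ps' \<and> snd (last ps') = z"
  using assms
proof (induction)
  case (start e t z')
  have "apath ends H X [(e, z')]" by (rule apath.start[where ends = ends, OF start.hyps])
  moreover have "z = z'" using start.prems by simp
  ultimately show ?case by (intro exI[of _ "[(e, z')]"]) simp
next
  case (step ps e z')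
  show ?case
  proof (cases "z \<in> snd ` set ps")
    case True then show ?thesis by (rule step.IH)
  next
    case False
    then have "z = z'" using step.prems by auto
    moreover have "apath ends H X (ps @ [(e, z')])" by (rule apath.step[where ends = ends, OF step.hyps])
    ultimately show ?thesis by (intro exI[of _ "ps @ [(e, z')]"]) simp
  qed
qed

text \<open>The walk is cut at its last visit to \<open>X\<close>: whenever it meets
  \<open>X\<close> the path built so far is forgotten, and whenever it revisits a vertex of the path
  a prefix is taken instead.\<close>

lemma apath_exists:
  assumes "(x, z) \<in> (adj_via ends H)\<^sup>*" "x \<in> X" "z \<notin> X"
  obtains ps where "apath ends H X ps" "snd (last ps) = z"
proof -
  have "z \<in> X \<or> (\<exists>ps. apath ends H X ps \<and> snd (last ps) = z)" using assms(1)
  proof (induction rule: rtrancl_induct)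
    case base then show ?case using assms by simp
  next
    case (step p q)
    obtain e where e: "e \<in> H" "ends e = {p, q}" using step(2) by (auto simp: adj_via_def)
    show ?case
    proof (cases "q \<in> X")
      case True then show ?thesis by simp
    next
      case q: False
      show ?thesis
      proof (cases "p \<in> X")
        case True
        have "apath ends H X [(e, q)]" by (rule apath.start[where ends = ends, OF e True q])
        then show ?thesis by (intro disjI2 exI[of _ "[(e, q)]"]) simp
      next
        case False
        then obtain ps where ps: "apath ends H X ps" "snd (last ps) = p" using step.IH by blast
        show ?thesis
        proof (cases "q \<in> snd ` set ps")
          case True
          show ?thesis by (rule disjI2[OF apath_prefix[OF ps(1) True]])
        next
          case False
          have "apath ends H X (ps @ [(e, q)])" by (rule apath.step[where ends = ends, OF ps(1) e(1) _ q False]) (simp add: ps e)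
          then show ?thesis by (intro disjI2 exI[of _ "ps @ [(e, q)]"]) simp
        qed
      qed
    qed
  qed
  then show ?thesis using assms(3) that by blast
qed

section \<open>Missing colours, Kempe components and swaps\<close>

locale mgraph =
  fixes A :: "'e set" and ends :: "'e \<Rightarrow> 'a set" and k :: nat
  assumes finA: "finite A" and card2: "e \<in> A \<Longrightarrow> card (ends e) = 2"
begin

abbreviation proper :: "('e \<Rightarrow> nat) \<Rightarrow> bool" where
  "proper \<phi> \<equiv> proper_edge_colouring A ends k \<phi>"

definition miss :: "('e \<Rightarrow> nat) \<Rightarrow> 'a \<Rightarrow> nat set" where
  "miss \<phi> v = {c. c < k \<and> (\<forall>e\<in>A. v \<in> ends e \<longrightarrow> \<phi> e \<noteq> c)}"

definition ab :: "('e \<Rightarrow> nat) \<Rightarrow> nat \<Rightarrow> nat \<Rightarrow> 'e set" where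
  "ab \<phi> a b = {e\<in>A. \<phi> e = a \<or> \<phi> e = b}"

definition kc :: "('e \<Rightarrow> nat) \<Rightarrow> nat \<Rightarrow> nat \<Rightarrow> 'a \<Rightarrow> 'a set" where
  "kc \<phi> a b v = (adj_via ends (ab \<phi> a b))\<^sup>* `` {v}"

definition kclosed :: "('e \<Rightarrow> nat) \<Rightarrow> nat \<Rightarrow> nat \<Rightarrow> 'a set \<Rightarrow> bool" where
  "kclosed \<phi> a b C \<longleftrightarrow> (\<forall>e\<in>ab \<phi> a b. ends e \<inter> C \<noteq> {} \<longrightarrow> ends e \<subseteq> C)"

text \<open>The test is only that the edge meets \<open>C\<close>, so the same function serves for a
  Kempe component, for the complement of a root and for the two ends of an edge. Under
  \<open>kclosed\<close> an edge of colour \<open>a\<close> or \<open>b\<close> that meets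
  \<open>C\<close> lies inside it.\<close>

definition swap :: "('e \<Rightarrow> nat) \<Rightarrow> nat \<Rightarrow> nat \<Rightarrow> 'a set \<Rightarrow> 'e \<Rightarrow> nat" where
  "swap \<phi> a b C e = (if e \<in> A \<and> ends e \<inter> C \<noteq> {}
     then (if \<phi> e = a then b else if \<phi> e = b then a else \<phi> e) else \<phi> e)"

lemma finite_ab [simp]: "finite (ab \<phi> a b)"
  using finA by (simp add: ab_def)

lemma ab_card2: "e \<in> ab \<phi> a b \<Longrightarrow> card (ends e) = 2"
  by (simp add: ab_def card2)

lemma ab_commute: "ab \<phi> a b = ab \<phi> b a" by (auto simp: ab_def)

lemma kc_commute: "kc \<phi> a b v = kc \<phi> b a v" by (simp add: kc_def ab_commute)

lemma miss_lt: "c \<in> miss \<phi> v \<Longrightarrow> c < k" by (simp add: miss_def)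

lemma finite_miss [simp]: "finite (miss \<phi> v)"
  by (rule finite_subset[of _ "{..<k}"]) (auto simp: miss_def)

lemma missD: "c \<in> miss \<phi> v \<Longrightarrow> e \<in> A \<Longrightarrow> v \<in> ends e \<Longrightarrow> \<phi> e \<noteq> c" by (simp add: miss_def)

lemma not_miss: "c < k \<Longrightarrow> c \<notin> miss \<phi> v \<Longrightarrow> \<exists>e\<in>A. v \<in> ends e \<and> \<phi> e = c" by (auto simp: miss_def)

lemma proper_lt: "proper \<phi> \<Longrightarrow> e \<in> A \<Longrightarrow> \<phi> e < k" by (simp add: proper_edge_colouring_def)

lemma proper_inj: "proper \<phi> \<Longrightarrow> e \<in> A \<Longrightarrow> e' \<in> A \<Longrightarrow> v \<in> ends e \<Longrightarrow> v \<in> ends e' \<Longrightarrow> \<phi> e = \<phi> e' \<Longrightarrow> e = e'"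
  unfolding proper_edge_colouring_def by blast

lemma ends2: "e \<in> A \<Longrightarrow> \<exists>p q. p \<noteq> q \<and> ends e = {p, q}" using card2 by (meson card_2_iff)

lemma ends_other: "e \<in> A \<Longrightarrow> v \<in> ends e \<Longrightarrow> \<exists>q. q \<noteq> v \<and> ends e = {v, q}"
  using ends2[of e] by auto

lemma ends_ne: "e \<in> A \<Longrightarrow> ends e = {p, q} \<Longrightarrow> p \<noteq> q"
  using card2 by fastforce

lemma kc_closed: "kclosed \<phi> a b (kc \<phi> a b v)"
  unfolding kclosed_def
proof (intro ballI impI)
  fix e assume e: "e \<in> ab \<phi> a b" "ends e \<inter> kc \<phi> a b v \<noteq> {}"
  show "ends e \<subseteq> kc \<phi> a b v" by (rule component_closed[OF e(1) ab_card2[OF e(1)] kc_def e(2)])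
qed

lemma kc_self [simp]: "v \<in> kc \<phi> a b v" by (simp add: kc_def)

lemma kc_sym: "u \<in> kc \<phi> a b v \<Longrightarrow> v \<in> kc \<phi> a b u"
  by (simp add: kc_def adj_via_rtrancl_sym)

lemma kc_min: "kclosed \<phi> a b C \<Longrightarrow> v \<in> C \<Longrightarrow> kc \<phi> a b v \<subseteq> C"
proof
  fix u assume C: "kclosed \<phi> a b C" "v \<in> C" and "u \<in> kc \<phi> a b v"
  then have "(v, u) \<in> (adj_via ends (ab \<phi> a b))\<^sup>*" by (simp add: kc_def)
  then show "u \<in> C"
    by (induction rule: rtrancl_induct) (use C in \<open>auto simp: adj_via_def kclosed_def\<close>)
qed

lemma kc_eq: "u \<in> kc \<phi> a b v \<Longrightarrow> kc \<phi> a b u = kc \<phi> a b v"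
proof -
  assume u: "u \<in> kc \<phi> a b v"
  have "kc \<phi> a b u \<subseteq> kc \<phi> a b v" by (rule kc_min[OF kc_closed u])
  moreover have "kc \<phi> a b v \<subseteq> kc \<phi> a b u" by (rule kc_min[OF kc_closed kc_sym[OF u]])
  ultimately show ?thesis by simp
qed

lemma swap_in_ab: "swap \<phi> a b C e = a \<or> swap \<phi> a b C e = b \<longleftrightarrow> \<phi> e = a \<or> \<phi> e = b"
  by (auto simp: swap_def)

lemma swap_other: "\<phi> e \<noteq> a \<Longrightarrow> \<phi> e \<noteq> b \<Longrightarrow> swap \<phi> a b C e = \<phi> e" by (simp add: swap_def)

lemma swap_disj: "ends e \<inter> C = {} \<Longrightarrow> swap \<phi> a b C e = \<phi> e" by (simp add: swap_def)

lemma ab_swap [simp]: "ab (swap \<phi> a b C) a b = ab \<phi> a b" by (auto simp: ab_def swap_in_ab)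

lemma swap_proper:
  assumes "proper \<phi>" "a < k" "b < k" "kclosed \<phi> a b C"
  shows "proper (swap \<phi> a b C)"
  unfolding proper_edge_colouring_def
proof (intro conjI ballI impI)
  fix e assume "e \<in> A" then show "swap \<phi> a b C e < k" using assms by (auto simp: swap_def proper_lt)
next
  fix e f assume ef: "e \<in> A" "f \<in> A" "e \<noteq> f \<and> ends e \<inter> ends f \<noteq> {}"
  then have ne: "\<phi> e \<noteq> \<phi> f" using assms(1) by (simp add: proper_edge_colouring_def)
  obtain v where v: "v \<in> ends e" "v \<in> ends f" using ef by blast
  have *: "ends e \<subseteq> C \<or> ends e \<inter> C = {}" if "\<phi> e = a \<or> \<phi> e = b" "e \<in> A" for e
    using assms(4) that unfolding kclosed_def ab_def by blast
  show "swap \<phi> a b C e \<noteq> swap \<phi> a b C f"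
  proof (cases "(\<phi> e = a \<or> \<phi> e = b) \<and> (\<phi> f = a \<or> \<phi> f = b)")
    case True
    then have "ends e \<inter> C \<noteq> {} \<longleftrightarrow> v \<in> C" "ends f \<inter> C \<noteq> {} \<longleftrightarrow> v \<in> C" using * ef v by blast+
    then show ?thesis using True ne ef by (auto simp: swap_def)
  next
    case False
    then show ?thesis using swap_in_ab[of \<phi> a b C e] swap_in_ab[of \<phi> a b C f]
        swap_other[of \<phi> e a b C] swap_other[of \<phi> f a b C] ne by metis
  qed
qed

lemma miss_swap_out:
  assumes "kclosed \<phi> a b C" "v \<notin> C"
  shows "miss (swap \<phi> a b C) v = miss \<phi> v"
proof -
  have "swap \<phi> a b C e = \<phi> e" if "e \<in> A" "v \<in> ends e" for e
  proof (cases "\<phi> e = a \<or> \<phi> e = b")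
    case True
    then have "ends e \<inter> C = {}" using assms that unfolding kclosed_def ab_def by blast
    then show ?thesis by (simp add: swap_disj)
  next
    case False then show ?thesis by (simp add: swap_other)
  qed
  then show ?thesis by (auto simp: miss_def)
qed

lemma miss_swap_in:
  assumes "v \<in> C" "a < k" "b < k"
  shows "c \<in> miss (swap \<phi> a b C) v \<longleftrightarrow> (if c = a then b else if c = b then a else c) \<in> miss \<phi> v"
proof -
  have "swap \<phi> a b C e = (if \<phi> e = a then b else if \<phi> e = b then a else \<phi> e)" if "e \<in> A" "v \<in> ends e" for e
    using that assms by (auto simp: swap_def)
  then show ?thesis using assms by (auto simp: miss_def)
qed

lemma miss_swap_other:
  assumes "kclosed \<phi> a b C" "a < k" "b < k" "c \<noteq> a" "c \<noteq> b"
  shows "c \<in> miss (swap \<phi> a b C) v \<longleftrightarrow> c \<in> miss \<phi> v"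
  using miss_swap_out[OF assms(1)] miss_swap_in[OF _ assms(2,3)] assms(4,5) by (cases "v \<in> C") auto

lemma miss_swap_neither:
  assumes "kclosed \<phi> a b C" "a < k" "b < k" "a \<notin> miss \<phi> v" "b \<notin> miss \<phi> v"
  shows "miss (swap \<phi> a b C) v = miss \<phi> v"
proof (cases "v \<in> C")
  case True
  show ?thesis using miss_swap_in[OF True assms(2,3)] assms(4,5) by (intro set_eqI) simp
qed (rule miss_swap_out[OF assms(1)])

lemma card_at_colour:
  assumes "proper \<phi>" "c < k"
  shows "card {e\<in>A. \<phi> e = c \<and> v \<in> ends e} = (if c \<in> miss \<phi> v then 0 else 1)"
proof (cases "c \<in> miss \<phi> v")
  case True
  then have "{e\<in>A. \<phi> e = c \<and> v \<in> ends e} = {}" by (auto simp: miss_def)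
  then show ?thesis using True by (simp only: card.empty if_True)
next
  case False
  then obtain e where e: "e \<in> A" "v \<in> ends e" "\<phi> e = c" using not_miss assms by blast
  then have "{e\<in>A. \<phi> e = c \<and> v \<in> ends e} = {e}" using proper_inj[OF assms(1)] by auto
  then show ?thesis using False by simp
qed

lemma deg_ab:
  assumes "proper \<phi>" "a < k" "b < k" "a \<noteq> b"
  shows "deg_in ends (ab \<phi> a b) v = (if a \<in> miss \<phi> v then 0 else 1) + (if b \<in> miss \<phi> v then 0 else 1)"
proof -
  have "{e\<in>ab \<phi> a b. v \<in> ends e} = {e\<in>A. \<phi> e = a \<and> v \<in> ends e} \<union> {e\<in>A. \<phi> e = b \<and> v \<in> ends e}"
    by (auto simp: ab_def)
  moreover have "card ({e\<in>A. \<phi> e = a \<and> v \<in> ends e} \<union> {e\<in>A. \<phi> e = b \<and> v \<in> ends e}) =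
     card {e\<in>A. \<phi> e = a \<and> v \<in> ends e} + card {e\<in>A. \<phi> e = b \<and> v \<in> ends e}"
    using finA assms(4) by (intro card_Un_disjoint) auto
  ultimately show ?thesis using card_at_colour[OF assms(1,2)] card_at_colour[OF assms(1,3)]
    by (simp add: deg_in_def)
qed

lemma kc_three_ends:
  assumes "proper \<phi>" "a < k" "b < k" "a \<noteq> b" "u \<in> kc \<phi> a b p" "v \<in> kc \<phi> a b p" "w \<in> kc \<phi> a b p"
    "u \<noteq> v" "u \<noteq> w" "v \<noteq> w" "a \<in> miss \<phi> u \<or> b \<in> miss \<phi> u" "a \<in> miss \<phi> v \<or> b \<in> miss \<phi> v"
    "a \<in> miss \<phi> w \<or> b \<in> miss \<phi> w"
  shows False
proof (rule component_three_ends[where H = "ab \<phi> a b" and ends = ends and p = p and u = u and v = v and w = w, OF finite_ab ab_card2 refl])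
  show "u \<in> (adj_via ends (ab \<phi> a b))\<^sup>* `` {p}" "v \<in> (adj_via ends (ab \<phi> a b))\<^sup>* `` {p}"
    "w \<in> (adj_via ends (ab \<phi> a b))\<^sup>* `` {p}" using assms by (simp_all add: kc_def)
qed (use assms deg_ab[OF assms(1-4)] in auto)

lemma kc_other_end:
  assumes "proper \<phi>" "a < k" "b < k" "a \<noteq> b" "a \<in> miss \<phi> u" "b \<notin> miss \<phi> u"
  obtains v where "v \<in> kc \<phi> a b u" "v \<noteq> u" "a \<in> miss \<phi> v \<longleftrightarrow> b \<notin> miss \<phi> v"
proof -
  have u: "u \<in> kc \<phi> a b u" "odd (deg_in ends (ab \<phi> a b) u)"
    using deg_ab[OF assms(1-4)] assms(5,6) by simp_all
  obtain v where v: "v \<in> kc \<phi> a b u" "v \<noteq> u" "odd (deg_in ends (ab \<phi> a b) v)"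
    by (rule component_other_end[OF finite_ab ab_card2 kc_def[of \<phi> a b u] u])
  then show ?thesis using that deg_ab[OF assms(1-4)] by (auto split: if_splits)
qed

lemma kc_isolated:
  assumes "a \<in> miss \<phi> v" "b \<in> miss \<phi> v" shows "kc \<phi> a b v = {v}"
proof -
  have "kclosed \<phi> a b {v}" using assms by (auto simp: kclosed_def ab_def miss_def)
  then have "kc \<phi> a b v \<subseteq> {v}" by (rule kc_min) simp
  then show ?thesis using kc_self[of v \<phi> a b] by blast
qed

definition elem :: "('e \<Rightarrow> nat) \<Rightarrow> 'a set \<Rightarrow> bool" where
  "elem \<phi> X \<longleftrightarrow> (\<forall>u\<in>X. \<forall>v\<in>X. u \<noteq> v \<longrightarrow> miss \<phi> u \<inter> miss \<phi> v = {})"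

lemma elemD: "elem \<phi> X \<Longrightarrow> u \<in> X \<Longrightarrow> v \<in> X \<Longrightarrow> c \<in> miss \<phi> u \<Longrightarrow> c \<in> miss \<phi> v \<Longrightarrow> u = v"
  unfolding elem_def by blast

lemma elem_mono: "elem \<phi> X \<Longrightarrow> Y \<subseteq> X \<Longrightarrow> elem \<phi> Y"
  unfolding elem_def by blast

definition missU :: "('e \<Rightarrow> nat) \<Rightarrow> 'a set \<Rightarrow> nat set" where
  "missU \<phi> X = (\<Union>v\<in>X. miss \<phi> v)"

lemma missU_mono: "X \<subseteq> Y \<Longrightarrow> missU \<phi> X \<subseteq> missU \<phi> Y" by (auto simp: missU_def)

lemma finite_missU [simp]: "finite (missU \<phi> X)"
  by (rule finite_subset[of _ "{..<k}"]) (auto simp: missU_def miss_def)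

lemma card_missU:
  assumes "finite X" "elem \<phi> X" shows "card (missU \<phi> X) = (\<Sum>v\<in>X. card (miss \<phi> v))"
  unfolding missU_def using assms by (intro card_UN_disjoint) (auto simp: elem_def)

end

section \<open>Tails over a fat root\<close>

text \<open>\<open>W\<close> is the fat root, \<open>y\<close> the first tail vertex,
  \<open>\<Gamma>\<close> the colours missing in \<open>W\<close>, and \<open>P\<close> the exit
  colours whose crossings of \<open>W\<close> are to be kept. \<open>S\<close> is the class of
  admissible recolourings: it is closed under Kempe swaps that are disjoint from \<open>W\<close> or
  involve no colour of \<open>\<Gamma> \<union> P\<close>. \<open>S_uniq\<close> generalises what is
  obvious for a root with the single vertex \<open>x\<close>: a chain through \<open>x\<close> in a
  colour missing at \<open>x\<close> has only one further end.\<close>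

locale tail_root = mgraph A ends k
  for A :: "'e set" and ends :: "'e \<Rightarrow> 'a set" and k :: nat +
  fixes W :: "'a set" and y :: 'a and \<Gamma> P :: "nat set" and S :: "('e \<Rightarrow> nat) set" and G :: "nat \<Rightarrow> nat set"
  assumes S_proper: "\<phi> \<in> S \<Longrightarrow> proper \<phi>"
    and S_missU: "\<phi> \<in> S \<Longrightarrow> missU \<phi> W = \<Gamma>"
    and S_elem: "\<phi> \<in> S \<Longrightarrow> elem \<phi> W"
    and S_closed: "\<phi> \<in> S \<Longrightarrow> e \<in> A \<Longrightarrow> ends e \<inter> W \<noteq> {} \<Longrightarrow> \<not> ends e \<subseteq> W \<Longrightarrow> \<phi> e \<notin> \<Gamma>"
    and S_swap: "\<phi> \<in> S \<Longrightarrow> a < k \<Longrightarrow> b < k \<Longrightarrow> a \<noteq> b \<Longrightarrow> kclosed \<phi> a b C \<Longrightarrow>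
      C \<inter> W = {} \<or> a \<notin> \<Gamma> \<union> P \<and> b \<notin> \<Gamma> \<union> P \<Longrightarrow> swap \<phi> a b C \<in> S"
    and S_uniq: "\<phi> \<in> S \<Longrightarrow> c \<in> \<Gamma> \<Longrightarrow> d < k \<Longrightarrow> d \<notin> \<Gamma> \<Longrightarrow> z \<notin> W \<Longrightarrow> z' \<notin> W \<Longrightarrow>
      c \<in> miss \<phi> z \<or> d \<in> miss \<phi> z \<Longrightarrow> c \<in> miss \<phi> z' \<or> d \<in> miss \<phi> z' \<Longrightarrow>
      kc \<phi> c d z \<inter> W \<noteq> {} \<Longrightarrow> kc \<phi> c d z' \<inter> W \<noteq> {} \<Longrightarrow> z = z'"
    and y_W: "y \<notin> W"
    and S_y: "\<phi> \<in> S \<Longrightarrow> miss \<phi> y \<inter> \<Gamma> = {}"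
    and fin_W: "finite W" and fin_\<Gamma>: "finite \<Gamma>" and fin_P: "finite P" and P_\<Gamma>: "P \<inter> \<Gamma> = {}"
    and G_sub: "d \<in> P \<Longrightarrow> G d \<subseteq> \<Gamma>" and G_card: "d \<in> P \<Longrightarrow> card (G d) = 2"
    and G_disj: "d \<in> P \<Longrightarrow> d' \<in> P \<Longrightarrow> c \<in> G d \<Longrightarrow> c \<in> G d' \<Longrightarrow> d = d'"
    and card_\<Gamma>: "2 * card P + 2 \<le> card \<Gamma>"
    and S_miss: "\<phi> \<in> S \<Longrightarrow> miss \<phi> v \<noteq> {}"
begin

definition Z :: "('e \<times> 'a) list \<Rightarrow> nat \<Rightarrow> 'a" where
  "Z T i = (case i of 0 \<Rightarrow> y | Suc m \<Rightarrow> snd (T ! m))"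

definition Y :: "('e \<times> 'a) list \<Rightarrow> nat \<Rightarrow> 'a set" where
  "Y T m = W \<union> Z T ` {..<m}"

abbreviation X :: "('e \<times> 'a) list \<Rightarrow> nat \<Rightarrow> 'a set" where "X T j \<equiv> Y T (Suc j)"

abbreviation E :: "('e \<times> 'a) list \<Rightarrow> nat \<Rightarrow> 'e" where "E T i \<equiv> fst (T ! i)"

text \<open>The analogue of a Tashkinov tree in which everything up to \<open>W\<close> has been
  contracted to one root.\<close>

definition valid :: "('e \<Rightarrow> nat) \<Rightarrow> ('e \<times> 'a) list \<Rightarrow> bool" where
  "valid \<phi> T \<longleftrightarrow> distinct (y # map snd T) \<and> snd ` set T \<inter> W = {} \<and>
     (\<forall>i<length T. E T i \<in> A \<and> (\<exists>t\<in>X T i. ends (E T i) = {t, Z T (Suc i)}) \<and> \<phi> (E T i) \<in> missU \<phi> (X T i))"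

text \<open>The reservation rule. The last edge is exempt, which keeps the rule intact when the last
  edge is moved one place forward (\<open>drop_last\<close>) or recoloured (the first alternative in
  \<open>free\<close>).\<close>

definition cls :: "('e \<Rightarrow> nat) \<Rightarrow> ('e \<times> 'a) list \<Rightarrow> bool" where
  "cls \<phi> T \<longleftrightarrow> (\<forall>l. Suc l < length T \<longrightarrow> (\<forall>d\<in>P. \<phi> (E T l) \<in> G d \<longrightarrow> (\<exists>b\<le>l. d \<in> miss \<phi> (Z T b))))"

text \<open>The least such \<open>q\<close> is the path number of the tail, the quantity on which
  Tashkinov's induction runs.\<close>

definition pathf :: "nat \<Rightarrow> ('e \<times> 'a) list \<Rightarrow> bool" where
  "pathf q T \<longleftrightarrow> (\<forall>i<length T. q \<le> i \<longrightarrow> ends (E T i) = {Z T i, Z T (Suc i)})"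

definition unused :: "('e \<Rightarrow> nat) \<Rightarrow> ('e \<times> 'a) list \<Rightarrow> nat \<Rightarrow> nat \<Rightarrow> bool" where
  "unused \<phi> T j c \<longleftrightarrow> (\<forall>l<j. \<phi> (E T l) \<noteq> c)"

lemma Z_0 [simp]: "Z T 0 = y" and Z_Suc [simp]: "Z T (Suc i) = snd (T ! i)"
  by (simp_all add: Z_def)

lemma Z_take: "i \<le> j \<Longrightarrow> Z (take j T) i = Z T i"
  by (cases i) (auto simp: Z_def)

lemma Z_append: "i \<le> length T \<Longrightarrow> Z (T @ T') i = Z T i"
  by (cases i) (auto simp: Z_def nth_append)

lemma Y_take: "m \<le> Suc j \<Longrightarrow> Y (take j T) m = Y T m"
  unfolding Y_def by (intro arg_cong2[of _ _ _ _ "(\<union>)"] image_cong refl) (auto simp: Z_take)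

lemma Y_append: "m \<le> Suc (length T) \<Longrightarrow> Y (T @ T') m = Y T m"
  unfolding Y_def by (intro arg_cong2[of _ _ _ _ "(\<union>)"] image_cong refl) (auto simp: Z_append)

lemma Y_mono: "m \<le> m' \<Longrightarrow> Y T m \<subseteq> Y T m'" by (auto simp: Y_def)

lemma Y_0 [simp]: "Y T 0 = W" by (simp add: Y_def)

lemma Y_Suc: "Y T (Suc m) = insert (Z T m) (Y T m)" by (auto simp: Y_def lessThan_Suc)

lemma W_Y: "W \<subseteq> Y T m" by (auto simp: Y_def)

lemma Z_in_Y: "i < m \<Longrightarrow> Z T i \<in> Y T m" by (auto simp: Y_def)

lemma finite_Y [simp]: "finite (Y T m)" using fin_W by (simp add: Y_def)

lemma \<Gamma>_Y: "\<phi> \<in> S \<Longrightarrow> \<Gamma> \<subseteq> missU \<phi> (Y T m)"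
  using S_missU W_Y missU_mono by metis

lemma missU_Y_Suc: "missU \<phi> (Y T (Suc m)) = missU \<phi> (Y T m) \<union> miss \<phi> (Z T m)"
  by (auto simp: Y_Suc missU_def)

lemma valid_Z_W: assumes "valid \<phi> T" "i \<le> length T" shows "Z T i \<notin> W"
proof (cases i)
  case 0 then show ?thesis using y_W by simp
next
  case (Suc m)
  then have "snd (T ! m) \<in> snd ` set T" using assms(2) by simp
  moreover have "snd ` set T \<inter> W = {}" using assms(1) by (simp add: valid_def)
  ultimately show ?thesis using Suc by (simp add: disjoint_iff)
qed

lemma valid_Z_inj:
  assumes "valid \<phi> T" "i \<le> length T" "i' \<le> length T" "Z T i = Z T i'" shows "i = i'"
proof -
  have d: "distinct (y # map snd T)" using assms by (simp add: valid_def)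
  have e: "Z T i = (y # map snd T) ! i" if "i \<le> length T" for i
    using that by (cases i) simp_all
  have "(y # map snd T) ! i = (y # map snd T) ! i'" using e[OF assms(2)] e[OF assms(3)] assms(4) by (simp only:)
  then show ?thesis using assms(2,3) by (subst (asm) nth_eq_iff_index_eq[OF d]) simp_all
qed

lemma valid_Z_Y:
  assumes "valid \<phi> T" "m \<le> i" "i \<le> length T" shows "Z T i \<notin> Y T m"
proof
  assume "Z T i \<in> Y T m"
  then obtain i' where i': "i' < m" "Z T i = Z T i'" using valid_Z_W[OF assms(1,3)] unfolding Y_def by blast
  have "i = i'" by (rule valid_Z_inj[OF assms(1,3) _ i'(2)]) (use i'(1) assms in linarith)
  then show False using i'(1) assms(2) by simp
qed

lemma valid_E: "valid \<phi> T \<Longrightarrow> i < length T \<Longrightarrow> E T i \<in> A"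
  "valid \<phi> T \<Longrightarrow> i < length T \<Longrightarrow> \<exists>t\<in>X T i. ends (E T i) = {t, Z T (Suc i)}"
  "valid \<phi> T \<Longrightarrow> i < length T \<Longrightarrow> \<phi> (E T i) \<in> missU \<phi> (X T i)"
  unfolding valid_def by blast+

lemma valid_take:
  assumes "valid \<phi> T" "j \<le> length T" shows "valid \<phi> (take j T)"
  unfolding valid_def
proof (intro conjI allI impI)
  have "distinct (y # map snd T)" using assms(1) by (simp add: valid_def)
  then have "distinct (take (Suc j) (y # map snd T))" by (rule distinct_take)
  then show "distinct (y # map snd (take j T))" by (simp add: take_map)
  have "snd ` set T \<inter> W = {}" using assms(1) by (simp add: valid_def)
  moreover have "snd ` set (take j T) \<subseteq> snd ` set T" using set_take_subset[of j T] by (rule image_mono)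
  ultimately show "snd ` set (take j T) \<inter> W = {}" by blast
next
  fix i assume i: "i < length (take j T)"
  then have e: "E (take j T) i = E T i" and x: "X (take j T) i = X T i" and z: "Z (take j T) (Suc i) = Z T (Suc i)"
    by (simp_all add: Y_take Z_take del: Z_Suc)
  show "E (take j T) i \<in> A" "\<exists>t\<in>X (take j T) i. ends (E (take j T) i) = {t, Z (take j T) (Suc i)}"
    "\<phi> (E (take j T) i) \<in> missU \<phi> (X (take j T) i)"
    unfolding e x z using valid_E[OF assms(1), of i] i by auto
qed

lemma cls_take:
  assumes "cls \<phi> T" "j \<le> length T" shows "cls \<phi> (take j T)"
  unfolding cls_def
proof (intro allI impI ballI)
  fix l d assume l: "Suc l < length (take j T)" "d \<in> P" "\<phi> (E (take j T) l) \<in> G d"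
  then have "Suc l < length T" "\<phi> (E T l) \<in> G d" by auto
  then obtain b where "b \<le> l" "d \<in> miss \<phi> (Z T b)" using assms(1) l(2) unfolding cls_def by blast
  then show "\<exists>b\<le>l. d \<in> miss \<phi> (Z (take j T) b)" using l by (intro exI[of _ b]) (auto simp: Z_take)
qed

lemma pathf_take: "pathf q T \<Longrightarrow> pathf q (take j T)"
  unfolding pathf_def by (auto simp: Z_take simp del: Z_Suc)

lemma base_elem: assumes "\<phi> \<in> S" shows "elem \<phi> (insert y W)"
proof -
  have "miss \<phi> y \<inter> miss \<phi> w = {}" if "w \<in> W" for w
    using S_y[OF assms] S_missU[OF assms] that by (auto simp: missU_def)
  then show ?thesis using S_elem[OF assms] unfolding elem_def by blast
qed

lemma missU_k: "c \<in> missU \<phi> V \<Longrightarrow> c < k" by (auto simp: missU_def miss_def)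

lemma \<Gamma>_k: "\<phi> \<in> S \<Longrightarrow> c \<in> \<Gamma> \<Longrightarrow> c < k" using S_missU by (metis missU_k)

lemma \<Gamma>_tail:
  assumes "\<phi> \<in> S" "elem \<phi> (Y T m)" "valid \<phi> T" "i < m" "i \<le> length T" "c \<in> miss \<phi> (Z T i)"
  shows "c \<notin> \<Gamma>"
proof
  assume "c \<in> \<Gamma>"
  then obtain w where w: "w \<in> W" "c \<in> miss \<phi> w" using S_missU[OF assms(1)] by (auto simp: missU_def)
  have "w \<in> Y T m" using w(1) W_Y by blast
  then have "w = Z T i" by (intro elemD[OF assms(2) _ Z_in_Y[OF assms(4)] w(2) assms(6)])
  then show False using valid_Z_W[OF assms(3,5)] w by simp
qed

lemma unused_mono: "unused \<phi> T j c \<Longrightarrow> i \<le> j \<Longrightarrow> unused \<phi> T i c" by (auto simp: unused_def)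

lemma unused_Suc: "unused \<phi> T (Suc j) c \<longleftrightarrow> unused \<phi> T j c \<and> \<phi> (E T j) \<noteq> c"
  by (auto simp: unused_def less_Suc_eq)

text \<open>The colour of an earlier edge is missing at an earlier vertex, and elementarity lets no
  second vertex miss it.\<close>

lemma unused_auto:
  assumes "valid \<phi> T" "elem \<phi> (Y T m)" "i < m" "i \<le> length T" "c \<in> miss \<phi> (Z T i)"
  shows "unused \<phi> T i c"
  unfolding unused_def
proof (intro allI impI notI)
  fix l assume l: "l < i" "\<phi> (E T l) = c"
  then obtain t where t: "t \<in> X T l" "c \<in> miss \<phi> t" 
  proof -
    have "\<phi> (E T l) \<in> missU \<phi> (X T l)" using l(1) assms(4) by (intro valid_E(3)[OF assms(1)]) simp
    then show ?thesis using that l(2) unfolding missU_def by blast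
  qed
  have "Y T (Suc l) \<subseteq> Y T m" using l(1) assms(3) by (intro Y_mono) simp
  then have "t \<in> Y T m" using t(1) by (rule subsetD)
  then have "t = Z T i" using elemD[OF assms(2) _ Z_in_Y[OF assms(3)] t(2) assms(5)] by simp
  moreover have "Z T i \<notin> X T l" using l(1) by (intro valid_Z_Y[OF assms(1) _ assms(4)]) simp
  ultimately show False using t(1) by simp
qed

text \<open>An earlier use of \<open>c\<close> would, by \<open>cls\<close>, need \<open>d\<close>
  missing at a vertex before \<open>Z T i\<close>, against elementarity. The exempt last edge does
  not interfere because \<open>i < length T\<close>.\<close>

lemma unused_G:
  assumes "valid \<phi> T" "cls \<phi> T" "elem \<phi> (Y T m)" "i < m" "i < length T" "d \<in> P" "d \<in> miss \<phi> (Z T i)" "c \<in> G d"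
  shows "unused \<phi> T i c"
  unfolding unused_def
proof (intro allI impI notI)
  fix l assume l: "l < i" "\<phi> (E T l) = c"
  then have "Suc l < length T" "\<phi> (E T l) \<in> G d" using assms(5,8) by auto
  then obtain b where b: "b \<le> l" "d \<in> miss \<phi> (Z T b)" using assms(2,6) unfolding cls_def by blast
  have "b < m" using b(1) l(1) assms(4) by simp
  then have "Z T b = Z T i" by (intro elemD[OF assms(3) Z_in_Y Z_in_Y[OF assms(4)] b(2) assms(7)])
  moreover have "b \<le> length T" "i \<le> length T" using b(1) l(1) assms(5) by simp_all
  ultimately have "b = i" by (intro valid_Z_inj[OF assms(1)])
  then show False using b(1) l(1) by simp
qed

definition nice :: "('e \<Rightarrow> nat) \<Rightarrow> ('e \<times> 'a) list \<Rightarrow> nat \<Rightarrow> nat set" where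
  "nice \<phi> T m = {c \<in> missU \<phi> (Y T m). c \<notin> P \<and> unused \<phi> T m c \<and>
     (\<forall>d\<in>P. c \<in> G d \<longrightarrow> (\<exists>b<m. d \<in> miss \<phi> (Z T b)))}"

text \<open>At least \<open>card \<Gamma> + m\<close> colours are missing, one for each tail vertex
  besides those of \<open>W\<close>. At most \<open>m\<close> of them are used, and each
  \<open>d\<close> in \<open>P\<close> spoils at most two: itself if it is already missing on the
  tail, otherwise its two reserved colours. The axiom \<open>card_\<Gamma>\<close> is tailored to
  this count.\<close>

lemma card_nice:
  assumes "\<phi> \<in> S" "valid \<phi> T" "elem \<phi> (Y T m)" "m \<le> length T"
  shows "2 \<le> card (nice \<phi> T m)"
proof -
  define Pa where "Pa = {d\<in>P. \<exists>b<m. d \<in> miss \<phi> (Z T b)}"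
  define U where "U = (\<lambda>l. \<phi> (E T l)) ` {..<m}"
  have Wsub: "Y T m = W \<union> Z T ` {..<m}" by (simp add: Y_def)
  have "card (missU \<phi> (Y T m)) = (\<Sum>v\<in>Y T m. card (miss \<phi> v))" using assms by (intro card_missU) auto
  also have "\<dots> = (\<Sum>v\<in>W. card (miss \<phi> v)) + (\<Sum>v\<in>Z T ` {..<m}. card (miss \<phi> v))"
    unfolding Wsub using fin_W valid_Z_W[OF assms(2)] assms(4) by (intro sum.union_disjoint) auto
  also have "(\<Sum>v\<in>W. card (miss \<phi> v)) = card \<Gamma>"
    using card_missU[OF fin_W S_elem[OF assms(1)]] S_missU[OF assms(1)] by simp
  finally have c0: "card (missU \<phi> (Y T m)) = card \<Gamma> + (\<Sum>v\<in>Z T ` {..<m}. card (miss \<phi> v))" .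
  have "(\<Sum>v\<in>Z T ` {..<m}. 1) \<le> (\<Sum>v\<in>Z T ` {..<m}. card (miss \<phi> v))"
    using S_miss[OF assms(1)] by (intro sum_mono) (simp add: Suc_leI card_gt_0_iff)
  moreover have "(\<Sum>v\<in>Z T ` {..<m}. 1::nat) = m"
  proof -
    have "inj_on (Z T) {..<m}" using valid_Z_inj[OF assms(2)] assms(4) by (intro inj_onI) auto
    then show ?thesis by (simp add: card_image)
  qed
  ultimately have c1: "card \<Gamma> + m \<le> card (missU \<phi> (Y T m))" using c0 by simp
  have sub: "missU \<phi> (Y T m) \<subseteq> nice \<phi> T m \<union> (U \<union> Pa \<union> (\<Union>d\<in>P - Pa. G d))"
  proof
    fix c assume c: "c \<in> missU \<phi> (Y T m)"
    show "c \<in> nice \<phi> T m \<union> (U \<union> Pa \<union> (\<Union>d\<in>P - Pa. G d))"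
    proof (cases "c \<in> nice \<phi> T m")
      case False
      then consider "c \<in> P" | "\<not> unused \<phi> T m c" | d where "d \<in> P" "c \<in> G d" "\<not> (\<exists>b<m. d \<in> miss \<phi> (Z T b))"
        using c unfolding nice_def by blast
      then show ?thesis
      proof cases
        case 1
        then have "c \<notin> missU \<phi> W" using S_missU[OF assms(1)] P_\<Gamma> by auto
        then have "c \<in> Pa" using c 1 unfolding Pa_def missU_def Y_def by auto
        then show ?thesis by simp
      next
        case 2 then show ?thesis by (auto simp: U_def unused_def)
      next
        case 3 then show ?thesis by (auto simp: Pa_def)
      qed
    qed simp
  qed
  have fG: "finite (G d)" if "d \<in> P" for d using G_sub[OF that] fin_\<Gamma> finite_subset by blast
  have PaP: "Pa \<subseteq> P" by (auto simp: Pa_def)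
  have fin: "finite U" "finite Pa" "finite (P - Pa)" using fin_P by (auto simp: U_def Pa_def)
  have "card (U \<union> Pa \<union> (\<Union>d\<in>P - Pa. G d)) \<le> card U + card Pa + card (\<Union>d\<in>P - Pa. G d)"
    by (meson add_le_mono card_Un_le le_trans order_refl)
  also have "card (\<Union>d\<in>P - Pa. G d) \<le> (\<Sum>d\<in>P - Pa. card (G d))" using fin by (intro card_UN_le) auto
  also have "\<dots> = 2 * card (P - Pa)" using G_card by simp
  also have "card (P - Pa) = card P - card Pa" using PaP fin by (intro card_Diff_subset) auto
  also have "card U \<le> m" unfolding U_def by (metis card_image_le card_lessThan finite_lessThan)
  finally have c2: "card (U \<union> Pa \<union> (\<Union>d\<in>P - Pa. G d)) \<le> m + card Pa + 2 * (card P - card Pa)" by simp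
  have "card Pa \<le> card P" using PaP fin_P card_mono by blast
  then have c3: "card (U \<union> Pa \<union> (\<Union>d\<in>P - Pa. G d)) \<le> m + 2 * card P" using c2 by simp
  have finN: "finite (nice \<phi> T m)" by (rule finite_subset[of _ "missU \<phi> (Y T m)"]) (auto simp: nice_def)
  have "card (missU \<phi> (Y T m)) \<le> card (nice \<phi> T m \<union> (U \<union> Pa \<union> (\<Union>d\<in>P - Pa. G d)))"
    using sub finN fin fG by (intro card_mono) auto
  also have "\<dots> \<le> card (nice \<phi> T m) + card (U \<union> Pa \<union> (\<Union>d\<in>P - Pa. G d))" by (rule card_Un_le)
  finally show ?thesis using c1 c3 card_\<Gamma> by simp
qed

end

section \<open>The induction step of the tail theorem\<close>

locale tail_step = tail_root A ends k W y \<Gamma> P S G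
  for A :: "'e set" and ends :: "'e \<Rightarrow> 'a set" and k :: nat and W y \<Gamma> P S G +
  fixes q N :: nat
  assumes IHq: "q' < q \<Longrightarrow> \<phi> \<in> S \<Longrightarrow> valid \<phi> T \<Longrightarrow> cls \<phi> T \<Longrightarrow> pathf q' T \<Longrightarrow> elem \<phi> (X T (length T))"
    and IHn: "\<phi> \<in> S \<Longrightarrow> valid \<phi> T \<Longrightarrow> cls \<phi> T \<Longrightarrow> pathf q T \<Longrightarrow> length T < N \<Longrightarrow> elem \<phi> (X T (length T))"
    and qN: "q \<le> N"
begin

text \<open>A candidate counterexample, with the repeated colour at its last vertex. The earlier
  vertex that also misses the colour is recorded separately, in \<open>safe\<close> and
  \<open>st\<close>.\<close>

definition dup :: "('e \<Rightarrow> nat) \<Rightarrow> ('e \<times> 'a) list \<Rightarrow> nat \<Rightarrow> bool" where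
  "dup \<phi> T \<alpha> \<longleftrightarrow> \<phi> \<in> S \<and> valid \<phi> T \<and> cls \<phi> T \<and> pathf q T \<and> length T = N \<and> \<alpha> \<in> miss \<phi> (Z T N)"

lemma dupD: assumes "dup \<phi> T \<alpha>"
  shows "\<phi> \<in> S" "valid \<phi> T" "cls \<phi> T" "pathf q T" "length T = N" "\<alpha> \<in> miss \<phi> (Z T N)" "proper \<phi>"
  using assms S_proper by (auto simp: dup_def)

text \<open>A swap is going to change only edges of index at least \<open>j\<close>. For
  \<open>Suc j \<ge> N\<close> that leaves just the last edge, which \<open>cls\<close>
  exempts.\<close>

definition free :: "('e \<Rightarrow> nat) \<Rightarrow> ('e \<times> 'a) list \<Rightarrow> nat \<Rightarrow> nat \<Rightarrow> bool" where
  "free \<phi> T j c \<longleftrightarrow> Suc j \<ge> N \<or> (\<forall>d\<in>P. c \<in> G d \<longrightarrow> (\<exists>b\<le>j. d \<in> miss \<phi> (Z T b)))"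

definition safe :: "('e \<Rightarrow> nat) \<Rightarrow> ('e \<times> 'a) list \<Rightarrow> nat \<Rightarrow> nat \<Rightarrow> bool" where
  "safe \<phi> T j c \<longleftrightarrow> c \<in> missU \<phi> (X T j) \<and> unused \<phi> T j c \<and> free \<phi> T j c"

lemma safe_cong:
  assumes "j < N" "\<And>u. u \<in> Y T N \<Longrightarrow> miss \<phi>' u = miss \<phi> u" "\<And>l. l < j \<Longrightarrow> \<phi>' (E T l) = \<phi> (E T l)"
  shows "safe \<phi>' T j c = safe \<phi> T j c"
proof -
  have "Y T (Suc j) \<subseteq> Y T N" using assms(1) by (intro Y_mono) simp
  then have "missU \<phi>' (Y T (Suc j)) = missU \<phi> (Y T (Suc j))" unfolding missU_def using assms(2) by blast
  moreover have "miss \<phi>' (Z T b) = miss \<phi> (Z T b)" if "b \<le> j" for b using that assms(1) by (intro assms(2) Z_in_Y) simp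
  ultimately show ?thesis using assms(3) by (simp add: safe_def unused_def free_def cong: conj_cong)
qed

lemma dup_elem:
  assumes "dup \<phi> T \<alpha>" "m \<le> N" shows "elem \<phi> (Y T m)"
proof (cases m)
  case 0 then show ?thesis using S_elem dupD(1)[OF assms(1)] by simp
next
  case (Suc b)
  note d = dupD[OF assms(1)]
  have "elem \<phi> (X (take b T) (length (take b T)))"
    using Suc assms(2) d by (intro IHn valid_take cls_take pathf_take) auto
  moreover have "length (take b T) = b" using Suc assms(2) d(5) by simp
  moreover have "Y (take b T) (Suc b) = Y T (Suc b)" by (intro Y_take) simp
  ultimately show ?thesis using Suc by simp
qed

text \<open>Recolouring a component at \<open>Z T b\<close> that avoids the other tail vertices concerned
  would produce a shorter non-elementary tail.\<close>

lemma no_short_swap: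
  assumes d: "dup \<phi> T \<kappa>" and b: "b < N" and ab: "a < k" "a' < k" "a \<noteq> a'"
    and C: "kclosed \<phi> a a' C" "swap \<phi> a a' C \<in> S"
    and un: "unused \<phi> T b a" "unused \<phi> T b a'"
    and t: "Z T b \<in> C" "a' \<in> miss \<phi> (Z T b)"
    and s: "s \<in> Y T b" "a \<in> miss \<phi> s"
    and out: "\<And>u. u \<in> Y T b \<Longrightarrow> a \<in> miss \<phi> u \<or> a' \<in> miss \<phi> u \<Longrightarrow> u \<notin> C"
  shows False
proof -
  let ?f = "swap \<phi> a a' C"
  note dd = dupD[OF d]
  have m: "miss ?f u = miss \<phi> u" if "u \<in> Y T b" for u
  proof (cases "a \<in> miss \<phi> u \<or> a' \<in> miss \<phi> u")
    case True show ?thesis by (rule miss_swap_out[OF C(1) out[OF that True]])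
  next
    case False then show ?thesis by (intro miss_swap_neither[OF C(1) ab(1,2)]) simp_all
  qed
  have mU: "missU ?f (Y T m) = missU \<phi> (Y T m)" if "m \<le> b" for m
    unfolding missU_def using m Y_mono[OF that, of T] by blast
  have c: "?f (E T l) = \<phi> (E T l)" if "l < b" for l
    using un that by (intro swap_other) (auto simp: unused_def)
  let ?T = "take b T"
  have len: "length ?T = b" using b dd(5) by simp
  have v: "valid \<phi> ?T" using dd b by (intro valid_take) auto
  have "valid ?f ?T"
    unfolding valid_def
  proof (intro conjI allI impI)
    show "distinct (y # map snd ?T)" "snd ` set ?T \<inter> W = {}" using v by (auto simp: valid_def)
  next
    fix i assume i: "i < length ?T"
    then have ib: "i < b" using len by simp
    show "E ?T i \<in> A" "\<exists>t\<in>X ?T i. ends (E ?T i) = {t, Z ?T (Suc i)}" using valid_E[OF v i] by auto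
    have "Y ?T (Suc i) = Y T (Suc i)" using ib by (intro Y_take) simp
    then show "?f (E ?T i) \<in> missU ?f (X ?T i)" using valid_E(3)[OF v i] mU[of "Suc i"] c[OF ib] ib by simp
  qed
  moreover have "cls ?f ?T"
    unfolding cls_def
  proof (intro allI impI ballI)
    fix l d assume l: "Suc l < length ?T" "d \<in> P" "?f (E ?T l) \<in> G d"
    have cl: "cls \<phi> ?T" using dd b by (intro cls_take) auto
    have lb: "l < b" using l len by simp
    then have "\<phi> (E ?T l) \<in> G d" using l(3) c by simp
    then obtain b' where b': "b' \<le> l" "d \<in> miss \<phi> (Z ?T b')" using cl l unfolding cls_def by blast
    moreover have "Z ?T b' = Z T b'" using b' lb by (intro Z_take) simp
    moreover have "Z T b' \<in> Y T b" using b' lb by (intro Z_in_Y) simp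
    ultimately show "\<exists>b\<le>l. d \<in> miss ?f (Z ?T b)" by (intro exI[of _ b']) (simp add: m)
  qed
  ultimately have "elem ?f (X ?T (length ?T))" using dd(4) b len C(2) by (intro IHn pathf_take) auto
  moreover have "X ?T (length ?T) = insert (Z T b) (Y T b)"
    using len Y_take[of "Suc b" b T] by (simp add: Y_Suc)
  ultimately have el: "elem ?f (insert (Z T b) (Y T b))" by simp
  have "a \<in> miss ?f (Z T b)" using miss_swap_in[OF t(1) ab(1,2)] t(2) by simp
  moreover have "a \<in> miss ?f s" using m[OF s(1)] s(2) by simp
  ultimately have "Z T b = s" using elemD[OF el, of "Z T b" s a] s(1) by simp
  then show False using valid_Z_Y[OF dd(2), of b b] s(1) b dd(5) by simp
qed

text \<open>The tail vertices missing one of the two colours already account for another chain. If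
  both colours are in \<open>\<Gamma>\<close>, these vertices lie in \<open>W\<close>, which no edge
  of the two colours leaves. If one is, the tail vertex missing the other has a chain that meets
  \<open>W\<close>, and \<open>S_uniq\<close> leaves no room for \<open>Z T N\<close>. If none is,
  the two tail vertices share a chain, which has no third end. Wherever a chain failed to connect as
  claimed, a swap at the later vertex would give a shorter counterexample by
  \<open>no_short_swap\<close>.\<close>

lemma comp_avoid:
  assumes d: "dup \<phi> T \<alpha>" and j: "j < N" and s: "safe \<phi> T j \<alpha>" "safe \<phi> T j \<beta>" and ne: "\<alpha> \<noteq> \<beta>"
    and P: "\<alpha> \<notin> P \<and> \<beta> \<notin> P \<or> \<alpha> \<in> \<Gamma> \<or> \<beta> \<in> \<Gamma>"
  shows "(\<alpha> \<in> \<Gamma> \<or> \<beta> \<in> \<Gamma> \<longrightarrow> kc \<phi> \<alpha> \<beta> (Z T N) \<inter> W = {}) \<and>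
    (\<forall>u\<in>Y T N. \<alpha> \<in> miss \<phi> u \<or> \<beta> \<in> miss \<phi> u \<longrightarrow> u \<notin> kc \<phi> \<alpha> \<beta> (Z T N))"
proof -
  note dd = dupD[OF d]
  let ?K = "kc \<phi> \<alpha> \<beta> (Z T N)"
  have el: "elem \<phi> (Y T N)" by (rule dup_elem[OF d order_refl])
  have k: "\<alpha> < k" "\<beta> < k" using s missU_k by (auto simp: safe_def)
  have un: "unused \<phi> T b \<alpha>" "unused \<phi> T b \<beta>" if "b \<le> j" for b
    using s that unused_mono by (auto simp: safe_def)
  have ZN: "Z T N \<notin> W" "Z T N \<notin> Y T N" using valid_Z_W[OF dd(2)] valid_Z_Y[OF dd(2), of N N] dd(5) by auto
  have XY: "X T j \<subseteq> Y T N" using j by (intro Y_mono) simp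
  have uq: "u = v" if "u \<in> Y T N" "v \<in> Y T N" "c \<in> miss \<phi> u" "c \<in> miss \<phi> v" for u v c
    by (rule elemD[OF el that])
  have tailv: "\<exists>b\<le>j. c \<in> miss \<phi> (Z T b)" if "c \<in> missU \<phi> (X T j)" "c \<notin> \<Gamma>" for c
  proof -
    have "c \<notin> missU \<phi> W" using S_missU[OF dd(1)] that by simp
    then show ?thesis using that by (auto simp: missU_def Y_def less_Suc_eq_le)
  qed
  have wv: "\<exists>w\<in>W. c \<in> miss \<phi> w" if "c \<in> \<Gamma>" for c
    using S_missU[OF dd(1)] that by (auto simp: missU_def)
  have mixed: "kc \<phi> c e (Z T N) \<inter> W = {} \<and> (\<forall>u\<in>Y T N. c \<in> miss \<phi> u \<or> e \<in> miss \<phi> u \<longrightarrow> u \<notin> kc \<phi> c e (Z T N))"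
    if ce: "c \<in> \<Gamma>" "e \<notin> \<Gamma>" "c < k" "e < k" "e \<in> missU \<phi> (X T j)" "\<And>b. b \<le> j \<Longrightarrow> unused \<phi> T b c \<and> unused \<phi> T b e"
      "c \<in> miss \<phi> (Z T N) \<or> e \<in> miss \<phi> (Z T N)" for c e
  proof -
    obtain b where b: "b \<le> j" "e \<in> miss \<phi> (Z T b)" using tailv ce by blast
    obtain w where w: "w \<in> W" "c \<in> miss \<phi> w" using wv ce by blast
    have cne: "c \<noteq> e" using ce by auto
    have ZbW: "Z T b \<notin> W" using valid_Z_W[OF dd(2)] b j dd(5) by simp
    have ZbY: "Z T b \<in> Y T N" using b j by (intro Z_in_Y) simp
    have wY: "w \<in> Y T m" for m using w W_Y by blast
    have meets: "kc \<phi> c e (Z T b) \<inter> W \<noteq> {}"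
    proof
      assume dis: "kc \<phi> c e (Z T b) \<inter> W = {}"
      show False
      proof (rule no_short_swap[OF d _ ce(3,4) cne kc_closed])
        show "b < N" using b j by simp
        show "swap \<phi> c e (kc \<phi> c e (Z T b)) \<in> S" using S_swap[OF dd(1) ce(3,4) cne kc_closed] dis by blast
        show "unused \<phi> T b c" "unused \<phi> T b e" using ce(6) b by auto
        show "Z T b \<in> kc \<phi> c e (Z T b)" "e \<in> miss \<phi> (Z T b)" "w \<in> Y T b" "c \<in> miss \<phi> w" using b w wY by auto
        fix u assume u: "u \<in> Y T b" "c \<in> miss \<phi> u \<or> e \<in> miss \<phi> u"
        have uY: "u \<in> Y T N" using u Y_mono[of b N T] b j by auto
        show "u \<notin> kc \<phi> c e (Z T b)"
        proof (cases "c \<in> miss \<phi> u")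
          case True then show ?thesis using uq[OF uY wY True w(2)] dis w by blast
        next
          case False
          then have "u = Z T b" using uq[OF uY ZbY _ b(2)] u by blast
          then show ?thesis using valid_Z_Y[OF dd(2), of b b] u b j dd(5) by simp
        qed
      qed
    qed
    have neN: "Z T b \<noteq> Z T N" using ZbY ZN by auto
    have disj: "kc \<phi> c e (Z T N) \<inter> W = {}"
    proof (rule ccontr)
      assume "kc \<phi> c e (Z T N) \<inter> W \<noteq> {}"
      then have "Z T b = Z T N" using S_uniq[OF dd(1) ce(1,4,2) ZbW ZN(1) _ _ meets] b(2) ce(7) by blast
      then show False using neN by simp
    qed
    moreover have "u \<notin> kc \<phi> c e (Z T N)" if u: "u \<in> Y T N" "c \<in> miss \<phi> u \<or> e \<in> miss \<phi> u" for u
    proof (cases "c \<in> miss \<phi> u")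
      case True then show ?thesis using uq[OF u(1) wY True w(2)] disj w by blast
    next
      case False
      then have "u = Z T b" using uq[OF u(1) ZbY _ b(2)] u by blast
      then show ?thesis using kc_eq[of u \<phi> c e "Z T N"] meets disj by auto
    qed
    ultimately show ?thesis by blast
  qed
  consider (both) "\<alpha> \<in> \<Gamma>" "\<beta> \<in> \<Gamma>" | (one) "\<alpha> \<in> \<Gamma>" "\<beta> \<notin> \<Gamma>" | (two) "\<beta> \<in> \<Gamma>" "\<alpha> \<notin> \<Gamma>" | (none) "\<alpha> \<notin> \<Gamma>" "\<beta> \<notin> \<Gamma>" by blast
  then show ?thesis
  proof cases
    case one
    show ?thesis using mixed[OF one k, of] s un dd(6) one by (auto simp: safe_def)
  next
    case two
    have "kc \<phi> \<beta> \<alpha> (Z T N) \<inter> W = {} \<and> (\<forall>u\<in>Y T N. \<beta> \<in> miss \<phi> u \<or> \<alpha> \<in> miss \<phi> u \<longrightarrow> u \<notin> kc \<phi> \<beta> \<alpha> (Z T N))"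
      using s un dd(6) by (intro mixed two k) (auto simp: safe_def)
    then show ?thesis unfolding kc_commute[of \<phi> \<beta> \<alpha>] by blast
  next
    case both
    have "kclosed \<phi> \<alpha> \<beta> (- W)" unfolding kclosed_def
    proof (intro ballI impI)
      fix e assume e: "e \<in> ab \<phi> \<alpha> \<beta>" "ends e \<inter> - W \<noteq> {}"
      then show "ends e \<subseteq> - W" using S_closed[OF dd(1), of e] both by (auto simp: ab_def)
    qed
    then have K: "?K \<subseteq> - W" using ZN by (intro kc_min) auto
    moreover have "u \<in> W" if u: "u \<in> Y T N" "\<alpha> \<in> miss \<phi> u \<or> \<beta> \<in> miss \<phi> u" for u
    proof -
      obtain c where c: "c \<in> \<Gamma>" "c \<in> miss \<phi> u" using u both by blast
      obtain w where w: "w \<in> W" "c \<in> miss \<phi> w" using wv c by blast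
      then show ?thesis using uq[OF u(1) _ c(2) w(2)] W_Y by blast
    qed
    ultimately show ?thesis by blast
  next
    case none
    then have P: "\<alpha> \<notin> \<Gamma> \<union> P \<and> \<beta> \<notin> \<Gamma> \<union> P" using P by blast
    have key: "kc \<phi> c e (Z T b) \<inter> {Z T a, Z T N} = {Z T a} \<or> a = b"
      if ce: "c \<notin> \<Gamma> \<union> P" "e \<notin> \<Gamma> \<union> P" "c < k" "e < k" "c \<noteq> e" "a \<le> b" "b \<le> j" "c \<in> miss \<phi> (Z T a)" "e \<in> miss \<phi> (Z T b)"
        "c \<in> miss \<phi> (Z T N) \<or> e \<in> miss \<phi> (Z T N)" "unused \<phi> T b c" "unused \<phi> T b e" for c e a b
    proof (cases "a = b")
      case False
      have aY: "Z T a \<in> Y T N" "Z T b \<in> Y T N" using ce j by (auto intro!: Z_in_Y)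
      have nab: "Z T a \<noteq> Z T b" using valid_Z_inj[OF dd(2), of a b] ce j dd(5) False by auto
      have in1: "Z T a \<in> kc \<phi> c e (Z T b)"
      proof (rule ccontr)
        assume out: "Z T a \<notin> kc \<phi> c e (Z T b)"
        show False
        proof (rule no_short_swap[OF d _ ce(3,4,5) kc_closed])
          show "b < N" using ce j by simp
          show "swap \<phi> c e (kc \<phi> c e (Z T b)) \<in> S" using S_swap[OF dd(1) ce(3,4,5) kc_closed] ce by blast
          show "unused \<phi> T b c" "unused \<phi> T b e" "Z T b \<in> kc \<phi> c e (Z T b)" "e \<in> miss \<phi> (Z T b)" "c \<in> miss \<phi> (Z T a)"
            using ce by auto
          show "Z T a \<in> Y T b" using ce False by (intro Z_in_Y) simp
          fix u assume u: "u \<in> Y T b" "c \<in> miss \<phi> u \<or> e \<in> miss \<phi> u"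
          have uY: "u \<in> Y T N" using u Y_mono[of b N T] ce j by auto
          show "u \<notin> kc \<phi> c e (Z T b)"
          proof (cases "c \<in> miss \<phi> u")
            case True then show ?thesis using uq[OF uY aY(1) True ce(8)] out by blast
          next
            case False
            then have "u = Z T b" using uq[OF uY aY(2) _ ce(9)] u by blast
            then show ?thesis using valid_Z_Y[OF dd(2), of b b] u ce j dd(5) by simp
          qed
        qed
      qed
      have "Z T N \<notin> kc \<phi> c e (Z T b)"
      proof
        assume inN: "Z T N \<in> kc \<phi> c e (Z T b)"
        show False
          by (rule kc_three_ends[OF dd(7) ce(3,4,5) in1 inN kc_self]) (use aY ZN nab ce in auto)
      qed
      then show ?thesis using in1 by blast
    qed simp
    obtain a b where a: "a \<le> j" "\<alpha> \<in> miss \<phi> (Z T a)" and b: "b \<le> j" "\<beta> \<in> miss \<phi> (Z T b)"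
      using tailv s none unfolding safe_def by blast
    have abY: "Z T a \<in> Y T N" "Z T b \<in> Y T N" using a b j by (auto intro!: Z_in_Y)
    have goal: "Z T a \<notin> ?K \<and> Z T b \<notin> ?K"
    proof (cases "a = b")
      case True
      have "kc \<phi> \<alpha> \<beta> (Z T a) = {Z T a}" using a b True by (intro kc_isolated) auto
      then show ?thesis using True kc_sym[of "Z T a" \<phi> \<alpha> \<beta> "Z T N"] abY ZN by auto
    next
      case False
      have "\<exists>t. Z T a \<in> kc \<phi> \<alpha> \<beta> t \<and> Z T b \<in> kc \<phi> \<alpha> \<beta> t \<and> Z T N \<notin> kc \<phi> \<alpha> \<beta> t"
      proof (cases "a \<le> b")
        case True
        have "kc \<phi> \<alpha> \<beta> (Z T b) \<inter> {Z T a, Z T N} = {Z T a}"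
          using key[of \<alpha> \<beta> a b] P k ne True b a dd(6) un[OF b(1)] False by blast
        moreover have "Z T N \<noteq> Z T a" using abY ZN by auto
        ultimately show ?thesis using kc_self[of "Z T b" \<phi> \<alpha> \<beta>] by blast
      next
        case False
        then have "b \<le> a" by simp
        then have "kc \<phi> \<beta> \<alpha> (Z T a) \<inter> {Z T b, Z T N} = {Z T b}"
          using key[of \<beta> \<alpha> b a] P k ne b a dd(6) un[OF a(1)] \<open>a \<noteq> b\<close> by blast
        moreover have "Z T N \<noteq> Z T b" using abY ZN by auto
        ultimately show ?thesis using kc_self[of "Z T a" \<phi> \<alpha> \<beta>] unfolding kc_commute[of \<phi> \<beta> \<alpha>] by blast
      qed
      then obtain t where t: "Z T a \<in> kc \<phi> \<alpha> \<beta> t" "Z T b \<in> kc \<phi> \<alpha> \<beta> t" "Z T N \<notin> kc \<phi> \<alpha> \<beta> t" by blast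
      have "v \<notin> ?K" if "v \<in> kc \<phi> \<alpha> \<beta> t" for v
      proof
        assume "v \<in> ?K"
        then have "Z T N \<in> kc \<phi> \<alpha> \<beta> v" by (rule kc_sym)
        then show False using kc_eq[OF that] t(3) by simp
      qed
      then show ?thesis using t by blast
    qed
    have "u \<notin> ?K" if "u \<in> Y T N" "\<alpha> \<in> miss \<phi> u \<or> \<beta> \<in> miss \<phi> u" for u
      using that goal uq[OF that(1) abY(1) _ a(2)] uq[OF that(1) abY(2) _ b(2)] by blast
    then show ?thesis using none by blast
  qed
qed

text \<open>Only edges of index at least \<open>j\<close> change, and only between two colours that
  are both missing on \<open>X T j\<close>; so the tail stays valid, and \<open>free\<close> secures
  \<open>cls\<close>.\<close>

lemma move:
  assumes d: "dup \<phi> T \<alpha>" and j: "j < N" and s: "safe \<phi> T j \<alpha>" "safe \<phi> T j \<beta>" and ne: "\<alpha> \<noteq> \<beta>"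
    and P: "\<alpha> \<notin> P \<and> \<beta> \<notin> P \<or> \<alpha> \<in> \<Gamma> \<or> \<beta> \<in> \<Gamma>" and f: "\<phi>' = swap \<phi> \<alpha> \<beta> (kc \<phi> \<alpha> \<beta> (Z T N))"
  shows "dup \<phi>' T \<beta>" "\<And>u. u \<in> Y T N \<Longrightarrow> miss \<phi>' u = miss \<phi> u" "\<And>l. l < j \<Longrightarrow> \<phi>' (E T l) = \<phi> (E T l)"
proof -
  note dd = dupD[OF d]
  let ?K = "kc \<phi> \<alpha> \<beta> (Z T N)"
  have k: "\<alpha> < k" "\<beta> < k" using s missU_k by (auto simp: safe_def)
  note av = comp_avoid[OF d j s ne P]
  show m: "miss \<phi>' u = miss \<phi> u" if u: "u \<in> Y T N" for u
    unfolding f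
  proof (cases "\<alpha> \<in> miss \<phi> u \<or> \<beta> \<in> miss \<phi> u")
    case True
    then have "u \<notin> ?K" using av u by blast
    then show "miss (swap \<phi> \<alpha> \<beta> ?K) u = miss \<phi> u" by (rule miss_swap_out[OF kc_closed])
  next
    case False then show "miss (swap \<phi> \<alpha> \<beta> ?K) u = miss \<phi> u" by (intro miss_swap_neither[OF kc_closed k]) simp_all
  qed
  show c: "\<phi>' (E T l) = \<phi> (E T l)" if "l < j" for l
    unfolding f using s that unfolding safe_def unused_def by (intro swap_other) blast+
  have mU: "missU \<phi>' (Y T m) = missU \<phi> (Y T m)" if "m \<le> N" for m
    unfolding missU_def using m Y_mono[OF that, of T] by blast
  have S': "\<phi>' \<in> S" unfolding f
  proof (rule S_swap[OF dd(1) k ne kc_closed])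
    show "?K \<inter> W = {} \<or> \<alpha> \<notin> \<Gamma> \<union> P \<and> \<beta> \<notin> \<Gamma> \<union> P" using av P by blast
  qed
  have col: "\<phi>' e = \<phi> e \<or> (\<phi> e = \<alpha> \<and> \<phi>' e = \<beta>) \<or> (\<phi> e = \<beta> \<and> \<phi>' e = \<alpha>)" for e
    unfolding f swap_def by (cases "\<phi> e = \<alpha>"; cases "\<phi> e = \<beta>") simp_all
  have "valid \<phi>' T" unfolding valid_def
  proof (intro conjI allI impI)
    show "distinct (y # map snd T)" "snd ` set T \<inter> W = {}" using dd(2) by (auto simp: valid_def)
  next
    fix i assume i: "i < length T"
    show "E T i \<in> A" "\<exists>t\<in>X T i. ends (E T i) = {t, Z T (Suc i)}" using valid_E[OF dd(2) i] by auto
    have e: "missU \<phi>' (X T i) = missU \<phi> (X T i)" using i dd(5) by (intro mU) simp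
    show "\<phi>' (E T i) \<in> missU \<phi>' (X T i)"
    proof (cases "i < j")
      case True then show ?thesis using c e valid_E(3)[OF dd(2) i] by simp
    next
      case False
      then have "missU \<phi> (X T j) \<subseteq> missU \<phi> (X T i)" by (intro missU_mono Y_mono) simp
      then have "\<alpha> \<in> missU \<phi> (X T i)" "\<beta> \<in> missU \<phi> (X T i)" using s by (auto simp: safe_def)
      then show ?thesis using col[of "E T i"] e valid_E(3)[OF dd(2) i] by metis
    qed
  qed
  moreover have "cls \<phi>' T" unfolding cls_def
  proof (intro allI impI ballI)
    fix l d assume l: "Suc l < length T" "d \<in> P" "\<phi>' (E T l) \<in> G d"
    have "\<exists>b\<le>l. d \<in> miss \<phi> (Z T b)"
    proof (cases "\<phi>' (E T l) = \<phi> (E T l)")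
      case True then show ?thesis using dd(3) l unfolding cls_def by metis
    next
      case False
      then have lj: "j \<le> l" using c by (meson not_le)
      have "\<phi>' (E T l) = \<alpha> \<or> \<phi>' (E T l) = \<beta>" using col[of "E T l"] False by blast
      then have "free \<phi> T j (\<phi>' (E T l))" using s unfolding safe_def by metis
      moreover have "\<not> N \<le> Suc j" using l(1) lj dd(5) by simp
      ultimately have "\<exists>b\<le>j. d \<in> miss \<phi> (Z T b)" using l(2,3) unfolding free_def by blast
      then show ?thesis using lj le_trans by blast
    qed
    then obtain b where "b \<le> l" "d \<in> miss \<phi> (Z T b)" by blast
    moreover from this have "miss \<phi>' (Z T b) = miss \<phi> (Z T b)" using l(1) dd(5) by (intro m Z_in_Y) simp
    ultimately show "\<exists>b\<le>l. d \<in> miss \<phi>' (Z T b)" by blast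
  qed
  moreover have "\<beta> \<in> miss \<phi>' (Z T N)" unfolding f using miss_swap_in[OF kc_self k] dd(6) ne by simp
  ultimately show "dup \<phi>' T \<beta>" using S' dd(4,5) by (simp add: dup_def)
qed

end

section \<open>Contradictions from shorter tails and from smaller path numbers\<close>

context tail_step
begin

definition reserved_ok :: "('e \<Rightarrow> nat) \<Rightarrow> ('e \<times> 'a) list \<Rightarrow> nat \<Rightarrow> nat \<Rightarrow> bool" where
  "reserved_ok \<phi> T m c \<longleftrightarrow> (\<forall>d\<in>P. c \<in> G d \<longrightarrow> (\<exists>b<m. d \<in> miss \<phi> (Z T b)))"

text \<open>If the chain of \<open>z\<close> met \<open>X T i\<close>, a piece of it from
  \<open>X T i\<close> to \<open>z\<close> could be appended to \<open>take i T\<close>. The result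
  is a path from index \<open>Suc i < q\<close> on, so the outer induction makes it elementary,
  although \<open>a\<close> is missing both at \<open>z\<close> and on \<open>X T i\<close>.\<close>

lemma two_colour:
  assumes d: "dup \<phi> T \<kappa>" and i: "Suc i < q" and ab: "a \<in> missU \<phi> (X T i)" "b \<in> missU \<phi> (X T i)"
    and res: "reserved_ok \<phi> T (Suc i) a" "reserved_ok \<phi> T (Suc i) b" and z: "z \<notin> X T i" "a \<in> miss \<phi> z"
  shows "kc \<phi> a b z \<inter> X T i = {}"
proof (rule ccontr)
  note dd = dupD[OF d]
  assume "kc \<phi> a b z \<inter> X T i \<noteq> {}"
  then obtain x where x: "x \<in> kc \<phi> a b z" "x \<in> X T i" by blast
  then have "z \<in> kc \<phi> a b x" using kc_sym by blast
  then have "(x, z) \<in> (adj_via ends (ab \<phi> a b))\<^sup>*" by (simp add: kc_def)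
  then obtain ps where ps: "apath ends (ab \<phi> a b) (X T i) ps" "snd (last ps) = z"
    by (rule apath_exists[where ends = ends, OF _ x(2) z(1)])
  note pp = apath_props[where ends = ends, OF ps(1)]
  define T' where "T' = take i T @ ps"
  have len: "length (take i T) = i" using i qN dd(5) by simp
  have nth1: "T' ! l = T ! l" if "l < i" for l using that len by (simp add: T'_def nth_append)
  have nth2: "T' ! (i + l) = ps ! l" for l using len by (simp add: T'_def nth_append)
  have len': "length T' = i + length ps" using len by (simp add: T'_def)
  have YT: "Y T' m = Y T m" if "m \<le> Suc i" for m
  proof -
    have "Y T' m = Y (take i T) m" unfolding T'_def using that len by (intro Y_append) simp
    also have "\<dots> = Y T m" using that by (rule Y_take)
    finally show ?thesis .
  qed
  have ZT: "Z T' b = Z T b" if "b \<le> i" for b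
  proof -
    have "Z T' b = Z (take i T) b" unfolding T'_def using that len by (intro Z_append) simp
    also have "\<dots> = Z T b" using that by (rule Z_take)
    finally show ?thesis .
  qed
  have Z2: "Z T' (Suc (i + l)) = snd (ps ! l)" for l using nth2 by simp
  have iN: "i \<le> length T" using len by simp
  have vt: "valid \<phi> (take i T)" by (rule valid_take[OF dd(2) iN])
  have sub: "insert y (snd ` set (take i T)) \<subseteq> X T i"
  proof
    fix u assume "u \<in> insert y (snd ` set (take i T))"
    then have "u \<in> set (y # map snd (take i T))" by simp
    then obtain b where b: "b < length (y # map snd (take i T))" "(y # map snd (take i T)) ! b = u"
      unfolding in_set_conv_nth by blast
    have bi: "b < Suc i" using b(1) len by simp
    have "u = Z T b"
    proof (cases b)
      case 0
      have "y = u" using b(2) unfolding 0 nth_Cons_0 .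
      then show ?thesis unfolding 0 Z_0 by (rule sym)
    next
      case (Suc b') then show ?thesis using b by simp
    qed
    then show "u \<in> X T i" using Z_in_Y[OF bi] by simp
  qed
  have val: "valid \<phi> T'" unfolding valid_def
  proof (intro conjI allI impI)
    have "distinct (y # map snd (take i T))" "snd ` set (take i T) \<inter> W = {}"
      using vt by (simp_all add: valid_def)
    moreover have "(insert y (snd ` set (take i T))) \<inter> snd ` set ps = {}" using sub pp(3) by blast
    ultimately show "distinct (y # map snd T')" using pp(2) by (auto simp: T'_def)
    have "snd ` set ps \<inter> W = {}" using pp(3) W_Y by blast
    then show "snd ` set T' \<inter> W = {}" using \<open>snd ` set (take i T) \<inter> W = {}\<close> by (auto simp: T'_def)
  next
    fix l assume l: "l < length T'"
    have "E T' l \<in> A \<and> (\<exists>t\<in>X T' l. ends (E T' l) = {t, Z T' (Suc l)}) \<and> \<phi> (E T' l) \<in> missU \<phi> (X T' l)"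
    proof (cases "l < i")
      case True
      then have "Y T' (Suc l) = Y T (Suc l)" by (intro YT) simp
      moreover have "l < length T" using True iN by simp
      ultimately show ?thesis using valid_E[OF dd(2)] nth1[OF True] by simp
    next
      case False
      then obtain m where m: "l = i + m" by (metis le_add_diff_inverse not_less)
      then have mp: "m < length ps" using l len' by simp
      have e: "E T' l = fst (ps ! m)" "Z T' (Suc l) = snd (ps ! m)" using nth2 m by simp_all
      have eab: "fst (ps ! m) \<in> ab \<phi> a b" using pp(4) mp by (meson image_subset_iff nth_mem)
      then have A: "E T' l \<in> A" "\<phi> (E T' l) \<in> {a, b}" using e by (auto simp: ab_def)
      have XX: "X T i \<subseteq> X T' l"
      proof -
        have "Y T' (Suc i) \<subseteq> Y T' (Suc l)" using m by (intro Y_mono) simp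
        then show ?thesis using YT[of "Suc i"] by simp
      qed
      then have "\<phi> (E T' l) \<in> missU \<phi> (X T' l)" using A(2) ab missU_mono by blast
      moreover have "\<exists>t\<in>X T' l. ends (E T' l) = {t, Z T' (Suc l)}"
      proof (cases m)
        case 0
        obtain t where "t \<in> X T i" "ends (fst (ps ! 0)) = {t, snd (ps ! 0)}" using pp(5) by blast
        then show ?thesis using 0 e XX by (intro bexI[of _ t]) auto
      next
        case (Suc m')
        then have "ends (E T' l) = {snd (ps ! m'), snd (ps ! m)}" using pp(6)[of m'] mp e by simp
        moreover have "snd (ps ! m') = Z T' l" using Z2[of m'] m Suc by simp
        moreover have "Z T' l \<in> X T' l" by (rule Z_in_Y) simp
        ultimately show ?thesis using e by auto
      qed
      ultimately show ?thesis using A by blast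
    qed
    then show "E T' l \<in> A" "\<exists>t\<in>X T' l. ends (E T' l) = {t, Z T' (Suc l)}" "\<phi> (E T' l) \<in> missU \<phi> (X T' l)" by blast+
  qed
  moreover have "cls \<phi> T'" unfolding cls_def
  proof (intro allI impI ballI)
    fix l d assume l: "Suc l < length T'" "d \<in> P" "\<phi> (E T' l) \<in> G d"
    show "\<exists>b\<le>l. d \<in> miss \<phi> (Z T' b)"
    proof (cases "l < i")
      case True
      have "Suc l < length T" using True i qN dd(5) by simp
      then obtain b where b: "b \<le> l" "d \<in> miss \<phi> (Z T b)" using dd(3) l nth1[OF True] unfolding cls_def by metis
      then show ?thesis using ZT[of b] True by (intro exI[of _ b]) simp
    next
      case False
      then obtain m where m: "l = i + m" by (metis le_add_diff_inverse not_less)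
      then have mp: "m < length ps" using l len' by simp
      have "fst (ps ! m) \<in> ab \<phi> a b" using pp(4) mp by (meson image_subset_iff nth_mem)
      then have "\<phi> (E T' l) = a \<or> \<phi> (E T' l) = b" using nth2 m by (simp add: ab_def)
      then obtain b' where b': "b' < Suc i" "d \<in> miss \<phi> (Z T b')"
      proof
        assume "\<phi> (E T' l) = a"
        then show ?thesis using res(1) l(2,3) that unfolding reserved_ok_def by auto
      next
        assume "\<phi> (E T' l) = b"
        then show ?thesis using res(2) l(2,3) that unfolding reserved_ok_def by auto
      qed
      then show ?thesis using ZT[of b'] m by (intro exI[of _ b']) simp
    qed
  qed
  moreover have "pathf (Suc i) T'" unfolding pathf_def
  proof (intro allI impI)
    fix l assume l: "l < length T'" "Suc i \<le> l"
    then obtain m where m: "l = i + Suc m" by (metis add_Suc_right add_Suc_shift le_add_diff_inverse)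
    have "ends (E T' l) = {snd (ps ! m), snd (ps ! Suc m)}" using pp(6)[of m] m l len' nth2[of "Suc m"] by simp
    then show "ends (E T' l) = {Z T' l, Z T' (Suc l)}" using Z2[of m] Z2[of "Suc m"] m by simp
  qed
  ultimately have el: "elem \<phi> (X T' (length T'))" using IHq[OF i dd(1)] by blast
  have "Z T' (length T') = z"
  proof -
    obtain m where m: "length ps = Suc m" using pp(1) by (cases ps) auto
    then show ?thesis using ps(2) pp(1) len' Z2[of m] by (simp add: last_conv_nth)
  qed
  then have zin: "z \<in> X T' (length T')" using Z_in_Y[of "length T'" "Suc (length T')" T'] by simp
  obtain t where t: "t \<in> X T i" "a \<in> miss \<phi> t" using ab by (auto simp: missU_def)
  have "X T i \<subseteq> X T' (length T')" using YT[of "Suc i"] Y_mono[of "Suc i" "Suc (length T')" T'] len' by simp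
  then have "t = z" using elemD[OF el _ zin t(2) z(2)] t(1) by blast
  then show False using t z by simp
qed

text \<open>With \<open>\<beta>\<close> missing at both ends of the last edge, these ends form a
  Kempe component for \<open>\<beta>\<close> and the colour \<open>c\<close> of that edge.
  Recolouring the edge frees \<open>c\<close> at \<open>Z T M\<close>; since \<open>c\<close> is
  also missing on an earlier vertex, the tail ending at \<open>Z T M\<close> is a shorter
  counterexample.\<close>

lemma recolour_last:
  assumes d: "dup \<phi> T \<beta>" and M: "N = Suc M" "q \<le> M" and b: "\<beta> \<in> miss \<phi> (Z T M)"
  shows False
proof -
  note dd = dupD[OF d]
  define c where "c = \<phi> (E T M)"
  define u where "u = Z T M" define v where "v = Z T N"
  have MT: "M < length T" using M dd(5) by simp
  have en: "ends (E T M) = {u, v}" using dd(4) M MT unfolding pathf_def u_def v_def by blast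
  have EA: "E T M \<in> A" by (rule valid_E(1)[OF dd(2) MT])
  have cm: "c \<in> missU \<phi> (X T M)" unfolding c_def by (rule valid_E(3)[OF dd(2) MT])
  have ck: "c < k" "\<beta> < k" using proper_lt[OF dd(7) EA] dd(6) miss_lt by (auto simp: c_def)
  have bu: "\<beta> \<in> miss \<phi> u" "\<beta> \<in> miss \<phi> v" using b dd(6) by (auto simp: u_def v_def)
  have cb: "c \<noteq> \<beta>" using missD[OF bu(1) EA] en by (auto simp: c_def)
  have cu: "c \<notin> miss \<phi> u" using missD[of c \<phi> u, OF _ EA] en by (auto simp: c_def)
  have cl: "kclosed \<phi> c \<beta> {u, v}" unfolding kclosed_def
  proof (intro ballI impI)
    fix e assume e: "e \<in> ab \<phi> c \<beta>" "ends e \<inter> {u, v} \<noteq> {}"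
    then obtain x where x: "x \<in> {u, v}" "x \<in> ends e" by blast
    have eA: "e \<in> A" "\<phi> e = c \<or> \<phi> e = \<beta>" using e by (auto simp: ab_def)
    have "\<phi> e \<noteq> \<beta>" using missD[of \<beta> \<phi> x e] bu x eA by blast
    then have "\<phi> e = \<phi> (E T M)" using eA by (simp add: c_def)
    moreover have "x \<in> ends (E T M)" using x en by simp
    ultimately have "e = E T M" using proper_inj[OF dd(7) eA(1) EA x(2)] by blast
    then show "ends e \<subseteq> {u, v}" using en by simp
  qed
  have W0: "u \<notin> W" "v \<notin> W" using valid_Z_W[OF dd(2)] MT M dd(5) by (simp_all add: u_def v_def del: Z_Suc)
  let ?f = "swap \<phi> c \<beta> {u, v}"
  have S': "?f \<in> S" using W0 by (intro S_swap[OF dd(1) ck cb cl]) auto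
  have uX: "u \<notin> Y T M" "v \<notin> Y T M" using valid_Z_Y[OF dd(2)] MT M dd(5) by (simp_all add: u_def v_def del: Z_Suc)
  have m: "miss ?f x = miss \<phi> x" if "x \<in> Y T M" for x using that uX by (intro miss_swap_out[OF cl]) auto
  have mU: "missU ?f (Y T m) = missU \<phi> (Y T m)" if "m \<le> M" for m
    unfolding missU_def using m Y_mono[OF that, of T] by blast
  have col: "?f (E T l) = \<phi> (E T l)" if l: "l < M" for l
  proof (cases "\<phi> (E T l) = c \<or> \<phi> (E T l) = \<beta>")
    case True
    have lT: "l < length T" using l MT by simp
    obtain t where t: "t \<in> X T l" "ends (E T l) = {t, Z T (Suc l)}" using valid_E(2)[OF dd(2) lT] by blast
    have EAl: "E T l \<in> A" by (rule valid_E(1)[OF dd(2) lT])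
    have ne: "E T l \<noteq> E T M"
    proof
      assume "E T l = E T M"
      then have "v \<in> {t, Z T (Suc l)}" using t en by auto
      moreover have "v \<noteq> Z T (Suc l)" using valid_Z_inj[OF dd(2), of N "Suc l"] l M dd(5) by (auto simp: v_def simp del: Z_Suc)
      moreover have "v \<notin> X T l" using valid_Z_Y[OF dd(2), of "Suc l" N] l M dd(5) by (simp add: v_def)
      ultimately show False using t(1) by blast
    qed
    have "ends (E T l) \<inter> {u, v} = {}"
    proof (rule ccontr)
      assume "ends (E T l) \<inter> {u, v} \<noteq> {}"
      then obtain x where x: "x \<in> {u, v}" "x \<in> ends (E T l)" by blast
      have "\<phi> (E T l) \<noteq> \<beta>" using missD[of \<beta> \<phi> x "E T l"] bu x EAl by blast
      then have "\<phi> (E T l) = \<phi> (E T M)" using True by (simp add: c_def)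
      moreover have "x \<in> ends (E T M)" using x en by simp
      ultimately show False using proper_inj[OF dd(7) EAl EA x(2)] ne by blast
    qed
    then show ?thesis by (rule swap_disj)
  next
    case False then show ?thesis by (simp add: swap_other)
  qed
  let ?T = "take M T"
  have len: "length ?T = M" using MT by simp
  have v': "valid \<phi> ?T" using MT by (intro valid_take[OF dd(2)]) simp
  have "valid ?f ?T" unfolding valid_def
  proof (intro conjI allI impI)
    show "distinct (y # map snd ?T)" "snd ` set ?T \<inter> W = {}" using v' by (simp_all add: valid_def)
  next
    fix i assume i: "i < length ?T"
    then have iM: "i < M" using len by simp
    show "E ?T i \<in> A" "\<exists>t\<in>X ?T i. ends (E ?T i) = {t, Z ?T (Suc i)}" using valid_E[OF v' i] by blast+
    have "Y ?T (Suc i) = Y T (Suc i)" using iM by (intro Y_take) simp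
    then show "?f (E ?T i) \<in> missU ?f (X ?T i)" using valid_E(3)[OF v' i] mU[of "Suc i"] col[OF iM] iM by simp
  qed
  moreover have "cls ?f ?T" unfolding cls_def
  proof (intro allI impI ballI)
    fix l d assume l: "Suc l < length ?T" "d \<in> P" "?f (E ?T l) \<in> G d"
    have cl: "cls \<phi> ?T" using MT by (intro cls_take[OF dd(3)]) simp
    have lb: "l < M" using l len by simp
    then have "\<phi> (E ?T l) \<in> G d" using l(3) col by simp
    then obtain b' where b': "b' \<le> l" "d \<in> miss \<phi> (Z ?T b')" using cl l unfolding cls_def by blast
    moreover have "Z ?T b' = Z T b'" using b' lb by (intro Z_take) simp
    moreover have "Z T b' \<in> Y T M" using b' lb by (intro Z_in_Y) simp
    ultimately show "\<exists>b\<le>l. d \<in> miss ?f (Z ?T b)" by (intro exI[of _ b']) (simp add: m)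
  qed
  ultimately have "elem ?f (X ?T (length ?T))" using M len S' by (intro IHn pathf_take dd(4)) simp_all
  moreover have "X ?T (length ?T) = insert u (Y T M)" using len Y_take[of "Suc M" M T] by (simp add: Y_Suc u_def)
  ultimately have el: "elem ?f (insert u (Y T M))" by simp
  obtain s where s: "s \<in> X T M" "c \<in> miss \<phi> s" using cm by (auto simp: missU_def)
  then have sY: "s \<in> Y T M" using cu by (auto simp: Y_Suc u_def)
  have "c \<in> miss ?f u" using miss_swap_in[of u "{u, v}", OF _ ck] bu by simp
  moreover have "c \<in> miss ?f s" using m[OF sY] s by simp
  ultimately have "u = s" using elemD[OF el, of u s c] sY by simp
  then show False using sY uX by simp
qed

text \<open>The last edge attaches below \<open>Z T M\<close>, and its colour is missing there, so
  \<open>Z T M\<close> can be left out and the shorter tail still ends at the vertex with the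
  repeated colour. For \<open>M = 0\<close> there is nothing to leave out; then the edge would leave
  \<open>W\<close> with a colour of \<open>\<Gamma>\<close>.\<close>

lemma drop_last:
  assumes d: "dup \<phi> T a" and M: "N = Suc M" "q = N" and a: "a \<in> missU \<phi> (Y T M)" "\<phi> (E T M) \<in> missU \<phi> (Y T M)"
    and t: "t \<in> Y T M" "ends (E T M) = {t, Z T N}"
  shows False
proof -
  note dd = dupD[OF d]
  have MT: "M < length T" using M dd(5) by simp
  have EA: "E T M \<in> A" by (rule valid_E(1)[OF dd(2) MT])
  have ZN: "Z T N \<notin> W" "Z T N \<notin> Y T M" using valid_Z_W[OF dd(2)] valid_Z_Y[OF dd(2)] M dd(5) by (simp_all del: Z_Suc)
  show False
  proof (cases M)
    case 0
    then have "\<phi> (E T M) \<in> \<Gamma>" "t \<in> W" using a t S_missU[OF dd(1)] by simp_all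
    then show False using S_closed[OF dd(1) EA] t ZN by auto
  next
    case (Suc m)
    define T' where "T' = take m T @ [T ! M]"
    have len: "length (take m T) = m" using MT Suc by simp
    have len': "length T' = M" using len Suc by (simp add: T'_def)
    have nth1: "T' ! l = T ! l" if "l < m" for l using that len by (simp add: T'_def nth_append)
    have nth2: "T' ! m = T ! M" using len by (simp add: T'_def nth_append)
    have YT: "Y T' j = Y T j" if "j \<le> Suc m" for j
    proof -
      have "Y T' j = Y (take m T) j" unfolding T'_def using that len by (intro Y_append) simp
      also have "\<dots> = Y T j" using that by (rule Y_take)
      finally show ?thesis .
    qed
    have ZT: "Z T' b = Z T b" if "b \<le> m" for b
    proof -
      have "Z T' b = Z (take m T) b" unfolding T'_def using that len by (intro Z_append) simp
      also have "\<dots> = Z T b" using that by (rule Z_take)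
      finally show ?thesis .
    qed
    have ZM: "Z T' M = Z T N" using nth2 Suc M by simp
    have vt: "distinct (y # map snd T)" "snd ` set T \<inter> W = {}" using dd(2) by (simp_all add: valid_def)
    have "valid \<phi> T'" unfolding valid_def
    proof (intro conjI allI impI)
      have s: "set T' \<subseteq> set T" using MT set_take_subset[of m T] by (auto simp: T'_def)
      then show "snd ` set T' \<inter> W = {}" using vt(2) by blast
      have "distinct (take (Suc m) (y # map snd T))" using vt(1) by (rule distinct_take)
      then have "distinct (y # map snd (take m T))" by (simp add: take_map)
      moreover have "snd (T ! M) \<notin> insert y (snd ` set (take m T))"
      proof
        assume "snd (T ! M) \<in> insert y (snd ` set (take m T))"
        then have "Z T N \<in> set (y # map snd (take m T))" using M by simp
        then obtain b where b: "b < length (y # map snd (take m T))" "(y # map snd (take m T)) ! b = Z T N"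
          unfolding in_set_conv_nth by blast
        have "Z T b = Z T N" using b by (cases b) simp_all
        moreover have "b \<le> m" using b len by simp
        ultimately have "Z T N \<in> Y T M" using Z_in_Y[of b M T] Suc by simp
        then show False using ZN by simp
      qed
      ultimately show "distinct (y # map snd T')" unfolding T'_def by auto
    next
      fix l assume l: "l < length T'"
      have "E T' l \<in> A \<and> (\<exists>t\<in>X T' l. ends (E T' l) = {t, Z T' (Suc l)}) \<and> \<phi> (E T' l) \<in> missU \<phi> (X T' l)"
      proof (cases "l < m")
        case True
        then have "Y T' (Suc l) = Y T (Suc l)" by (intro YT) simp
        moreover have "l < length T" using True MT Suc by simp
        ultimately show ?thesis using valid_E[OF dd(2)] nth1[OF True] by simp
      next
        case False
        then have lm: "l = m" using l len' Suc by simp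
        then have "Y T' (Suc l) = Y T M" using YT[of "Suc m"] Suc by simp
        then show ?thesis using EA t a(2) nth2 ZM lm Suc by auto
      qed
      then show "E T' l \<in> A" "\<exists>t\<in>X T' l. ends (E T' l) = {t, Z T' (Suc l)}" "\<phi> (E T' l) \<in> missU \<phi> (X T' l)" by blast+
    qed
    moreover have "cls \<phi> T'" unfolding cls_def
    proof (intro allI impI ballI)
      fix l d assume l: "Suc l < length T'" "d \<in> P" "\<phi> (E T' l) \<in> G d"
      have lm: "l < m" using l len' Suc by simp
      have "Suc l < length T" using lm Suc MT by simp
      then obtain b where b: "b \<le> l" "d \<in> miss \<phi> (Z T b)" using dd(3) l nth1[OF lm] unfolding cls_def by metis
      then show "\<exists>b\<le>l. d \<in> miss \<phi> (Z T' b)" using ZT[of b] lm by (intro exI[of _ b]) simp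
    qed
    moreover have "pathf q T'" using M len' by (simp add: pathf_def)
    ultimately have "elem \<phi> (X T' (length T'))" by (rule IHn[OF dd(1)]) (use M len' in simp)
    moreover have "X T' (length T') = insert (Z T N) (Y T M)" using len' ZM YT[of "Suc m"] Suc by (simp add: Y_Suc del: Z_Suc)
    ultimately have el: "elem \<phi> (insert (Z T N) (Y T M))" by simp
    obtain s where s: "s \<in> Y T M" "a \<in> miss \<phi> s" using a(1) by (auto simp: missU_def)
    have "Z T N = s" by (rule elemD[OF el _ _ dd(6) s(2)]) (use s in auto)
    then show False using s ZN by simp
  qed
qed

definition same :: "('e \<Rightarrow> nat) \<Rightarrow> ('e \<Rightarrow> nat) \<Rightarrow> ('e \<times> 'a) list \<Rightarrow> nat \<Rightarrow> bool" where
  "same \<phi> \<phi>' T j \<longleftrightarrow> (\<forall>u\<in>Y T N. miss \<phi>' u = miss \<phi> u) \<and> (\<forall>l<j. \<phi>' (E T l) = \<phi> (E T l))"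

lemma same_refl: "same \<phi> \<phi> T j" by (simp add: same_def)

lemma same_trans: "same \<phi> \<phi>' T j \<Longrightarrow> same \<phi>' \<phi>'' T j \<Longrightarrow> same \<phi> \<phi>'' T j" by (simp add: same_def)

lemma same_safe: "same \<phi> \<phi>' T j \<Longrightarrow> j < N \<Longrightarrow> safe \<phi>' T j c = safe \<phi> T j c"
  unfolding same_def by (intro safe_cong) auto

lemma same_miss: "same \<phi> \<phi>' T j \<Longrightarrow> u \<in> Y T N \<Longrightarrow> miss \<phi>' u = miss \<phi> u" by (simp add: same_def)

lemma same_missU: "same \<phi> \<phi>' T j \<Longrightarrow> m \<le> N \<Longrightarrow> missU \<phi>' (Y T m) = missU \<phi> (Y T m)"
  using Y_mono[of m N T] unfolding same_def missU_def by blast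

lemma same_reserved:
  assumes "same \<phi> \<phi>' T j" "m \<le> N" shows "reserved_ok \<phi>' T m c = reserved_ok \<phi> T m c"
proof -
  have "miss \<phi>' (Z T b) = miss \<phi> (Z T b)" if "b < m" for b
    using that assms(2) by (intro same_miss[OF assms(1)] Z_in_Y) simp
  then show ?thesis unfolding reserved_ok_def by (auto cong: conj_cong)
qed

lemma step:
  assumes d: "dup \<phi> T \<alpha>" and j: "j < N" and s: "safe \<phi> T j \<alpha>" "safe \<phi> T j \<beta>" and ne: "\<alpha> \<noteq> \<beta>"
    and P: "\<alpha> \<notin> P \<and> \<beta> \<notin> P \<or> \<alpha> \<in> \<Gamma> \<or> \<beta> \<in> \<Gamma>"
  obtains \<phi>' where "dup \<phi>' T \<beta>" "same \<phi> \<phi>' T j" "\<phi>' = swap \<phi> \<alpha> \<beta> (kc \<phi> \<alpha> \<beta> (Z T N))"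
  using that move[OF d j s ne P refl] unfolding same_def by blast

text \<open>Records how \<open>E T j\<close> may have acquired the colour \<open>\<gamma>\<close>:
  some chain from \<open>Z T N\<close> ran through this edge. \<open>two_colour\<close> rules this
  out later for edges before the path part.\<close>

definition flip_wit :: "('e \<Rightarrow> nat) \<Rightarrow> ('e \<times> 'a) list \<Rightarrow> nat \<Rightarrow> nat \<Rightarrow> bool" where
  "flip_wit \<phi> T j \<gamma> \<longleftrightarrow> (\<exists>\<phi>1 a. dup \<phi>1 T a \<and> same \<phi> \<phi>1 T j \<and> a \<noteq> \<gamma> \<and> safe \<phi>1 T j a \<and>
     ends (E T j) \<subseteq> kc \<phi>1 a \<gamma> (Z T N))"

lemma step_wit:
  assumes d: "dup \<phi> T \<alpha>" and j: "j < N" and s: "safe \<phi> T j \<alpha>" "safe \<phi> T j \<gamma>"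
    and P: "\<alpha> \<notin> P \<and> \<gamma> \<notin> P \<or> \<alpha> \<in> \<Gamma> \<or> \<gamma> \<in> \<Gamma>"
  obtains \<phi>' where "dup \<phi>' T \<gamma>" "same \<phi> \<phi>' T j"
    "\<phi>' (E T j) = \<gamma> \<Longrightarrow> \<phi> (E T j) = \<gamma> \<or> flip_wit \<phi> T j \<gamma>"
proof (cases "\<alpha> = \<gamma>")
  case True then show ?thesis using that[of \<phi>] d same_refl by blast
next
  case False
  obtain \<phi>' where f: "dup \<phi>' T \<gamma>" "same \<phi> \<phi>' T j" "\<phi>' = swap \<phi> \<alpha> \<gamma> (kc \<phi> \<alpha> \<gamma> (Z T N))"
    by (rule step[OF d j s False P])
  have "\<phi> (E T j) = \<gamma> \<or> flip_wit \<phi> T j \<gamma>" if "\<phi>' (E T j) = \<gamma>"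
  proof (cases "\<phi> (E T j) = \<gamma>")
    case ne: False
    then have "\<phi>' (E T j) \<noteq> \<phi> (E T j)" using that by simp
    then have e: "E T j \<in> A" "ends (E T j) \<inter> kc \<phi> \<alpha> \<gamma> (Z T N) \<noteq> {}" "E T j \<in> ab \<phi> \<alpha> \<gamma>"
      unfolding f(3) swap_def ab_def by (auto split: if_splits)
    then have "ends (E T j) \<subseteq> kc \<phi> \<alpha> \<gamma> (Z T N)" using kc_closed unfolding kclosed_def by blast
    then show ?thesis using d s False same_refl unfolding flip_wit_def by blast
  qed simp
  then show ?thesis using that f by blast
qed

text \<open>A direct swap of a protected colour with a colour outside \<open>\<Gamma>\<close> is
  inadmissible, as its chain might cross \<open>W\<close>. The detour through a colour of
  \<open>\<Gamma>\<close> consists of two swaps that are disjoint from \<open>W\<close>.\<close>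

lemma goto:
  assumes d: "dup \<phi> T \<alpha>" and j: "j < N" and s: "safe \<phi> T j \<alpha>" "safe \<phi> T j \<gamma>"
    and h: "\<alpha> \<in> P \<Longrightarrow> \<exists>c\<in>\<Gamma>. safe \<phi> T j c" and g: "\<gamma> \<notin> P"
  obtains \<phi>' where "dup \<phi>' T \<gamma>" "same \<phi> \<phi>' T j"
    "\<phi>' (E T j) = \<gamma> \<Longrightarrow> \<phi> (E T j) = \<gamma> \<or> flip_wit \<phi> T j \<gamma>"
proof (cases "\<alpha> \<in> P \<and> \<gamma> \<notin> \<Gamma>")
  case False
  then have "\<alpha> \<notin> P \<and> \<gamma> \<notin> P \<or> \<alpha> \<in> \<Gamma> \<or> \<gamma> \<in> \<Gamma>" using g by blast
  then show ?thesis using step_wit[OF d j s] that by blast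
next
  case True
  then obtain c where c: "c \<in> \<Gamma>" "safe \<phi> T j c" using h by blast
  have ne: "\<alpha> \<noteq> c" "c \<noteq> \<gamma>" using c True P_\<Gamma> by auto
  obtain f where f: "dup f T c" "same \<phi> f T j" "f = swap \<phi> \<alpha> c (kc \<phi> \<alpha> c (Z T N))"
    by (rule step[OF d j s(1) c(2) ne(1)]) (use c in blast)+
  have s': "safe f T j c" "safe f T j \<gamma>" using same_safe[OF f(2) j] c s by blast+
  have e: "\<phi> (E T j) = \<gamma>" if "f (E T j) = \<gamma>"
    using that ne True s g unfolding f(3) swap_def by (auto split: if_splits)
  obtain \<phi>' where f': "dup \<phi>' T \<gamma>" "same f \<phi>' T j" "\<phi>' (E T j) = \<gamma> \<Longrightarrow> f (E T j) = \<gamma> \<or> flip_wit f T j \<gamma>"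
    by (rule step_wit[OF f(1) j s']) (use c in blast)+
  have "flip_wit \<phi> T j \<gamma>" if "flip_wit f T j \<gamma>"
    using that same_trans[OF f(2)] unfolding flip_wit_def by blast
  then show ?thesis using that[OF f'(1) same_trans[OF f(2) f'(2)]] f'(3) e by blast
qed

text \<open>The side condition supplies the only kind of partner against which a protected repeated
  colour can be exchanged.\<close>

definition st :: "('e \<Rightarrow> nat) \<Rightarrow> ('e \<times> 'a) list \<Rightarrow> nat \<Rightarrow> nat \<Rightarrow> bool" where
  "st \<phi> T j \<alpha> \<longleftrightarrow> dup \<phi> T \<alpha> \<and> j < N \<and> \<alpha> \<in> missU \<phi> (X T j) \<and> unused \<phi> T j \<alpha> \<and> (\<alpha> \<in> P \<longrightarrow> (\<exists>c\<in>\<Gamma>. safe \<phi> T j c))"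

text \<open>The purpose of the reservation: once a protected colour is missing on the tail, its
  reserved colours are permitted and none of them has been used yet.\<close>

lemma G_safe:
  assumes d: "dup \<phi> T \<kappa>" and i: "i < N" and \<delta>: "\<delta> \<in> P" "\<delta> \<in> miss \<phi> (Z T i)" and c: "c \<in> G \<delta>"
  shows "c \<in> \<Gamma>" "safe \<phi> T i c"
proof -
  note dd = dupD[OF d]
  show cG: "c \<in> \<Gamma>" using G_sub \<delta> c by blast
  have "unused \<phi> T i c" using i dd(5) by (intro unused_G[OF dd(2,3) dup_elem[OF d order_refl] i _ \<delta> c]) simp
  moreover have "c \<in> missU \<phi> (X T i)" using cG \<Gamma>_Y[OF dd(1)] by blast
  moreover have "free \<phi> T i c" unfolding free_def using G_disj[OF _ \<delta>(1) _ c] \<delta>(2) by blast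
  ultimately show "safe \<phi> T i c" by (simp add: safe_def)
qed

lemma G_two:
  assumes "\<delta> \<in> P" obtains c c' where "c \<in> G \<delta>" "c' \<in> G \<delta>" "c \<noteq> c'"
proof -
  have "card (G \<delta>) = 2" using G_card assms by blast
  then obtain c c' where "G \<delta> = {c, c'}" "c \<noteq> c'" by (meson card_2_iff)
  then show ?thesis using that by blast
qed

lemma st_init:
  assumes d: "dup \<phi> T \<alpha>" and a: "\<alpha> \<in> missU \<phi> (Y T N)" and N: "N \<ge> 1"
  shows "\<exists>j. st \<phi> T j \<alpha>"
proof (cases "\<alpha> \<in> \<Gamma>")
  case True
  have "\<alpha> \<in> missU \<phi> (X T 0)" using True \<Gamma>_Y[OF dupD(1)[OF d]] by blast
  moreover have "\<alpha> \<notin> P" using True P_\<Gamma> by blast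
  ultimately show ?thesis using d N by (intro exI[of _ 0]) (simp add: st_def unused_def)
next
  case False
  note dd = dupD[OF d]
  have "\<alpha> \<notin> missU \<phi> W" using S_missU[OF dd(1)] False by simp
  then obtain i where i: "i < N" "\<alpha> \<in> miss \<phi> (Z T i)" using a unfolding missU_def Y_def by blast
  have "unused \<phi> T i \<alpha>" using i dd(5) by (intro unused_auto[OF dd(2) dup_elem[OF d order_refl] i(1) _ i(2)]) simp
  moreover have "\<alpha> \<in> missU \<phi> (X T i)" using i(2) Z_in_Y[of i "Suc i" T] unfolding missU_def by blast
  moreover have "\<exists>c\<in>\<Gamma>. safe \<phi> T i c" if "\<alpha> \<in> P"
    using G_two[OF that] G_safe[OF d i(1) that i(2)] by metis
  ultimately show ?thesis using d i(1) unfolding st_def by blast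
qed

text \<open>A reserved colour that is still blocked has to wait: the index is raised to the first
  tail vertex that misses the corresponding exit colour, or else to the last index. By
  \<open>cls\<close> no edge passed on the way has the reserved colour.\<close>

lemma st_lift:
  assumes "st \<phi> T j \<alpha>" obtains j' where "j \<le> j'" "st \<phi> T j' \<alpha>" "safe \<phi> T j' \<alpha>"
proof (cases "free \<phi> T j \<alpha>")
  case True then show ?thesis using that[of j] assms by (simp add: st_def safe_def)
next
  case False
  have d: "dup \<phi> T \<alpha>" and j: "j < N" and u: "unused \<phi> T j \<alpha>" using assms by (simp_all add: st_def)
  note dd = dupD[OF d]
  obtain \<delta> where \<delta>: "\<delta> \<in> P" "\<alpha> \<in> G \<delta>" "\<not> (\<exists>b\<le>j. \<delta> \<in> miss \<phi> (Z T b))" and jN: "\<not> N \<le> Suc j"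
    using False unfolding free_def by blast
  define Q where "Q i \<longleftrightarrow> \<delta> \<in> miss \<phi> (Z T i) \<or> Suc i = N" for i
  have "Q (N - 1)" using j by (simp add: Q_def)
  define j' where "j' = (LEAST i. Q i)"
  have Q': "Q j'" unfolding j'_def by (rule LeastI) fact
  have min: "\<not> Q i" if "i < j'" for i using that unfolding j'_def by (rule not_less_Least)
  have j'N: "j' < N" using Least_le[of Q "N - 1", OF \<open>Q (N - 1)\<close>] j by (simp add: j'_def)
  have jj': "j \<le> j'"
  proof (rule ccontr)
    assume "\<not> j \<le> j'"
    then have "j' \<le> j" "Suc j' \<noteq> N" using jN by simp_all
    then show False using Q' \<delta>(3) unfolding Q_def by blast
  qed
  have aG: "\<alpha> \<in> \<Gamma>" using G_sub \<delta> by blast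
  have "unused \<phi> T j' \<alpha>" unfolding unused_def
  proof (intro allI impI notI)
    fix l assume l: "l < j'" "\<phi> (E T l) = \<alpha>"
    then have "Suc l < length T" using j'N dd(5) by simp
    then obtain b where b: "b \<le> l" "\<delta> \<in> miss \<phi> (Z T b)" using dd(3) l(2) \<delta>(1,2) unfolding cls_def by blast
    then show False using min[of b] l(1) unfolding Q_def by simp
  qed
  moreover have "free \<phi> T j' \<alpha>" unfolding free_def
  proof (rule disjCI)
    assume "\<not> (\<forall>d\<in>P. \<alpha> \<in> G d \<longrightarrow> (\<exists>b\<le>j'. d \<in> miss \<phi> (Z T b)))"
    then obtain d' where d': "d' \<in> P" "\<alpha> \<in> G d'" "\<not> (\<exists>b\<le>j'. d' \<in> miss \<phi> (Z T b))" by blast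
    have "d' = \<delta>" by (rule G_disj[OF d'(1) \<delta>(1) d'(2) \<delta>(2)])
    then show "Suc j' \<ge> N" using Q' d'(3) unfolding Q_def by auto
  qed
  moreover have "\<alpha> \<in> missU \<phi> (X T j')" using aG \<Gamma>_Y[OF dd(1)] by blast
  moreover have "\<alpha> \<notin> P" using aG P_\<Gamma> by blast
  ultimately show ?thesis using that[of j'] jj' d j'N by (simp add: st_def safe_def)
qed

end

section \<open>Pushing the repeated colour along the tail\<close>

context tail_step
begin

lemma nice_safe:
  assumes "c \<in> nice \<phi> T m" "j < N" "Suc j = m \<or> j = m"
  shows "safe \<phi> T j c" "c \<notin> P" "reserved_ok \<phi> T m c" "unused \<phi> T m c" "c \<in> missU \<phi> (Y T m)"
proof -
  show n: "c \<notin> P" "reserved_ok \<phi> T m c" "unused \<phi> T m c" "c \<in> missU \<phi> (Y T m)"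
    using assms(1) by (simp_all add: nice_def reserved_ok_def)
  have "Y T m \<subseteq> X T j" using assms(3) by (intro Y_mono) auto
  then have "c \<in> missU \<phi> (X T j)" using n(4) missU_mono by blast
  moreover have "unused \<phi> T j c" using n(3) assms(3) by (auto intro: unused_mono)
  moreover have "\<exists>b\<le>j. d \<in> miss \<phi> (Z T b)" if d: "d \<in> P" "c \<in> G d" for d
  proof -
    obtain b where "b < m" "d \<in> miss \<phi> (Z T b)" using n(2) d unfolding reserved_ok_def by blast
    then show ?thesis using assms(3) by (intro exI[of _ b]) auto
  qed
  ultimately show "safe \<phi> T j c" by (simp add: safe_def free_def)
qed

lemma safe_reserved: "safe \<phi> T j c \<Longrightarrow> Suc j < N \<Longrightarrow> reserved_ok \<phi> T (Suc j) c"
  by (simp add: safe_def free_def reserved_ok_def less_Suc_eq_le)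

text \<open>On the path part \<open>E T j\<close> is incident with \<open>Z T j\<close>, so it
  cannot have a colour missing there. Making such a colour the repeated one advances the index; at
  the last edge \<open>recolour_last\<close> gives a contradiction instead.\<close>

lemma walk:
  assumes d: "dup \<phi> T \<alpha>" and j: "j < N" "q \<le> j" and s: "safe \<phi> T j \<alpha>"
    and h: "\<alpha> \<in> P \<Longrightarrow> \<exists>c\<in>\<Gamma>. safe \<phi> T j c"
  shows "Suc j < N \<and> (\<exists>\<phi>' \<alpha>'. st \<phi>' T (Suc j) \<alpha>')"
proof -
  note dd = dupD[OF d]
  obtain \<beta> where b: "\<beta> \<in> miss \<phi> (Z T j)" using S_miss[OF dd(1)] by blast
  have jY: "Z T j \<in> Y T N" by (rule Z_in_Y[OF j(1)])
  have bs: "safe \<phi> T j \<beta>"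
  proof -
    have "unused \<phi> T j \<beta>" using j(1) dd(5) by (intro unused_auto[OF dd(2) dup_elem[OF d order_refl] j(1) _ b]) simp
    moreover have "\<beta> \<in> missU \<phi> (X T j)" using b Z_in_Y[of j "Suc j" T] unfolding missU_def by blast
    moreover have "free \<phi> T j \<beta>" if "\<beta> \<in> \<Gamma>"
      using \<Gamma>_tail[OF dd(1) dup_elem[OF d order_refl] dd(2) j(1) _ b] j(1) dd(5) that by simp
    moreover have "free \<phi> T j \<beta>" if "\<beta> \<notin> \<Gamma>" unfolding free_def using G_sub that by blast
    ultimately show ?thesis unfolding safe_def by blast
  qed
  have "\<exists>\<phi>'. dup \<phi>' T \<beta> \<and> same \<phi> \<phi>' T j"
  proof (cases "\<beta> \<in> P")
    case False
    then show ?thesis using goto[OF d j(1) s bs h] by metis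
  next
    case True
    obtain c where c: "c \<in> \<Gamma>" "safe \<phi> T j c" using G_two[OF True] G_safe[OF d j(1) True b] by metis
    have cP: "c \<notin> P" using c P_\<Gamma> by blast
    obtain f where f: "dup f T c" "same \<phi> f T j" using goto[OF d j(1) s c(2) h cP] by metis
    have ne: "c \<noteq> \<beta>" using cP True by blast
    obtain \<phi>' where "dup \<phi>' T \<beta>" "same f \<phi>' T j"
      by (rule step[OF f(1) j(1) _ _ ne]) (use same_safe[OF f(2) j(1)] c bs in blast)+
    then show ?thesis using same_trans[OF f(2)] by blast
  qed
  then obtain \<phi>' where f: "dup \<phi>' T \<beta>" "same \<phi> \<phi>' T j" by blast
  note ff = dupD[OF f(1)]
  have b': "\<beta> \<in> miss \<phi>' (Z T j)" using same_miss[OF f(2) jY] b by simp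
  have "Suc j \<noteq> N"
  proof
    assume "Suc j = N"
    then show False using recolour_last[OF f(1) _ j(2) b'] by simp
  qed
  then have jN: "Suc j < N" using j by simp
  have jT: "j < length T" using j ff(5) by simp
  have bs': "safe \<phi>' T j \<beta>" using same_safe[OF f(2) j(1)] bs by simp
  have "Z T j \<in> ends (E T j)" using ff(4) j(2) jT unfolding pathf_def by blast
  then have "\<phi>' (E T j) \<noteq> \<beta>" using missD[OF b' valid_E(1)[OF ff(2) jT]] by blast
  then have u: "unused \<phi>' T (Suc j) \<beta>" using bs' by (simp add: unused_Suc safe_def)
  have "Y T (Suc j) \<subseteq> Y T (Suc (Suc j))" by (rule Y_mono) simp
  then have XX: "missU \<phi>' (X T j) \<subseteq> missU \<phi>' (X T (Suc j))" by (rule missU_mono)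
  \<comment> \<open>Reserved colours come in pairs so that one of them differs from the colour of
    \<open>E T j\<close> and stays usable at the next index.\<close>
  have "\<exists>c\<in>\<Gamma>. safe \<phi>' T (Suc j) c" if bP: "\<beta> \<in> P"
  proof -
    obtain c1 c2 where c: "c1 \<in> G \<beta>" "c2 \<in> G \<beta>" "c1 \<noteq> c2" by (rule G_two[OF bP])
    then obtain c where c: "c \<in> G \<beta>" "\<phi>' (E T j) \<noteq> c" by metis
    note cs = G_safe[OF f(1) j(1) bP b' c(1)]
    have "free \<phi>' T (Suc j) c" unfolding free_def using G_disj[OF _ bP _ c(1)] b' le_SucI by blast
    then have "safe \<phi>' T (Suc j) c" using cs c(2) XX unfolding safe_def unused_Suc by blast
    then show ?thesis using cs(1) by blast
  qed
  then have "st \<phi>' T (Suc j) \<beta>" using f(1) jN u bs' XX unfolding st_def safe_def by blast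
  then show ?thesis using jN by blast
qed

lemma no_flip_wit:
  assumes w: "flip_wit \<phi> T j \<gamma>" and g: "safe \<phi> T j \<gamma>" and j: "Suc j < q"
    and e: "v \<in> ends (E T j)" "v \<in> X T j"
  shows False
proof -
  obtain f a where f: "dup f T a" "same \<phi> f T j" "a \<noteq> \<gamma>" "safe f T j a" "ends (E T j) \<subseteq> kc f a \<gamma> (Z T N)"
    using w unfolding flip_wit_def by blast
  have jN: "Suc j < N" using j qN by simp
  have g': "safe f T j \<gamma>" using same_safe[OF f(2)] g jN by simp
  have "kc f a \<gamma> (Z T N) \<inter> X T j = {}"
  proof (rule two_colour[OF f(1) j])
    show "a \<in> missU f (X T j)" "\<gamma> \<in> missU f (X T j)" using f(4) g' by (simp_all add: safe_def)
    show "reserved_ok f T (Suc j) a" "reserved_ok f T (Suc j) \<gamma>" using f(4) g' safe_reserved jN by blast+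
    show "Z T N \<notin> X T j" using valid_Z_Y[OF dupD(2)[OF f(1)], of "Suc j" N] jN dupD(5)[OF f(1)] by simp
    show "a \<in> miss f (Z T N)" by (rule dupD(6)[OF f(1)])
  qed
  then show False using f(5) e by blast
qed

lemma raise:
  assumes d: "dup \<phi> T \<alpha>" and j: "Suc j < q" and s: "safe \<phi> T j \<alpha>"
    and h: "\<alpha> \<in> P \<Longrightarrow> \<exists>c\<in>\<Gamma>. safe \<phi> T j c"
  shows "\<exists>\<phi>' \<alpha>'. st \<phi>' T (Suc j) \<alpha>'"
proof -
  note dd = dupD[OF d]
  have jN: "Suc j < N" using j qN by simp
  then have j1: "j < N" by simp
  have "2 \<le> card (nice \<phi> T (Suc j))"
    by (rule card_nice[OF dd(1,2) dup_elem[OF d]]) (use jN dd(5) in simp_all)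
  then obtain \<gamma> where g: "\<gamma> \<in> nice \<phi> T (Suc j)" by fastforce
  note gs = nice_safe[OF g j1 disjI1[OF refl]]
  have "\<exists>\<phi>'. dup \<phi>' T \<gamma> \<and> same \<phi> \<phi>' T j \<and> (\<phi>' (E T j) = \<gamma> \<longrightarrow> \<phi> (E T j) = \<gamma> \<or> flip_wit \<phi> T j \<gamma>)"
  proof (rule goto[OF d j1 s gs(1) _ gs(2)])
    show "\<exists>c\<in>\<Gamma>. safe \<phi> T j c" if "\<alpha> \<in> P" using h that .
    fix \<phi>' assume a: "dup \<phi>' T \<gamma>" "same \<phi> \<phi>' T j" "\<phi>' (E T j) = \<gamma> \<Longrightarrow> \<phi> (E T j) = \<gamma> \<or> flip_wit \<phi> T j \<gamma>"
    show ?thesis by (intro exI conjI impI) (rule a, rule a, rule a)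
  qed
  then obtain \<phi>' where f: "dup \<phi>' T \<gamma>" "same \<phi> \<phi>' T j" "\<phi>' (E T j) = \<gamma> \<Longrightarrow> \<phi> (E T j) = \<gamma> \<or> flip_wit \<phi> T j \<gamma>"
    by (elim exE conjE) (rule that, assumption, assumption, erule mp)
  have jT: "j < length T" using j1 dd(5) by simp
  obtain t where t: "t \<in> X T j" "ends (E T j) = {t, Z T (Suc j)}" using valid_E(2)[OF dd(2) jT] by blast
  have "\<phi>' (E T j) \<noteq> \<gamma>"
  proof
    assume "\<phi>' (E T j) = \<gamma>"
    moreover have "\<phi> (E T j) \<noteq> \<gamma>" using gs(4) by (simp add: unused_Suc)
    ultimately have w: "flip_wit \<phi> T j \<gamma>" using f(3) by blast
    show False by (rule no_flip_wit[OF w gs(1) j _ t(1)]) (simp add: t)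
  qed
  moreover have gs': "safe \<phi>' T j \<gamma>" using same_safe[OF f(2) j1] gs by simp
  ultimately have "unused \<phi>' T (Suc j) \<gamma>" by (simp add: unused_Suc safe_def)
  moreover have "missU \<phi>' (X T j) \<subseteq> missU \<phi>' (X T (Suc j))" by (intro missU_mono Y_mono) simp
  ultimately show ?thesis using f(1) jN gs' gs(2) unfolding st_def safe_def by blast
qed

text \<open>This is the branching index: \<open>E T j\<close> starts in \<open>Y T j\<close> and not
  at \<open>Z T j\<close>. Now \<open>two_colour\<close> reaches only up to \<open>Y T j\<close>,
  hence both auxiliary colours are chosen missing on that set. If \<open>E T j\<close> is not the
  last edge, the second colour helps when the first one sits on it. If it is the last edge, the aim
  is \<open>drop_last\<close>: one colour is put on the edge, the other one becomes the repeated
  colour.\<close>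

lemma raise_last:
  assumes d: "dup \<phi> T \<alpha>" and j: "Suc j = q" and s: "safe \<phi> T j \<alpha>"
    and h: "\<alpha> \<in> P \<Longrightarrow> \<exists>c\<in>\<Gamma>. safe \<phi> T j c"
    and t: "t \<in> Y T j" "ends (E T j) = {t, Z T (Suc j)}"
  shows "Suc j < N \<and> (\<exists>\<phi>' \<alpha>'. st \<phi>' T (Suc j) \<alpha>')"
proof -
  note dd = dupD[OF d]
  have j1: "j < N" using j qN by simp
  have jT: "j < length T" using j1 dd(5) by simp
  have "2 \<le> card (nice \<phi> T j)"
    by (rule card_nice[OF dd(1,2) dup_elem[OF d]]) (use j1 dd(5) in simp_all)
  then obtain N0 where N0: "N0 \<subseteq> nice \<phi> T j" "card N0 = 2" by (meson obtain_subset_with_card_n)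
  then obtain g1 g2 where g: "g1 \<in> nice \<phi> T j" "g2 \<in> nice \<phi> T j" "g1 \<noteq> g2" by (auto simp: card_2_iff)
  note s1 = nice_safe[OF g(1) j1 disjI2[OF refl]] and s2 = nice_safe[OF g(2) j1 disjI2[OF refl]]
  obtain f where f: "dup f T g1" "same \<phi> f T j"
    using goto[OF d j1 s s1(1) h s1(2)] by metis
  note ff = dupD[OF f(1)]
  have ss: "safe f T j g1" "safe f T j g2" using same_safe[OF f(2) j1] s1 s2 by simp_all
  have mY: "missU f (Y T j) = missU \<phi> (Y T j)" using j1 by (intro same_missU[OF f(2)]) simp
  have EA: "E T j \<in> A" by (rule valid_E(1)[OF dd(2) jT])
  have Xs: "missU f' (X T j) \<subseteq> missU f' (X T (Suc j))" for f' by (intro missU_mono Y_mono) simp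
  have stI: "st f' T (Suc j) c" if "dup f' T c" "safe f' T j c" "f' (E T j) \<noteq> c" "c \<notin> P" "Suc j < N" for f' c
    using that Xs[of f'] unfolding st_def safe_def unused_Suc by blast
  show ?thesis
  proof (cases "Suc j < N")
    case True
    show ?thesis
    proof (cases "f (E T j) = g1")
      case False
      then show ?thesis using stI[OF f(1) ss(1) False s1(2) True] True by blast
    next
      case eq: True
      obtain f' where f': "dup f' T g2" "same f f' T j" "f' = swap f g1 g2 (kc f g1 g2 (Z T N))"
        by (rule step[OF f(1) j1 ss g(3)]) (use s1 s2 in blast)+
      have "f' (E T j) \<noteq> g2"
      proof
        assume "f' (E T j) = g2"
        then have m: "ends (E T j) \<inter> kc f g1 g2 (Z T N) \<noteq> {}"
          using eq g(3) unfolding f'(3) swap_def by (auto split: if_splits)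
        moreover have "E T j \<in> ab f g1 g2" using EA eq by (simp add: ab_def)
        ultimately have tk: "t \<in> kc f g1 g2 (Z T N)" using kc_closed t(2) unfolding kclosed_def by blast
        show False
        proof (cases j)
          case 0
          then have "f (E T j) \<in> \<Gamma>" "t \<in> W" using s1(5) mY eq S_missU[OF ff(1)] t by simp_all
          moreover have "Z T (Suc j) \<notin> W" using valid_Z_W[OF dd(2)] jT by (simp del: Z_Suc)
          ultimately show False using S_closed[OF ff(1) EA] t(2) by auto
        next
          case (Suc i)
          have "kc f g1 g2 (Z T N) \<inter> X T i = {}"
          proof (rule two_colour[OF f(1)])
            show "Suc i < q" using j Suc by simp
            show "g1 \<in> missU f (X T i)" "g2 \<in> missU f (X T i)" using s1(5) s2(5) mY Suc by simp_all
            show "reserved_ok f T (Suc i) g1" "reserved_ok f T (Suc i) g2"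
              using same_reserved[OF f(2), of j] s1(3) s2(3) j1 Suc by simp_all
            show "Z T N \<notin> X T i" using valid_Z_Y[OF ff(2), of "Suc i" N] j1 Suc ff(5) by simp
            show "g1 \<in> miss f (Z T N)" by (rule ff(6))
          qed
          then show False using tk t(1) Suc by blast
        qed
      qed
      moreover have "safe f' T j g2" using same_safe[OF f'(2) j1] ss by simp
      ultimately show ?thesis using stI[OF f'(1) _ _ s2(2) True] True by blast
    qed
  next
    case False
    then have jN: "N = Suc j" "q = N" using j1 j by simp_all
    have t': "ends (E T j) = {t, Z T N}" using t(2) jN by simp
    have drop: False if "dup f' T c" "c \<in> missU f' (Y T j)" "f' (E T j) \<in> missU f' (Y T j)" for f' c
      by (rule drop_last[OF that(1) jN that(2,3) t(1) t'])
    define \<epsilon> where "\<epsilon> = f (E T j)"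
    have g1Y: "g1 \<in> missU f (Y T j)" "g2 \<in> missU f (Y T j)" using s1(5) s2(5) mY by simp_all
    \<comment> \<open>Unless \<open>drop_last\<close> already applies, the colour of the last edge
      is missing on \<open>X T j\<close> only at \<open>Z T j\<close>.\<close>
    have eY: "\<epsilon> \<notin> missU f (Y T j)" using drop[OF f(1) g1Y(1)] by (auto simp: \<epsilon>_def)
    have "\<epsilon> \<in> missU f (X T j)" unfolding \<epsilon>_def by (rule valid_E(3)[OF ff(2) jT])
    then have eZ: "\<epsilon> \<in> miss f (Z T j)" using eY by (auto simp: missU_Y_Suc)
    have eu: "unused f T j \<epsilon>" using jT by (intro unused_auto[OF ff(2) dup_elem[OF f(1) order_refl] j1 _ eZ]) simp
    have "free f T j \<epsilon>" using jN(1) unfolding free_def by linarith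
    then have es: "safe f T j \<epsilon>" using eu \<open>\<epsilon> \<in> missU f (X T j)\<close> unfolding safe_def by blast
    have \<Gamma>Y: "\<Gamma> \<subseteq> missU f (Y T j)" by (rule \<Gamma>_Y[OF ff(1)])
    have eg: "\<epsilon> \<noteq> g1" "\<epsilon> \<noteq> g2" using g1Y eY by auto
    have ZNe: "Z T N \<in> ends (E T j)" using t' by simp
    have flip: "f1 (E T j) = c" if "f1 = swap f0 c c' (kc f0 c c' (Z T N))" "f0 (E T j) = c'" for f0 f1 c c'
      using that EA ZNe kc_self[of "Z T N" f0 c c'] unfolding swap_def by auto
    have jle: "j \<le> N" using j1 by simp
    show ?thesis
    proof (cases "\<epsilon> \<in> P")
      case False
      \<comment> \<open>Since the last edge ends at \<open>Z T N\<close>, the first swap recolours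
        it to \<open>g1\<close>; the second one moves the repeated colour on to \<open>g2\<close>
        and leaves this edge alone.\<close>
      obtain f1 where f1: "dup f1 T \<epsilon>" "same f f1 T j" "f1 = swap f g1 \<epsilon> (kc f g1 \<epsilon> (Z T N))"
        by (rule step[OF f(1) j1 ss(1) es]) (use eg s1 False in blast)+
      have c1: "f1 (E T j) = g1" using flip[OF f1(3)] by (simp add: \<epsilon>_def)
      have ss1: "safe f1 T j \<epsilon>" "safe f1 T j g2" using same_safe[OF f1(2) j1] es ss by simp_all
      obtain f2 where f2: "dup f2 T g2" "same f1 f2 T j" "f2 = swap f1 \<epsilon> g2 (kc f1 \<epsilon> g2 (Z T N))"
        by (rule step[OF f1(1) j1 ss1]) (use eg s2 False in blast)+
      have c2: "f2 (E T j) = g1" unfolding f2(3) using c1 eg g(3) by (subst swap_other) auto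
      have "missU f2 (Y T j) = missU f (Y T j)" using same_missU[OF same_trans[OF f1(2) f2(2)] jle] .
      then show ?thesis using drop[OF f2(1)] c2 g1Y by simp
    next
      case True
      \<comment> \<open>For a protected \<open>\<epsilon>\<close> the roles of \<open>g1\<close> and
        \<open>g2\<close> pass to its two reserved colours, which lie in \<open>\<Gamma>\<close> and
        so are admissible partners.\<close>
      obtain c c' where c: "c \<in> G \<epsilon>" "c' \<in> G \<epsilon>" "c \<noteq> c'" by (rule G_two[OF True])
      note cs = G_safe[OF f(1) j1 True eZ c(1)] and cs' = G_safe[OF f(1) j1 True eZ c(2)]
      have ce: "c \<noteq> \<epsilon>" "c' \<noteq> \<epsilon>" using cs(1) cs'(1) P_\<Gamma> True by auto
      have "\<exists>f1. dup f1 T c \<and> same f f1 T j \<and> f1 (E T j) = \<epsilon>"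
      proof (cases "g1 = c")
        case True then show ?thesis using f(1) same_refl \<epsilon>_def by blast
      next
        case ne: False
        obtain f1 where f1: "dup f1 T c" "same f f1 T j" "f1 = swap f g1 c (kc f g1 c (Z T N))"
          by (rule step[OF f(1) j1 ss(1) cs(2) ne]) (use cs(1) in blast)+
        have "f1 (E T j) = \<epsilon>" unfolding f1(3) \<epsilon>_def using eg ce unfolding \<epsilon>_def by (intro swap_other) auto
        then show ?thesis using f1 by blast
      qed
      then obtain f1 where f1: "dup f1 T c" "same f f1 T j" "f1 (E T j) = \<epsilon>" by blast
      have ss1: "safe f1 T j c" "safe f1 T j \<epsilon>" using same_safe[OF f1(2) j1] es cs(2) by simp_all
      obtain f2 where f2: "dup f2 T \<epsilon>" "same f1 f2 T j" "f2 = swap f1 c \<epsilon> (kc f1 c \<epsilon> (Z T N))"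
        by (rule step[OF f1(1) j1 ss1 ce(1)]) (use cs(1) in blast)+
      have c2: "f2 (E T j) = c" using flip[OF f2(3) f1(3)] .
      have tr: "same f f2 T j" by (rule same_trans[OF f1(2) f2(2)])
      have ss2: "safe f2 T j \<epsilon>" "safe f2 T j c'" using same_safe[OF tr j1] es cs'(2) by simp_all
      obtain f3 where f3: "dup f3 T c'" "same f2 f3 T j" "f3 = swap f2 \<epsilon> c' (kc f2 \<epsilon> c' (Z T N))"
        by (rule step[OF f2(1) j1 ss2]) (use ce cs'(1) in blast)+
      have c3: "f3 (E T j) = c" unfolding f3(3) using c2 ce c(3) by (subst swap_other) auto
      have "missU f3 (Y T j) = missU f (Y T j)" using same_missU[OF same_trans[OF tr f3(2)] jle] .
      then show ?thesis using drop[OF f3(1)] c3 cs(1) cs'(1) \<Gamma>Y by auto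
    qed
  qed
qed

text \<open>From every state another one with larger index can be reached, yet the index stays below
  \<open>N\<close>.\<close>

lemma no_st:
  assumes np: "q = 0 \<or> \<not> pathf (q - 1) T"
  shows "\<not> st \<phi> T j \<alpha>"
proof (induction "N - j" arbitrary: \<phi> j \<alpha> rule: less_induct)
  case less
  show ?case
  proof
    assume "st \<phi> T j \<alpha>"
    then obtain i where i: "j \<le> i" "st \<phi> T i \<alpha>" "safe \<phi> T i \<alpha>" by (rule st_lift)
    have d: "dup \<phi> T \<alpha>" and iN: "i < N" and h: "\<alpha> \<in> P \<Longrightarrow> \<exists>c\<in>\<Gamma>. safe \<phi> T i c"
      using i(2) by (simp_all add: st_def)
    note dd = dupD[OF d]
    have lt: "N - Suc i < N - j" using i(1) iN by simp
    have fin: False if "st \<phi>' T (Suc i) \<alpha>'" for \<phi>' \<alpha>'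
      using less[OF lt] that by blast
    consider "q \<le> i" | "Suc i < q" | "Suc i = q" by linarith
    then show False
    proof cases
      case 1 then show False using walk[OF d iN 1 i(3) h] fin by blast
    next
      case 2 then show False using raise[OF d 2 i(3) h] fin by blast
    next
      case 3
      have iT: "i < length T" using iN dd(5) by simp
      obtain t where t: "t \<in> X T i" "ends (E T i) = {t, Z T (Suc i)}" using valid_E(2)[OF dd(2) iT] by blast
      \<comment> \<open>Otherwise the path part would begin one edge earlier.\<close>
      have "t \<noteq> Z T i"
      proof
        assume eq: "t = Z T i"
        have "pathf i T" unfolding pathf_def
        proof (intro allI impI)
          fix l assume l: "l < length T" "i \<le> l"
          show "ends (E T l) = {Z T l, Z T (Suc l)}"
          proof (cases "l = i")
            case True then show ?thesis using t eq by simp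
          next
            case False then show ?thesis using dd(4) l 3 unfolding pathf_def by simp
          qed
        qed
        then show False using np 3 by auto
      qed
      then have "t \<in> Y T i" using t(1) by (simp add: Y_Suc)
      then show False using raise_last[OF d 3 i(3) h _ t(2)] fin by blast
    qed
  qed
qed

end

text \<open>The outer induction is on the path number, the inner one on the length. Tails that are
  too short for \<open>q\<close>, or paths already from \<open>q - 1\<close> on, belong to the outer
  hypothesis, so the step may assume a genuine branching at \<open>q - 1\<close>.\<close>

theorem (in tail_root) tail_elem_pathf:
  assumes "\<phi> \<in> S" "valid \<phi> T" "cls \<phi> T" "pathf q T"
  shows "elem \<phi> (X T (length T))"
  using assms
proof (induction q arbitrary: \<phi> T rule: less_induct)
  case (less q)
  note IHq = less.IH
  show ?case using less.prems
  proof (induction "length T" arbitrary: \<phi> T rule: less_induct)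
    case (less T)
    note IHn = less.hyps
    show ?case
    proof (cases "q \<le> length T")
      case False
      have "pathf (length T) T" by (simp add: pathf_def)
      then show ?thesis using IHq[of "length T"] less.prems False by simp
    next
      case True
      interpret tail_step A ends k W y \<Gamma> P S G q "length T"
        by unfold_locales (use IHq IHn True in blast)+
      show ?thesis
      proof (cases "q = 0 \<or> \<not> pathf (q - 1) T")
        case False
        then show ?thesis using IHq[of "q - 1"] less.prems by simp
      next
        case np: True
        show ?thesis
        proof (cases "length T = 0")
          case True
          have "X T (length T) = insert y W" using True by (simp add: Y_Suc)
          then show ?thesis using base_elem[OF less.prems(1)] by simp
        next
          case False
          then obtain M where M: "length T = Suc M" by (cases "length T") auto
          show ?thesis
          proof (rule ccontr)
            assume ne: "\<not> elem \<phi> (X T (length T))"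
            have t: "elem \<phi> (X (take M T) (length (take M T)))"
              using M by (intro IHn valid_take cls_take pathf_take less.prems) simp_all
            have "X (take M T) (length (take M T)) = Y T (length T)"
              using M Y_take[of "Suc M" M T] by simp
            then have el: "elem \<phi> (Y T (length T))" using t by simp
            have "\<exists>\<alpha>. \<alpha> \<in> miss \<phi> (Z T (length T)) \<and> \<alpha> \<in> missU \<phi> (Y T (length T))"
            proof (rule ccontr)
              assume "\<not> ?thesis"
              then have "elem \<phi> (insert (Z T (length T)) (Y T (length T)))"
                using el unfolding elem_def missU_def by blast
              then show False using ne unfolding Y_Suc by blast
            qed
            then obtain \<alpha> where a: "\<alpha> \<in> miss \<phi> (Z T (length T))" "\<alpha> \<in> missU \<phi> (Y T (length T))" by blast
            have "dup \<phi> T \<alpha>" using less.prems a(1) by (simp add: dup_def)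
            then show False using st_init[OF _ a(2)] no_st[OF np] M by simp
          qed
        qed
      qed
    qed
  qed
qed

corollary (in tail_root) tail_elem:
  assumes "\<phi> \<in> S" "valid \<phi> T" "cls \<phi> T"
  shows "elem \<phi> (X T (length T))"
proof (rule tail_elem_pathf[OF assms])
  show "pathf (length T) T" by (simp add: pathf_def)
qed

section \<open>Closed roots\<close>

lemma disjoint_pairs:
  fixes P R :: "nat set"
  assumes "finite P" "finite R" "2 * card P \<le> card R"
  shows "\<exists>G. (\<forall>d\<in>P. G d \<subseteq> R \<and> card (G d) = 2) \<and> (\<forall>d\<in>P. \<forall>d'\<in>P. G d \<inter> G d' \<noteq> {} \<longrightarrow> d = d')"
  using assms
proof (induction P arbitrary: R rule: finite_induct)
  case empty then show ?case by simp
next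
  case (insert d P)
  then have "2 \<le> card R" by simp
  then obtain B where B: "B \<subseteq> R" "card B = 2" by (meson obtain_subset_with_card_n)
  have fB: "finite B" using B(2) card.infinite by fastforce
  have "card (R - B) = card R - 2" using B fB by (simp add: card_Diff_subset)
  then have "2 * card P \<le> card (R - B)" using insert by simp
  then obtain G where G: "\<forall>d\<in>P. G d \<subseteq> R - B \<and> card (G d) = 2" "\<forall>d\<in>P. \<forall>d'\<in>P. G d \<inter> G d' \<noteq> {} \<longrightarrow> d = d'"
    using insert.IH[of "R - B"] insert.prems by blast
  define G' where "G' = G(d := B)"
  have e: "G' d = B" "\<And>d'. d' \<in> P \<Longrightarrow> G' d' = G d'" using insert.hyps by (auto simp: G'_def)
  have "\<forall>d'\<in>insert d P. G' d' \<subseteq> R \<and> card (G' d') = 2" using e G(1) B by auto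
  moreover have "\<forall>d1\<in>insert d P. \<forall>d2\<in>insert d P. G' d1 \<inter> G' d2 \<noteq> {} \<longrightarrow> d1 = d2"
  proof (intro ballI impI)
    fix d1 d2 assume a: "d1 \<in> insert d P" "d2 \<in> insert d P" "G' d1 \<inter> G' d2 \<noteq> {}"
    have no: "B \<inter> G d' = {}" if "d' \<in> P" for d' using G(1) that by blast
    consider "d1 = d \<and> d2 = d" | "d1 = d \<and> d2 \<in> P" | "d1 \<in> P \<and> d2 = d" | "d1 \<in> P \<and> d2 \<in> P" using a by blast
    then show "d1 = d2"
    proof cases
      case 2 then show ?thesis using a(3) e no by auto
    next
      case 3 then show ?thesis using a(3) e no by auto
    next
      case 4 then show ?thesis using a(3) e G(2) by auto
    qed simp
  qed
  ultimately show ?case by blast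
qed

section \<open>Parity and growth of closed elementary sets\<close>

context mgraph
begin

text \<open>By elementarity exactly one vertex of \<open>X\<close> misses \<open>c\<close>; the
  edges of colour \<open>c\<close> match all other vertices within \<open>X\<close>.\<close>

lemma odd_closed:
  assumes "proper \<phi>" "finite X" "elem \<phi> X" "c \<in> missU \<phi> X"
    and cl: "\<And>e p q. e \<in> A \<Longrightarrow> p \<in> ends e \<Longrightarrow> q \<in> ends e \<Longrightarrow> p \<in> X \<Longrightarrow> q \<notin> X \<Longrightarrow> \<phi> e \<noteq> c"
  shows "odd (card X)"
proof -
  obtain u where u: "u \<in> X" "c \<in> miss \<phi> u" using assms(4) by (auto simp: missU_def)
  have ck: "c < k" using u miss_lt by blast
  define H where "H = {e\<in>A. \<phi> e = c}"
  have H: "finite H" "\<And>e. e \<in> H \<Longrightarrow> card (ends e) = 2" using finA card2 by (simp_all add: H_def)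
  have Hc: "ends e \<subseteq> X" if "e \<in> H" "ends e \<inter> X \<noteq> {}" for e using cl that unfolding H_def by blast
  have "(\<Sum>v\<in>X. deg_in ends H v) = 2 * card {e\<in>H. ends e \<subseteq> X}"
    by (rule handshake[where ends = ends, OF H assms(2) Hc])
  moreover have "(\<Sum>v\<in>X. deg_in ends H v) = card (X - {u})"
  proof -
    have dg: "deg_in ends H v = (if c \<in> miss \<phi> v then 0 else 1)" for v
    proof -
      have "{e\<in>H. v \<in> ends e} = {e\<in>A. \<phi> e = c \<and> v \<in> ends e}" by (auto simp: H_def)
      then show ?thesis unfolding deg_in_def using card_at_colour[OF assms(1) ck] by metis
    qed
    have "(\<Sum>v\<in>X. deg_in ends H v) = (\<Sum>v\<in>X. if v = u then 0 else 1)"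
    proof (rule sum.cong[OF refl])
      fix v assume "v \<in> X"
      then have "c \<in> miss \<phi> v \<longleftrightarrow> v = u" using elemD[OF assms(3) _ u(1) _ u(2)] u by blast
      then show "deg_in ends H v = (if v = u then 0 else 1)" using dg by simp
    qed
    also have "\<dots> = card (X - {u})" using assms(2) by (simp add: sum.If_cases Diff_eq)
    finally show ?thesis .
  qed
  ultimately have "card (X - {u}) = 2 * card {e\<in>H. ends e \<subseteq> X}" by simp
  moreover have "card X = Suc (card (X - {u}))" using u assms(2) by (metis card_Suc_Diff1)
  ultimately show ?thesis by simp
qed

text \<open>A colour of \<open>Q\<close> is missing at a vertex of \<open>X\<close>, hence present
  at \<open>z\<close>. Its edge at \<open>z\<close> leads neither into \<open>X\<close> nor out of
  \<open>X'\<close>, so it is one of the at most \<open>\<mu>\<close> edges to each other vertex of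
  \<open>X' - X\<close>. The \<open>- 1\<close> accounts for \<open>z\<close> itself.\<close>

lemma growth:
  assumes pr: "proper \<phi>" and X': "finite X'" "elem \<phi> X'" and sub: "X \<subseteq> X'" and z: "z \<in> X'" "z \<notin> X"
    and Q: "Q \<subseteq> missU \<phi> X"
    and cl: "\<And>e p q. e \<in> A \<Longrightarrow> p \<in> ends e \<Longrightarrow> q \<in> ends e \<Longrightarrow> p \<in> X \<Longrightarrow> q \<notin> X \<Longrightarrow> \<phi> e \<notin> Q"
    and cl': "\<And>e p q. e \<in> A \<Longrightarrow> p \<in> ends e \<Longrightarrow> q \<in> ends e \<Longrightarrow> p \<in> X' \<Longrightarrow> q \<notin> X' \<Longrightarrow> \<phi> e \<notin> Q"
    and mu: "\<And>u v. u \<noteq> v \<Longrightarrow> card {e\<in>A. ends e = {u, v}} \<le> \<mu>"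
  shows "card Q \<le> \<mu> * (card (X' - X) - 1)"
proof -
  define D where "D = X' - X - {z}"
  have fD: "finite D" using X' by (simp add: D_def)
  have cD: "card D = card (X' - X) - 1" using z X' by (simp add: D_def)
  have "Q \<subseteq> \<phi> ` (\<Union>w\<in>D. {e\<in>A. ends e = {z, w}})"
  proof
    fix c assume c: "c \<in> Q"
    obtain u where u: "u \<in> X" "c \<in> miss \<phi> u" using Q c by (auto simp: missU_def)
    have "c \<notin> miss \<phi> z" using elemD[OF X'(2) _ z(1) u(2)] u sub z(2) by blast
    then obtain e where e: "e \<in> A" "z \<in> ends e" "\<phi> e = c" using not_miss miss_lt[OF u(2)] by blast
    obtain w where w: "w \<noteq> z" "ends e = {z, w}" using ends_other[OF e(1,2)] by blast
    have "w \<in> X'" using cl'[of e z w] e w z c by auto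
    moreover have "w \<notin> X" using cl[of e w z] e w z c by auto
    ultimately show "c \<in> \<phi> ` (\<Union>w\<in>D. {e\<in>A. ends e = {z, w}})" using e w unfolding D_def by blast
  qed
  then have "card Q \<le> card (\<phi> ` (\<Union>w\<in>D. {e\<in>A. ends e = {z, w}}))"
    using fD finA by (intro card_mono) auto
  also have "\<dots> \<le> card (\<Union>w\<in>D. {e\<in>A. ends e = {z, w}})" using fD finA by (intro card_image_le) auto
  also have "\<dots> \<le> (\<Sum>w\<in>D. card {e\<in>A. ends e = {z, w}})" by (rule card_UN_le[OF fD])
  also have "\<dots> \<le> (\<Sum>w\<in>D. \<mu>)" using mu by (intro sum_mono) (auto simp: D_def)
  finally show ?thesis using cD by (simp add: mult.commute)
qed

end

section \<open>Tails that are maximal under frozen recolourings\<close>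

context tail_root
begin

lemma change_G:
  assumes "\<And>d. d \<in> P \<Longrightarrow> G' d \<subseteq> \<Gamma>" "\<And>d. d \<in> P \<Longrightarrow> card (G' d) = 2"
    "\<And>d d' c. d \<in> P \<Longrightarrow> d' \<in> P \<Longrightarrow> c \<in> G' d \<Longrightarrow> c \<in> G' d' \<Longrightarrow> d = d'"
  shows "tail_root A ends k W y \<Gamma> P S G'"
  by (unfold_locales)
    (fact S_proper S_missU S_elem S_closed S_swap S_uniq y_W S_y fin_W fin_\<Gamma> fin_P P_\<Gamma> assms card_\<Gamma> S_miss)+

definition avoid :: "('e \<Rightarrow> nat) \<Rightarrow> ('e \<times> 'a) list \<Rightarrow> nat set \<Rightarrow> bool" where
  "avoid \<phi> T R \<longleftrightarrow> (\<forall>i<length T. \<phi> (E T i) \<notin> R)"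

text \<open>The tail theorem does not prescribe the pairing: if no edge has a colour of
  \<open>R\<close>, all reserved pairs can be placed inside \<open>R\<close>, and \<open>cls\<close>
  holds vacuously.\<close>

lemma elem_avoid:
  assumes "\<phi> \<in> S" "valid \<phi> T" "avoid \<phi> T R" "R \<subseteq> \<Gamma>" "2 * card P \<le> card R"
  shows "elem \<phi> (X T (length T))"
proof -
  have fR: "finite R" using assms(4) fin_\<Gamma> finite_subset by blast
  obtain G' where G: "\<forall>d\<in>P. G' d \<subseteq> R \<and> card (G' d) = 2" "\<forall>d\<in>P. \<forall>d'\<in>P. G' d \<inter> G' d' \<noteq> {} \<longrightarrow> d = d'"
    using disjoint_pairs[OF fin_P fR assms(5)] by blast
  interpret g: tail_root A ends k W y \<Gamma> P S G'
    by (rule change_G) (use G assms(4) in blast)+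
  have "g.cls \<phi> T" unfolding g.cls_def
  proof (intro allI impI ballI)
    fix l d assume l: "Suc l < length T" "d \<in> P" "\<phi> (E T l) \<in> G' d"
    then have "\<phi> (E T l) \<in> R" using G(1) by blast
    then show "\<exists>b\<le>l. d \<in> miss \<phi> (Z T b)" using assms(3) l(1) unfolding avoid_def by simp
  qed
  then show ?thesis using g.tail_elem assms(1,2) by blast
qed

definition freeze :: "('e \<Rightarrow> nat) \<Rightarrow> ('e \<times> 'a) list \<Rightarrow> ('e \<Rightarrow> nat) set" where
  "freeze \<phi> T = {\<psi>\<in>S. (\<forall>i<length T. \<psi> (E T i) = \<phi> (E T i)) \<and> (\<forall>u\<in>X T (length T). miss \<psi> u = miss \<phi> u)}"

lemma freeze_self: "\<phi> \<in> S \<Longrightarrow> \<phi> \<in> freeze \<phi> T" by (simp add: freeze_def)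

lemma freezeD:
  assumes "\<psi> \<in> freeze \<phi> T"
  shows "\<psi> \<in> S" "\<And>i. i < length T \<Longrightarrow> \<psi> (E T i) = \<phi> (E T i)" "\<And>u. u \<in> X T (length T) \<Longrightarrow> miss \<psi> u = miss \<phi> u"
  using assms by (simp_all add: freeze_def)

lemma freeze_missU: "\<psi> \<in> freeze \<phi> T \<Longrightarrow> m \<le> Suc (length T) \<Longrightarrow> missU \<psi> (Y T m) = missU \<phi> (Y T m)"
  using freezeD(3)[of \<psi> \<phi> T] Y_mono[of m "Suc (length T)" T] unfolding missU_def by blast

lemma freeze_avoid: "\<psi> \<in> freeze \<phi> T \<Longrightarrow> avoid \<psi> T R = avoid \<phi> T R"
  unfolding avoid_def by (simp add: freezeD(2))

lemma freeze_valid: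
  assumes "\<psi> \<in> freeze \<phi> T" "valid \<phi> T" shows "valid \<psi> T"
  unfolding valid_def
proof (intro conjI allI impI)
  show "distinct (y # map snd T)" "snd ` set T \<inter> W = {}" using assms(2) by (simp_all add: valid_def)
  fix i assume i: "i < length T"
  show "E T i \<in> A" "\<exists>t\<in>X T i. ends (E T i) = {t, Z T (Suc i)}" using valid_E[OF assms(2) i] by blast+
  have "missU \<psi> (X T i) = missU \<phi> (X T i)" using i by (intro freeze_missU[OF assms(1)]) simp
  then show "\<psi> (E T i) \<in> missU \<psi> (X T i)" using valid_E(3)[OF assms(2) i] freezeD(2)[OF assms(1) i] by simp
qed

lemma freeze_trans:
  assumes "\<psi> \<in> freeze \<phi> T" "\<chi> \<in> freeze \<psi> (T @ T1)" shows "\<chi> \<in> freeze \<phi> T"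
proof -
  have "X T (length T) \<subseteq> X (T @ T1) (length (T @ T1))"
    using Y_append[of "Suc (length T)" T T1] Y_mono[of "Suc (length T)" "Suc (length (T @ T1))" "T @ T1"] by simp
  then have "miss \<chi> u = miss \<phi> u" if "u \<in> X T (length T)" for u
    using freezeD(3)[OF assms(2), of u] freezeD(3)[OF assms(1), of u] that by auto
  moreover have "\<chi> (E T i) = \<phi> (E T i)" if "i < length T" for i
    using freezeD(2)[OF assms(2), of i] freezeD(2)[OF assms(1), of i] that by (simp add: nth_append)
  ultimately show ?thesis using freezeD(1)[OF assms(2)] by (simp add: freeze_def)
qed

lemma freeze_swapI:
  assumes f: "\<psi> \<in> freeze \<phi> T" and S': "swap \<psi> a b C \<in> S" and ab: "a < k" "b < k" and C: "kclosed \<psi> a b C"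
    and m: "\<And>u. u \<in> X T (length T) \<Longrightarrow> u \<in> C \<Longrightarrow> a \<notin> miss \<psi> u \<and> b \<notin> miss \<psi> u"
    and e: "\<And>i. i < length T \<Longrightarrow> \<psi> (E T i) \<noteq> a \<and> \<psi> (E T i) \<noteq> b \<or> ends (E T i) \<inter> C = {}"
  shows "swap \<psi> a b C \<in> freeze \<phi> T"
proof -
  have "swap \<psi> a b C (E T i) = \<phi> (E T i)" if "i < length T" for i
    using e[OF that] freezeD(2)[OF f that] swap_other swap_disj by metis
  moreover have "miss (swap \<psi> a b C) u = miss \<phi> u" if u: "u \<in> X T (length T)" for u
  proof (cases "u \<in> C")
    case True
    then have "miss (swap \<psi> a b C) u = miss \<psi> u" using m[OF u True] by (intro miss_swap_neither[OF C ab]) simp_all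
    then show ?thesis using freezeD(3)[OF f u] by simp
  next
    case False
    then show ?thesis using miss_swap_out[OF C False] freezeD(3)[OF f u] by simp
  qed
  ultimately show ?thesis using S' unfolding freeze_def by simp
qed

lemma valid_colour:
  assumes "valid \<phi> T" "i < length T" shows "\<phi> (E T i) \<in> missU \<phi> (X T (length T))" "ends (E T i) \<subseteq> X T (length T)"
proof -
  have sub: "Y T (Suc i) \<subseteq> X T (length T)" using assms(2) by (intro Y_mono) simp
  then show "\<phi> (E T i) \<in> missU \<phi> (X T (length T))" using valid_E(3)[OF assms] missU_mono by blast
  obtain t where t: "t \<in> X T i" "ends (E T i) = {t, Z T (Suc i)}" using valid_E(2)[OF assms] by blast
  have "Z T (Suc i) \<in> X T (length T)" using assms(2) by (intro Z_in_Y) simp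
  moreover have "t \<in> X T (length T)" using t(1) sub by (rule rev_subsetD)
  ultimately show "ends (E T i) \<subseteq> X T (length T)" unfolding t(2) by simp
qed

text \<open>Maximality refers to all frozen recolourings at once. Therefore the restriction on
  leaving colours, \<open>stuck_closed\<close>, remains true for every colouring in the class of the
  next root.\<close>

definition stuck :: "('e \<Rightarrow> nat) \<Rightarrow> ('e \<times> 'a) list \<Rightarrow> nat set \<Rightarrow> bool" where
  "stuck \<phi> T R \<longleftrightarrow> \<phi> \<in> S \<and> valid \<phi> T \<and> avoid \<phi> T R \<and>
     (\<forall>\<psi>\<in>freeze \<phi> T. \<forall>T1. valid \<psi> (T @ T1) \<longrightarrow> avoid \<psi> (T @ T1) R \<longrightarrow> T1 = [])"

lemma length_le: assumes "valid \<phi> T" shows "length T \<le> card (\<Union>(ends ` A))"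
proof -
  have fin: "finite (\<Union>(ends ` A))" using finA card2 by (metis (no_types, lifting) card.infinite finite_UN_I zero_neq_numeral)
  have "snd ` set T \<subseteq> \<Union>(ends ` A)"
  proof
    fix z assume "z \<in> snd ` set T"
    then obtain p where "p \<in> set T" "z = snd p" by blast
    then obtain i where i: "i < length T" "snd (T ! i) = z" unfolding in_set_conv_nth by blast
    then have "z \<in> ends (E T i)" "E T i \<in> A" using valid_E(1,2)[OF assms i(1)] by auto
    then show "z \<in> \<Union>(ends ` A)" by blast
  qed
  then have "card (snd ` set T) \<le> card (\<Union>(ends ` A))" by (rule card_mono[OF fin])
  moreover have "distinct (map snd T)" using assms by (simp add: valid_def)
  then have "card (set (map snd T)) = length T" by (metis distinct_card length_map)
  ultimately show ?thesis by simp
qed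

lemma stuck_ex:
  assumes "\<phi> \<in> S" "valid \<phi> T" "avoid \<phi> T R"
  obtains \<psi> T1 where "\<psi> \<in> freeze \<phi> T" "stuck \<psi> (T @ T1) R"
proof -
  define Q where "Q n \<longleftrightarrow> (\<exists>\<psi> T1. \<psi> \<in> freeze \<phi> T \<and> valid \<psi> (T @ T1) \<and> avoid \<psi> (T @ T1) R \<and> length T1 = n)" for n
  have "Q 0" unfolding Q_def using assms freeze_self by (intro exI[of _ \<phi>] exI[of _ "[]"]) simp
  moreover have bd: "n \<le> card (\<Union>(ends ` A))" if q: "Q n" for n
  proof -
    obtain \<psi> T1 where v: "valid \<psi> (T @ T1)" "length T1 = n" using q unfolding Q_def by (elim exE conjE) (rule that)
    then show ?thesis using length_le[OF v(1)] by simp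
  qed
  ultimately obtain n where n: "Q n" "\<And>m. Q m \<Longrightarrow> m \<le> n" using GreatestI_nat[of Q 0 "card (\<Union>(ends ` A))"] Greatest_le_nat[of Q _ "card (\<Union>(ends ` A))"] by blast
  then obtain \<psi> T1 where p: "\<psi> \<in> freeze \<phi> T" "valid \<psi> (T @ T1)" "avoid \<psi> (T @ T1) R" "length T1 = n" unfolding Q_def by (elim exE conjE) (rule that)
  have "T2 = []" if "\<chi> \<in> freeze \<psi> (T @ T1)" "valid \<chi> ((T @ T1) @ T2)" "avoid \<chi> ((T @ T1) @ T2) R" for \<chi> T2
  proof -
    have "Q (length (T1 @ T2))" unfolding Q_def
      using freeze_trans[OF p(1) that(1)] that(2,3) by (intro exI[of _ \<chi>] exI[of _ "T1 @ T2"]) simp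
    then have "length (T1 @ T2) \<le> n" by (rule n(2))
    then show ?thesis using p(4) by simp
  qed
  then have "stuck \<psi> (T @ T1) R" using p freezeD(1) unfolding stuck_def by blast
  then show ?thesis using that p by blast
qed

lemma valid_snoc:
  assumes v: "valid \<phi> T" and e: "e \<in> A" "p \<in> ends e" "q \<in> ends e" "p \<in> X T (length T)" "q \<notin> X T (length T)"
    and c: "\<phi> e \<in> missU \<phi> (X T (length T))"
  shows "valid \<phi> (T @ [(e, q)])"
  unfolding valid_def
proof (intro conjI allI impI)
  have d: "distinct (y # map snd T)" "snd ` set T \<inter> W = {}" using v by (simp_all add: valid_def)
  have qy: "q \<noteq> y" "q \<notin> W" using e(5) Z_in_Y[of 0 "Suc (length T)" T] W_Y by auto
  have "q \<notin> snd ` set T"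
  proof
    assume "q \<in> snd ` set T"
    then obtain pr where "pr \<in> set T" "q = snd pr" by blast
    then obtain i where "i < length T" "snd (T ! i) = q" unfolding in_set_conv_nth by blast
    then have "q = Z T (Suc i)" "Suc i < Suc (length T)" by simp_all
    then show False using e(5) Z_in_Y[of "Suc i" "Suc (length T)" T] by simp
  qed
  then show "distinct (y # map snd (T @ [(e, q)]))" "snd ` set (T @ [(e, q)]) \<inter> W = {}" using d qy by auto
  fix i assume i: "i < length (T @ [(e, q)])"
  have YY: "Y (T @ [(e, q)]) (Suc i) = Y T (Suc i)" using i by (intro Y_append) simp
  have "E (T @ [(e, q)]) i \<in> A \<and> (\<exists>t\<in>X (T @ [(e, q)]) i. ends (E (T @ [(e, q)]) i) = {t, Z (T @ [(e, q)]) (Suc i)}) \<and>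
      \<phi> (E (T @ [(e, q)]) i) \<in> missU \<phi> (X (T @ [(e, q)]) i)"
  proof (cases "i < length T")
    case True
    then have "(T @ [(e, q)]) ! i = T ! i" by (simp add: nth_append)
    then show ?thesis using YY valid_E[OF v True] by simp
  next
    case False
    then have il: "i = length T" using i by simp
    have "p \<noteq> q" using e by auto
    then have "ends e = {p, q}" using ends2[OF e(1)] e(2,3) by auto
    then show ?thesis using YY il e c by auto
  qed
  then show "E (T @ [(e, q)]) i \<in> A" "\<exists>t\<in>X (T @ [(e, q)]) i. ends (E (T @ [(e, q)]) i) = {t, Z (T @ [(e, q)]) (Suc i)}"
    "\<phi> (E (T @ [(e, q)]) i) \<in> missU \<phi> (X (T @ [(e, q)]) i)" by blast+
qed

lemma avoid_snoc: "avoid \<phi> (T @ [(e, q)]) R \<longleftrightarrow> avoid \<phi> T R \<and> \<phi> e \<notin> R"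
  unfolding avoid_def by (auto simp: nth_append less_Suc_eq)

lemma stuck_closed:
  assumes st: "stuck \<phi> T R" and f: "\<psi> \<in> freeze \<phi> T"
    and e: "e \<in> A" "p \<in> ends e" "q \<in> ends e" "p \<in> X T (length T)" "q \<notin> X T (length T)"
    and c: "\<psi> e \<in> missU \<phi> (X T (length T))"
  shows "\<psi> e \<in> R"
proof (rule ccontr)
  assume "\<psi> e \<notin> R"
  have v: "valid \<psi> T" using freeze_valid[OF f] st by (simp add: stuck_def)
  have "missU \<psi> (X T (length T)) = missU \<phi> (X T (length T))" by (rule freeze_missU[OF f]) simp
  then have "valid \<psi> (T @ [(e, q)])" using valid_snoc[OF v e] c by simp
  moreover have "avoid \<psi> (T @ [(e, q)]) R"
    using freeze_avoid[OF f] st \<open>\<psi> e \<notin> R\<close> by (simp add: avoid_snoc stuck_def)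
  ultimately show False using st f unfolding stuck_def by blast
qed

end

text \<open>\<open>F\<close> contains the free colours. By \<open>R_exit\<close>, for a free colour
  \<open>c\<close> every exit of colour \<open>d\<close> hangs on the chain that starts at the
  vertex of \<open>W\<close> missing \<open>c\<close>. A single free colour suffices to control all
  of \<open>\<Gamma>\<close>, because colours of \<open>\<Gamma>\<close> can be exchanged outside
  \<open>W\<close>.\<close>

locale closed_root = mgraph A ends k
  for A :: "'e set" and ends :: "'e \<Rightarrow> 'a set" and k :: nat +
  fixes W :: "'a set" and \<Gamma> P :: "nat set" and S :: "('e \<Rightarrow> nat) set" and F :: "nat set"
  assumes R_proper: "\<phi> \<in> S \<Longrightarrow> proper \<phi>"
    and R_missU: "\<phi> \<in> S \<Longrightarrow> missU \<phi> W = \<Gamma>"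
    and R_elem: "\<phi> \<in> S \<Longrightarrow> elem \<phi> W"
    and R_closed: "\<phi> \<in> S \<Longrightarrow> e \<in> A \<Longrightarrow> p \<in> ends e \<Longrightarrow> q \<in> ends e \<Longrightarrow> p \<in> W \<Longrightarrow> q \<notin> W \<Longrightarrow> \<phi> e \<notin> \<Gamma>"
    and R_swap: "\<phi> \<in> S \<Longrightarrow> a < k \<Longrightarrow> b < k \<Longrightarrow> a \<noteq> b \<Longrightarrow> kclosed \<phi> a b C \<Longrightarrow>
      C \<inter> W = {} \<or> a \<notin> \<Gamma> \<union> P \<and> b \<notin> \<Gamma> \<union> P \<Longrightarrow> swap \<phi> a b C \<in> S"
    and R_exit: "\<phi> \<in> S \<Longrightarrow> c \<in> F \<Longrightarrow> d < k \<Longrightarrow> d \<notin> \<Gamma> \<Longrightarrow> e \<in> A \<Longrightarrow> \<phi> e = d \<Longrightarrow> p \<in> ends e \<Longrightarrow> q \<in> ends e \<Longrightarrow>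
      p \<in> W \<Longrightarrow> q \<notin> W \<Longrightarrow> \<exists>u\<in>W. c \<in> miss \<phi> u \<and> p \<in> kc \<phi> c d u"
    and R_fin: "finite W" "finite P" and R_P: "P \<inter> \<Gamma> = {}" and R_F: "F \<subseteq> \<Gamma>" "F \<noteq> {}"
    and R_miss: "\<phi> \<in> S \<Longrightarrow> miss \<phi> v \<noteq> {}" and R_ne: "S \<noteq> {}"
begin

lemma \<Gamma>_k: "c \<in> \<Gamma> \<Longrightarrow> c < k"
proof -
  assume c: "c \<in> \<Gamma>"
  obtain \<phi> where "\<phi> \<in> S" using R_ne by blast
  then have "c \<in> missU \<phi> W" using R_missU c by simp
  then show ?thesis by (auto simp: missU_def dest: miss_lt)
qed

definition permutes_outside :: "('e \<Rightarrow> nat) \<Rightarrow> nat \<Rightarrow> nat \<Rightarrow> ('e \<Rightarrow> nat) \<Rightarrow> bool" where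
  "permutes_outside \<phi> a b \<psi> \<longleftrightarrow> \<psi> \<in> S \<and> (\<forall>e\<in>A. ends e \<inter> W \<noteq> {} \<longrightarrow> \<psi> e = \<phi> e) \<and>
    (\<forall>e\<in>A. ends e \<inter> W = {} \<longrightarrow> \<phi> e = a \<longrightarrow> \<psi> e = b) \<and> (\<forall>e. \<phi> e \<notin> \<Gamma> \<longrightarrow> \<psi> e = \<phi> e) \<and>
    (\<forall>v. v \<notin> W \<longrightarrow> a \<in> miss \<phi> v \<longrightarrow> b \<in> miss \<psi> v) \<and> (\<forall>v d. d \<notin> \<Gamma> \<longrightarrow> d \<in> miss \<phi> v \<longrightarrow> d \<in> miss \<psi> v) \<and>
    (\<forall>v\<in>W. miss \<psi> v = miss \<phi> v)"

lemma permutes_outsideD: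
  assumes "permutes_outside \<phi> a b \<psi>"
  shows "\<psi> \<in> S" "\<And>e. e \<in> A \<Longrightarrow> ends e \<inter> W \<noteq> {} \<Longrightarrow> \<psi> e = \<phi> e"
    "\<And>e. e \<in> A \<Longrightarrow> ends e \<inter> W = {} \<Longrightarrow> \<phi> e = a \<Longrightarrow> \<psi> e = b"
    "\<And>e. \<phi> e \<notin> \<Gamma> \<Longrightarrow> \<psi> e = \<phi> e"
    "\<And>v. v \<notin> W \<Longrightarrow> a \<in> miss \<phi> v \<Longrightarrow> b \<in> miss \<psi> v" "\<And>v d. d \<notin> \<Gamma> \<Longrightarrow> d \<in> miss \<phi> v \<Longrightarrow> d \<in> miss \<psi> v"
    "\<And>v. v \<in> W \<Longrightarrow> miss \<psi> v = miss \<phi> v"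
  using assms by (simp_all add: permutes_outside_def)

text \<open>No edge with a colour of \<open>\<Gamma>\<close> crosses the boundary of
  \<open>W\<close>, so the complement of \<open>W\<close> is closed for the two colours and can be
  swapped as a whole.\<close>

lemma perm_outside:
  assumes "\<phi> \<in> S" "a \<in> \<Gamma>" "b \<in> \<Gamma>"
  shows "\<exists>\<psi>. permutes_outside \<phi> a b \<psi>"
proof (cases "a = b")
  case True then show ?thesis using assms by (intro exI[of _ \<phi>]) (simp add: permutes_outside_def)
next
  case False
  have ab: "a < k" "b < k" using assms \<Gamma>_k by blast+
  have cl: "kclosed \<phi> a b (- W)" unfolding kclosed_def
  proof (intro ballI impI)
    fix e assume e: "e \<in> ab \<phi> a b" "ends e \<inter> - W \<noteq> {}"
    then have "e \<in> A" "\<phi> e \<in> \<Gamma>" using assms by (auto simp: ab_def)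
    then show "ends e \<subseteq> - W" using R_closed[OF assms(1), of e] e(2) by blast
  qed
  let ?f = "swap \<phi> a b (- W)"
  show ?thesis
  proof (intro exI[of _ ?f], unfold permutes_outside_def, intro conjI ballI allI impI)
    show "?f \<in> S" by (rule R_swap[OF assms(1) ab False cl]) simp
    show "?f e = \<phi> e" if "e \<in> A" "ends e \<inter> W \<noteq> {}" for e
    proof (cases "\<phi> e = a \<or> \<phi> e = b")
      case True
      then have "e \<in> ab \<phi> a b" using that by (simp add: ab_def)
      then have "ends e \<inter> - W = {}" using cl that(2) unfolding kclosed_def by blast
      then show ?thesis by (rule swap_disj)
    next
      case False then show ?thesis by (simp add: swap_other)
    qed
    show "?f e = b" if "e \<in> A" "ends e \<inter> W = {}" "\<phi> e = a" for e
    proof -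
      have "ends e \<noteq> {}" using card2[OF that(1)] by auto
      then have "ends e \<inter> - W \<noteq> {}" using that(2) by blast
      then show ?thesis using that by (simp add: swap_def)
    qed
    show "?f e = \<phi> e" if "\<phi> e \<notin> \<Gamma>" for e using that assms by (intro swap_other) auto
    show "b \<in> miss ?f v" if "v \<notin> W" "a \<in> miss \<phi> v" for v
      using miss_swap_in[of v "- W", OF _ ab] that by simp
    show "d \<in> miss ?f v" if "d \<notin> \<Gamma>" "d \<in> miss \<phi> v" for v d
      using miss_swap_other[OF cl ab, of d v] that assms by blast
    show "miss ?f v = miss \<phi> v" if "v \<in> W" for v using that by (intro miss_swap_out[OF cl]) simp
  qed
qed

text \<open>After \<open>c\<close> has been exchanged outside \<open>W\<close> with a free colour
  \<open>c0\<close>, a chain entering \<open>W\<close> from outside enters through an exit, and by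
  \<open>R_exit\<close> belongs to the chain of the vertex missing \<open>c0\<close>. That vertex is
  one end of the chain, which leaves one end for \<open>z\<close> and \<open>z'\<close>
  together.\<close>

lemma comp_uniq:
  assumes S: "\<phi> \<in> S" and c: "c \<in> \<Gamma>" and d: "d < k" "d \<notin> \<Gamma>" and z: "z \<notin> W" "z' \<notin> W"
    and m: "c \<in> miss \<phi> z \<or> d \<in> miss \<phi> z" "c \<in> miss \<phi> z' \<or> d \<in> miss \<phi> z'"
    and K: "kc \<phi> c d z \<inter> W \<noteq> {}" "kc \<phi> c d z' \<inter> W \<noteq> {}"
  shows "z = z'"
proof -
  obtain c0 where c0: "c0 \<in> F" using R_F by blast
  then have c0G: "c0 \<in> \<Gamma>" using R_F by blast
  obtain \<psi> where p0: "permutes_outside \<phi> c c0 \<psi>" using perm_outside[OF S c c0G] by blast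
  note p = permutes_outsideD[OF p0]
  have key: "\<exists>u\<in>W. c0 \<in> miss \<psi> u \<and> x \<in> kc \<psi> c0 d u" if x: "x \<notin> W" "kc \<phi> c d x \<inter> W \<noteq> {}" for x
  proof -
    obtain w where w: "w \<in> W" "(x, w) \<in> (adj_via ends (ab \<phi> c d))\<^sup>*" using x(2) by (auto simp: kc_def)
    obtain p' q' where h: "(p', q') \<in> adj_via ends (ab \<phi> c d)" "p' \<notin> W" "q' \<in> W"
      "(x, p') \<in> (adj_via ends {e\<in>ab \<phi> c d. ends e \<inter> W = {}})\<^sup>*"
      by (rule first_hit[where ends = ends, OF w(2) x(1) w(1)])
    obtain e where e: "e \<in> A" "\<phi> e = c \<or> \<phi> e = d" "ends e = {p', q'}" using h(1) by (auto simp: adj_via_def ab_def)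
    have "\<phi> e \<notin> \<Gamma>" using R_closed[OF S e(1), of q' p'] e(3) h by simp
    then have ed: "\<psi> e = d" using e(2) c p(4)[of e] by auto
    obtain u where u: "u \<in> W" "c0 \<in> miss \<psi> u" "q' \<in> kc \<psi> c0 d u"
      using R_exit[OF p(1) c0 d e(1) ed, of q' p'] e(3) h by auto
    have "e \<in> ab \<psi> c0 d" using e(1) ed by (simp add: ab_def)
    then have p'u: "p' \<in> kc \<psi> c0 d u" using kc_closed[of \<psi> c0 d u] e(3) u(3) unfolding kclosed_def by blast
    have "{e\<in>ab \<phi> c d. ends e \<inter> W = {}} \<subseteq> ab \<psi> c0 d"
    proof
      fix e assume e: "e \<in> {e\<in>ab \<phi> c d. ends e \<inter> W = {}}"
      then have "e \<in> A" "ends e \<inter> W = {}" "\<phi> e = c \<or> \<phi> e = d" by (auto simp: ab_def)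
      then have "\<psi> e = c0 \<or> \<psi> e = d" using p(3)[of e] p(4)[of e] d by auto
      then show "e \<in> ab \<psi> c0 d" using \<open>e \<in> A\<close> by (simp add: ab_def)
    qed
    then have "(x, p') \<in> (adj_via ends (ab \<psi> c0 d))\<^sup>*" using h(4) rtrancl_mono[OF adj_via_mono[where ends = ends]] by blast
    then have "p' \<in> kc \<psi> c0 d x" by (simp add: kc_def)
    then have "x \<in> kc \<psi> c0 d p'" by (rule kc_sym)
    then show ?thesis using u kc_eq[OF p'u] by blast
  qed
  obtain u where u: "u \<in> W" "c0 \<in> miss \<psi> u" "z \<in> kc \<psi> c0 d u" using key[OF z(1) K(1)] by blast
  obtain u' where u': "u' \<in> W" "c0 \<in> miss \<psi> u'" "z' \<in> kc \<psi> c0 d u'" using key[OF z(2) K(2)] by blast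
  have uu: "u' = u" by (rule elemD[OF R_elem[OF p(1)] u'(1) u(1) u'(2) u(2)])
  have cd: "c0 \<noteq> d" using c0G d by blast
  have m': "c0 \<in> miss \<psi> z \<or> d \<in> miss \<psi> z" "c0 \<in> miss \<psi> z' \<or> d \<in> miss \<psi> z'"
    using m p(5)[OF z(1)] p(5)[OF z(2)] p(6)[OF d(2)] by blast+
  show ?thesis
  proof (rule ccontr)
    assume ne: "z \<noteq> z'"
    show False
      by (rule kc_three_ends[OF R_proper[OF p(1)] \<Gamma>_k[OF c0G] d(1) cd u(3) _ kc_self ne])
        (use u' uu u z m' in auto)
  qed
qed

end

section \<open>Leaving a closed root along a colour with two exits\<close>

context closed_root
begin

lemma finite_\<Gamma>: "finite \<Gamma>"
  by (rule finite_subset[of _ "{..<k}"]) (use \<Gamma>_k in auto)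

text \<open>The vertex \<open>y\<close> is where the chain of \<open>c0\<close> and
  \<open>\<delta>\<close> from the vertex missing \<open>c0\<close> leaves \<open>W\<close> for the
  first time. Were a colour of \<open>\<Gamma>\<close> missing at \<open>y\<close>, exchanging it
  with \<open>c0\<close> outside \<open>W\<close> would end the chain there; but both given exits
  have to lie on it. The argument must survive recolouring, so \<open>S1\<close> fixes the edges of
  colours \<open>c0\<close> and \<open>\<delta>\<close> at \<open>W\<close>. This is why
  \<open>\<delta>\<close> becomes protected.\<close>

lemma extend:
  assumes S: "\<phi>0 \<in> S" and \<delta>: "\<delta> < k" "\<delta> \<notin> \<Gamma>"
    and e1: "e1 \<in> A" "\<phi>0 e1 = \<delta>" "p1 \<in> ends e1" "q1 \<in> ends e1" "p1 \<in> W" "q1 \<notin> W"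
    and e2: "e2 \<in> A" "\<phi>0 e2 = \<delta>" "p2 \<in> ends e2" "q2 \<in> ends e2" "p2 \<in> W" "q2 \<notin> W"
    and ne: "e1 \<noteq> e2" and card: "2 * card (insert \<delta> P) + 2 \<le> card \<Gamma>"
    and G: "\<And>d. d \<in> insert \<delta> P \<Longrightarrow> G d \<subseteq> \<Gamma>" "\<And>d. d \<in> insert \<delta> P \<Longrightarrow> card (G d) = 2"
      "\<And>d d' c. d \<in> insert \<delta> P \<Longrightarrow> d' \<in> insert \<delta> P \<Longrightarrow> c \<in> G d \<Longrightarrow> c \<in> G d' \<Longrightarrow> d = d'"
  obtains y S1 where "tail_root A ends k W y \<Gamma> (insert \<delta> P) S1 G" "\<phi>0 \<in> S1" "S1 \<subseteq> S"
proof -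
  obtain c0 where c0: "c0 \<in> F" using R_F by blast
  then have c0G: "c0 \<in> \<Gamma>" using R_F by blast
  have c0k: "c0 < k" by (rule \<Gamma>_k[OF c0G])
  have cd: "c0 \<noteq> \<delta>" using c0G \<delta> by blast
  obtain u0 where u0: "u0 \<in> W" "c0 \<in> miss \<phi>0 u0" using R_missU[OF S] c0G by (auto simp: missU_def)
  have pr0: "proper \<phi>0" by (rule R_proper[OF S])
  define H where "H = {e\<in>ab \<phi>0 c0 \<delta>. ends e \<subseteq> W}"
  have H: "finite H" "\<And>e. e \<in> H \<Longrightarrow> card (ends e) = 2" using finite_ab[of \<phi>0 c0 \<delta>] ab_card2[of _ \<phi>0 c0 \<delta>] by (simp_all add: H_def)
  \<comment> \<open>\<open>C\<close> is the initial segment of the chain from \<open>u0\<close>, as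
    far as it stays inside \<open>W\<close>.\<close>
  define C where "C = (adj_via ends H)\<^sup>* `` {u0}"
  have Ccl: "ends e \<subseteq> C" if "e \<in> H" "ends e \<inter> C \<noteq> {}" for e
    by (rule component_closed[where ends = ends, OF that(1) H(2)[OF that(1)] C_def that(2)])
  have u0C: "u0 \<in> C" by (simp add: C_def)
  have CW: "C \<subseteq> W"
  proof
    fix v assume "v \<in> C"
    then have "(u0, v) \<in> (adj_via ends H)\<^sup>*" by (simp add: C_def)
    then show "v \<in> W" by (induction rule: rtrancl_induct) (use u0 in \<open>auto simp: adj_via_def H_def\<close>)
  qed
  have bnd: "\<phi>0 e = \<delta> \<and> (\<exists>q\<in>ends e. q \<notin> W)" if e: "e \<in> ab \<phi>0 c0 \<delta>" "v \<in> ends e" "v \<in> W" "\<not> ends e \<subseteq> W" for e v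
  proof -
    obtain q where q: "q \<in> ends e" "q \<notin> W" using e(4) by blast
    have "e \<in> A" "\<phi>0 e = c0 \<or> \<phi>0 e = \<delta>" using e(1) by (auto simp: ab_def)
    moreover have "\<phi>0 e \<notin> \<Gamma>" by (rule R_closed[OF S \<open>e \<in> A\<close> e(2) q(1) e(3) q(2)])
    ultimately show ?thesis using q c0G by auto
  qed
  have "\<exists>f\<in>A. \<exists>w\<in>C. \<exists>y. \<phi>0 f = \<delta> \<and> w \<in> ends f \<and> y \<in> ends f \<and> y \<notin> W"
  proof (rule ccontr)
    assume no: "\<not> ?thesis"
    have "kclosed \<phi>0 c0 \<delta> C" unfolding kclosed_def
    proof (intro ballI impI)
      fix e assume e: "e \<in> ab \<phi>0 c0 \<delta>" "ends e \<inter> C \<noteq> {}"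
      then obtain v where v: "v \<in> ends e" "v \<in> C" by blast
      have "ends e \<subseteq> W"
      proof (rule ccontr)
        assume nW: "\<not> ends e \<subseteq> W"
        have "v \<in> W" using v(2) CW by blast
        then have "\<phi>0 e = \<delta> \<and> (\<exists>q\<in>ends e. q \<notin> W)" by (rule bnd[OF e(1) v(1) _ nW])
        moreover have "e \<in> A" using e(1) by (simp add: ab_def)
        ultimately show False using no v by blast
      qed
      then show "ends e \<subseteq> C" using e by (intro Ccl) (simp_all add: H_def)
    qed
    then have K: "kc \<phi>0 c0 \<delta> u0 \<subseteq> C" by (rule kc_min[OF _ u0C])
    obtain u where u: "u \<in> W" "c0 \<in> miss \<phi>0 u" "p1 \<in> kc \<phi>0 c0 \<delta> u"
      using R_exit[OF S c0 \<delta> e1] by blast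
    have "u = u0" by (rule elemD[OF R_elem[OF S] u(1) u0(1) u(2) u0(2)])
    then have "p1 \<in> C" using u K by blast
    then show False using no e1 by blast
  qed
  then obtain f w y where f: "f \<in> A" "\<phi>0 f = \<delta>" "w \<in> ends f" "w \<in> C" "y \<in> ends f" "y \<notin> W" by blast
  have wW: "w \<in> W" using f CW by blast
  have wy: "ends f = {w, y}"
  proof -
    have "w \<noteq> y" using wW f by blast
    then show ?thesis using ends2[OF f(1)] f(3,5) by auto
  qed
  have degab: "deg_in ends (ab \<phi>0 c0 \<delta>) v \<le> 2" for v using deg_ab[OF pr0 c0k \<delta>(1) cd] by simp
  have degH: "deg_in ends H v \<le> deg_in ends (ab \<phi>0 c0 \<delta>) v" for v
    unfolding deg_in_def H_def by (intro card_mono) auto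
  have degH1: "deg_in ends H v < deg_in ends (ab \<phi>0 c0 \<delta>) v"
    if "e \<in> ab \<phi>0 c0 \<delta>" "v \<in> ends e" "\<not> ends e \<subseteq> W" for e v
    unfolding deg_in_def H_def using that by (intro psubset_card_mono) auto
  have fab: "f \<in> ab \<phi>0 c0 \<delta>" "\<not> ends f \<subseteq> W" using f by (auto simp: ab_def)
  \<comment> \<open>The segment already has the ends \<open>u0\<close> and \<open>w\<close>; another
    vertex from which the chain leaves \<open>W\<close> would be a third end.\<close>
  have exit1: "v = w" if v: "v \<in> C" "e \<in> ab \<phi>0 c0 \<delta>" "v \<in> ends e" "\<not> ends e \<subseteq> W" for v e
  proof (rule ccontr)
    assume nvw: "v \<noteq> w"
    have iso: "C = {u0}" if "deg_in ends H u0 = 0"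
    proof -
      have "{e\<in>H. u0 \<in> ends e} = {}" using that H(1) by (simp add: deg_in_def)
      then have "e \<notin> H" if "u0 \<in> ends e" for e using that by blast
      then have "(u0, x) \<notin> adj_via ends H" for x by (auto simp: adj_via_def)
      then show ?thesis unfolding C_def by (auto elim: converse_rtranclE)
    qed
    have d0: "deg_in ends (ab \<phi>0 c0 \<delta>) u0 \<le> 1" using deg_ab[OF pr0 c0k \<delta>(1) cd] u0 by simp
    have nu: "x \<noteq> u0" if x: "x \<in> C" "e' \<in> ab \<phi>0 c0 \<delta>" "x \<in> ends e'" "\<not> ends e' \<subseteq> W" for x e'
    proof
      assume "x = u0"
      then have "deg_in ends H u0 = 0" using degH1[OF x(2,3,4)] d0 by simp
      then have "C = {u0}" by (rule iso)
      then show False using v(1) f(4) nvw by simp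
    qed
    have ds: "deg_in ends H x \<le> 1" if "e' \<in> ab \<phi>0 c0 \<delta>" "x \<in> ends e'" "\<not> ends e' \<subseteq> W" for x e'
      using degH1[OF that] degab[of x] by simp
    show False
    proof (rule component_three_ends[where ends = ends, OF H C_def _ u0C v(1) f(4)])
      show "deg_in ends H x \<le> 2" for x using degH[of x] degab[of x] by simp
      show "u0 \<noteq> v" using nu[OF v] by simp
      show "u0 \<noteq> w" using nu[OF f(4) fab(1) f(3) fab(2)] by simp
      show "v \<noteq> w" by (rule nvw)
      show "deg_in ends H u0 \<le> 1" using degH[of u0] d0 by simp
      show "deg_in ends H v \<le> 1" by (rule ds[OF v(2,3,4)])
      show "deg_in ends H w \<le> 1" by (rule ds[OF fab(1) f(3) fab(2)])
    qed
  qed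
  define S1 where "S1 = {\<phi>\<in>S. \<forall>e\<in>A. ends e \<inter> W \<noteq> {} \<longrightarrow> (\<phi> e = c0 \<longleftrightarrow> \<phi>0 e = c0) \<and> (\<phi> e = \<delta> \<longleftrightarrow> \<phi>0 e = \<delta>)}"
  have S1S: "\<phi> \<in> S" if "\<phi> \<in> S1" for \<phi> using that by (simp add: S1_def)
  have Sy: "miss \<phi> y \<inter> \<Gamma> = {}" if \<phi>: "\<phi> \<in> S1" for \<phi>
  proof (rule ccontr)
    assume "miss \<phi> y \<inter> \<Gamma> \<noteq> {}"
    then obtain c where c: "c \<in> miss \<phi> y" "c \<in> \<Gamma>" by blast
    obtain \<psi> where p0: "permutes_outside \<phi> c c0 \<psi>" using perm_outside[OF S1S[OF \<phi>] c(2) c0G] by blast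
    note p = permutes_outsideD[OF p0]
    have ag: "(\<psi> e = c0 \<longleftrightarrow> \<phi>0 e = c0) \<and> (\<psi> e = \<delta> \<longleftrightarrow> \<phi>0 e = \<delta>)" if "e \<in> A" "ends e \<inter> W \<noteq> {}" for e
      using p(2)[OF that] \<phi> that unfolding S1_def by auto
    have my: "c0 \<in> miss \<psi> y" by (rule p(5)[OF f(6) c(1)])
    have \<psi>f: "\<psi> f = \<delta>" using ag[OF f(1)] f wW by auto
    \<comment> \<open>With \<open>c0\<close> missing at \<open>y\<close>, the segment, the edge
      \<open>f\<close> and \<open>y\<close> are closed under the two colours, so the chain of
      \<open>u0\<close> goes no further.\<close>
    have "kclosed \<psi> c0 \<delta> (insert y C)" unfolding kclosed_def
    proof (intro ballI impI)
      fix e assume e: "e \<in> ab \<psi> c0 \<delta>" "ends e \<inter> insert y C \<noteq> {}"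
      have eA: "e \<in> A" using e(1) by (simp add: ab_def)
      obtain v where v: "v \<in> ends e" "v \<in> insert y C" using e(2) by blast
      show "ends e \<subseteq> insert y C"
      proof (cases "v = y")
        case True
        then have "\<psi> e \<noteq> c0" using missD[OF my eA] v by simp
        then have "\<psi> e = \<psi> f" using e(1) \<psi>f by (auto simp: ab_def)
        then have "e = f" using proper_inj[OF R_proper[OF p(1)] eA f(1) v(1)] f(5) True by simp
        then show ?thesis using wy f(4) by simp
      next
        case False
        then have vC: "v \<in> C" "v \<in> W" using v CW by auto
        have "ends e \<inter> W \<noteq> {}" using vC v by blast
        then have e0: "e \<in> ab \<phi>0 c0 \<delta>" using ag[OF eA] e(1) by (auto simp: ab_def)
        show ?thesis
        proof (cases "ends e \<subseteq> W")
          case True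
          then have "e \<in> H" using e0 by (simp add: H_def)
          moreover have "ends e \<inter> C \<noteq> {}" using v(1) vC(1) by blast
          ultimately show ?thesis using Ccl by blast
        next
          case nW: False
          have vw: "v = w" by (rule exit1[OF vC(1) e0 v(1) nW])
          have "\<phi>0 e = \<phi>0 f" using bnd[OF e0 v(1) vC(2) nW] f(2) by simp
          then have "e = f" using proper_inj[OF pr0 eA f(1) v(1)] f(3) vw by simp
          then show ?thesis using wy f(4) by simp
        qed
      qed
    qed
    then have K: "kc \<psi> c0 \<delta> u0 \<subseteq> insert y C" by (rule kc_min) (simp add: u0C)
    have final: "g = f" if g: "g \<in> A" "\<phi>0 g = \<delta>" "p \<in> ends g" "q \<in> ends g" "p \<in> W" "q \<notin> W" for g p q
    proof -
      have \<psi>g: "\<psi> g = \<delta>" using ag[OF g(1)] g by auto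
      obtain u where u: "u \<in> W" "c0 \<in> miss \<psi> u" "p \<in> kc \<psi> c0 \<delta> u"
        using R_exit[OF p(1) c0 \<delta> g(1) \<psi>g g(3-6)] by blast
      have "c0 \<in> miss \<psi> u0" unfolding miss_def
      proof (intro CollectI conjI ballI impI)
        show "c0 < k" by (rule c0k)
        fix e assume e: "e \<in> A" "u0 \<in> ends e"
        then have "ends e \<inter> W \<noteq> {}" using u0 by blast
        then show "\<psi> e \<noteq> c0" using ag[OF e(1)] missD[OF u0(2) e] by simp
      qed
      then have "u = u0" using elemD[OF R_elem[OF p(1)] u(1) u0(1) u(2)] by blast
      moreover have "g \<in> ab \<psi> c0 \<delta>" using g(1) \<psi>g by (simp add: ab_def)
      ultimately have "q \<in> kc \<psi> c0 \<delta> u0" using kc_closed[of \<psi> c0 \<delta> u0] u(3) g(3,4) unfolding kclosed_def by blast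
      then have "q = y" using K g(6) CW by blast
      then show ?thesis using proper_inj[OF R_proper[OF p(1)] g(1) f(1) g(4)] f(5) \<psi>g \<psi>f by simp
    qed
    show False using final[OF e1] final[OF e2] ne by simp
  qed
  have "tail_root A ends k W y \<Gamma> (insert \<delta> P) S1 G"
  proof unfold_locales
    fix \<phi> a b C' assume a: "\<phi> \<in> S1" "a < k" "b < k" "a \<noteq> b" "kclosed \<phi> a b C'"
      "C' \<inter> W = {} \<or> a \<notin> \<Gamma> \<union> insert \<delta> P \<and> b \<notin> \<Gamma> \<union> insert \<delta> P"
    have "swap \<phi> a b C' \<in> S" using R_swap[OF S1S[OF a(1)] a(2-5)] a(6) by blast
    moreover have "(swap \<phi> a b C' e = c0 \<longleftrightarrow> \<phi>0 e = c0) \<and> (swap \<phi> a b C' e = \<delta> \<longleftrightarrow> \<phi>0 e = \<delta>)"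
      if e: "e \<in> A" "ends e \<inter> W \<noteq> {}" for e
    proof -
      have ag: "(\<phi> e = c0 \<longleftrightarrow> \<phi>0 e = c0) \<and> (\<phi> e = \<delta> \<longleftrightarrow> \<phi>0 e = \<delta>)" using a(1) e by (simp add: S1_def)
      show ?thesis
      proof (cases "C' \<inter> W = {}")
        case True
        have "swap \<phi> a b C' e = \<phi> e"
        proof (cases "\<phi> e = a \<or> \<phi> e = b")
          case ab: True
          have "ends e \<inter> C' = {}"
          proof (rule ccontr)
            assume ne: "ends e \<inter> C' \<noteq> {}"
            have "e \<in> ab \<phi> a b" using e(1) ab by (simp add: ab_def)
            then have "ends e \<subseteq> C'" using a(5) ne unfolding kclosed_def by blast
            then show False using True e(2) by blast
          qed
          then show ?thesis by (rule swap_disj)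
        next
          case False then show ?thesis by (simp add: swap_other)
        qed
        then show ?thesis using ag by simp
      next
        case False
        then have "a \<noteq> c0" "b \<noteq> c0" "a \<noteq> \<delta>" "b \<noteq> \<delta>" using a(6) c0G by auto
        then show ?thesis using ag unfolding swap_def by auto
      qed
    qed
    ultimately show "swap \<phi> a b C' \<in> S1" by (simp add: S1_def)
  next
    fix \<phi> c d z z' assume a: "\<phi> \<in> S1" "c \<in> \<Gamma>" "d < k" "d \<notin> \<Gamma>" "z \<notin> W" "z' \<notin> W"
      "c \<in> miss \<phi> z \<or> d \<in> miss \<phi> z" "c \<in> miss \<phi> z' \<or> d \<in> miss \<phi> z'"
      "kc \<phi> c d z \<inter> W \<noteq> {}" "kc \<phi> c d z' \<inter> W \<noteq> {}"
    show "z = z'" by (rule comp_uniq[OF S1S[OF a(1)] a(2-10)])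
  next
    fix \<phi> e assume a: "\<phi> \<in> S1" "e \<in> A" "ends e \<inter> W \<noteq> {}" "\<not> ends e \<subseteq> W"
    then obtain p q where "p \<in> ends e" "p \<in> W" "q \<in> ends e" "q \<notin> W" by blast
    then show "\<phi> e \<notin> \<Gamma>" using R_closed[OF S1S[OF a(1)] a(2)] by blast
  next
    fix \<phi> assume "\<phi> \<in> S1" then show "miss \<phi> y \<inter> \<Gamma> = {}" by (rule Sy)
  next
    fix \<phi> v assume "\<phi> \<in> S1" then show "miss \<phi> v \<noteq> {}" using R_miss S1S by blast
  next
    show "insert \<delta> P \<inter> \<Gamma> = {}" using R_P \<delta> by blast
  qed (use R_proper R_missU R_elem S1S f(6) R_fin finite_\<Gamma> G card in auto)
  moreover have "\<phi>0 \<in> S1" using S by (simp add: S1_def)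
  ultimately show ?thesis using that S1S by blast
qed

end

section \<open>Stuck tails as new closed roots\<close>

context tail_root
begin

lemma new_root:
  assumes st: "stuck \<phi> T R" and R: "R \<subseteq> \<Gamma>" "2 * card P \<le> card R" and F: "F \<subseteq> \<Gamma>" "F \<inter> R \<noteq> {}"
    and exitF: "\<And>\<phi> c d e p q. \<phi> \<in> S \<Longrightarrow> c \<in> F \<Longrightarrow> d < k \<Longrightarrow> d \<notin> \<Gamma> \<Longrightarrow> e \<in> A \<Longrightarrow> \<phi> e = d \<Longrightarrow> p \<in> ends e \<Longrightarrow> q \<in> ends e \<Longrightarrow>
      p \<in> W \<Longrightarrow> q \<notin> W \<Longrightarrow> \<exists>u\<in>W. c \<in> miss \<phi> u \<and> p \<in> kc \<phi> c d u"
    and closed: "\<And>\<psi> e p q. \<psi> \<in> freeze \<phi> T \<Longrightarrow> e \<in> A \<Longrightarrow> p \<in> ends e \<Longrightarrow> q \<in> ends e \<Longrightarrow> p \<in> X T (length T) \<Longrightarrow>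
      q \<notin> X T (length T) \<Longrightarrow> \<psi> e \<notin> missU \<phi> (X T (length T))"
  shows "closed_root A ends k (X T (length T)) (missU \<phi> (X T (length T))) (P - missU \<phi> (X T (length T))) (freeze \<phi> T) (F \<inter> R)"
proof -
  define V where "V = X T (length T)"
  define \<Gamma>V where "\<Gamma>V = missU \<phi> V"
  have s: "\<phi> \<in> S" "valid \<phi> T" "avoid \<phi> T R" using st by (simp_all add: stuck_def)
  have \<Gamma>V: "\<Gamma> \<subseteq> \<Gamma>V" unfolding \<Gamma>V_def V_def by (rule \<Gamma>_Y[OF s(1)])
  have mU: "missU \<psi> V = \<Gamma>V" if "\<psi> \<in> freeze \<phi> T" for \<psi>
    unfolding \<Gamma>V_def V_def by (rule freeze_missU[OF that]) simp
  have val: "valid \<psi> T" "avoid \<psi> T R" if "\<psi> \<in> freeze \<phi> T" for \<psi>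
    using freeze_valid[OF that s(2)] freeze_avoid[OF that] s(3) by simp_all
  have el: "elem \<psi> V" if "\<psi> \<in> freeze \<phi> T" for \<psi>
    unfolding V_def by (rule elem_avoid[OF freezeD(1)[OF that] val[OF that] R])
  have colV: "\<psi> (E T i) \<in> \<Gamma>V" "ends (E T i) \<subseteq> V" if "\<psi> \<in> freeze \<phi> T" "i < length T" for \<psi> i
    using valid_colour[OF val(1)[OF that(1)] that(2)] mU[OF that(1)] by (simp_all add: V_def)
  have cl: "\<psi> e \<notin> \<Gamma>V" if "\<psi> \<in> freeze \<phi> T" "e \<in> A" "p \<in> ends e" "q \<in> ends e" "p \<in> V" "q \<notin> V" for \<psi> e p q
    using closed that by (simp add: V_def \<Gamma>V_def)
  have "closed_root A ends k V \<Gamma>V (P - \<Gamma>V) (freeze \<phi> T) (F \<inter> R)"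
  proof unfold_locales
    fix \<psi> a b C assume a: "\<psi> \<in> freeze \<phi> T" "a < k" "b < k" "a \<noteq> b" "kclosed \<psi> a b C"
      "C \<inter> V = {} \<or> a \<notin> \<Gamma>V \<union> (P - \<Gamma>V) \<and> b \<notin> \<Gamma>V \<union> (P - \<Gamma>V)"
    have "W \<subseteq> V" by (simp add: V_def W_Y)
    then have "C \<inter> W = {} \<or> a \<notin> \<Gamma> \<union> P \<and> b \<notin> \<Gamma> \<union> P" using a(6) \<Gamma>V by blast
    then have S': "swap \<psi> a b C \<in> S" by (rule S_swap[OF freezeD(1)[OF a(1)] a(2-5)])
    show "swap \<psi> a b C \<in> freeze \<phi> T"
    proof (rule freeze_swapI[OF a(1) S' a(2,3,5)])
      fix u assume u: "u \<in> X T (length T)" "u \<in> C"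
      then have "a \<notin> \<Gamma>V" "b \<notin> \<Gamma>V" using a(6) by (auto simp: V_def)
      then show "a \<notin> miss \<psi> u \<and> b \<notin> miss \<psi> u" using u mU[OF a(1)] by (auto simp: missU_def V_def)
    next
      fix i assume i: "i < length T"
      show "\<psi> (E T i) \<noteq> a \<and> \<psi> (E T i) \<noteq> b \<or> ends (E T i) \<inter> C = {}" using colV[OF a(1) i] a(6) by blast
    qed
  next
    fix \<psi> c d e p q assume a: "\<psi> \<in> freeze \<phi> T" "c \<in> F \<inter> R" "d < k" "d \<notin> \<Gamma>V" "e \<in> A" "\<psi> e = d" "p \<in> ends e" "q \<in> ends e"
      "p \<in> V" "q \<notin> V"
    have psi: "\<psi> \<in> S" by (rule freezeD(1)[OF a(1)])
    have cG: "c \<in> \<Gamma>" "c \<in> \<Gamma>V" using a(2) F \<Gamma>V by blast+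
    have ck: "c < k" by (rule \<Gamma>_k[OF psi cG(1)])
    have cd: "c \<noteq> d" using cG a(4) by blast
    obtain w where w: "w \<in> W" "c \<in> miss \<psi> w" using S_missU[OF psi] cG by (auto simp: missU_def)
    have wV: "w \<in> V" using w W_Y by (auto simp: V_def)
    have "p \<in> kc \<psi> c d w"
    proof (rule ccontr)
      assume np: "p \<notin> kc \<psi> c d w"
      define K where "K = kc \<psi> c d p"
      have cl': "kclosed \<psi> c d K" unfolding K_def by (rule kc_closed)
      have wK: "w \<notin> K" using np kc_sym unfolding K_def by blast
      have pK: "p \<in> K" by (simp add: K_def)
      \<comment> \<open>Coming from outside, \<open>K\<close> could enter \<open>W\<close> only
        through an exit, whose inner end lies on the chain of \<open>w\<close> by
        \<open>exitF\<close>; then \<open>p\<close> would lie on that chain too.\<close>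
      have KW: "K \<inter> W = {}"
      proof (rule ccontr)
        assume "K \<inter> W \<noteq> {}"
        then obtain v where v: "v \<in> K" "v \<in> W" by blast
        have eab: "e \<in> ab \<psi> c d" using a(5,6) by (simp add: ab_def)
        have qK: "q \<in> K" using cl' eab pK a(7,8) unfolding kclosed_def by blast
        have qW: "q \<notin> W" using a(10) W_Y by (auto simp: V_def)
        have "v \<in> kc \<psi> c d q" using v(1) kc_eq[of q \<psi> c d p] qK unfolding K_def by simp
        then have "(q, v) \<in> (adj_via ends (ab \<psi> c d))\<^sup>*" by (simp add: kc_def)
        then obtain p' q' where h: "(p', q') \<in> adj_via ends (ab \<psi> c d)" "p' \<notin> W" "q' \<in> W"
          "(q, p') \<in> (adj_via ends {e\<in>ab \<psi> c d. ends e \<inter> W = {}})\<^sup>*"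
          by (rule first_hit[where ends = ends, OF _ qW v(2)])
        obtain e' where e': "e' \<in> ab \<psi> c d" "ends e' = {p', q'}" using h(1) by (auto simp: adj_via_def)
        have e'A: "e' \<in> A" "\<psi> e' = c \<or> \<psi> e' = d" using e'(1) by (auto simp: ab_def)
        have "\<psi> e' \<notin> \<Gamma>" using S_closed[OF psi e'A(1)] e'(2) h(2,3) by auto
        then have e'd: "\<psi> e' = d" using e'A(2) cG by auto
        obtain u where u: "u \<in> W" "c \<in> miss \<psi> u" "q' \<in> kc \<psi> c d u"
          using exitF[OF psi _ a(3) _ e'A(1) e'd, of c q' p'] a(2,4) \<Gamma>V e'(2) h(2,3) by auto
        have "u = w" by (rule elemD[OF S_elem[OF psi] u(1) w(1) u(2) w(2)])
        then have q'w: "q' \<in> kc \<psi> c d w" using u by simp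
        have "{e\<in>ab \<psi> c d. ends e \<inter> W = {}} \<subseteq> ab \<psi> c d" by blast
        then have "(q, p') \<in> (adj_via ends (ab \<psi> c d))\<^sup>*" using h(4) rtrancl_mono[OF adj_via_mono[where ends = ends]] by blast
        then have "p' \<in> kc \<psi> c d q" by (simp add: kc_def)
        then have "p' \<in> K" using kc_eq[of q \<psi> c d p] qK unfolding K_def by simp
        then have "q' \<in> K" using cl' e' unfolding kclosed_def by blast
        then have "kc \<psi> c d q' = K" unfolding K_def by (rule kc_eq)
        moreover have "kc \<psi> c d q' = kc \<psi> c d w" by (rule kc_eq[OF q'w])
        ultimately show False using pK np by simp
      qed
      have mK: "c \<notin> miss \<psi> u \<and> d \<notin> miss \<psi> u" if u: "u \<in> V" "u \<in> K" for u
      proof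
        show "c \<notin> miss \<psi> u" using elemD[OF el[OF a(1)] u(1) wV _ w(2)] u(2) wK by blast
        show "d \<notin> miss \<psi> u" using mU[OF a(1)] u(1) a(4) by (auto simp: missU_def)
      qed
      have S': "swap \<psi> c d K \<in> S" using KW by (intro S_swap[OF psi ck a(3) cd cl']) simp
      have "swap \<psi> c d K \<in> freeze \<phi> T"
      proof (rule freeze_swapI[OF a(1) S' ck a(3) cl'])
        fix u assume "u \<in> X T (length T)" "u \<in> K"
        then show "c \<notin> miss \<psi> u \<and> d \<notin> miss \<psi> u" using mK by (simp add: V_def)
      next
        fix i assume i: "i < length T"
        have "\<psi> (E T i) \<notin> R" using val(2)[OF a(1)] i by (simp add: avoid_def)
        then have "\<psi> (E T i) \<noteq> c" using a(2) by blast
        moreover have "\<psi> (E T i) \<noteq> d" using colV(1)[OF a(1) i] a(4) by blast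
        ultimately show "\<psi> (E T i) \<noteq> c \<and> \<psi> (E T i) \<noteq> d \<or> ends (E T i) \<inter> K = {}" by blast
      qed
      then have "swap \<psi> c d K e \<notin> \<Gamma>V" by (rule cl[OF _ a(5,7,8,9,10)])
      moreover have "swap \<psi> c d K e = c" using a(5,6,7) pK cd unfolding swap_def by auto
      ultimately show False using cG by simp
    qed
    then show "\<exists>u\<in>V. c \<in> miss \<psi> u \<and> p \<in> kc \<psi> c d u" using w wV by blast
  next
    fix \<psi> assume "\<psi> \<in> freeze \<phi> T" then show "proper \<psi>" using freezeD(1) S_proper by blast
  next
    show "F \<inter> R \<subseteq> \<Gamma>V" using F \<Gamma>V by blast
    show "F \<inter> R \<noteq> {}" by (rule F(2))
    show "freeze \<phi> T \<noteq> {}" using freeze_self[OF s(1)] by blast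
    show "finite V" by (simp add: V_def)
    show "finite (P - \<Gamma>V)" using fin_P by simp
    show "(P - \<Gamma>V) \<inter> \<Gamma>V = {}" by blast
  next
    fix \<psi> v assume "\<psi> \<in> freeze \<phi> T" then show "miss \<psi> v \<noteq> {}" using freezeD(1) S_miss by blast
  qed (fact mU el cl)+
  then show ?thesis unfolding V_def \<Gamma>V_def .
qed

end

section \<open>Colourings missing one edge\<close>

lemma odd_gap: "odd (a::nat) \<Longrightarrow> odd b \<Longrightarrow> a < b \<Longrightarrow> a + 2 \<le> b"
  by presburger

text \<open>Within \<open>H'\<close> the component is a path with the ends \<open>u\<close> and
  \<open>z\<close>. An edge of \<open>H\<close> missing from \<open>H'\<close> but touching the
  component would make a third vertex of degree at most 1.\<close>

lemma two_ends_component: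
  assumes H: "finite H" "\<And>e. e \<in> H \<Longrightarrow> card (ends e) = 2" and sub: "H' \<subseteq> H"
    and C: "C = (adj_via ends H')\<^sup>* `` {u}" and z: "z \<in> C" "z \<noteq> u"
    and d2: "\<And>v. deg_in ends H v \<le> 2" and d1: "deg_in ends H u \<le> 1" "deg_in ends H z \<le> 1"
    and e: "e \<in> H" "ends e \<inter> C \<noteq> {}"
  shows "e \<in> H'"
proof (rule ccontr)
  assume nH: "e \<notin> H'"
  have H': "finite H'" "\<And>e. e \<in> H' \<Longrightarrow> card (ends e) = 2" using H sub finite_subset by auto
  have uC: "u \<in> C" using C by simp
  have le: "deg_in ends H' v \<le> deg_in ends H v" for v
    unfolding deg_in_def using sub H(1) by (intro card_mono) auto
  have less: "deg_in ends H' v < deg_in ends H v" if "v \<in> ends e" for v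
    unfolding deg_in_def using sub H(1) e(1) nH that by (intro psubset_card_mono) auto
  have iso: "deg_in ends H' v \<noteq> 0" if v: "v \<in> C" for v
  proof
    assume "deg_in ends H' v = 0"
    then have "{e\<in>H'. v \<in> ends e} = {}" using H'(1) by (simp add: deg_in_def)
    then have no: "(v, w) \<notin> adj_via ends H'" for w by (auto simp: adj_via_def)
    obtain w where w: "w \<in> C" "w \<noteq> v" using z uC by metis
    have "(u, v) \<in> (adj_via ends H')\<^sup>*" "(u, w) \<in> (adj_via ends H')\<^sup>*" using v w(1) C by simp_all
    then have "(v, w) \<in> (adj_via ends H')\<^sup>*" using adj_via_rtrancl_sym[where ends = ends] rtrancl_trans by metis
    then show False using no w(2) by (auto elim: converse_rtranclE)
  qed
  obtain t where t: "t \<in> ends e" "t \<in> C" using e(2) by blast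
  have tu: "t \<noteq> u" using less[OF t(1)] iso[OF t(2)] d1(1) by auto
  have tz: "t \<noteq> z" using less[OF t(1)] iso[OF t(2)] d1(2) by auto
  show False
  proof (rule component_three_ends[where ends = ends, OF H' C _ uC z(1) t(2)])
    show "deg_in ends H' v \<le> 2" for v using le[of v] d2[of v] by simp
    show "u \<noteq> z" "u \<noteq> t" "z \<noteq> t" using z tu tz by simp_all
    show "deg_in ends H' u \<le> 1" "deg_in ends H' z \<le> 1" using le[of u] le[of z] d1 by simp_all
    show "deg_in ends H' t \<le> 1" using less[OF t(1)] d2[of t] by simp
  qed
qed

section \<open>Vertex closures of an edge with a restricted palette\<close>

context mgraph
begin

text \<open>With \<open>C = UNIV\<close> this is the usual vertex-Tashkinov closure of the edge
  \<open>xy\<close>. Restricting the colours of the edges used, though not the missing colours,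
  shows which colours the closure can do without.\<close>

inductive_set clo :: "('e \<Rightarrow> nat) \<Rightarrow> 'a \<Rightarrow> 'a \<Rightarrow> nat set \<Rightarrow> 'a set"
  for \<phi> :: "'e \<Rightarrow> nat" and x y :: 'a and C :: "nat set" where
  clo_x: "x \<in> clo \<phi> x y C"
| clo_y: "y \<in> clo \<phi> x y C"
| clo_step: "u \<in> clo \<phi> x y C \<Longrightarrow> w \<in> clo \<phi> x y C \<Longrightarrow> g \<in> A \<Longrightarrow> u \<in> ends g \<Longrightarrow> v \<in> ends g \<Longrightarrow>
    \<phi> g \<in> miss \<phi> w \<Longrightarrow> \<phi> g \<in> C \<Longrightarrow> v \<in> clo \<phi> x y C"

lemma clo_mono: assumes "C \<subseteq> C'" shows "clo \<phi> x y C \<subseteq> clo \<phi> x y C'"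
proof
  fix v assume "v \<in> clo \<phi> x y C"
  then show "v \<in> clo \<phi> x y C'"
    by (induction rule: clo.induct) (use assms in \<open>blast intro: clo_x clo_y clo_step\<close>)+
qed

lemma clo_closed:
  assumes "g \<in> A" "p \<in> ends g" "q \<in> ends g" "p \<in> clo \<phi> x y C" "q \<notin> clo \<phi> x y C" "\<phi> g \<in> missU \<phi> (clo \<phi> x y C)"
  shows "\<phi> g \<notin> C"
proof
  assume "\<phi> g \<in> C"
  obtain w where "w \<in> clo \<phi> x y C" "\<phi> g \<in> miss \<phi> w" using assms(6) by (auto simp: missU_def)
  then show False using clo_step[OF assms(4) _ assms(1,2,3) _ \<open>\<phi> g \<in> C\<close>] assms(5) by blast
qed

lemma clo_least:
  assumes "x \<in> X" "y \<in> X"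
    and "\<And>g p q. g \<in> A \<Longrightarrow> p \<in> ends g \<Longrightarrow> q \<in> ends g \<Longrightarrow> p \<in> X \<Longrightarrow> q \<notin> X \<Longrightarrow> \<phi> g \<in> missU \<phi> X \<Longrightarrow> \<phi> g \<notin> C"
  shows "clo \<phi> x y C \<subseteq> X"
proof
  fix v assume "v \<in> clo \<phi> x y C"
  then show "v \<in> X"
  proof (induction rule: clo.induct)
    case (clo_step u w g v)
    then have "\<phi> g \<in> missU \<phi> X" by (auto simp: missU_def)
    then show ?case using assms(3)[of g u v] clo_step by blast
  qed (use assms in auto)
qed

lemma clo_exit:
  assumes "clo \<phi> x y C \<noteq> clo \<phi> x y UNIV"
  obtains g p q where "g \<in> A" "p \<in> ends g" "q \<in> ends g" "p \<in> clo \<phi> x y C" "q \<notin> clo \<phi> x y C"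
    "\<phi> g \<in> missU \<phi> (clo \<phi> x y C)" "\<phi> g \<notin> C"
proof -
  have "\<not> clo \<phi> x y UNIV \<subseteq> clo \<phi> x y C" using assms clo_mono[of C UNIV \<phi> x y] by blast
  then have "\<exists>g p q. g \<in> A \<and> p \<in> ends g \<and> q \<in> ends g \<and> p \<in> clo \<phi> x y C \<and> q \<notin> clo \<phi> x y C \<and> \<phi> g \<in> missU \<phi> (clo \<phi> x y C)"
    using clo_least[of x "clo \<phi> x y C" y \<phi> UNIV] clo_x clo_y by blast
  then obtain g p q where g: "g \<in> A" "p \<in> ends g" "q \<in> ends g" "p \<in> clo \<phi> x y C" "q \<notin> clo \<phi> x y C"
    "\<phi> g \<in> missU \<phi> (clo \<phi> x y C)" by blast
  show ?thesis by (rule that[OF g clo_closed[OF g]])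
qed

end

section \<open>One uncoloured edge: the ordinary Tashkinov theorem\<close>

locale dgraph =
  fixes Es :: "'e set" and ends :: "'e \<Rightarrow> 'a set" and k s \<mu> :: nat
  assumes finEs: "finite Es" and Es2: "e \<in> Es \<Longrightarrow> card (ends e) = 2" and s1: "1 \<le> s"
    and degs: "card {e\<in>Es. v \<in> ends e} + s \<le> k"
    and mult: "u \<noteq> v \<Longrightarrow> card {e\<in>Es. ends e = {u, v}} \<le> \<mu>"
    and notcol: "\<not> proper_edge_colouring Es ends k \<phi>"

locale config = dgraph Es ends k s \<mu>
  for Es :: "'e set" and ends :: "'e \<Rightarrow> 'a set" and k s \<mu> :: nat +
  fixes e :: 'e and \<phi> :: "'e \<Rightarrow> nat" and x y :: 'a
  assumes eEs: "e \<in> Es" and pr: "proper_edge_colouring (Es - {e}) ends k \<phi>" and exy: "ends e = {x, y}"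
begin

sublocale mgraph "Es - {e}" ends k
  by unfold_locales (use finEs Es2 in auto)

lemma xy: "x \<noteq> y" using Es2[OF eEs] exy by auto

lemma mult': "u \<noteq> v \<Longrightarrow> card {e'\<in>Es - {e}. ends e' = {u, v}} \<le> \<mu>"
proof -
  assume "u \<noteq> v"
  then have "card {e'\<in>Es. ends e' = {u, v}} \<le> \<mu>" by (rule mult)
  moreover have "card {e'\<in>Es - {e}. ends e' = {u, v}} \<le> card {e'\<in>Es. ends e' = {u, v}}"
    using finEs by (intro card_mono) auto
  ultimately show ?thesis by simp
qed

lemma card_miss:
  assumes "proper \<psi>" shows "card (miss \<psi> v) + card {e'\<in>Es - {e}. v \<in> ends e'} = k"
proof -
  let ?D = "{e'\<in>Es - {e}. v \<in> ends e'}"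
  have "inj_on \<psi> ?D" using proper_inj[OF assms] by (intro inj_onI) blast
  then have 1: "card (\<psi> ` ?D) = card ?D" by (rule card_image)
  have 2: "\<psi> ` ?D \<subseteq> {..<k}" using proper_lt[OF assms] by auto
  have "miss \<psi> v = {..<k} - \<psi> ` ?D" by (auto simp: miss_def)
  then have "card (miss \<psi> v) = k - card (\<psi> ` ?D)" using 2 finEs by (simp add: card_Diff_subset)
  moreover have "card (\<psi> ` ?D) \<le> k" using card_mono[OF _ 2] by simp
  ultimately show ?thesis using 1 by simp
qed

lemma miss_s: "proper \<psi> \<Longrightarrow> s \<le> card (miss \<psi> v)"
proof -
  assume p: "proper \<psi>"
  have "card {e'\<in>Es - {e}. v \<in> ends e'} \<le> card {e'\<in>Es. v \<in> ends e'}" using finEs by (intro card_mono) auto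
  then show ?thesis using card_miss[OF p, of v] degs[of v] by simp
qed

lemma miss_s1: assumes p: "proper \<psi>" and v: "v \<in> {x, y}" shows "s + 1 \<le> card (miss \<psi> v)"
proof -
  have "{e'\<in>Es. v \<in> ends e'} = insert e {e'\<in>Es - {e}. v \<in> ends e'}" using eEs exy v by auto
  then have "card {e'\<in>Es. v \<in> ends e'} = Suc (card {e'\<in>Es - {e}. v \<in> ends e'})" using finEs by simp
  then show ?thesis using card_miss[OF p, of v] degs[of v] by simp
qed

lemma miss_ne: "proper \<psi> \<Longrightarrow> miss \<psi> v \<noteq> {}"
  using miss_s[of \<psi> v] s1 by fastforce

text \<open>Every vertex misses at least \<open>s\<close> colours, and each end of the uncoloured
  edge one more. The second bound discards \<open>v\<close>, together with the extra colour if
  \<open>v\<close> is such an end.\<close>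

lemma card_missU_ge:
  assumes p: "proper \<psi>" and X: "finite X" "elem \<psi> X" "x \<in> X" "y \<in> X"
  shows "card X * s + 2 \<le> card (missU \<psi> X)"
    and "v \<in> X \<Longrightarrow> (card X - 1) * s + (if v \<in> {x, y} then 1 else 2) \<le> card (missU \<psi> X - miss \<psi> v)"
proof -
  define m where "m u = (if u \<in> {x, y} then s + 1 else s)" for u
  have m: "m u \<le> card (miss \<psi> u)" for u using miss_s[OF p] miss_s1[OF p] by (simp add: m_def)
  have sm: "(\<Sum>u\<in>Y. m u) = card Y * s + card (Y \<inter> {x, y})" if "finite Y" for Y
  proof -
    have "(\<Sum>u\<in>Y. m u) = (\<Sum>u\<in>Y. s + (if u \<in> {x, y} then 1 else 0))" by (intro sum.cong refl) (simp add: m_def)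
    also have "\<dots> = card Y * s + card (Y \<inter> {x, y})" using that by (simp add: sum.distrib sum.If_cases Int_def conj_commute)
    finally show ?thesis .
  qed
  have "card X * s + card (X \<inter> {x, y}) \<le> card (missU \<psi> X)"
    using sm[OF X(1)] card_missU[OF X(1,2)] m sum_mono[of X m "\<lambda>u. card (miss \<psi> u)"] by simp
  moreover have "X \<inter> {x, y} = {x, y}" using X by blast
  ultimately show "card X * s + 2 \<le> card (missU \<psi> X)" using xy by simp
  assume v: "v \<in> X"
  have fX: "finite (X - {v})" using X by simp
  have el: "elem \<psi> (X - {v})" by (rule elem_mono[OF X(2)]) simp
  have "missU \<psi> (X - {v}) \<subseteq> missU \<psi> X - miss \<psi> v"
    using X(2) v unfolding elem_def missU_def by blast
  then have "card (missU \<psi> (X - {v})) \<le> card (missU \<psi> X - miss \<psi> v)" by (intro card_mono) auto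
  moreover have "card (X - {v}) * s + card ((X - {v}) \<inter> {x, y}) \<le> card (missU \<psi> (X - {v}))"
    using sm[OF fX] card_missU[OF fX el] m sum_mono[of "X - {v}" m "\<lambda>u. card (miss \<psi> u)"] by simp
  moreover have "card (X - {v}) = card X - 1" using v X by simp
  moreover have "card ((X - {v}) \<inter> {x, y}) = (if v \<in> {x, y} then 1 else 2)"
  proof -
    have "(X - {v}) \<inter> {x, y} = {x, y} - {v}" using X by blast
    then show ?thesis using xy by auto
  qed
  ultimately show "(card X - 1) * s + (if v \<in> {x, y} then 1 else 2) \<le> card (missU \<psi> X - miss \<psi> v)" by simp
qed

lemma no_common: assumes p: "proper \<psi>" shows "miss \<psi> y \<inter> miss \<psi> x = {}"
proof (rule ccontr)
  assume "miss \<psi> y \<inter> miss \<psi> x \<noteq> {}"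
  then obtain c where c: "c \<in> miss \<psi> y" "c \<in> miss \<psi> x" by blast
  have "proper_edge_colouring Es ends k (\<psi>(e := c))" unfolding proper_edge_colouring_def
  proof (intro conjI ballI impI)
    fix g assume "g \<in> Es" then show "(\<psi>(e := c)) g < k" using proper_lt[OF p] miss_lt[OF c(1)] by auto
  next
    fix g h assume gh: "g \<in> Es" "h \<in> Es" "g \<noteq> h \<and> ends g \<inter> ends h \<noteq> {}"
    have ec: "\<psi> g \<noteq> c" if g: "g \<in> Es" "g \<noteq> e" "ends g \<inter> ends e \<noteq> {}" for g
    proof -
      have "x \<in> ends g \<or> y \<in> ends g" using g(3) exy by auto
      then show ?thesis using missD[OF c(1), of g] missD[OF c(2), of g] g by blast
    qed
    show "(\<psi>(e := c)) g \<noteq> (\<psi>(e := c)) h"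
    proof (cases "g = e \<or> h = e")
      case True
      then show ?thesis using gh ec[of g] ec[of h] by auto
    next
      case False
      then show ?thesis using p gh unfolding proper_edge_colouring_def by auto
    qed
  qed
  then show False using notcol by blast
qed

definition S0 :: "('e \<Rightarrow> nat) set" where "S0 = {\<psi>. proper \<psi> \<and> miss \<psi> x = miss \<phi> x}"

text \<open>With a one-vertex root and no protected colours the tail theorem becomes the usual
  Tashkinov theorem: \<open>cls\<close> is void, and \<open>S_uniq\<close> holds because
  \<open>x\<close> is one end of the chain.\<close>

sublocale t: tail_root "Es - {e}" ends k "{x}" y "miss \<phi> x" "{}" S0 "\<lambda>_. {}"
proof unfold_locales
  fix \<psi> a b C assume a: "\<psi> \<in> S0" "a < k" "b < k" "a \<noteq> b" "kclosed \<psi> a b C"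
    "C \<inter> {x} = {} \<or> a \<notin> miss \<phi> x \<union> {} \<and> b \<notin> miss \<phi> x \<union> {}"
  have "miss (swap \<psi> a b C) x = miss \<psi> x"
  proof (cases "x \<in> C")
    case True
    then show ?thesis using a by (intro miss_swap_neither[OF a(5,2,3)]) (auto simp: S0_def)
  next
    case False then show ?thesis by (rule miss_swap_out[OF a(5)])
  qed
  then show "swap \<psi> a b C \<in> S0" using a(1) swap_proper[OF _ a(2,3,5)] by (simp add: S0_def)
next
  fix \<psi> c d z z' assume a: "\<psi> \<in> S0" "c \<in> miss \<phi> x" "d < k" "d \<notin> miss \<phi> x" "z \<notin> {x}" "z' \<notin> {x}"
    "c \<in> miss \<psi> z \<or> d \<in> miss \<psi> z" "c \<in> miss \<psi> z' \<or> d \<in> miss \<psi> z'"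
    "kc \<psi> c d z \<inter> {x} \<noteq> {}" "kc \<psi> c d z' \<inter> {x} \<noteq> {}"
  have p: "proper \<psi>" "c \<in> miss \<psi> x" using a by (simp_all add: S0_def)
  have "x \<in> kc \<psi> c d z" "x \<in> kc \<psi> c d z'" using a by auto
  then have zz: "z \<in> kc \<psi> c d x" "z' \<in> kc \<psi> c d x" using kc_sym by blast+
  have cd: "c \<noteq> d" using a by auto
  show "z = z'"
  proof (rule ccontr)
    assume ne: "z \<noteq> z'"
    show False
      by (rule kc_three_ends[OF p(1) miss_lt[OF p(2)] a(3) cd zz kc_self ne]) (use a p in auto)
  qed
next
  fix \<psi> assume "\<psi> \<in> S0" then show "missU \<psi> {x} = miss \<phi> x" by (simp add: S0_def missU_def)
next
  fix \<psi> assume "\<psi> \<in> S0" then show "miss \<psi> y \<inter> miss \<phi> x = {}" using no_common[of \<psi>] by (simp add: S0_def)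
next
  fix \<psi> g assume a: "\<psi> \<in> S0" "g \<in> Es - {e}" "ends g \<inter> {x} \<noteq> {}" "\<not> ends g \<subseteq> {x}"
  then show "\<psi> g \<notin> miss \<phi> x" using missD[of "\<psi> g" \<psi> x g] by (auto simp: S0_def)
next
  show "2 * card ({}::nat set) + 2 \<le> card (miss \<phi> x)" using miss_s1[OF pr, of x] s1 by simp
next
  fix \<psi> v assume "\<psi> \<in> S0" then show "miss \<psi> v \<noteq> {}" using miss_ne by (simp add: S0_def)
qed (use xy in \<open>auto simp: S0_def elem_def\<close>)

lemma \<phi>S0: "\<phi> \<in> S0" using pr by (simp add: S0_def)

lemma valid_elem: "t.valid \<phi> T \<Longrightarrow> elem \<phi> (t.Y T (Suc (length T)))"
  by (rule t.tail_elem[OF \<phi>S0]) (auto simp: t.cls_def)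

lemma valid_clo:
  assumes "t.valid \<phi> T" "\<And>i. i < length T \<Longrightarrow> \<phi> (t.E T i) \<in> C"
  shows "t.Y T (Suc (length T)) \<subseteq> clo \<phi> x y C"
proof -
    have "t.Y T (Suc i) \<subseteq> clo \<phi> x y C" if "i \<le> length T" for i
      using that
    proof (induction i)
      case 0
      have "t.Y T (Suc 0) = {y, x}" by (simp add: t.Y_Suc)
      then show ?case using clo_x[of x \<phi> y C] clo_y[of y \<phi> x C] by simp
    next
      case (Suc i)
      then have IH: "t.Y T (Suc i) \<subseteq> clo \<phi> x y C" and i: "i < length T" by simp_all
      obtain u where u: "u \<in> t.Y T (Suc i)" "ends (t.E T i) = {u, t.Z T (Suc i)}" using t.valid_E(2)[OF assms(1) i] by blast
      obtain w where w: "w \<in> t.Y T (Suc i)" "\<phi> (t.E T i) \<in> miss \<phi> w" using t.valid_E(3)[OF assms(1) i] by (auto simp: missU_def)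
      have "t.Z T (Suc i) \<in> clo \<phi> x y C"
      proof (rule clo_step)
        show "u \<in> clo \<phi> x y C" "w \<in> clo \<phi> x y C" using u w IH by blast+
        show "t.E T i \<in> Es - {e}" by (rule t.valid_E(1)[OF assms(1) i])
        show "u \<in> ends (t.E T i)" "t.Z T (Suc i) \<in> ends (t.E T i)" using u by simp_all
        show "\<phi> (t.E T i) \<in> miss \<phi> w" by (rule w(2))
        show "\<phi> (t.E T i) \<in> C" using assms(2) i by blast
      qed
      then show ?case unfolding t.Y_Suc[of T "Suc i"] using IH by blast
    qed
    then show ?thesis by blast
  qed

text \<open>A longest tail with colours in \<open>C\<close> cannot be extended, so its vertex set is
  closed and contains the closure; the converse inclusion follows along the tail.\<close>

lemma clo_tail:
  obtains T where "t.valid \<phi> T" "t.Y T (Suc (length T)) = clo \<phi> x y C" "\<And>i. i < length T \<Longrightarrow> \<phi> (t.E T i) \<in> C"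
proof -
  define Q where "Q n \<longleftrightarrow> (\<exists>T. t.valid \<phi> T \<and> (\<forall>i<length T. \<phi> (t.E T i) \<in> C) \<and> length T = n)" for n
  have v0: "t.valid \<phi> []" using xy by (simp add: t.valid_def)
  then have "Q 0" by (auto simp: Q_def)
  moreover have "n \<le> card (\<Union>(ends ` (Es - {e})))" if q: "Q n" for n
    using q t.length_le unfolding Q_def by blast
  ultimately obtain n where n: "Q n" "\<And>m. Q m \<Longrightarrow> m \<le> n"
    using GreatestI_nat[of Q 0 "card (\<Union>(ends ` (Es - {e})))"] Greatest_le_nat[of Q _ "card (\<Union>(ends ` (Es - {e})))"] by blast
  then obtain T where T: "t.valid \<phi> T" "\<forall>i<length T. \<phi> (t.E T i) \<in> C" "length T = n" unfolding Q_def by blast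
  let ?X = "t.Y T (Suc (length T))"
  have xX: "x \<in> ?X" "y \<in> ?X" using t.W_Y[of T "Suc (length T)"] t.Z_in_Y[of 0 "Suc (length T)" T] by auto
  have "clo \<phi> x y C \<subseteq> ?X"
  proof (rule clo_least[OF xX], rule notI)
    fix g p q assume g: "g \<in> Es - {e}" "p \<in> ends g" "q \<in> ends g" "p \<in> ?X" "q \<notin> ?X" "\<phi> g \<in> missU \<phi> ?X" "\<phi> g \<in> C"
    have "t.valid \<phi> (T @ [(g, q)])" by (rule t.valid_snoc[OF T(1) g(1-6)])
    moreover have "\<forall>i<length (T @ [(g, q)]). \<phi> (t.E (T @ [(g, q)]) i) \<in> C"
      using T(2) g(7) by (auto simp: nth_append less_Suc_eq)
    ultimately have "Q (Suc n)" unfolding Q_def using T(3) by (intro exI[of _ "T @ [(g, q)]"]) simp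
    then show False using n(2) by fastforce
  qed
  moreover have "?X \<subseteq> clo \<phi> x y C" using T by (intro valid_clo) auto
  ultimately show ?thesis using that[OF T(1)] T(2) by blast
qed

abbreviation cl :: "nat set \<Rightarrow> 'a set" where "cl C \<equiv> clo \<phi> x y C"

lemma cl_props: "elem \<phi> (cl C)" "finite (cl C)" "x \<in> cl C" "y \<in> cl C"
proof -
  obtain T where T: "t.valid \<phi> T" "t.Y T (Suc (length T)) = cl C" by (rule clo_tail[of C]) blast
  show "elem \<phi> (cl C)" using valid_elem[OF T(1)] T(2) by simp
  show "finite (cl C)" using t.finite_Y[of T "Suc (length T)"] T(2) by simp
qed (rule clo_x, rule clo_y)

lemma cl_odd:
  assumes "c \<in> missU \<phi> (cl C)" "c \<in> C" shows "odd (card (cl C))"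
proof (rule odd_closed[OF pr cl_props(2,1) assms(1)])
  fix g p q assume g: "g \<in> Es - {e}" "p \<in> ends g" "q \<in> ends g" "p \<in> cl C" "q \<notin> cl C"
  show "\<phi> g \<noteq> c" using clo_closed[OF g] assms by blast
qed

lemma few_colours:
  obtains U where "cl U = cl UNIV" "U \<subseteq> missU \<phi> (cl UNIV)" "2 * card U + 1 \<le> card (cl UNIV)"
proof -
  define Q where "Q n \<longleftrightarrow> (\<exists>U. U \<subseteq> missU \<phi> (cl U) \<and> 2 * card U + 1 \<le> card (cl U) \<and> card U = n)" for n
  have fin: "finite U" if "U \<subseteq> missU \<phi> (cl U)" for U using that finite_missU finite_subset by blast
  have c2: "2 \<le> card (cl U)" for U
  proof -
    have "{x, y} \<subseteq> cl U" using cl_props(3,4) by blast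
    then have "card {x, y} \<le> card (cl U)" by (intro card_mono cl_props(2))
    then show ?thesis using xy by simp
  qed
  have "1 \<le> card (cl {})" using c2[of "{}"] by linarith
  then have "Q 0" unfolding Q_def by (intro exI[of _ "{}"]) simp
  moreover have "n \<le> k" if q: "Q n" for n
  proof -
    obtain U where U: "U \<subseteq> missU \<phi> (cl U)" "card U = n" using q unfolding Q_def by blast
    have "U \<subseteq> {..<k}" using U(1) by (auto simp: missU_def dest: miss_lt)
    then show ?thesis using card_mono[of "{..<k}" U] U(2) by simp
  qed
  ultimately obtain n where n: "Q n" "\<And>m. Q m \<Longrightarrow> m \<le> n"
    using GreatestI_nat[of Q 0 k] Greatest_le_nat[of Q _ k] by blast
  then obtain U where U: "U \<subseteq> missU \<phi> (cl U)" "2 * card U + 1 \<le> card (cl U)" "card U = n" unfolding Q_def by blast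
  have "cl U = cl UNIV"
  proof (rule ccontr)
    assume "cl U \<noteq> cl UNIV"
    then obtain g p q where g: "g \<in> Es - {e}" "p \<in> ends g" "q \<in> ends g" "p \<in> cl U" "q \<notin> cl U"
      "\<phi> g \<in> missU \<phi> (cl U)" "\<phi> g \<notin> U" by (rule clo_exit)
    define U' where "U' = insert (\<phi> g) U"
    have cU: "card U' = Suc (card U)" using g(7) fin[OF U(1)] by (simp add: U'_def)
    have sub: "cl U \<subseteq> cl U'" unfolding U'_def by (rule clo_mono) blast
    have mU: "missU \<phi> (cl U) \<subseteq> missU \<phi> (cl U')" by (rule missU_mono[OF sub])
    have "q \<in> cl U'"
    proof (rule ccontr)
      assume "q \<notin> cl U'"
      then show False using clo_closed[OF g(1,2,3), of \<phi> x y U'] g(4,6) sub mU by (auto simp: U'_def)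
    qed
    then have "cl U \<subset> cl U'" using sub g(5) by blast
    then have lt: "card (cl U) < card (cl U')" by (intro psubset_card_mono cl_props(2))
    have o': "odd (card (cl U'))" using cl_odd[of "\<phi> g" U'] g(6) mU by (auto simp: U'_def)
    have "2 * card U' + 1 \<le> card (cl U')"
    proof (cases "U = {}")
      case True
      then show ?thesis using cU lt c2[of U] by simp
    next
      case False
      then obtain c where "c \<in> U" by blast
      then have "odd (card (cl U))" using cl_odd[of c U] U(1) by blast
      then have "card (cl U) + 2 \<le> card (cl U')" using odd_gap lt o' by blast
      then show ?thesis using cU U(2) by simp
    qed
    moreover have "U' \<subseteq> missU \<phi> (cl U')" using U(1) mU g(6) by (auto simp: U'_def)
    ultimately have "Q (Suc n)" unfolding Q_def using cU U(3) by (intro exI[of _ U']) simp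
    then show False using n(2) by fastforce
  qed
  then show ?thesis using that U by metis
qed

end

text \<open>Sizes of nested closures while the colours missing at an exit vertex are given back one
  at a time. The offset \<open>\<epsilon>\<close> counts the extra missing colours at those ends of
  the uncoloured edge that differ from the exit vertex.\<close>

definition chain :: "nat \<Rightarrow> nat \<Rightarrow> nat \<Rightarrow> nat \<Rightarrow> nat \<Rightarrow> nat \<Rightarrow> bool" where
  "chain s \<mu> \<epsilon> q a0 n \<longleftrightarrow> (\<exists>a. a0 \<le> a 0 \<and> (\<forall>i\<le>q. odd (a i)) \<and>
     (\<forall>i<q. a i < a (Suc i) \<and> (a i - 1) * s + \<epsilon> \<le> \<mu> * (a (Suc i) - a i - 1)) \<and> a q \<le> n)"

section \<open>Exit vertices\<close>

context mgraph
begin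

text \<open>The \<open>(c, \<delta>)\<close>-path from \<open>z\<close> runs outside \<open>W\<close> until it enters \<open>W\<close> at \<open>v\<close>,
  and \<open>v\<close> is not the only exit of colour \<open>\<delta>\<close>.\<close>

definition exit_at :: "('e \<Rightarrow> nat) \<Rightarrow> 'a set \<Rightarrow> nat set \<Rightarrow> 'a \<Rightarrow> bool" where
  "exit_at \<phi> W \<Gamma> v \<longleftrightarrow> (\<exists>\<delta> c z p g g' p' q'. \<delta> < k \<and> \<delta> \<notin> \<Gamma> \<and> c \<in> \<Gamma> \<and> z \<notin> W \<and> (c \<in> miss \<phi> z \<or> \<delta> \<in> miss \<phi> z) \<and>
     (z, p) \<in> (adj_via ends {h\<in>ab \<phi> c \<delta>. ends h \<inter> W = {}})\<^sup>* \<and> g \<in> A \<and> \<phi> g = \<delta> \<and> ends g = {p, v} \<and> p \<notin> W \<and> v \<in> W \<and>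
     g' \<in> A \<and> \<phi> g' = \<delta> \<and> g' \<noteq> g \<and> p' \<in> ends g' \<and> q' \<in> ends g' \<and> p' \<in> W \<and> q' \<notin> W)"

lemma exit_atI:
  assumes "\<delta> < k" "\<delta> \<notin> \<Gamma>" "c \<in> \<Gamma>" "z \<notin> W" "c \<in> miss \<phi> z \<or> \<delta> \<in> miss \<phi> z"
     "(z, p) \<in> (adj_via ends {h\<in>ab \<phi> c \<delta>. ends h \<inter> W = {}})\<^sup>*" "g \<in> A" "\<phi> g = \<delta>" "ends g = {p, v}" "p \<notin> W" "v \<in> W"
     "g' \<in> A" "\<phi> g' = \<delta>" "g' \<noteq> g" "p' \<in> ends g'" "q' \<in> ends g'" "p' \<in> W" "q' \<notin> W"
  shows "exit_at \<phi> W \<Gamma> v"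
  unfolding exit_at_def
  by (rule exI[where x = \<delta>], rule exI[where x = c], rule exI[where x = z], rule exI[where x = p], rule exI[where x = g],
      rule exI[where x = g'], rule exI[where x = p'], rule exI[where x = q'], intro conjI) (rule assms)+

end

text \<open>The chain starting in \<open>W\<close> at the vertex missing a free colour has its other
  end \<open>z\<close> outside \<open>W\<close>, since \<open>W\<close> is elementary and does not
  miss \<open>\<delta>\<close>. Followed back from \<open>z\<close>, it first enters
  \<open>W\<close> at the required vertex, and one of the two given exits differs from the entering
  edge.\<close>

lemma (in closed_root) exit_at_ex:
  assumes S: "\<phi> \<in> S" and \<delta>: "\<delta> < k" "\<delta> \<notin> \<Gamma>"
    and e1: "e1 \<in> A" "\<phi> e1 = \<delta>" "p1 \<in> ends e1" "q1 \<in> ends e1" "p1 \<in> W" "q1 \<notin> W"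
    and e2: "e2 \<in> A" "\<phi> e2 = \<delta>" "p2 \<in> ends e2" "q2 \<in> ends e2" "p2 \<in> W" "q2 \<notin> W"
    and ne: "e1 \<noteq> e2"
  shows "\<exists>v. exit_at \<phi> W \<Gamma> v"
proof -
  obtain c where c: "c \<in> F" using R_F by blast
  then have cG: "c \<in> \<Gamma>" using R_F by blast
  have cd: "c \<noteq> \<delta>" using cG \<delta> by blast
  have p: "proper \<phi>" by (rule R_proper[OF S])
  obtain u where u: "u \<in> W" "c \<in> miss \<phi> u" using R_missU[OF S] cG by (auto simp: missU_def)
  have dW: "\<delta> \<notin> miss \<phi> w" if "w \<in> W" for w using R_missU[OF S] \<delta>(2) that by (auto simp: missU_def)
  obtain z where z: "z \<in> kc \<phi> c \<delta> u" "z \<noteq> u" "c \<in> miss \<phi> z \<longleftrightarrow> \<delta> \<notin> miss \<phi> z"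
    by (rule kc_other_end[OF p \<Gamma>_k[OF cG] \<delta>(1) cd u(2) dW[OF u(1)]])
  have zW: "z \<notin> W"
  proof
    assume zW: "z \<in> W"
    then have "c \<in> miss \<phi> z" using z(3) dW by blast
    then show False using elemD[OF R_elem[OF S] zW u(1) _ u(2)] z(2) by blast
  qed
  have "u \<in> kc \<phi> c \<delta> z" by (rule kc_sym[OF z(1)])
  then have "(z, u) \<in> (adj_via ends (ab \<phi> c \<delta>))\<^sup>*" by (simp add: kc_def)
  then obtain p' v where h: "(p', v) \<in> adj_via ends (ab \<phi> c \<delta>)" "p' \<notin> W" "v \<in> W"
    "(z, p') \<in> (adj_via ends {e\<in>ab \<phi> c \<delta>. ends e \<inter> W = {}})\<^sup>*"
    by (rule first_hit[where ends = ends, OF _ zW u(1)])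
  obtain g where g: "g \<in> A" "\<phi> g = c \<or> \<phi> g = \<delta>" "ends g = {p', v}" using h(1) by (auto simp: adj_via_def ab_def)
  have "\<phi> g \<notin> \<Gamma>" using R_closed[OF S g(1), of v p'] g(3) h by simp
  then have gd: "\<phi> g = \<delta>" using g(2) cG by auto
  have "\<exists>g' p' q'. g' \<in> A \<and> \<phi> g' = \<delta> \<and> g' \<noteq> g \<and> p' \<in> ends g' \<and> q' \<in> ends g' \<and> p' \<in> W \<and> q' \<notin> W"
  proof (cases "e1 = g")
    case True then show ?thesis using e2 ne by blast
  next
    case False then show ?thesis using e1 by blast
  qed
  then obtain g' s' t' where g': "g' \<in> A" "\<phi> g' = \<delta>" "g' \<noteq> g" "s' \<in> ends g'" "t' \<in> ends g'" "s' \<in> W" "t' \<notin> W" by blast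
  have "c \<in> miss \<phi> z \<or> \<delta> \<in> miss \<phi> z" using z(3) by blast
  then have "exit_at \<phi> W \<Gamma> v" by (rule exit_atI[OF \<delta> cG zW _ h(4) g(1) gd g(3) h(2,3) g'])
  then show ?thesis by blast
qed

section \<open>Configurations with a largest closure\<close>

locale maxconfig = config Es ends k s \<mu> e \<phi> x y
  for Es :: "'e set" and ends :: "'e \<Rightarrow> 'a set" and k s \<mu> e \<phi> x y +
  assumes max: "\<And>e' \<phi>' x' y'. config Es ends k s \<mu> e' \<phi>' x' y' \<Longrightarrow>
     card (mgraph.clo (Es - {e'}) ends k \<phi>' x' y' UNIV) \<le> card (mgraph.clo (Es - {e}) ends k \<phi> x y UNIV)"
begin

abbreviation W :: "'a set" where "W \<equiv> cl UNIV"
abbreviation \<Gamma>W :: "nat set" where "\<Gamma>W \<equiv> missU \<phi> (cl UNIV)"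

text \<open>The tail stays valid after a frozen recolouring, so the new closure contains
  \<open>W\<close>; by maximality it is \<open>W\<close>.\<close>

lemma spanning_closed:
  assumes T: "t.valid \<phi> T" "t.Y T (Suc (length T)) = W" and f: "\<psi> \<in> t.freeze \<phi> T"
    and g: "g \<in> Es - {e}" "p \<in> ends g" "q \<in> ends g" "p \<in> W" "q \<notin> W"
  shows "\<psi> g \<notin> \<Gamma>W"
proof
  assume gG: "\<psi> g \<in> \<Gamma>W"
  have pr': "proper \<psi>" and mx: "miss \<psi> x = miss \<phi> x" using t.freezeD(1)[OF f] by (simp_all add: S0_def)
  interpret c2: config Es ends k s \<mu> e \<psi> x y by unfold_locales (use eEs pr' exy in auto)
  have v: "t.valid \<psi> T" by (rule t.freeze_valid[OF f T(1)])
  have sub: "W \<subseteq> clo \<psi> x y UNIV" using c2.valid_clo[OF v, of UNIV] T(2) by simp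
  have "clo \<psi> x y UNIV = W"
    using card_seteq[OF c2.cl_props(2) sub max[OF c2.config_axioms]] by simp
  moreover have "missU \<psi> W = \<Gamma>W" using t.freeze_missU[OF f, of "Suc (length T)"] T(2) by simp
  ultimately show False using clo_closed[OF g(1-3), of \<psi> x y UNIV] g(4,5) gG by simp
qed

lemma spanning_root:
  assumes T: "t.valid \<phi> T" "t.Y T (Suc (length T)) = W"
    and F: "F = {c\<in>\<Gamma>W. \<forall>i<length T. \<phi> (t.E T i) \<noteq> c}" "F \<noteq> {}"
  shows "closed_root (Es - {e}) ends k W \<Gamma>W {} (t.freeze \<phi> T) F"
proof -
  have fr: "\<psi> \<in> S0" "proper \<psi>" "t.valid \<psi> T" "missU \<psi> W = \<Gamma>W" if "\<psi> \<in> t.freeze \<phi> T" for \<psi>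
    using t.freezeD(1)[OF that] t.freeze_valid[OF that T(1)] t.freeze_missU[OF that, of "Suc (length T)"] T(2)
    by (simp_all add: S0_def)
  have el: "elem \<psi> W" if "\<psi> \<in> t.freeze \<phi> T" for \<psi>
    using t.tail_elem[OF fr(1,3)[OF that]] T(2) by (simp add: t.cls_def)
  have col: "\<psi> (t.E T i) \<in> \<Gamma>W" "\<psi> (t.E T i) = \<phi> (t.E T i)" if "\<psi> \<in> t.freeze \<phi> T" "i < length T" for \<psi> i
    using t.valid_colour[OF fr(3)[OF that(1)] that(2)] fr(4)[OF that(1)] T(2) t.freezeD(2)[OF that] by simp_all
  have xW: "x \<in> W" by (rule cl_props(3))
  have W': "t.Y T (Suc (length T)) = W" by (rule T(2))
  show ?thesis
  proof unfold_locales
    fix \<psi> a b C assume a: "\<psi> \<in> t.freeze \<phi> T" "a < k" "b < k" "a \<noteq> b" "kclosed \<psi> a b C"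
      "C \<inter> W = {} \<or> a \<notin> \<Gamma>W \<union> {} \<and> b \<notin> \<Gamma>W \<union> {}"
    have m: "a \<notin> miss \<psi> u \<and> b \<notin> miss \<psi> u" if "u \<in> W" "u \<in> C" for u
      using that a(6) fr(4)[OF a(1)] by (auto simp: missU_def)
    have "miss (swap \<psi> a b C) x = miss \<psi> x"
    proof (cases "x \<in> C")
      case True
      then show ?thesis using m[OF xW] by (intro miss_swap_neither[OF a(5,2,3)]) simp_all
    next
      case False then show ?thesis by (rule miss_swap_out[OF a(5)])
    qed
    then have S': "swap \<psi> a b C \<in> S0" using fr(1)[OF a(1)] swap_proper[OF fr(2)[OF a(1)] a(2,3,5)] by (simp add: S0_def)
    show "swap \<psi> a b C \<in> t.freeze \<phi> T"
    proof (rule t.freeze_swapI[OF a(1) S' a(2,3,5)])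
      fix u assume "u \<in> t.Y T (Suc (length T))" "u \<in> C" then show "a \<notin> miss \<psi> u \<and> b \<notin> miss \<psi> u" using m W' by simp
    next
      fix i assume i: "i < length T"
      have "ends (t.E T i) \<subseteq> W" using t.valid_colour(2)[OF T(1) i] W' by simp
      then show "\<psi> (t.E T i) \<noteq> a \<and> \<psi> (t.E T i) \<noteq> b \<or> ends (t.E T i) \<inter> C = {}" using col(1)[OF a(1) i] a(6) by blast
    qed
  next
    fix \<psi> c d g p q assume a: "\<psi> \<in> t.freeze \<phi> T" "c \<in> F" "d < k" "d \<notin> \<Gamma>W" "g \<in> Es - {e}" "\<psi> g = d" "p \<in> ends g" "q \<in> ends g"
      "p \<in> W" "q \<notin> W"
    have cG: "c \<in> \<Gamma>W" using a(2) F(1) by blast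
    obtain w where w: "w \<in> W" "c \<in> miss \<psi> w" using cG fr(4)[OF a(1)] unfolding missU_def by blast
    have ck: "c < k" by (rule miss_lt[OF w(2)])
    have cd: "c \<noteq> d" using cG a(4) by blast
    have "p \<in> kc \<psi> c d w"
    proof (rule ccontr)
      assume np: "p \<notin> kc \<psi> c d w"
      define K where "K = kc \<psi> c d p"
      have clK: "kclosed \<psi> c d K" unfolding K_def by (rule kc_closed)
      have wK: "w \<notin> K" using np kc_sym unfolding K_def by blast
      have pK: "p \<in> K" by (simp add: K_def)
      have m: "c \<notin> miss \<psi> u \<and> d \<notin> miss \<psi> u" if u: "u \<in> W" "u \<in> K" for u
      proof
        show "c \<notin> miss \<psi> u" using elemD[OF el[OF a(1)] u(1) w(1) _ w(2)] u(2) wK by blast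
        show "d \<notin> miss \<psi> u" using fr(4)[OF a(1)] u(1) a(4) unfolding missU_def by blast
      qed
      have "miss (swap \<psi> c d K) x = miss \<psi> x"
      proof (cases "x \<in> K")
        case True
        then show ?thesis using m[OF xW] by (intro miss_swap_neither[OF clK ck a(3)]) simp_all
      next
        case False then show ?thesis by (rule miss_swap_out[OF clK])
      qed
      then have S': "swap \<psi> c d K \<in> S0" using fr(1)[OF a(1)] swap_proper[OF fr(2)[OF a(1)] ck a(3) clK] by (simp add: S0_def)
      have "swap \<psi> c d K \<in> t.freeze \<phi> T"
      proof (rule t.freeze_swapI[OF a(1) S' ck a(3) clK])
        fix u assume "u \<in> t.Y T (Suc (length T))" "u \<in> K" then show "c \<notin> miss \<psi> u \<and> d \<notin> miss \<psi> u" using m W' by simp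
      next
        fix i assume i: "i < length T"
        have "\<psi> (t.E T i) \<noteq> c" using col(2)[OF a(1) i] a(2) F(1) i by auto
        moreover have "\<psi> (t.E T i) \<noteq> d" using col(1)[OF a(1) i] a(4) by blast
        ultimately show "\<psi> (t.E T i) \<noteq> c \<and> \<psi> (t.E T i) \<noteq> d \<or> ends (t.E T i) \<inter> K = {}" by blast
      qed
      then have "swap \<psi> c d K g \<notin> \<Gamma>W" by (rule spanning_closed[OF T _ a(5,7,8,9,10)])
      moreover have "swap \<psi> c d K g = c" using a(5,6,7) pK cd unfolding swap_def by auto
      ultimately show False using cG by simp
    qed
    then show "\<exists>u\<in>W. c \<in> miss \<psi> u \<and> p \<in> kc \<psi> c d u" using w by blast
  next
    fix \<psi> g p q assume "\<psi> \<in> t.freeze \<phi> T" "g \<in> Es - {e}" "p \<in> ends g" "q \<in> ends g" "p \<in> W" "q \<notin> W"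
    then show "\<psi> g \<notin> \<Gamma>W" by (rule spanning_closed[OF T])
  next
    show "t.freeze \<phi> T \<noteq> {}" using t.freeze_self[OF \<phi>S0] by blast
  next
    fix \<psi> v assume "\<psi> \<in> t.freeze \<phi> T" then show "miss \<psi> v \<noteq> {}" using fr(2) miss_ne by blast
  qed (use F fr(2,4) el cl_props(2) in auto)
qed

text \<open>If \<open>\<alpha>\<close> were dispensable, it would be a free colour of
  \<open>W\<close>. Exchange \<open>c\<close> with \<open>\<alpha>\<close> outside \<open>W\<close>:
  the chain of \<open>v\<close> in the colours \<open>\<alpha>\<close> and \<open>\<delta>\<close>
  then goes out through \<open>g\<close> to \<open>z\<close> and meets \<open>W\<close> only in
  \<open>v\<close>. By \<open>R_exit\<close> the inner end of the other exit edge \<open>g'\<close>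
  lies on it too, which forces \<open>g' = g\<close>.\<close>

lemma exit_colour_needed:
  assumes xd: "exit_at \<phi> W \<Gamma>W v" and \<alpha>: "\<alpha> \<in> miss \<phi> v"
  shows "cl (- {\<alpha>}) \<noteq> W"
proof
  assume span: "cl (- {\<alpha>}) = W"
  obtain T where T: "t.valid \<phi> T" "t.Y T (Suc (length T)) = cl (- {\<alpha>})" "\<And>i. i < length T \<Longrightarrow> \<phi> (t.E T i) \<in> - {\<alpha>}"
    by (rule clo_tail[of "- {\<alpha>}"]) blast
  define F where "F = {c\<in>\<Gamma>W. \<forall>i<length T. \<phi> (t.E T i) \<noteq> c}"
  obtain \<delta> c z p g g' p' q' where x: "\<delta> < k" "\<delta> \<notin> \<Gamma>W" "c \<in> \<Gamma>W" "z \<notin> W" "c \<in> miss \<phi> z \<or> \<delta> \<in> miss \<phi> z"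
     "(z, p) \<in> (adj_via ends {h\<in>ab \<phi> c \<delta>. ends h \<inter> W = {}})\<^sup>*" "g \<in> Es - {e}" "\<phi> g = \<delta>" "ends g = {p, v}" "p \<notin> W" "v \<in> W"
     "g' \<in> Es - {e}" "\<phi> g' = \<delta>" "g' \<noteq> g" "p' \<in> ends g'" "q' \<in> ends g'" "p' \<in> W" "q' \<notin> W"
    using xd unfolding exit_at_def by (elim exE conjE) (rule that)
  have \<alpha>G: "\<alpha> \<in> \<Gamma>W" using \<alpha> x(11) unfolding missU_def by blast
  have \<alpha>F: "\<alpha> \<in> F" using \<alpha>G T(3) by (auto simp: F_def)
  interpret r: closed_root "Es - {e}" ends k W \<Gamma>W "{}" "t.freeze \<phi> T" F
    by (rule spanning_root[OF T(1) _ F_def]) (use T(2) span \<alpha>F in auto)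
  have \<phi>f: "\<phi> \<in> t.freeze \<phi> T" by (rule t.freeze_self[OF \<phi>S0])
  obtain \<psi> where p0: "r.permutes_outside \<phi> c \<alpha> \<psi>" using r.perm_outside[OF \<phi>f x(3) \<alpha>G] by blast
  note pp = r.permutes_outsideD[OF p0]
  have prp: "proper \<psi>" by (rule r.R_proper[OF pp(1)])
  have a\<delta>: "\<alpha> \<noteq> \<delta>" using \<alpha>G x(2) by blast
  have \<alpha>k: "\<alpha> < k" by (rule miss_lt[OF \<alpha>])
  have \<psi>g: "\<psi> g = \<delta>" using pp(4)[of g] x(2,8) by simp
  have \<psi>g': "\<psi> g' = \<delta>" using pp(4)[of g'] x(2,13) by simp
  have mv: "\<alpha> \<in> miss \<psi> v" using pp(7)[OF x(11)] \<alpha> by simp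
  have mz: "\<alpha> \<in> miss \<psi> z \<or> \<delta> \<in> miss \<psi> z" using x(5) pp(5)[OF x(4)] pp(6)[OF x(2)] by blast
  \<comment> \<open>In \<open>H'\<close> the component of \<open>v\<close> runs through
    \<open>g\<close> to \<open>z\<close>. Both are ends, so by \<open>two_ends_component\<close> it
    is already the full Kempe chain.\<close>
  define H' where "H' = insert g {h\<in>ab \<psi> \<alpha> \<delta>. ends h \<inter> W = {}}"
  define C where "C = (adj_via ends H')\<^sup>* `` {v}"
  have gab: "g \<in> ab \<psi> \<alpha> \<delta>" using x(7) \<psi>g by (simp add: ab_def)
  have sub: "H' \<subseteq> ab \<psi> \<alpha> \<delta>" using gab by (auto simp: H'_def)
  have "{h\<in>ab \<phi> c \<delta>. ends h \<inter> W = {}} \<subseteq> H'"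
  proof
    fix h assume h: "h \<in> {h\<in>ab \<phi> c \<delta>. ends h \<inter> W = {}}"
    then have h1: "h \<in> Es - {e}" "ends h \<inter> W = {}" "\<phi> h = c \<or> \<phi> h = \<delta>" by (auto simp: ab_def)
    have "\<psi> h = \<alpha> \<or> \<psi> h = \<delta>" using h1(3) pp(3)[OF h1(1,2)] pp(4)[of h] x(2) by auto
    then show "h \<in> H'" using h1 by (simp add: H'_def ab_def)
  qed
  then have "(z, p) \<in> (adj_via ends H')\<^sup>*" using x(6) rtrancl_mono[OF adj_via_mono[where ends = ends]] by blast
  moreover have "(p, v) \<in> adj_via ends H'" using x(9) by (auto simp: adj_via_def H'_def)
  ultimately have "(z, v) \<in> (adj_via ends H')\<^sup>*" by simp
  then have zC: "z \<in> C" using adj_via_rtrancl_sym[where ends = ends] by (simp add: C_def)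
  have CW: "t \<notin> W \<or> t = v" if "t \<in> C" for t
  proof -
    have "(v, t) \<in> (adj_via ends H')\<^sup>*" using that by (simp add: C_def)
    then show ?thesis
    proof (induction rule: rtrancl_induct)
      case (step a b)
      then obtain h where h: "h \<in> H'" "ends h = {a, b}" by (auto simp: adj_via_def)
      show ?case
      proof (cases "h = g")
        case True then show ?thesis using h(2) x(9,10) by auto
      next
        case False then show ?thesis using h by (auto simp: H'_def)
      qed
    qed simp
  qed
  have dg: "deg_in ends (ab \<psi> \<alpha> \<delta>) t = (if \<alpha> \<in> miss \<psi> t then 0 else 1) + (if \<delta> \<in> miss \<psi> t then 0 else 1)" for t
    by (rule deg_ab[OF prp \<alpha>k x(1) a\<delta>])
  have zv: "z \<noteq> v" using x(4) x(11) by metis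
  have dg2: "deg_in ends (ab \<psi> \<alpha> \<delta>) t \<le> 2" for t using dg[of t] by (cases "\<alpha> \<in> miss \<psi> t"; cases "\<delta> \<in> miss \<psi> t") simp_all
  have dgv: "deg_in ends (ab \<psi> \<alpha> \<delta>) v \<le> 1" using dg[of v] mv by simp
  have dgz: "deg_in ends (ab \<psi> \<alpha> \<delta>) z \<le> 1" using dg[of z] mz by (cases "\<alpha> \<in> miss \<psi> z") simp_all
  have clC: "h \<in> H'" if "h \<in> ab \<psi> \<alpha> \<delta>" "ends h \<inter> C \<noteq> {}" for h
    by (rule two_ends_component[where ends = ends and H = "ab \<psi> \<alpha> \<delta>" and H' = H' and u = v and z = z and C = C,
      OF finite_ab ab_card2 sub C_def zC zv dg2 dgv dgz that])
  have "kclosed \<psi> \<alpha> \<delta> C" unfolding kclosed_def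
  proof (intro ballI impI)
    fix h assume h: "h \<in> ab \<psi> \<alpha> \<delta>" "ends h \<inter> C \<noteq> {}"
    show "ends h \<subseteq> C" by (rule component_closed[where ends = ends, OF clC[OF h] ab_card2[OF h(1)] C_def h(2)])
  qed
  then have K: "kc \<psi> \<alpha> \<delta> v \<subseteq> C" by (rule kc_min) (simp add: C_def)
  obtain u where u: "u \<in> W" "\<alpha> \<in> miss \<psi> u" "p' \<in> kc \<psi> \<alpha> \<delta> u"
    using r.R_exit[OF pp(1) \<alpha>F x(1,2,12) \<psi>g' x(15-18)] by blast
  have "u = v" by (rule elemD[OF r.R_elem[OF pp(1)] u(1) x(11) u(2) mv])
  then have "p' = v" using u(3) K CW x(17) by blast
  then have "g' = g" using proper_inj[OF prp x(12,7,15)] x(9) \<psi>g \<psi>g' by simp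
  then show False using x(14) by simp
qed

text \<open>All colours missing at \<open>v\<close> are forbidden at the start, and a colour that
  blocks the closure is released in each step. By \<open>exit_colour_needed\<close> the closure is
  proper as long as a colour is forbidden, so every release is a true enlargement, to which
  \<open>growth\<close> applies with the missing colours not missing at \<open>v\<close>.\<close>

lemma chain_of_exit:
  assumes xd: "exit_at \<phi> W \<Gamma>W v" and a0: "a0 \<le> card (cl (- miss \<phi> v))" and q: "q \<le> card (miss \<phi> v)"
    and \<epsilon>: "\<epsilon> = (if v \<in> {x, y} then 1 else 2)"
  shows "chain s \<mu> \<epsilon> q a0 (card W)"
proof -
  have vW: "v \<in> W" using xd unfolding exit_at_def by blast
  have elW: "elem \<phi> W" by (rule cl_props(1))
  have clW: "cl C \<subseteq> W" for C by (rule clo_mono) simp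
  define Q where "Q C = missU \<phi> (cl C) - miss \<phi> v" for C
  have cQ: "(card (cl C) - 1) * s + \<epsilon> \<le> card (Q C)" for C
  proof (cases "v \<in> cl C")
    case True then show ?thesis using card_missU_ge(2)[OF pr cl_props(2,1,3,4), of v C] \<epsilon> by (simp add: Q_def)
  next
    case False
    have "missU \<phi> (cl C) \<inter> miss \<phi> v = {}" 
    proof (rule ccontr)
      assume "missU \<phi> (cl C) \<inter> miss \<phi> v \<noteq> {}"
      then obtain c u where u: "u \<in> cl C" "c \<in> miss \<phi> u" "c \<in> miss \<phi> v" by (auto simp: missU_def)
      have "u \<in> W" using u(1) clW[of C] by (rule rev_subsetD)
      then have "u = v" by (rule elemD[OF elW _ vW u(2,3)])
      then show False using u(1) False by simp
    qed
    then have QC: "Q C = missU \<phi> (cl C)" unfolding Q_def by blast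
    have "card (cl C) * s + 2 \<le> card (missU \<phi> (cl C))" by (rule card_missU_ge(1)[OF pr cl_props(2,1,3,4)])
    moreover have "(card (cl C) - 1) * s \<le> card (cl C) * s" by simp
    moreover have "\<epsilon> \<le> 2" using \<epsilon> by simp
    ultimately show ?thesis unfolding QC by linarith
  qed
  have Qne: "\<exists>c. c \<in> Q C" for C
  proof -
    have "0 < card (Q C)" using cQ[of C] \<epsilon> by (auto split: if_splits)
    then show ?thesis by (auto simp: card_gt_0_iff)
  qed
  have odd: "odd (card (cl (- R)))" if "R \<subseteq> miss \<phi> v" for R
  proof -
    obtain c where "c \<in> Q (- R)" using Qne by blast
    then show ?thesis using cl_odd[of c "- R"] that by (auto simp: Q_def)
  qed
  have "\<exists>a R. R \<subseteq> miss \<phi> v \<and> card R + i = card (miss \<phi> v) \<and> a i = card (cl (- R)) \<and> a0 \<le> a 0 \<and> (\<forall>l\<le>i. odd (a l)) \<and>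
    (\<forall>l<i. a l < a (Suc l) \<and> (a l - 1) * s + \<epsilon> \<le> \<mu> * (a (Suc l) - a l - 1))" if "i \<le> card (miss \<phi> v)" for i
    using that
  proof (induction i)
    case 0
    show ?case
      using a0 odd[OF subset_refl] by (intro exI[of _ "\<lambda>_. card (cl (- miss \<phi> v))"] exI[of _ "miss \<phi> v"]) simp
  next
    case (Suc i)
    from Suc.IH[OF Suc_leD[OF Suc.prems]] obtain a R where IH: "R \<subseteq> miss \<phi> v" "card R + i = card (miss \<phi> v)" "a i = card (cl (- R))" "a0 \<le> a 0"
      "\<forall>l\<le>i. odd (a l)" "\<forall>l<i. a l < a (Suc l) \<and> (a l - 1) * s + \<epsilon> \<le> \<mu> * (a (Suc l) - a l - 1)"
      by (elim exE conjE) (rule that)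
    have fR: "finite R" by (rule finite_subset[OF IH(1) finite_miss])
    have "R \<noteq> {}" using IH(2) Suc.prems by (intro notI) simp
    then obtain r0 where r0: "r0 \<in> R" by blast
    have "cl (- R) \<noteq> W"
    proof
      assume eq: "cl (- R) = W"
      have "cl (- R) \<subseteq> cl (- {r0})" using r0 by (intro clo_mono) blast
      then have "cl (- {r0}) = W" using eq clW[of "- {r0}"] by blast
      moreover have "r0 \<in> miss \<phi> v" using r0 IH(1) by blast
      ultimately show False using exit_colour_needed[OF xd] by blast
    qed
    then obtain g p q where g: "g \<in> Es - {e}" "p \<in> ends g" "q \<in> ends g" "p \<in> cl (- R)" "q \<notin> cl (- R)"
      "\<phi> g \<in> missU \<phi> (cl (- R))" "\<phi> g \<notin> - R" by (rule clo_exit)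
    define R' where "R' = R - {\<phi> g}"
    have R'm: "R' \<subseteq> miss \<phi> v" using IH(1) by (auto simp: R'_def)
    have cR: "card R = Suc (card R')" using card_Suc_Diff1[OF fR, of "\<phi> g"] g(7) by (simp add: R'_def)
    have sub: "cl (- R) \<subseteq> cl (- R')" by (rule clo_mono) (auto simp: R'_def)
    have mU: "missU \<phi> (cl (- R)) \<subseteq> missU \<phi> (cl (- R'))" by (rule missU_mono[OF sub])
    have q': "q \<in> cl (- R')"
    proof (rule ccontr)
      assume "q \<notin> cl (- R')"
      moreover have "p \<in> cl (- R')" using g(4) sub by blast
      moreover have "\<phi> g \<in> missU \<phi> (cl (- R'))" using g(6) mU by blast
      ultimately have "\<phi> g \<notin> - R'" by (intro clo_closed[OF g(1,2,3)])
      then show False by (simp add: R'_def)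
    qed
    have lt: "card (cl (- R)) < card (cl (- R'))" using sub q' g(5) by (intro psubset_card_mono cl_props(2)) blast
    have "card (Q (- R)) \<le> \<mu> * (card (cl (- R') - cl (- R)) - 1)"
    proof (rule growth[OF pr cl_props(2,1) sub q' g(5)])
      show "Q (- R) \<subseteq> missU \<phi> (cl (- R))" by (auto simp: Q_def)
      fix h p q assume h: "h \<in> Es - {e}" "p \<in> ends h" "q \<in> ends h"
      show "\<phi> h \<notin> Q (- R)" if "p \<in> cl (- R)" "q \<notin> cl (- R)"
      proof
        assume "\<phi> h \<in> Q (- R)"
        then have a: "\<phi> h \<in> missU \<phi> (cl (- R))" "\<phi> h \<notin> miss \<phi> v" by (simp_all add: Q_def)
        have "\<phi> h \<notin> - R" by (rule clo_closed[OF h that a(1)])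
        then show False using IH(1) a(2) by blast
      qed
      show "\<phi> h \<notin> Q (- R)" if "p \<in> cl (- R')" "q \<notin> cl (- R')"
      proof
        assume "\<phi> h \<in> Q (- R)"
        then have a: "\<phi> h \<in> missU \<phi> (cl (- R'))" "\<phi> h \<notin> miss \<phi> v" using mU unfolding Q_def by blast+
        have "\<phi> h \<notin> - R'" by (rule clo_closed[OF h that a(1)])
        then show False using R'm a(2) by blast
      qed
    qed (rule mult')
    moreover have "card (cl (- R') - cl (- R)) = card (cl (- R')) - card (cl (- R))"
      by (rule card_Diff_subset[OF cl_props(2) sub])
    ultimately have st: "(a i - 1) * s + \<epsilon> \<le> \<mu> * (card (cl (- R')) - a i - 1)" using cQ[of "- R"] IH(3) by simp
    let ?a = "a(Suc i := card (cl (- R')))"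
    show ?case
    proof (intro exI[of _ ?a] exI[of _ R'] conjI allI impI)
      show "R' \<subseteq> miss \<phi> v" by (rule R'm)
      show "card R' + Suc i = card (miss \<phi> v)" using IH(2) cR by simp
      show "?a (Suc i) = card (cl (- R'))" "a0 \<le> ?a 0" using IH(4) by simp_all
      show "odd (?a l)" if "l \<le> Suc i" for l using that IH(5) odd[OF R'm] by (cases "l = Suc i") auto
      show "?a l < ?a (Suc l)" if "l < Suc i" for l using that IH(3,6) lt by (cases "l = i") auto
      show "(?a l - 1) * s + \<epsilon> \<le> \<mu> * (?a (Suc l) - ?a l - 1)" if "l < Suc i" for l
        using that IH(6) st by (cases "l = i") auto
    qed
  qed
  from this[OF q] obtain a R where "a q = card (cl (- R))" "a0 \<le> a 0" "\<forall>l\<le>q. odd (a l)"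
    "\<forall>l<q. a l < a (Suc l) \<and> (a l - 1) * s + \<epsilon> \<le> \<mu> * (a (Suc l) - a l - 1)" by blast
  moreover have "card (cl (- R)) \<le> card W" by (rule card_mono[OF cl_props(2) clW])
  ultimately show ?thesis unfolding chain_def by auto
qed

end

lemma (in mgraph) clo_sym: "clo \<phi> x y C = clo \<phi> y x C"
proof -
  have "clo \<phi> x y C \<subseteq> clo \<phi> y x C" for x y
    by (rule clo_least[OF clo_y clo_x]) (rule clo_closed)
  then show ?thesis by blast
qed

lemma odd_ge_3: "odd (n::nat) \<Longrightarrow> 2 \<le> n \<Longrightarrow> 3 \<le> n"
  by presburger

lemma (in maxconfig) exit_closure_ge_3:
  assumes v: "v \<in> W" shows "3 \<le> card (cl (- miss \<phi> v))"
proof -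
  obtain u where u: "u \<in> {x, y}" "u \<noteq> v" using xy by auto
  obtain c where c: "c \<in> miss \<phi> u" using miss_ne[OF pr] by blast
  have uC: "u \<in> cl C" for C using u(1) cl_props(3,4) by blast
  have "c \<notin> miss \<phi> v" using elemD[OF cl_props(1) uC v c] u(2) by blast
  moreover have "c \<in> missU \<phi> (cl (- miss \<phi> v))" using c uC unfolding missU_def by blast
  ultimately have "odd (card (cl (- miss \<phi> v)))" by (intro cl_odd) simp_all
  moreover have "2 \<le> card (cl (- miss \<phi> v))"
  proof -
    have "{x, y} \<subseteq> cl (- miss \<phi> v)" using cl_props(3,4) by blast
    then have "card {x, y} \<le> card (cl (- miss \<phi> v))" by (intro card_mono cl_props(2))
    then show ?thesis using xy by simp
  qed
  ultimately show ?thesis by (rule odd_ge_3)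
qed

section \<open>Fan shifts and the case \<open>s = 1\<close>\<close>

context dgraph
begin

text \<open>\<open>W\<close> and \<open>v\<close> are arguments, so that the uncoloured edge can
  travel by fan shifts while the closure and its exit vertex remain the same.\<close>

definition good :: "'e \<Rightarrow> ('e \<Rightarrow> nat) \<Rightarrow> 'a \<Rightarrow> 'a \<Rightarrow> 'a set \<Rightarrow> 'a \<Rightarrow> bool" where
  "good e \<phi> x y W v \<longleftrightarrow> maxconfig Es ends k s \<mu> e \<phi> x y \<and> mgraph.clo (Es - {e}) ends k \<phi> x y UNIV = W \<and>
     mgraph.exit_at (Es - {e}) ends k \<phi> W (mgraph.missU (Es - {e}) ends k \<phi> W) v"

lemma good_sym:
  assumes "good e \<phi> x y W v" shows "good e \<phi> y x W v"
proof -
  interpret maxconfig Es ends k s \<mu> e \<phi> x y using assms by (simp add: good_def)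
  have c: "config Es ends k s \<mu> e \<phi> y x"
    by unfold_locales (use eEs pr exy in \<open>auto simp: insert_commute\<close>)
  have "maxconfig Es ends k s \<mu> e \<phi> y x"
    using max c clo_sym[of \<phi> y x UNIV] by (simp add: maxconfig_def maxconfig_axioms_def)
  then show ?thesis using assms clo_sym[of \<phi> y x UNIV] by (simp add: good_def)
qed

text \<open>A fan shift: the edge \<open>g = yz\<close>, coloured with a colour missing at \<open>x\<close>, becomes the uncoloured edge.\<close>

lemma good_shift:
  assumes gd: "good e \<phi> x y W v" and g: "g \<in> Es - {e}" "ends g = {y, z}" "\<phi> g \<in> mgraph.miss (Es - {e}) ends k \<phi> x"
  shows "good g (\<phi>(e := \<phi> g)) y z W v"
    and "mgraph.miss (Es - {g}) ends k (\<phi>(e := \<phi> g)) y = mgraph.miss (Es - {e}) ends k \<phi> y"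
proof -
  interpret maxconfig Es ends k s \<mu> e \<phi> x y using gd by (simp add: good_def)
  have W: "cl UNIV = W" and xd: "exit_at \<phi> W (missU \<phi> W) v" using gd by (simp_all add: good_def)
  define c where "c = \<phi> g"
  define f where "f = \<phi>(e := c)"
  have c: "c \<in> miss \<phi> x" using g(3) by (simp add: c_def)
  have ck: "c < k" by (rule miss_lt[OF c])
  have yz: "y \<noteq> z" by (rule ends_ne[OF g(1,2)])
  have xz: "x \<noteq> z" using missD[OF c g(1)] g(2) by (auto simp: c_def)
  have ge: "g \<in> Es" "g \<noteq> e" "e \<in> Es - {g}" using g(1) eEs by auto
  have fo: "f h = \<phi> h" if "h \<noteq> e" for h using that by (simp add: f_def)
  have fe: "f e = c" by (simp add: f_def)
  have cne: "\<phi> h \<noteq> c" if h: "h \<in> Es" "h \<noteq> e" "h \<noteq> g" "ends h \<inter> ends e \<noteq> {}" for h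
  proof
    assume hc: "\<phi> h = c"
    have hA: "h \<in> Es - {e}" using h by simp
    consider "x \<in> ends h" | "y \<in> ends h" using h(4) exy by auto
    then show False
    proof cases
      case 1 then show False using missD[OF c hA] hc by blast
    next
      case 2
      have "h = g" by (rule proper_inj[OF pr hA g(1) 2]) (use g(2) hc in \<open>simp_all add: c_def\<close>)
      then show False using h(3) by simp
    qed
  qed
  have pf: "proper_edge_colouring (Es - {g}) ends k f"
    unfolding proper_edge_colouring_def
  proof (intro conjI ballI impI)
    fix h assume h: "h \<in> Es - {g}"
    show "f h < k"
    proof (cases "h = e")
      case True then show ?thesis using ck fe by simp
    next
      case False then show ?thesis using proper_lt[OF pr, of h] h fo by simp
    qed
  next
    fix h1 h2 assume h: "h1 \<in> Es - {g}" "h2 \<in> Es - {g}" "h1 \<noteq> h2 \<and> ends h1 \<inter> ends h2 \<noteq> {}"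
    consider "h1 = e" | "h2 = e" | "h1 \<noteq> e" "h2 \<noteq> e" by blast
    then show "f h1 \<noteq> f h2"
    proof cases
      case 1
      then have "ends h2 \<inter> ends e \<noteq> {}" using h(3) by (simp add: Int_commute)
      then show ?thesis using 1 cne[of h2] h fe fo[of h2] by auto
    next
      case 2
      then have "ends h1 \<inter> ends e \<noteq> {}" using h(3) by simp
      then show ?thesis using 2 cne[of h1] h fe fo[of h1] by auto
    next
      case 3
      have "\<phi> h1 \<noteq> \<phi> h2" using pr h 3 unfolding proper_edge_colouring_def by blast
      then show ?thesis using fo 3 by simp
    qed
  qed
  interpret c2: config Es ends k s \<mu> g f y z
    by unfold_locales (use ge pf g(2) in auto)
  have m_same: "c2.miss f u = miss \<phi> u" if u: "u \<noteq> x" "u \<noteq> z" for u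
  proof (cases "u = y")
    case False
    have "u \<notin> ends e" "u \<notin> ends g" using u False exy g(2) by auto
    then have "(h \<in> Es - {g} \<and> u \<in> ends h \<longrightarrow> f h \<noteq> c') \<longleftrightarrow> (h \<in> Es - {e} \<and> u \<in> ends h \<longrightarrow> \<phi> h \<noteq> c')" for h c'
      using fo[of h] by (cases "h = e"; cases "h = g") auto
    then show ?thesis unfolding c2.miss_def miss_def Ball_def by blast
  next
    case True
    have "(\<forall>h\<in>Es - {g}. y \<in> ends h \<longrightarrow> f h \<noteq> c') \<longleftrightarrow> (\<forall>h\<in>Es - {e}. y \<in> ends h \<longrightarrow> \<phi> h \<noteq> c')" for c'
    proof
      assume a: "\<forall>h\<in>Es - {g}. y \<in> ends h \<longrightarrow> f h \<noteq> c'"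
      show "\<forall>h\<in>Es - {e}. y \<in> ends h \<longrightarrow> \<phi> h \<noteq> c'"
      proof (intro ballI impI)
        fix h assume h: "h \<in> Es - {e}" "y \<in> ends h"
        show "\<phi> h \<noteq> c'"
        proof (cases "h = g")
          case True
          have "f e \<noteq> c'" using a ge(3) exy by blast
          then show ?thesis using True fe by (simp add: c_def)
        next
          case False
          then have "f h \<noteq> c'" using a h by blast
          then show ?thesis using fo h by auto
        qed
      qed
    next
      assume a: "\<forall>h\<in>Es - {e}. y \<in> ends h \<longrightarrow> \<phi> h \<noteq> c'"
      show "\<forall>h\<in>Es - {g}. y \<in> ends h \<longrightarrow> f h \<noteq> c'"
      proof (intro ballI impI)
        fix h assume h: "h \<in> Es - {g}" "y \<in> ends h"
        show "f h \<noteq> c'"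
        proof (cases "h = e")
          case True
          have "\<phi> g \<noteq> c'" using a g(1,2) by blast
          then show ?thesis using True fe by (simp add: c_def)
        next
          case False
          then have "\<phi> h \<noteq> c'" using a h by blast
          then show ?thesis using fo False by simp
        qed
      qed
    qed
    then show ?thesis unfolding True c2.miss_def miss_def by simp
  qed
  have m_z: "c2.miss f z = insert c (miss \<phi> z)"
  proof -
    have ze: "z \<notin> ends e" using exy xz yz by auto
    have "c \<in> c2.miss f z" unfolding c2.miss_def
    proof (intro CollectI conjI ballI impI)
      show "c < k" by (rule ck)
      fix h assume h: "h \<in> Es - {g}" "z \<in> ends h"
      then have hA: "h \<in> Es - {e}" "h \<noteq> e" using ze by auto
      show "f h \<noteq> c"
      proof
        assume "f h = c"
        then have "\<phi> h = \<phi> g" using fo[OF hA(2)] by (simp add: c_def)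
        then have "h = g" using proper_inj[OF pr hA(1) g(1) h(2)] g(2) by simp
        then show False using h(1) by simp
      qed
    qed
    moreover have "c' \<in> c2.miss f z \<longleftrightarrow> c' \<in> miss \<phi> z" if "c' \<noteq> c" for c'
    proof -
      have "(h \<in> Es - {g} \<and> z \<in> ends h \<longrightarrow> f h \<noteq> c') \<longleftrightarrow> (h \<in> Es - {e} \<and> z \<in> ends h \<longrightarrow> \<phi> h \<noteq> c')" for h
        using fo[of h] that ze by (cases "h = e"; cases "h = g") (auto simp: c_def)
      then show ?thesis unfolding c2.miss_def miss_def Ball_def by blast
    qed
    moreover have "c' \<in> c2.miss f z \<longleftrightarrow> c' \<in> insert c (miss \<phi> z)" for c'
      using calculation by (cases "c' = c") simp_all
    ultimately show ?thesis by blast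
  qed
  have m_x: "c2.miss f x = miss \<phi> x - {c}"
  proof -
    have xg: "x \<notin> ends g" using g(2) xy xz by auto
    have xe: "x \<in> ends e" using exy by simp
    have "c \<notin> c2.miss f x" using c2.missD[of c f x e] ge(3) xe fe by blast
    moreover have "c' \<in> c2.miss f x \<longleftrightarrow> c' \<in> miss \<phi> x" if "c' \<noteq> c" for c'
    proof -
      have "(h \<in> Es - {g} \<and> x \<in> ends h \<longrightarrow> f h \<noteq> c') \<longleftrightarrow> (h \<in> Es - {e} \<and> x \<in> ends h \<longrightarrow> \<phi> h \<noteq> c')" for h
        using fo[of h] fe that xg by (cases "h = e"; cases "h = g") auto
      then show ?thesis unfolding c2.miss_def miss_def Ball_def by blast
    qed
    moreover have "c' \<in> c2.miss f x \<longleftrightarrow> c' \<in> miss \<phi> x - {c}" for c'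
      using calculation by (cases "c' = c") simp_all
    ultimately show ?thesis by blast
  qed
  have xW: "x \<in> W" "y \<in> W" using cl_props(3,4)[of UNIV] W by simp_all
  \<comment> \<open>The formerly uncoloured edge now has a colour that is missing at
    \<open>z\<close>, and this brings \<open>x\<close> back into the closure.\<close>
  have x2: "x \<in> c2.cl UNIV"
  proof (rule c2.clo_step)
    show "y \<in> c2.cl UNIV" by (rule c2.cl_props(3))
    show "z \<in> c2.cl UNIV" by (rule c2.cl_props(4))
    show "e \<in> Es - {g}" by (rule ge(3))
    show "y \<in> ends e" "x \<in> ends e" using exy by simp_all
    show "f e \<in> c2.miss f z" using m_z fe by simp
  qed simp
  have sub: "W \<subseteq> c2.cl UNIV"
    unfolding W[symmetric]
  proof (rule clo_least[OF x2 c2.cl_props(3)])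
    fix h p q assume h: "h \<in> Es - {e}" "p \<in> ends h" "q \<in> ends h" "p \<in> c2.cl UNIV" "q \<notin> c2.cl UNIV" "\<phi> h \<in> missU \<phi> (c2.cl UNIV)"
    have "h \<noteq> g" using h(3,5) g(2) c2.cl_props(3,4)[of UNIV] by auto
    then have hA: "h \<in> Es - {g}" "f h = \<phi> h" using h(1) fo by auto
    obtain w where w: "w \<in> c2.cl UNIV" "\<phi> h \<in> miss \<phi> w" using h(6) by (auto simp: missU_def)
    have "\<exists>w'\<in>c2.cl UNIV. \<phi> h \<in> c2.miss f w'"
    proof (cases "\<phi> h = c")
      case True then show ?thesis using m_z c2.cl_props(4)[of UNIV] by blast
    next
      case False
      then have "\<phi> h \<in> c2.miss f w" using w(2) m_same[of w] m_z m_x by (cases "w = x"; cases "w = z") auto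
      then show ?thesis using w(1) by blast
    qed
    then obtain w' where w': "w' \<in> c2.cl UNIV" "f h \<in> c2.miss f w'" using hA(2) by auto
    have "q \<in> c2.cl UNIV" by (rule c2.clo_step[OF h(4) w'(1) hA(1) h(2,3) w'(2)]) simp
    then show "\<phi> h \<notin> UNIV" using h(5) by simp
  qed
  have W2: "c2.cl UNIV = W"
    using card_seteq[OF c2.cl_props(2) sub] max[OF c2.config_axioms] W by simp
  have zW: "z \<in> W" using c2.cl_props(4)[of UNIV] W2 by simp
  have mc: "maxconfig Es ends k s \<mu> g f y z"
    using max c2.config_axioms W W2 by (simp add: maxconfig_def maxconfig_axioms_def)
  have mU: "c2.missU f W = missU \<phi> W"
  proof (rule set_eqI)
    fix c'
    show "c' \<in> c2.missU f W \<longleftrightarrow> c' \<in> missU \<phi> W"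
    proof
      assume "c' \<in> c2.missU f W"
      then obtain u where u: "u \<in> W" "c' \<in> c2.miss f u" by (auto simp: c2.missU_def)
      show "c' \<in> missU \<phi> W"
      proof (cases "u = z")
        case True
        then show ?thesis using u m_z c xW zW by (auto simp: missU_def)
      next
        case False
        then have "c' \<in> miss \<phi> u" using u(2) m_same[of u] m_x by (cases "u = x") auto
        then show ?thesis using u(1) by (auto simp: missU_def)
      qed
    next
      assume "c' \<in> missU \<phi> W"
      then obtain u where u: "u \<in> W" "c' \<in> miss \<phi> u" by (auto simp: missU_def)
      show "c' \<in> c2.missU f W"
      proof (cases "c' = c")
        case True then show ?thesis using m_z zW by (auto simp: c2.missU_def)
      next
        case False
        then have "c' \<in> c2.miss f u" using u(2) m_same[of u] m_z m_x by (cases "u = x"; cases "u = z") auto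
        then show ?thesis using u(1) by (auto simp: c2.missU_def)
      qed
    qed
  qed
  obtain \<delta> d z0 p h h' p' q' where X: "\<delta> < k" "\<delta> \<notin> missU \<phi> W" "d \<in> missU \<phi> W" "z0 \<notin> W" "d \<in> miss \<phi> z0 \<or> \<delta> \<in> miss \<phi> z0"
     "(z0, p) \<in> (adj_via ends {h\<in>ab \<phi> d \<delta>. ends h \<inter> W = {}})\<^sup>*" "h \<in> Es - {e}" "\<phi> h = \<delta>" "ends h = {p, v}" "p \<notin> W" "v \<in> W"
     "h' \<in> Es - {e}" "\<phi> h' = \<delta>" "h' \<noteq> h" "p' \<in> ends h'" "q' \<in> ends h'" "p' \<in> W" "q' \<notin> W"
    using xd unfolding exit_at_def by (elim exE conjE) (rule that)
  have eW: "ends e \<subseteq> W" "ends g \<subseteq> W" using exy g(2) xW zW by simp_all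
  have out: "h \<in> Es - {g} \<and> f h = \<phi> h" if "h \<in> Es - {e}" "q \<in> ends h" "q \<notin> W" for h q
    using that eW fo by auto
  have ne: "ends e \<inter> W \<noteq> {}" "ends g \<inter> W \<noteq> {}" using exy g(2) xW by auto
  have "{h\<in>c2.ab f d \<delta>. ends h \<inter> W = {}} = {h\<in>ab \<phi> d \<delta>. ends h \<inter> W = {}}"
  proof -
    have "h \<in> Es - {g} \<and> (f h = d \<or> f h = \<delta>) \<longleftrightarrow> h \<in> Es - {e} \<and> (\<phi> h = d \<or> \<phi> h = \<delta>)" if "ends h \<inter> W = {}" for h
    proof -
      have "h \<noteq> e" "h \<noteq> g" using that ne by auto
      then show ?thesis using fo[of h] by simp
    qed
    then show ?thesis unfolding c2.ab_def ab_def by blast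
  qed
  then have X6: "(z0, p) \<in> (adj_via ends {h\<in>c2.ab f d \<delta>. ends h \<inter> W = {}})\<^sup>*" using X(6) by simp
  have "z0 \<noteq> x" "z0 \<noteq> z" using X(4) xW zW by auto
  then have X5: "d \<in> c2.miss f z0 \<or> \<delta> \<in> c2.miss f z0" using X(5) m_same by simp
  have h2: "h \<in> Es - {g}" "f h = \<delta>" using out[OF X(7), of p] X(8,9,10) by simp_all
  have h2': "h' \<in> Es - {g}" "f h' = \<delta>" using out[OF X(12,16,18)] X(13) by simp_all
  have "c2.exit_at f W (missU \<phi> W) v"
    by (rule c2.exit_atI[OF X(1-4) X5 X6 h2 X(9-11) h2' X(14-18)])
  then show "good g (\<phi>(e := \<phi> g)) y z W v" using mc W2 mU by (simp add: good_def f_def c_def)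
  show "mgraph.miss (Es - {g}) ends k (\<phi>(e := \<phi> g)) y = miss \<phi> y"
    using m_same[of y] xy yz by (simp add: f_def c_def)
qed

text \<open>An end of the uncoloured edge misses \<open>s + 1\<close> colours, so the chain is one
  step longer than in general; in return only the other end contributes to the offset.\<close>

lemma good_end_chain:
  assumes "good e \<phi> x y W v" "v \<in> {x, y}" shows "chain s \<mu> 1 (s + 1) 3 (card W)"
proof -
  interpret maxconfig Es ends k s \<mu> e \<phi> x y using assms by (simp add: good_def)
  have W: "cl UNIV = W" and xd: "exit_at \<phi> (cl UNIV) (missU \<phi> (cl UNIV)) v" using assms by (auto simp: good_def)
  have v: "v \<in> cl UNIV" using xd unfolding exit_at_def by blast
  have "chain s \<mu> 1 (s + 1) 3 (card (cl UNIV))"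
    by (rule chain_of_exit[OF xd exit_closure_ge_3[OF v]]) (use miss_s1[OF pr assms(2)] assms(2) in simp_all)
  then show ?thesis using W by simp
qed

lemma good_chain:
  assumes "good e \<phi> x y W v" "v \<notin> {x, y}" "a0 \<le> card (mgraph.clo (Es - {e}) ends k \<phi> x y (- mgraph.miss (Es - {e}) ends k \<phi> v))"
  shows "chain s \<mu> 2 s a0 (card W)"
proof -
  interpret maxconfig Es ends k s \<mu> e \<phi> x y using assms by (simp add: good_def)
  have W: "cl UNIV = W" and xd: "exit_at \<phi> (cl UNIV) (missU \<phi> (cl UNIV)) v" using assms by (auto simp: good_def)
  have "chain s \<mu> 2 s a0 (card (cl UNIV))"
    by (rule chain_of_exit[OF xd assms(3)]) (use miss_s[OF pr] assms(2) in simp_all)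
  then show ?thesis using W by simp
qed

lemma good_chain_3:
  assumes "good e \<phi> x y W v"
  shows "chain s \<mu> 1 (s + 1) 3 (card W) \<or> chain s \<mu> 2 s 3 (card W)"
proof (cases "v \<in> {x, y}")
  case True then show ?thesis using good_end_chain[OF assms] by blast
next
  case False
  interpret maxconfig Es ends k s \<mu> e \<phi> x y using assms by (simp add: good_def)
  have "v \<in> cl UNIV" using assms unfolding good_def exit_at_def by blast
  then show ?thesis using good_chain[OF assms False] exit_closure_ge_3 by blast
qed

text \<open>Otherwise a fan shift would make \<open>v\<close> an end of the uncoloured edge.\<close>

lemma shift_avoids:
  assumes nov: "\<And>e \<phi> x y. good e \<phi> x y W v \<Longrightarrow> v \<notin> {x, y}" and gd: "good e \<phi> x y W v"
    and g: "g \<in> Es - {e}" "y \<in> ends g" "\<phi> g \<in> mgraph.miss (Es - {e}) ends k \<phi> x"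
  shows "v \<notin> ends g"
proof -
  interpret maxconfig Es ends k s \<mu> e \<phi> x y using gd by (simp add: good_def)
  obtain z where z: "ends g = {y, z}" using ends_other[OF g(1,2)] by blast
  show ?thesis using nov[OF good_shift(1)[OF gd g(1) z g(3)]] z by simp
qed

text \<open>The estimates for \<open>s = 1\<close> rest on a better start value than 3. If no
  sequence of fan shifts makes \<open>v\<close> an end of the uncoloured edge, the closure
  \<open>U\<close> without the colours of \<open>v\<close> contains \<open>x\<close>,
  \<open>y\<close>, \<open>v\<close> and a fan neighbour \<open>z\<close> of \<open>y\<close>, hence
  at least 5 vertices by parity. If it has exactly 5, then a colour missing at \<open>x\<close> and
  two missing at \<open>y\<close> all lead from \<open>v\<close> to the fifth vertex, impossible for
  \<open>\<mu> = 2\<close>.\<close>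

lemma good_chain_1:
  assumes s: "s = 1" and gd: "good e \<phi> x y W v"
  shows "chain 1 \<mu> 1 2 3 (card W) \<or> chain 1 \<mu> 2 1 (if \<mu> = 2 then 7 else 5) (card W)"
proof (rule disjCI)
  assume no: "\<not> chain 1 \<mu> 2 1 (if \<mu> = 2 then 7 else 5) (card W)"
  show "chain 1 \<mu> 1 2 3 (card W)"
  proof (rule ccontr)
    assume no': "\<not> chain 1 \<mu> 1 2 3 (card W)"
    have nov: "v \<notin> {x, y}" if "good e \<phi> x y W v" for e \<phi> x y
      using good_end_chain[OF that] no' s by (auto simp: numeral_2_eq_2)
    interpret maxconfig Es ends k s \<mu> e \<phi> x y using gd by (simp add: good_def)
    have vxy: "v \<noteq> x" "v \<noteq> y" using nov[OF gd] by simp_all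
    have W: "cl UNIV = W" using gd by (simp add: good_def)
    have vW: "v \<in> W" using gd unfolding good_def exit_at_def by blast
    have elW: "elem \<phi> W" using cl_props(1)[of UNIV] W by simp
    define U where "U = cl (- miss \<phi> v)"
    have UW: "U \<subseteq> W" unfolding U_def W[symmetric] by (rule clo_mono) simp
    have xU: "x \<in> U" "y \<in> U" unfolding U_def by (rule cl_props)+
    have fU: "finite U" unfolding U_def by (rule cl_props)
    \<comment> \<open>If \<open>U\<close> is not everything, a blocked edge leaves it whose colour
      is missing both in \<open>U\<close> and at \<open>v\<close>; by elementarity only
      \<open>v\<close> can miss it.\<close>
    have vU: "v \<in> U"
    proof (rule ccontr)
      assume nv: "v \<notin> U"
      then have "cl (- miss \<phi> v) \<noteq> cl UNIV" using vW W by (auto simp: U_def)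
      then obtain g p q where g: "\<phi> g \<in> missU \<phi> (cl (- miss \<phi> v))" "\<phi> g \<notin> - miss \<phi> v" by (rule clo_exit)
      then obtain w where w: "w \<in> U" "\<phi> g \<in> miss \<phi> w" by (auto simp: missU_def U_def)
      have "w = v" by (rule elemD[OF elW _ vW w(2)]) (use w g UW in auto)
      then show False using w nv by simp
    qed
    have notv: "c \<notin> miss \<phi> v" if "c \<in> miss \<phi> u" "u \<in> {x, y}" for c u
      using elemD[OF elW _ vW that(1)] that(2) xU UW vxy by blast
    have other: "\<exists>g t. g \<in> Es - {e} \<and> ends g = {w, t} \<and> \<phi> g = c \<and> t \<in> U \<and> c \<notin> miss \<phi> t \<and> t \<noteq> w"
      if c: "c \<in> miss \<phi> u" "u \<in> {x, y}" and w: "w \<in> U" "w \<noteq> u" for c u w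
    proof -
      have uU: "u \<in> U" using c(2) xU by blast
      have "c \<notin> miss \<phi> w" using elemD[OF elW _ _ c(1)] w uU UW by blast
      then obtain g where g: "g \<in> Es - {e}" "w \<in> ends g" "\<phi> g = c" using not_miss[OF miss_lt[OF c(1)]] by blast
      obtain t where t: "t \<noteq> w" "ends g = {w, t}" using ends_other[OF g(1,2)] by blast
      have tg: "t \<in> ends g" using t by simp
      have "\<phi> g \<in> missU \<phi> (cl (- miss \<phi> v))" using g(3) c(1) uU by (auto simp: missU_def U_def)
      then have "t \<in> U" using clo_closed[OF g(1,2) tg, of \<phi> x y "- miss \<phi> v"] w(1) notv[OF c] g(3) by (auto simp: U_def)
      moreover have "c \<notin> miss \<phi> t" using missD[of c \<phi> t g] g tg by blast
      ultimately show ?thesis using g t by blast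
    qed
    have oddU: "odd (card U)"
    proof -
      obtain c where c: "c \<in> miss \<phi> x" using miss_ne[OF pr] by blast
      have "c \<in> missU \<phi> (cl (- miss \<phi> v))" using c xU by (auto simp: missU_def U_def)
      then show ?thesis using cl_odd[of c "- miss \<phi> v"] notv[OF c] by (simp add: U_def)
    qed
    have gd': "good e \<phi> y x W v" by (rule good_sym[OF gd])
    have nx: "t \<notin> {x, y, v}" if c: "c \<in> miss \<phi> x" and g: "g \<in> Es - {e}" "ends g = {y, t}" "\<phi> g = c" "c \<notin> miss \<phi> t" "t \<noteq> y" for c g t
    proof -
      have "v \<notin> ends g" by (rule shift_avoids[OF nov gd g(1)]) (use g c in simp_all)
      then show ?thesis using g c by auto
    qed
    have two: "\<exists>c1 c2. c1 \<in> miss \<phi> u \<and> c2 \<in> miss \<phi> u \<and> c1 \<noteq> c2" if "u \<in> {x, y}" for u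
    proof -
      have "2 \<le> card (miss \<phi> u)" using miss_s1[OF pr that] s by simp
      then obtain B where "B \<subseteq> miss \<phi> u" "card B = 2" by (meson obtain_subset_with_card_n)
      then show ?thesis by (auto simp: card_2_iff)
    qed
    obtain a b1 b2 where ab: "a \<in> miss \<phi> x" "b1 \<in> miss \<phi> y" "b2 \<in> miss \<phi> y" "b1 \<noteq> b2"
      using two[of x] two[of y] by blast
    obtain g z where g: "g \<in> Es - {e}" "ends g = {y, z}" "\<phi> g = a" "z \<in> U" "a \<notin> miss \<phi> z" "z \<noteq> y"
      using other[OF ab(1) _ xU(2)] xy by blast
    have z: "z \<notin> {x, y, v}" by (rule nx[OF ab(1) g(1-3,5,6)])
    have sub4: "{x, y, z, v} \<subseteq> U" using xU g(4) vU by blast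
    have c4: "card {x, y, z, v} = 4" using z xy vxy by auto
    have "4 \<le> card U" using card_mono[OF fU sub4] c4 by simp
    then have U5: "5 \<le> card U" using oddU by presburger
    have "\<not> (if \<mu> = 2 then 7 else 5) \<le> card U"
      using good_chain[OF gd, of "if \<mu> = 2 then 7 else 5"] nov[OF gd] no s by (auto simp: U_def)
    then have mu: "\<mu> = 2" and U7: "card U < 7" using U5 by (auto split: if_splits)
    then have "card U = 5" using U5 oddU by presburger
    then have "card (U - {x, y, z, v}) = 1" using sub4 c4 fU by (simp add: card_Diff_subset)
    then obtain w where w: "U - {x, y, z, v} = {w}" by (auto simp: card_1_singleton_iff)
    text \<open>Three edges from \<open>v\<close> must all lead to \<open>w\<close>.\<close>
    have gs: "good g (\<phi>(e := \<phi> g)) y z W v" and my: "mgraph.miss (Es - {g}) ends k (\<phi>(e := \<phi> g)) y = miss \<phi> y"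
      using good_shift[OF gd g(1,2)] g(3) ab(1) by simp_all
    have vw_a: "\<exists>h. h \<in> Es - {e} \<and> ends h = {v, w} \<and> \<phi> h = a"
    proof -
      obtain h t where h: "h \<in> Es - {e}" "ends h = {v, t}" "\<phi> h = a" "t \<in> U" "a \<notin> miss \<phi> t" "t \<noteq> v"
        using other[OF ab(1) _ vU vxy(1)] by blast
      have "t \<noteq> x" using h(5) ab(1) by blast
      moreover have "t \<noteq> y"
      proof
        assume "t = y"
        then have "v \<notin> ends h" using shift_avoids[OF nov gd h(1)] h(2,3) ab(1) by simp
        then show False using h(2) by simp
      qed
      moreover have "t \<noteq> z"
      proof
        assume "t = z"
        then have "h = g" using proper_inj[OF pr h(1) g(1), of z] h(2,3) g(2,3) by simp
        then have "v \<in> {y, z}" using h(2) g(2) by auto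
        then show False using vxy z by auto
      qed
      ultimately have "t = w" using w h(4,6) by blast
      then show ?thesis using h by blast
    qed
    have vw_b: "\<exists>h. h \<in> Es - {e} \<and> ends h = {v, w} \<and> \<phi> h = b" if b: "b \<in> miss \<phi> y" for b
    proof -
      obtain h t where h: "h \<in> Es - {e}" "ends h = {v, t}" "\<phi> h = b" "t \<in> U" "b \<notin> miss \<phi> t" "t \<noteq> v"
        using other[OF b _ vU vxy(2)] by blast
      have "t \<noteq> y" using h(5) b by blast
      moreover have "t \<noteq> x"
      proof
        assume "t = x"
        then have "v \<notin> ends h" using shift_avoids[OF nov gd' h(1)] h(2,3) b by simp
        then show False using h(2) by simp
      qed
      moreover have "t \<noteq> z"
      proof
        assume tz: "t = z"
        have hg: "h \<noteq> g" using h(2) g(2) vxy z by auto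
        have he: "h \<noteq> e" using h(1) by simp
        have "v \<notin> ends h" by (rule shift_avoids[OF nov gs]) (use h hg he tz b my in auto)
        then show False using h(2) by simp
      qed
      ultimately have "t = w" using w h(4,6) by blast
      then show ?thesis using h by blast
    qed
    obtain h0 h1 h2 where h: "h0 \<in> Es - {e}" "ends h0 = {v, w}" "\<phi> h0 = a" "h1 \<in> Es - {e}" "ends h1 = {v, w}" "\<phi> h1 = b1"
      "h2 \<in> Es - {e}" "ends h2 = {v, w}" "\<phi> h2 = b2" using vw_a vw_b[OF ab(2)] vw_b[OF ab(3)] by blast
    have "a \<notin> miss \<phi> y" using no_common[OF pr] ab(1) by blast
    then have "a \<noteq> b1" "a \<noteq> b2" using ab by auto
    then have "h0 \<noteq> h1" "h0 \<noteq> h2" "h1 \<noteq> h2" using h(3,6,9) ab(4) by auto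
    then have "card {h0, h1, h2} = 3" by simp
    moreover have "{h0, h1, h2} \<subseteq> {e' \<in> Es - {e}. ends e' = {v, w}}" using h by blast
    then have "card {h0, h1, h2} \<le> card {e' \<in> Es - {e}. ends e' = {v, w}}" using finEs by (intro card_mono) auto
    moreover have "v \<noteq> w" using w by blast
    ultimately show False using mult'[of v w] mu by simp
  qed
qed

end

section \<open>Iterated closed roots\<close>

text \<open>One round: of at least \<open>n * s + 2\<close> missing colours at most
  \<open>f + 2 * j + 2\<close> are kept off the tail, and all others lead from one new vertex into
  the new part.\<close>

definition grow :: "nat \<Rightarrow> nat \<Rightarrow> nat \<Rightarrow> nat \<Rightarrow> nat \<Rightarrow> nat \<Rightarrow> bool" where
  "grow s \<mu> f j n n' \<longleftrightarrow> odd n \<and> odd n' \<and> n < n' \<and> n * s + 2 \<le> f + 2 * j + 2 + \<mu> * (n' - n - 1)"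

section \<open>Accounting for free and reserved colours\<close>

context tail_root
begin

text \<open>\<open>R\<close> is the set of colours kept off the tail: at the outset all of
  \<open>F\<close> and two more per protected colour. The number \<open>t\<close> bounds how many of
  them have been lost; a round raises \<open>card P + t\<close> by at most one. As long as
  \<open>t\<close> is at most \<open>f\<close>, the reserved pairs fit into \<open>R\<close>, and
  below \<open>f\<close> some free colour survives.\<close>

definition stage :: "'a \<Rightarrow> 'a \<Rightarrow> nat \<Rightarrow> nat \<Rightarrow> nat set \<Rightarrow> ('e \<Rightarrow> nat) \<Rightarrow> ('e \<times> 'a) list \<Rightarrow> nat set \<Rightarrow> bool" where
  "stage x0 y0 f j F \<phi> T R \<longleftrightarrow> stuck \<phi> T R \<and> R \<subseteq> \<Gamma> \<and> F \<subseteq> \<Gamma> \<and> card F \<le> f \<and> x0 \<in> W \<and> y0 \<in> W \<and>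
     (\<forall>\<phi> c d e p q. \<phi> \<in> S \<longrightarrow> c \<in> F \<longrightarrow> d < k \<longrightarrow> d \<notin> \<Gamma> \<longrightarrow> e \<in> A \<longrightarrow> \<phi> e = d \<longrightarrow> p \<in> ends e \<longrightarrow> q \<in> ends e \<longrightarrow>
        p \<in> W \<longrightarrow> q \<notin> W \<longrightarrow> (\<exists>u\<in>W. c \<in> miss \<phi> u \<and> p \<in> kc \<phi> c d u)) \<and>
     card R \<le> f + 2 * card P \<and> (\<exists>t. card P + t \<le> j \<and> f \<le> card (F \<inter> R) + t \<and> f + 2 * card P \<le> card R + t)"

lemma stageD:
  assumes "stage x0 y0 f j F \<phi> T R"
  shows "stuck \<phi> T R" "R \<subseteq> \<Gamma>" "F \<subseteq> \<Gamma>" "card F \<le> f" "x0 \<in> W" "y0 \<in> W" "card R \<le> f + 2 * card P"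
    and "\<And>\<phi> c d e p q. \<phi> \<in> S \<Longrightarrow> c \<in> F \<Longrightarrow> d < k \<Longrightarrow> d \<notin> \<Gamma> \<Longrightarrow> e \<in> A \<Longrightarrow> \<phi> e = d \<Longrightarrow> p \<in> ends e \<Longrightarrow> q \<in> ends e \<Longrightarrow>
        p \<in> W \<Longrightarrow> q \<notin> W \<Longrightarrow> \<exists>u\<in>W. c \<in> miss \<phi> u \<and> p \<in> kc \<phi> c d u"
    and "\<exists>t. card P + t \<le> j \<and> f \<le> card (F \<inter> R) + t \<and> f + 2 * card P \<le> card R + t"
  using assms unfolding stage_def by simp_all

lemma stageI:
  assumes "stuck \<phi> T R" "R \<subseteq> \<Gamma>" "F \<subseteq> \<Gamma>" "card F \<le> f" "x0 \<in> W" "y0 \<in> W" "card R \<le> f + 2 * card P"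
    and "\<And>\<phi> c d e p q. \<phi> \<in> S \<Longrightarrow> c \<in> F \<Longrightarrow> d < k \<Longrightarrow> d \<notin> \<Gamma> \<Longrightarrow> e \<in> A \<Longrightarrow> \<phi> e = d \<Longrightarrow> p \<in> ends e \<Longrightarrow> q \<in> ends e \<Longrightarrow>
        p \<in> W \<Longrightarrow> q \<notin> W \<Longrightarrow> \<exists>u\<in>W. c \<in> miss \<phi> u \<and> p \<in> kc \<phi> c d u"
    and "card P + t \<le> j" "f \<le> card (F \<inter> R) + t" "f + 2 * card P \<le> card R + t"
  shows "stage x0 y0 f j F \<phi> T R"
  unfolding stage_def using assms(1-7,9-11) by (intro conjI allI impI exI[of _ t] assms(8))

lemma stage_elem:
  assumes "stage x0 y0 f j F \<phi> T R" "j \<le> f" "\<psi> \<in> freeze \<phi> T"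
  shows "elem \<psi> (X T (length T))" "2 * card P \<le> card R"
proof -
  show c: "2 * card P \<le> card R" using stageD(9)[OF assms(1)] assms(2) by linarith
  show "elem \<psi> (X T (length T))"
    using stageD(1)[OF assms(1)] freeze_valid[OF assms(3)] freeze_avoid[OF assms(3)] freezeD(1)[OF assms(3)] c
    by (intro elem_avoid[of \<psi> T R]) (use stageD(1,2)[OF assms(1)] in \<open>simp_all add: stuck_def\<close>)
qed

end

section \<open>Rounds of the iteration\<close>

context config
begin

definition root_state :: "nat \<Rightarrow> nat \<Rightarrow> nat \<Rightarrow> bool" where
  "root_state f j n \<longleftrightarrow> (\<exists>W \<Gamma> P S F t. closed_root (Es - {e}) ends k W \<Gamma> P S F \<and> card W = n \<and> x \<in> W \<and> y \<in> W \<and>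
     card F \<le> f \<and> f \<le> card F + t \<and> card P + t \<le> j)"

definition stage_state :: "nat \<Rightarrow> nat \<Rightarrow> nat \<Rightarrow> bool" where
  "stage_state f j n \<longleftrightarrow> (\<exists>W y' \<Gamma> P S G F \<phi> T R. tail_root (Es - {e}) ends k W y' \<Gamma> P S G \<and>
     tail_root.stage (Es - {e}) ends k W y' \<Gamma> P S x y f j F \<phi> T R \<and> card (tail_root.Y W y' T (Suc (length T))) = n)"

text \<open>A closed root without a colour having two exits is tight: it certifies the density.\<close>

definition tight :: "'a set \<Rightarrow> ('e \<Rightarrow> nat) \<Rightarrow> bool" where
  "tight W \<psi> \<longleftrightarrow> finite W \<and> x \<in> W \<and> y \<in> W \<and> proper \<psi> \<and> elem \<psi> W \<and>
     (\<forall>g\<in>Es - {e}. \<forall>p q. p \<in> ends g \<longrightarrow> q \<in> ends g \<longrightarrow> p \<in> W \<longrightarrow> q \<notin> W \<longrightarrow> \<psi> g \<notin> missU \<psi> W) \<and>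
     (\<forall>g1\<in>Es - {e}. \<forall>g2\<in>Es - {e}. \<psi> g1 = \<psi> g2 \<longrightarrow> ends g1 \<inter> W \<noteq> {} \<longrightarrow> \<not> ends g1 \<subseteq> W \<longrightarrow>
        ends g2 \<inter> W \<noteq> {} \<longrightarrow> \<not> ends g2 \<subseteq> W \<longrightarrow> g1 = g2)"

lemma root_two_exits:
  assumes r: "closed_root (Es - {e}) ends k W \<Gamma> P S F" and xy: "x \<in> W" "y \<in> W" and \<psi>: "\<psi> \<in> S" and nt: "\<not> tight W \<psi>"
  obtains \<delta> g1 p1 q1 g2 p2 q2 where "\<delta> < k" "\<delta> \<notin> \<Gamma>"
    "g1 \<in> Es - {e}" "\<psi> g1 = \<delta>" "p1 \<in> ends g1" "q1 \<in> ends g1" "p1 \<in> W" "q1 \<notin> W"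
    "g2 \<in> Es - {e}" "\<psi> g2 = \<delta>" "p2 \<in> ends g2" "q2 \<in> ends g2" "p2 \<in> W" "q2 \<notin> W" "g1 \<noteq> g2"
proof -
  interpret r: closed_root "Es - {e}" ends k W \<Gamma> P S F by (rule r)
  have p: "proper \<psi>" by (rule r.R_proper[OF \<psi>])
  have mU: "missU \<psi> W = \<Gamma>" by (rule r.R_missU[OF \<psi>])
  have cl: "\<forall>g\<in>Es - {e}. \<forall>p q. p \<in> ends g \<longrightarrow> q \<in> ends g \<longrightarrow> p \<in> W \<longrightarrow> q \<notin> W \<longrightarrow> \<psi> g \<notin> missU \<psi> W"
    using r.R_closed[OF \<psi>] mU by blast
  have "\<not> (\<forall>g1\<in>Es - {e}. \<forall>g2\<in>Es - {e}. \<psi> g1 = \<psi> g2 \<longrightarrow> ends g1 \<inter> W \<noteq> {} \<longrightarrow> \<not> ends g1 \<subseteq> W \<longrightarrow>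
        ends g2 \<inter> W \<noteq> {} \<longrightarrow> \<not> ends g2 \<subseteq> W \<longrightarrow> g1 = g2)"
    using nt xy p cl r.R_elem[OF \<psi>] r.R_fin(1) unfolding tight_def by blast
  then obtain g1 g2 where g: "g1 \<in> Es - {e}" "g2 \<in> Es - {e}" "\<psi> g1 = \<psi> g2" "ends g1 \<inter> W \<noteq> {}" "\<not> ends g1 \<subseteq> W"
    "ends g2 \<inter> W \<noteq> {}" "\<not> ends g2 \<subseteq> W" "g1 \<noteq> g2" by blast
  obtain p1 q1 where 1: "p1 \<in> ends g1" "q1 \<in> ends g1" "p1 \<in> W" "q1 \<notin> W" using g(4,5) by blast
  obtain p2 q2 where 2: "p2 \<in> ends g2" "q2 \<in> ends g2" "p2 \<in> W" "q2 \<notin> W" using g(6,7) by blast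
  show ?thesis
    by (rule that[OF proper_lt[OF p g(1)] r.R_closed[OF \<psi> g(1) 1] g(1) refl 1 g(2) g(3)[symmetric] 2 g(8)])
qed

lemma root_state_odd:
  assumes "root_state f j n" shows "odd n"
proof -
  obtain W \<Gamma> P S F where r: "closed_root (Es - {e}) ends k W \<Gamma> P S F" "card W = n" "x \<in> W"
    using assms unfolding root_state_def by blast
  interpret r: closed_root "Es - {e}" ends k W \<Gamma> P S F by (rule r(1))
  obtain \<psi> c where \<psi>: "\<psi> \<in> S" "c \<in> F" using r.R_ne r.R_F(2) by blast
  have c: "c \<in> missU \<psi> W" using r.R_missU[OF \<psi>(1)] \<psi>(2) r.R_F(1) by blast
  have "odd (card W)"
  proof (rule odd_closed[OF r.R_proper[OF \<psi>(1)] r.R_fin(1) r.R_elem[OF \<psi>(1)] c])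
    fix g p q assume "g \<in> Es - {e}" "p \<in> ends g" "q \<in> ends g" "p \<in> W" "q \<notin> W"
    then have "\<psi> g \<notin> \<Gamma>" by (rule r.R_closed[OF \<psi>(1)])
    then show "\<psi> g \<noteq> c" using \<psi>(2) r.R_F(1) by blast
  qed
  then show ?thesis using r(2) by simp
qed

text \<open>A root that is not tight has a colour with two exits. Protecting that colour yields an
  exit vertex, and a stuck tail from it encloses every colour of \<open>\<Gamma> - R\<close>, so
  \<open>growth\<close> applies between the root and the tail.\<close>

lemma root_step:
  assumes st: "root_state f j n" and nt: "\<And>W \<psi>. \<not> tight W \<psi>" and f: "2 \<le> f" "j < f" "f + 2 * j + 1 \<le> n * s"
  shows "\<exists>n'. stage_state f (Suc j) n' \<and> grow s \<mu> f j n n'"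
proof -
  obtain W \<Gamma> P S F t where r: "closed_root (Es - {e}) ends k W \<Gamma> P S F" "card W = n" and xy: "x \<in> W" "y \<in> W"
    and F: "card F \<le> f" "f \<le> card F + t" "card P + t \<le> j" using st unfolding root_state_def by blast
  interpret r: closed_root "Es - {e}" ends k W \<Gamma> P S F by (rule r(1))
  obtain \<phi>0 where \<phi>0: "\<phi>0 \<in> S" using r.R_ne by blast
  obtain \<delta> g1 p1 q1 g2 p2 q2 where \<delta>: "\<delta> < k" "\<delta> \<notin> \<Gamma>"
    "g1 \<in> Es - {e}" "\<phi>0 g1 = \<delta>" "p1 \<in> ends g1" "q1 \<in> ends g1" "p1 \<in> W" "q1 \<notin> W"
    "g2 \<in> Es - {e}" "\<phi>0 g2 = \<delta>" "p2 \<in> ends g2" "q2 \<in> ends g2" "p2 \<in> W" "q2 \<notin> W" "g1 \<noteq> g2"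
    by (rule root_two_exits[OF r(1) xy \<phi>0 nt])
  have p0: "proper \<phi>0" by (rule r.R_proper[OF \<phi>0])
  have c\<Gamma>: "n * s + 2 \<le> card \<Gamma>"
    using card_missU_ge(1)[OF p0 r.R_fin(1) r.R_elem[OF \<phi>0] xy] r.R_missU[OF \<phi>0] r(2) by simp
  define P1 where "P1 = insert \<delta> P"
  have fP1: "finite P1" using r.R_fin by (simp add: P1_def)
  have cP1: "card P1 \<le> Suc (card P)" unfolding P1_def by (rule card_insert_le_m1) (use r.R_fin in auto)
  have fF: "finite F" using r.R_F(1) r.finite_\<Gamma> finite_subset by blast
  have "card (\<Gamma> - F) = card \<Gamma> - card F" using r.R_F(1) fF by (intro card_Diff_subset) auto
  then have "2 * card P1 \<le> card (\<Gamma> - F)" using c\<Gamma> cP1 F f by simp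
  \<comment> \<open>Two colours besides \<open>F\<close> for each protected colour, so that losses
    are charged to the surplus \<open>f\<close> and not to the reserved pairs.\<close>
  then obtain B where B: "B \<subseteq> \<Gamma> - F" "card B = 2 * card P1" by (meson obtain_subset_with_card_n)
  have fB: "finite B" using B(1) r.finite_\<Gamma> finite_subset by blast
  define R where "R = F \<union> B"
  have R: "R \<subseteq> \<Gamma>" "F \<subseteq> R" "F \<inter> R = F" using B r.R_F(1) by (auto simp: R_def)
  have fR: "finite R" using fF fB by (simp add: R_def)
  have cR: "card R = card F + 2 * card P1"
    unfolding R_def using fF fB B by (subst card_Un_disjoint) auto
  obtain G where G: "\<forall>d\<in>P1. G d \<subseteq> R \<and> card (G d) = 2" "\<forall>d\<in>P1. \<forall>d'\<in>P1. G d \<inter> G d' \<noteq> {} \<longrightarrow> d = d'"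
    using disjoint_pairs[OF fP1 fR] cR by auto
  have c2: "2 * card (insert \<delta> P) + 2 \<le> card \<Gamma>" using c\<Gamma> cP1 F f by (simp add: P1_def)
  have G1: "G d \<subseteq> \<Gamma>" "card (G d) = 2" if "d \<in> insert \<delta> P" for d using G(1) that R(1) unfolding P1_def by blast+
  have G2: "d = d'" if "d \<in> insert \<delta> P" "d' \<in> insert \<delta> P" "c \<in> G d" "c \<in> G d'" for d d' c
    using G(2) that unfolding P1_def by blast
  obtain y' S1 where tr: "tail_root (Es - {e}) ends k W y' \<Gamma> (insert \<delta> P) S1 G" and S1: "\<phi>0 \<in> S1" "S1 \<subseteq> S"
    by (rule r.extend[OF \<phi>0 \<delta>(1,2) \<delta>(3-8) \<delta>(9-14) \<delta>(15) c2 G1 G2])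
  interpret t': tail_root "Es - {e}" ends k W y' \<Gamma> P1 S1 G using tr by (simp add: P1_def)
  have "t'.valid \<phi>0 []" "t'.avoid \<phi>0 [] R" using t'.y_W by (simp_all add: t'.valid_def t'.avoid_def)
  then obtain \<psi> T where "t'.stuck \<psi> ([] @ T) R" using t'.stuck_ex[OF S1(1)] by blast
  then have stk: "t'.stuck \<psi> T R" by simp
  have \<psi>: "\<psi> \<in> S1" "\<psi> \<in> S" using stk S1(2) by (auto simp: t'.stuck_def)
  have ex: "\<exists>u\<in>W. c \<in> miss \<phi> u \<and> p \<in> kc \<phi> c d u" if a: "\<phi> \<in> S1" "c \<in> F" "d < k" "d \<notin> \<Gamma>" "e' \<in> Es - {e}" "\<phi> e' = d"
    "p \<in> ends e'" "q \<in> ends e'" "p \<in> W" "q \<notin> W" for \<phi> c d e' p q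
    by (rule r.R_exit[OF subsetD[OF S1(2) a(1)] a(2-10)])
  have cRf: "card R \<le> f + 2 * card P1" using cR F(1) by simp
  have sg: "t'.stage x y f (Suc j) F \<psi> T R"
    by (rule t'.stageI[where t = t, OF stk R(1) r.R_F(1) F(1) xy cRf ex]) (use cP1 F R(3) cR in simp_all)
  let ?X = "t'.Y T (Suc (length T))"
  have \<psi>f: "\<psi> \<in> t'.freeze \<psi> T" by (rule t'.freeze_self[OF \<psi>(1)])
  have elX: "elem \<psi> ?X" by (rule t'.stage_elem(1)[OF sg _ \<psi>f]) (use f in simp)
  have mU: "missU \<psi> W = \<Gamma>" by (rule r.R_missU[OF \<psi>(2)])
  have \<Gamma>X: "\<Gamma> \<subseteq> missU \<psi> ?X" by (rule t'.\<Gamma>_Y[OF \<psi>(1)])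
  have pr\<psi>: "proper \<psi>" by (rule r.R_proper[OF \<psi>(2)])
  have clX: "\<psi> g \<in> R" if "g \<in> Es - {e}" "p \<in> ends g" "q \<in> ends g" "p \<in> ?X" "q \<notin> ?X" "\<psi> g \<in> missU \<psi> ?X" for g p q
    by (rule t'.stuck_closed[OF stk \<psi>f that])
  have y'X: "y' \<in> ?X" using t'.Z_in_Y[of 0 "Suc (length T)" T] by simp
  have WX: "W \<subseteq> ?X" by (rule t'.W_Y)
  have g: "card (\<Gamma> - R) \<le> \<mu> * (card (?X - W) - 1)"
  proof (rule growth[OF pr\<psi> t'.finite_Y elX WX y'X t'.y_W])
    show "\<Gamma> - R \<subseteq> missU \<psi> W" using mU by blast
    fix g p q assume h: "g \<in> Es - {e}" "p \<in> ends g" "q \<in> ends g"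
    show "\<psi> g \<notin> \<Gamma> - R" if "p \<in> W" "q \<notin> W" using r.R_closed[OF \<psi>(2) h that] by blast
    show "\<psi> g \<notin> \<Gamma> - R" if "p \<in> ?X" "q \<notin> ?X" using clX[OF h that] \<Gamma>X by blast
  qed (rule mult')
  have "card (\<Gamma> - R) = card \<Gamma> - card R" using R(1) fR by (intro card_Diff_subset)
  moreover have "card (?X - W) = card ?X - card W" using WX r.R_fin(1) by (intro card_Diff_subset)
  ultimately have g': "n * s + 2 \<le> f + 2 * j + 2 + \<mu> * (card ?X - n - 1)" using g c\<Gamma> cRf cP1 F r(2) by simp
  have "W \<subset> ?X" using WX y'X t'.y_W by blast
  then have lt: "n < card ?X" unfolding r(2)[symmetric] by (rule psubset_card_mono[OF t'.finite_Y])
  have "card R < card \<Gamma>" using cRf cP1 F f c\<Gamma> by simp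
  then have "\<not> \<Gamma> \<subseteq> R" using card_mono[OF fR, of \<Gamma>] by (intro notI) simp
  then obtain c where c: "c \<in> \<Gamma>" "c \<notin> R" by blast
  have "odd (card ?X)"
  proof (rule odd_closed[OF pr\<psi> t'.finite_Y elX])
    show "c \<in> missU \<psi> ?X" using c \<Gamma>X by blast
    then show "\<psi> g \<noteq> c" if "g \<in> Es - {e}" "p \<in> ends g" "q \<in> ends g" "p \<in> ?X" "q \<notin> ?X" for g p q
      using clX[OF that] c(2) by blast
  qed
  then have "grow s \<mu> f j n (card ?X)" using root_state_odd[OF st] lt g' by (simp add: grow_def)
  moreover have "stage_state f (Suc j) (card ?X)"
    unfolding stage_state_def using t'.tail_root_axioms sg by blast
  ultimately show ?thesis by blast
qed

text \<open>Either no frozen recolouring sends a missing colour out of the tail, which is then a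
  closed root at no cost, or some recolouring does. The colour sent out lies in \<open>R\<close> by
  maximality; it is given up and the tail is extended along it.\<close>

lemma stage_step:
  assumes st: "stage_state f j n" and f: "j < f" "f + 2 * j + 1 \<le> n * s" and odd: "odd n"
  shows "root_state f j n \<or> (\<exists>n'. stage_state f (Suc j) n' \<and> grow s \<mu> f j n n')"
proof -
  obtain W y' \<Gamma> P S G F \<phi>' T R where tr: "tail_root (Es - {e}) ends k W y' \<Gamma> P S G"
    and sg: "tail_root.stage (Es - {e}) ends k W y' \<Gamma> P S x y f j F \<phi>' T R"
    and n: "card (tail_root.Y W y' T (Suc (length T))) = n"
    using st unfolding stage_state_def by blast
  interpret t': tail_root "Es - {e}" ends k W y' \<Gamma> P S G by (rule tr)
  let ?X = "t'.Y T (Suc (length T))"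
  note D = t'.stageD[OF sg]
  note stk = D(1) and R = D(2,7) and F = D(3,4) and xW = D(5,6) and ex = D(8)
  obtain t where t: "card P + t \<le> j" "f \<le> card (F \<inter> R) + t" "f + 2 * card P \<le> card R + t"
    using D(9) by blast
  have fR: "finite R" using R(1) t'.fin_\<Gamma> finite_subset by blast
  have fF: "finite F" using F(1) t'.fin_\<Gamma> finite_subset by blast
  have WX: "W \<subseteq> ?X" by (rule t'.W_Y)
  have xX: "x \<in> ?X" "y \<in> ?X" using xW WX by blast+
  have s': "\<phi>' \<in> S" "t'.valid \<phi>' T" "t'.avoid \<phi>' T R" using stk by (simp_all add: t'.stuck_def)
  have cP: "2 * card P \<le> card R" using t f by simp
  have FR: "F \<inter> R \<noteq> {}"
  proof
    assume "F \<inter> R = {}"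
    then show False using t f by simp
  qed
  show ?thesis
  proof (cases "\<exists>\<psi>\<in>t'.freeze \<phi>' T. \<exists>g\<in>Es - {e}. \<exists>p q. p \<in> ends g \<and> q \<in> ends g \<and> p \<in> ?X \<and> q \<notin> ?X \<and> \<psi> g \<in> missU \<phi>' ?X")
    case False
    have "closed_root (Es - {e}) ends k ?X (missU \<phi>' ?X) (P - missU \<phi>' ?X) (t'.freeze \<phi>' T) (F \<inter> R)"
      by (rule t'.new_root[OF stk R(1) cP F(1) FR ex]) (use False in blast)+
    moreover have "card (F \<inter> R) \<le> f" by (rule le_trans[OF card_mono[OF fF Int_lower1] F(2)])
    moreover have "card (P - missU \<phi>' ?X) + t \<le> j"
      using card_mono[OF t'.fin_P Diff_subset, of "missU \<phi>' ?X"] t(1) by simp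
    ultimately have "root_state f j n" unfolding root_state_def using n xX t(2) by blast
    then show ?thesis by blast
  next
    case True
    then obtain \<psi> g p q where \<psi>: "\<psi> \<in> t'.freeze \<phi>' T" and g: "g \<in> Es - {e}" "p \<in> ends g" "q \<in> ends g" "p \<in> ?X" "q \<notin> ?X"
      and gm: "\<psi> g \<in> missU \<phi>' ?X" by blast
    have rR: "\<psi> g \<in> R" by (rule t'.stuck_closed[OF stk \<psi> g gm])
    define R' where "R' = R - {\<psi> g}"
    have cR': "card R = Suc (card R')" using card_Suc_Diff1[OF fR rR] by (simp add: R'_def)
    have R'R: "R' \<subseteq> R" by (auto simp: R'_def)
    have \<psi>S: "\<psi> \<in> S" by (rule t'.freezeD(1)[OF \<psi>])
    have v: "t'.valid \<psi> T" by (rule t'.freeze_valid[OF \<psi> s'(2)])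
    have mU: "missU \<psi> ?X = missU \<phi>' ?X" by (rule t'.freeze_missU[OF \<psi>]) simp
    let ?T = "T @ [(g, q)]"
    have v1: "t'.valid \<psi> ?T" by (rule t'.valid_snoc[OF v g]) (use gm mU in simp)
    have "t'.avoid \<psi> T R'" using t'.freeze_avoid[OF \<psi>, of R] s'(3) R'R unfolding t'.avoid_def by blast
    then have "t'.avoid \<psi> ?T R'" by (simp add: t'.avoid_snoc R'_def)
    then obtain \<psi>2 T1 where f2: "\<psi>2 \<in> t'.freeze \<psi> ?T" and stk2: "t'.stuck \<psi>2 (?T @ T1) R'"
      using t'.stuck_ex[OF \<psi>S v1] by blast
    define T2 where "T2 = ?T @ T1"
    have stk2': "t'.stuck \<psi>2 T2 R'" using stk2 by (simp only: T2_def)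
    let ?X2 = "t'.Y T2 (Suc (length T2))"
    have f2': "\<psi>2 \<in> t'.freeze \<phi>' T" by (rule t'.freeze_trans[OF \<psi> f2])
    have \<psi>2S: "\<psi>2 \<in> S" by (rule t'.freezeD(1)[OF f2])
    have p2: "proper \<psi>2" by (rule t'.S_proper[OF \<psi>2S])
    have card1: "card (F \<inter> R) \<le> Suc (card (F \<inter> R'))"
    proof -
      have "F \<inter> R \<subseteq> insert (\<psi> g) (F \<inter> R')" by (auto simp: R'_def)
      then have "card (F \<inter> R) \<le> card (insert (\<psi> g) (F \<inter> R'))" using fF by (intro card_mono) auto
      also have "\<dots> \<le> Suc (card (F \<inter> R'))" using fF by (simp add: card_insert_if)
      finally show ?thesis .
    qed
    have num: "card P + Suc t \<le> Suc j \<and> f \<le> card (F \<inter> R') + Suc t \<and> f + 2 * card P \<le> card R' + Suc t"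
      using t card1 cR' by simp
    have R2: "R' \<subseteq> \<Gamma>" "card R' \<le> f + 2 * card P" using R R'R cR' by auto
    have sg2: "t'.stage x y f (Suc j) F \<psi>2 T2 R'"
      by (rule t'.stageI[where t = "Suc t", OF stk2' R2(1) F xW R2(2) ex]) (use num in simp_all)
    have \<psi>2f: "\<psi>2 \<in> t'.freeze \<psi>2 T2" by (rule t'.freeze_self[OF \<psi>2S])
    have el2: "elem \<psi>2 ?X2" by (rule t'.stage_elem(1)[OF sg2 _ \<psi>2f]) (use f in simp)
    have mU2: "missU \<psi>2 ?X = missU \<phi>' ?X" by (rule t'.freeze_missU[OF f2']) simp
    have el: "elem \<psi>2 ?X" by (rule t'.stage_elem(1)[OF sg _ f2']) (use f in simp)
    have YT: "t'.Y T2 (Suc (length T)) = ?X" unfolding T2_def using t'.Y_append[of "Suc (length T)" T "[(g, q)] @ T1"] by simp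
    have XX: "?X \<subseteq> ?X2" using t'.Y_mono[of "Suc (length T)" "Suc (length T2)" T2] YT by (simp add: T2_def)
    have "t'.Z T2 (Suc (length T)) = q" by (simp add: T2_def nth_append)
    then have qX: "q \<in> ?X2" using t'.Z_in_Y[of "Suc (length T)" "Suc (length T2)" T2] by (simp add: T2_def)
    define Q where "Q = missU \<psi>2 ?X - R"
    have QX2: "Q \<subseteq> missU \<psi>2 ?X2" using missU_mono[OF XX] unfolding Q_def by blast
    have cl2: "\<psi>2 h \<in> R'" if "h \<in> Es - {e}" "p \<in> ends h" "q \<in> ends h" "p \<in> ?X2" "q \<notin> ?X2" "\<psi>2 h \<in> missU \<psi>2 ?X2" for h p q
      by (rule t'.stuck_closed[OF stk2' \<psi>2f that])
    have gr: "card Q \<le> \<mu> * (card (?X2 - ?X) - 1)"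
    proof (rule growth[OF p2 t'.finite_Y el2 XX qX g(5)])
      show "Q \<subseteq> missU \<psi>2 ?X" by (auto simp: Q_def)
      fix h p q assume h: "h \<in> Es - {e}" "p \<in> ends h" "q \<in> ends h"
      show "\<psi>2 h \<notin> Q" if "p \<in> ?X" "q \<notin> ?X"
        using t'.stuck_closed[OF stk f2' h that] mU2 unfolding Q_def by blast
      show "\<psi>2 h \<notin> Q" if "p \<in> ?X2" "q \<notin> ?X2" using cl2[OF h that] QX2 R'R unfolding Q_def by blast
    qed (rule mult')
    have cm: "n * s + 2 \<le> card (missU \<psi>2 ?X)" using card_missU_ge(1)[OF p2 t'.finite_Y el xX] n by simp
    have "card (missU \<psi>2 ?X) - card R \<le> card Q" unfolding Q_def by (rule diff_card_le_card_Diff[OF fR])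
    moreover have "card (?X2 - ?X) = card ?X2 - n" using card_Diff_subset[OF t'.finite_Y XX] n by simp
    ultimately have gr': "n * s + 2 \<le> f + 2 * j + 2 + \<mu> * (card ?X2 - n - 1)" using gr cm R(2) t(1) by simp
    have "?X \<subset> ?X2" using XX qX g(5) by blast
    then have lt: "n < card ?X2" unfolding n[symmetric] by (rule psubset_card_mono[OF t'.finite_Y])
    have "card R < card (missU \<psi>2 ?X)" using R(2) t(1) f cm by simp
    then have "\<not> missU \<psi>2 ?X \<subseteq> R" using card_mono[OF fR, of "missU \<psi>2 ?X"] by (intro notI) simp
    then obtain c where c: "c \<in> Q" "c \<notin> R'" using R'R unfolding Q_def by blast
    have "odd (card ?X2)"
    proof (rule odd_closed[OF p2 t'.finite_Y el2])
      show "c \<in> missU \<psi>2 ?X2" using c QX2 by blast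
      then show "\<psi>2 h \<noteq> c" if "h \<in> Es - {e}" "p \<in> ends h" "q \<in> ends h" "p \<in> ?X2" "q \<notin> ?X2" for h p q
        using cl2[OF that] c(2) by blast
    qed
    then have "grow s \<mu> f j n (card ?X2)" using odd lt gr' by (simp add: grow_def)
    moreover have "stage_state f (Suc j) (card ?X2)"
      unfolding stage_state_def using tr sg2 by blast
    ultimately show ?thesis by blast
  qed
qed

lemma root_state_bound: assumes "root_state f j n" shows "n * s + 2 \<le> k"
proof -
  obtain W \<Gamma> P S F where r: "closed_root (Es - {e}) ends k W \<Gamma> P S F" "card W = n" "x \<in> W" "y \<in> W"
    using assms unfolding root_state_def by blast
  interpret r: closed_root "Es - {e}" ends k W \<Gamma> P S F by (rule r(1))
  obtain \<psi> where \<psi>: "\<psi> \<in> S" using r.R_ne by blast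
  have "n * s + 2 \<le> card (missU \<psi> W)"
    using card_missU_ge(1)[OF r.R_proper[OF \<psi>] r.R_fin(1) r.R_elem[OF \<psi>] r(3,4)] r(2) by simp
  also have "\<dots> \<le> card {..<k}" by (intro card_mono) (auto simp: missU_def dest: miss_lt)
  finally show ?thesis by simp
qed

lemma stage_state_bound: assumes "stage_state f j n" "j \<le> f" shows "n * s + 2 \<le> k"
proof -
  obtain W y' \<Gamma> P S G F \<phi>' T R where tr: "tail_root (Es - {e}) ends k W y' \<Gamma> P S G"
    and sg: "tail_root.stage (Es - {e}) ends k W y' \<Gamma> P S x y f j F \<phi>' T R"
    and n: "card (tail_root.Y W y' T (Suc (length T))) = n"
    using assms unfolding stage_state_def by blast
  interpret t': tail_root "Es - {e}" ends k W y' \<Gamma> P S G by (rule tr)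
  have s': "\<phi>' \<in> S" and xW: "x \<in> W" "y \<in> W" using t'.stageD(1,5,6)[OF sg] by (simp_all add: t'.stuck_def)
  let ?X = "t'.Y T (Suc (length T))"
  have xX: "x \<in> ?X" "y \<in> ?X" using xW t'.W_Y by blast+
  have "n * s + 2 \<le> card (missU \<phi>' ?X)"
    using card_missU_ge(1)[OF t'.S_proper[OF s'] t'.finite_Y t'.stage_elem(1)[OF sg assms(2) t'.freeze_self[OF s']] xX] n by simp
  also have "\<dots> \<le> card {..<k}" by (intro card_mono) (auto simp: missU_def dest: miss_lt)
  finally show ?thesis by simp
qed

text \<open>Turning a stage into a root costs nothing; only enlargements are counted. Sizes are odd
  and so rise by at least 2 per round, which keeps \<open>f + 2 * j + 1 \<le> a j * s\<close> true
  while the number of protected colours rises.\<close>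

lemma process:
  assumes st: "root_state f 0 n1" and nt: "\<And>W \<psi>. \<not> tight W \<psi>" and f: "2 \<le> f" "f + 1 \<le> n1 * s"
  shows "\<exists>a. a 0 = n1 \<and> (\<forall>j<f. grow s \<mu> f j (a j) (a (Suc j))) \<and> a f * s + 2 \<le> k"
proof -
  have "\<exists>a. a 0 = n1 \<and> (\<forall>i<j. grow s \<mu> f i (a i) (a (Suc i))) \<and> odd (a j) \<and> n1 + 2 * j \<le> a j \<and>
    (root_state f j (a j) \<or> stage_state f j (a j))" if "j \<le> f" for j
    using that
  proof (induction j)
    case 0 show ?case using st root_state_odd[OF st] by (intro exI[of _ "\<lambda>_. n1"]) simp
  next
    case (Suc j)
    from Suc.IH[OF Suc_leD[OF Suc.prems]] obtain a where a: "a 0 = n1" "\<forall>i<j. grow s \<mu> f i (a i) (a (Suc i))" "odd (a j)"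
      "n1 + 2 * j \<le> a j" "root_state f j (a j) \<or> stage_state f j (a j)" by blast
    have jf: "j < f" using Suc.prems by simp
    have "f + 2 * j + 1 \<le> (n1 + 2 * j) * s"
    proof -
      have "2 * j * 1 \<le> 2 * j * s" by (rule mult_le_mono2[OF s1])
      then show ?thesis using f(2) unfolding add_mult_distrib by linarith
    qed
    also have "\<dots> \<le> a j * s" using a(4) by (rule mult_le_mono1)
    finally have f': "f + 2 * j + 1 \<le> a j * s" .
    obtain n' where n': "stage_state f (Suc j) n'" "grow s \<mu> f j (a j) n'"
      using a(5) root_step[OF _ nt f(1) jf f'] stage_step[OF _ jf f' a(3)] by blast
    have o: "odd n'" "a j < n'" using n'(2) by (simp_all add: grow_def)
    have "a j + 2 \<le> n'" by (rule odd_gap[OF a(3) o])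
    moreover have "\<forall>i<Suc j. grow s \<mu> f i ((a(Suc j := n')) i) ((a(Suc j := n')) (Suc i))"
      using a(2) n'(2) by (auto simp: less_Suc_eq)
    ultimately show ?case using a(1,4) n'(1) o(1) by (intro exI[of _ "a(Suc j := n')"]) simp
  qed
  from this[OF order_refl] obtain a where "a 0 = n1" "\<forall>i<f. grow s \<mu> f i (a i) (a (Suc i))"
    "root_state f f (a f) \<or> stage_state f f (a f)" by blast
  then show ?thesis using root_state_bound stage_state_bound by blast
qed

end

lemma root_shrink:
  assumes "closed_root A ends k W \<Gamma> P S F" "F' \<subseteq> F" "F' \<noteq> {}"
  shows "closed_root A ends k W \<Gamma> P S F'"
proof -
  interpret r: closed_root A ends k W \<Gamma> P S F by (rule assms(1))
  show ?thesis
    using r.R_proper r.R_missU r.R_elem r.R_closed r.R_swap r.R_fin r.R_P r.R_F r.R_miss r.R_ne assms(2,3)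
    by unfold_locales (auto intro: r.R_exit simp del: subset_iff)
qed

section \<open>Tight sets and the density\<close>

context config
begin

text \<open>A colour leaves at most one vertex of \<open>W\<close> without an edge inside
  \<open>W\<close>: if it is missing in \<open>W\<close>, it is missing once and has no exit;
  otherwise it has at most one exit. So each of the \<open>k\<close> colours has at least
  \<open>card W div 2\<close> edges in \<open>W\<close>, and the uncoloured edge comes on
  top.\<close>

lemma tight_count:
  assumes "tight W \<psi>"
  shows "odd (card W)" "3 \<le> card W" "k * (card W div 2) + 1 \<le> card {g\<in>Es. ends g \<subseteq> W}"
    and "\<And>v. v \<in> W \<Longrightarrow> v \<noteq> x \<Longrightarrow> \<exists>g\<in>Es. v \<in> ends g"
proof -
  have fW: "finite W" and xW: "x \<in> W" "y \<in> W" and p: "proper \<psi>" and el: "elem \<psi> W"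
    and cl: "\<And>g p q. g \<in> Es - {e} \<Longrightarrow> p \<in> ends g \<Longrightarrow> q \<in> ends g \<Longrightarrow> p \<in> W \<Longrightarrow> q \<notin> W \<Longrightarrow> \<psi> g \<notin> missU \<psi> W"
    and un: "\<And>g1 g2. g1 \<in> Es - {e} \<Longrightarrow> g2 \<in> Es - {e} \<Longrightarrow> \<psi> g1 = \<psi> g2 \<Longrightarrow> ends g1 \<inter> W \<noteq> {} \<Longrightarrow> \<not> ends g1 \<subseteq> W \<Longrightarrow>
        ends g2 \<inter> W \<noteq> {} \<Longrightarrow> \<not> ends g2 \<subseteq> W \<Longrightarrow> g1 = g2"
    using assms unfolding tight_def by blast+
  obtain c0 where c0: "c0 \<in> miss \<psi> x" using miss_ne[OF p] by blast
  have c0W: "c0 \<in> missU \<psi> W" using c0 xW unfolding missU_def by blast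
  show o: "odd (card W)"
  proof (rule odd_closed[OF p fW el c0W])
    fix g p q assume "g \<in> Es - {e}" "p \<in> ends g" "q \<in> ends g" "p \<in> W" "q \<notin> W"
    then have "\<psi> g \<notin> missU \<psi> W" by (rule cl)
    then show "\<psi> g \<noteq> c0" using c0W by blast
  qed
  have "card {x, y} \<le> card W" using xW by (intro card_mono[OF fW]) blast
  then have "2 \<le> card W" using xy by simp
  then show "3 \<le> card W" by (rule odd_ge_3[OF o])
  show "\<exists>g\<in>Es. v \<in> ends g" if v: "v \<in> W" "v \<noteq> x" for v
  proof (rule ccontr)
    assume no: "\<not> ?thesis"
    have "c0 \<in> miss \<psi> v" unfolding miss_def using no miss_lt[OF c0] by blast
    then show False using elemD[OF el v(1) xW(1) _ c0] v(2) by blast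
  qed
  define H where "H c = {g\<in>Es - {e}. \<psi> g = c \<and> ends g \<subseteq> W}" for c
  have fH: "finite (H c)" for c using finEs by (simp add: H_def)
  have cH: "card W div 2 \<le> card (H c)" if ck: "c < k" for c
  proof -
    have hs: "(\<Sum>v\<in>W. deg_in ends (H c) v) = 2 * card {g\<in>H c. ends g \<subseteq> W}"
      by (rule handshake[where ends = ends, OF fH _ fW]) (use card2 in \<open>auto simp: H_def\<close>)
    have "{g\<in>H c. ends g \<subseteq> W} = H c" by (auto simp: H_def)
    then have hs: "(\<Sum>v\<in>W. deg_in ends (H c) v) = 2 * card (H c)" using hs by simp
    define B where "B = {v\<in>W. deg_in ends (H c) v = 0}"
    have cases: "c \<in> miss \<psi> v \<or> (\<exists>g\<in>Es - {e}. \<psi> g = c \<and> v \<in> ends g \<and> \<not> ends g \<subseteq> W)" if "v \<in> B" for v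
    proof (rule disjCI)
      assume no: "\<not> (\<exists>g\<in>Es - {e}. \<psi> g = c \<and> v \<in> ends g \<and> \<not> ends g \<subseteq> W)"
      show "c \<in> miss \<psi> v"
      proof (rule ccontr)
        assume "c \<notin> miss \<psi> v"
        then obtain g where g: "g \<in> Es - {e}" "v \<in> ends g" "\<psi> g = c" using not_miss[OF ck] by blast
        then have "g \<in> {g\<in>H c. v \<in> ends g}" using no by (auto simp: H_def)
        then have "deg_in ends (H c) v \<noteq> 0" unfolding deg_in_def using fH[of c] by auto
        then show False using that by (simp add: B_def)
      qed
    qed
    have B1: "u = v" if uv: "u \<in> B" "v \<in> B" for u v
    proof -
      have W: "u \<in> W" "v \<in> W" using uv by (auto simp: B_def)
      have mix: False if m: "c \<in> miss \<psi> w" "w \<in> W" "g \<in> Es - {e}" "\<psi> g = c" "w' \<in> ends g" "w' \<in> W" "\<not> ends g \<subseteq> W" for w w' g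
      proof -
        obtain q where "q \<in> ends g" "q \<notin> W" using m(7) by blast
        then have "\<psi> g \<notin> missU \<psi> W" using cl[OF m(3,5) _ m(6)] by blast
        then show False using m(1,2,4) unfolding missU_def by blast
      qed
      show ?thesis
      proof (cases "c \<in> miss \<psi> u \<or> c \<in> miss \<psi> v")
        case True
        then show ?thesis using cases[OF uv(1)] cases[OF uv(2)] mix W elemD[OF el W] by blast
      next
        case False
        then obtain g h where g: "g \<in> Es - {e}" "\<psi> g = c" "u \<in> ends g" "\<not> ends g \<subseteq> W"
          and h: "h \<in> Es - {e}" "\<psi> h = c" "v \<in> ends h" "\<not> ends h \<subseteq> W" using cases[OF uv(1)] cases[OF uv(2)] by blast
        have "ends g \<inter> W \<noteq> {}" "ends h \<inter> W \<noteq> {}" using g h W by blast+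
        then have gh: "g = h" using un[OF g(1) h(1) _ _ g(4) _ h(4)] g(2) h(2) by simp
        obtain q where q: "ends g = {u, q}" using ends_other[OF g(1,3)] by blast
        then have "v = u \<or> v = q" using h(3) gh by simp
        then show ?thesis using q g(4) W by auto
      qed
    qed
    have fB: "finite B" using fW by (simp add: B_def)
    have cB: "card B \<le> 1" using B1 fB by (auto simp: card_le_Suc0_iff_eq)
    have "card (W - B) \<le> (\<Sum>v\<in>W - B. deg_in ends (H c) v)"
    proof -
      have "(\<Sum>v\<in>W - B. 1) \<le> (\<Sum>v\<in>W - B. deg_in ends (H c) v)" by (intro sum_mono) (auto simp: B_def)
      then show ?thesis by simp
    qed
    also have "\<dots> \<le> (\<Sum>v\<in>W. deg_in ends (H c) v)" using fW by (intro sum_mono2) auto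
    finally have "card (W - B) \<le> 2 * card (H c)" using hs by simp
    moreover have "card (W - B) = card W - card B" using fB by (intro card_Diff_subset) (auto simp: B_def)
    ultimately show ?thesis using cB by simp
  qed
  have "k * (card W div 2) \<le> (\<Sum>c<k. card (H c))"
    using sum_mono[of "{..<k}" "\<lambda>_. card W div 2" "\<lambda>c. card (H c)"] cH by simp
  also have "\<dots> = card (\<Union>c<k. H c)" by (rule card_UN_disjoint[symmetric]) (use fH in \<open>auto simp: H_def\<close>)
  also have "\<dots> \<le> card {g\<in>Es - {e}. ends g \<subseteq> W}" using finEs by (intro card_mono) (auto simp: H_def)
  finally have 1: "k * (card W div 2) \<le> card {g\<in>Es - {e}. ends g \<subseteq> W}" .
  have "{g\<in>Es. ends g \<subseteq> W} = insert e {g\<in>Es - {e}. ends g \<subseteq> W}" using eEs exy xW by auto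
  then have "card {g\<in>Es. ends g \<subseteq> W} = Suc (card {g\<in>Es - {e}. ends g \<subseteq> W})" using finEs by simp
  then show "k * (card W div 2) + 1 \<le> card {g\<in>Es. ends g \<subseteq> W}" using 1 by simp
qed

end

section \<open>The initial root\<close>

context maxconfig
begin

text \<open>By \<open>few_colours\<close> some tail spans \<open>W\<close> with at most
  \<open>(card W - 1) / 2\<close> colours; the other missing colours, out of at least
  \<open>card W * s + 2\<close>, are free. The inequality is doubled to avoid the fraction.\<close>

lemma first_root:
  obtains S F where "closed_root (Es - {e}) ends k W \<Gamma>W {} S F" "\<phi> \<in> S" "2 * card W * s + 5 \<le> 2 * card F + card W"
proof -
  obtain U where U: "cl U = W" "U \<subseteq> \<Gamma>W" "2 * card U + 1 \<le> card W" by (rule few_colours)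
  obtain T where T: "t.valid \<phi> T" "t.Y T (Suc (length T)) = cl U" "\<And>i. i < length T \<Longrightarrow> \<phi> (t.E T i) \<in> U"
    by (rule clo_tail[of U]) blast
  define F where "F = {c\<in>\<Gamma>W. \<forall>i<length T. \<phi> (t.E T i) \<noteq> c}"
  have c\<Gamma>: "card W * s + 2 \<le> card \<Gamma>W" by (rule card_missU_ge(1)[OF pr cl_props(2,1,3,4)])
  have fU: "finite U" using U(2) finite_missU finite_subset by blast
  have "\<Gamma>W - U \<subseteq> F" using T(3) by (auto simp: F_def)
  then have "card (\<Gamma>W - U) \<le> card F" by (intro card_mono) (auto simp: F_def)
  moreover have "card (\<Gamma>W - U) = card \<Gamma>W - card U" by (rule card_Diff_subset[OF fU U(2)])
  ultimately have num: "card W * s + 2 \<le> card F + card U" using c\<Gamma> by simp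
  have "card W * 1 \<le> card W * s" by (rule mult_le_mono2[OF s1])
  then have "0 < card F" using num U(3) by linarith
  then have "F \<noteq> {}" by auto
  then have "closed_root (Es - {e}) ends k W \<Gamma>W {} (t.freeze \<phi> T) F"
    using T U(1) by (intro spanning_root[OF _ _ F_def]) simp_all
  moreover have "2 * card W * s + 5 \<le> 2 * card F + card W" using num U(3) by simp
  ultimately show ?thesis using that t.freeze_self[OF \<phi>S0] by blast
qed

lemma first_state:
  assumes "1 \<le> f" "2 * f + card W \<le> 2 * card W * s + 5"
  shows "root_state f 0 (card W)"
proof -
  obtain S F where r: "closed_root (Es - {e}) ends k W \<Gamma>W {} S F" "2 * card W * s + 5 \<le> 2 * card F + card W"
    by (rule first_root)
  have "f \<le> card F" using r(2) assms(2) by simp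
  then obtain F' where F': "F' \<subseteq> F" "card F' = f" by (meson obtain_subset_with_card_n)
  have "F' \<noteq> {}" using F'(2) assms(1) by auto
  then have "closed_root (Es - {e}) ends k W \<Gamma>W {} S F'" by (rule root_shrink[OF r(1) F'(1)])
  then show ?thesis unfolding root_state_def
    using F'(2) cl_props(3,4) by (intro exI[of _ W] exI[of _ \<Gamma>W] exI[of _ "{}"] exI[of _ S] exI[of _ F'] exI[of _ 0]) simp
qed

lemma good_ex:
  assumes nt: "\<not> tight W \<phi>" shows "\<exists>v. good e \<phi> x y W v"
proof -
  obtain S F where r: "closed_root (Es - {e}) ends k W \<Gamma>W {} S F" "\<phi> \<in> S" by (rule first_root)
  interpret r: closed_root "Es - {e}" ends k W \<Gamma>W "{}" S F by (rule r(1))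
  obtain \<delta> g1 p1 q1 g2 p2 q2 where \<delta>: "\<delta> < k" "\<delta> \<notin> \<Gamma>W"
    "g1 \<in> Es - {e}" "\<phi> g1 = \<delta>" "p1 \<in> ends g1" "q1 \<in> ends g1" "p1 \<in> W" "q1 \<notin> W"
    "g2 \<in> Es - {e}" "\<phi> g2 = \<delta>" "p2 \<in> ends g2" "q2 \<in> ends g2" "p2 \<in> W" "q2 \<notin> W" "g1 \<noteq> g2"
    by (rule root_two_exits[OF r(1) cl_props(3,4) r(2) nt])
  have "\<exists>v. exit_at \<phi> W \<Gamma>W v" by (rule r.exit_at_ex[OF r(2) \<delta>])
  then show ?thesis using maxconfig_axioms by (auto simp: good_def)
qed

text \<open>More than \<open>(card W - 1) * s\<close> colours are missing in \<open>W\<close> but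
  not at \<open>y\<close>. Their edges at \<open>y\<close> stay in \<open>W\<close>, and at most
  \<open>\<mu>\<close> of them go to each other vertex.\<close>

lemma s_less_\<mu>: "s < \<mu>"
proof -
  define Q where "Q = \<Gamma>W - miss \<phi> y"
  have fD: "finite (W - {y})" using cl_props(2) by blast
  have "Q \<subseteq> \<phi> ` (\<Union>w\<in>W - {y}. {g\<in>Es - {e}. ends g = {y, w}})"
  proof
    fix c assume c: "c \<in> Q"
    then have "c < k" "c \<notin> miss \<phi> y" by (auto simp: Q_def missU_def dest: miss_lt)
    then obtain g where g: "g \<in> Es - {e}" "y \<in> ends g" "\<phi> g = c" using not_miss by blast
    obtain w where w: "w \<noteq> y" "ends g = {y, w}" using ends_other[OF g(1,2)] by blast
    have "w \<in> W"
    proof (rule ccontr)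
      assume "w \<notin> W"
      then have "\<phi> g \<notin> UNIV" using g(3) c w cl_props(4) by (intro clo_closed[OF g(1,2)]) (auto simp: Q_def)
      then show False by simp
    qed
    then show "c \<in> \<phi> ` (\<Union>w\<in>W - {y}. {g\<in>Es - {e}. ends g = {y, w}})" using g w by blast
  qed
  then have "card Q \<le> card (\<phi> ` (\<Union>w\<in>W - {y}. {g\<in>Es - {e}. ends g = {y, w}}))"
    using fD finEs by (intro card_mono) auto
  also have "\<dots> \<le> card (\<Union>w\<in>W - {y}. {g\<in>Es - {e}. ends g = {y, w}})" using fD finEs by (intro card_image_le) auto
  also have "\<dots> \<le> (\<Sum>w\<in>W - {y}. card {g\<in>Es - {e}. ends g = {y, w}})" by (rule card_UN_le[OF fD])
  also have "\<dots> \<le> (\<Sum>w\<in>W - {y}. \<mu>)" using mult' by (intro sum_mono) auto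
  also have "\<dots> = (card W - 1) * \<mu>" using cl_props(2,4) by simp
  finally have 1: "card Q \<le> (card W - 1) * \<mu>" .
  have "(card W - 1) * s + 1 \<le> card Q"
    using card_missU_ge(2)[OF pr cl_props(2,1,3,4), of y UNIV] cl_props(4)[of UNIV] by (simp add: Q_def)
  then have "(card W - 1) * s < (card W - 1) * \<mu>" using 1 by linarith
  then show ?thesis by simp
qed

end

text \<open>The combinatorial outcome on which the estimates work. It is quantified over
  \<open>f\<close> because different estimates favour different numbers of rounds; the third
  condition says that the initial root has \<open>f\<close> free colours.\<close>

definition steps :: "nat \<Rightarrow> nat \<Rightarrow> nat \<Rightarrow> nat \<Rightarrow> bool" where
  "steps s \<mu> k n \<longleftrightarrow> (\<forall>f. 2 \<le> f \<longrightarrow> f + 1 \<le> n * s \<longrightarrow> 2 * f + n \<le> 2 * n * s + 5 \<longrightarrow>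
     (\<exists>a. a 0 = n \<and> (\<forall>j<f. grow s \<mu> f j (a j) (a (Suc j))) \<and> a f * s + 2 \<le> k))"

text \<open>Tightness is tested for all sets and colourings belonging to the chosen configuration,
  so in the second case every root met in the iteration has a colour with two exits.\<close>

lemma (in dgraph) dichotomy:
  assumes "e0 \<in> Es" "proper_edge_colouring (Es - {e0}) ends k \<phi>0"
  shows "(\<exists>W. finite W \<and> W \<subseteq> \<Union>(ends ` Es) \<and> odd (card W) \<and> 3 \<le> card W \<and> k * (card W div 2) + 1 \<le> card {g\<in>Es. ends g \<subseteq> W}) \<or>
    (\<exists>n. s < \<mu> \<and> steps s \<mu> k n \<and> (chain s \<mu> 1 (s + 1) 3 n \<or> chain s \<mu> 2 s 3 n) \<and>
       (s = 1 \<longrightarrow> chain 1 \<mu> 1 2 3 n \<or> chain 1 \<mu> 2 1 (if \<mu> = 2 then 7 else 5) n))"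
proof -
  define Q where "Q n \<longleftrightarrow> (\<exists>e \<phi> x y. config Es ends k s \<mu> e \<phi> x y \<and> card (mgraph.clo (Es - {e}) ends k \<phi> x y UNIV) = n)" for n
  obtain x0 y0 where "ends e0 = {x0, y0}" using Es2[OF assms(1)] by (meson card_2_iff)
  then have "config Es ends k s \<mu> e0 \<phi>0 x0 y0" by unfold_locales (use assms in auto)
  then have Q0: "Q (card (mgraph.clo (Es - {e0}) ends k \<phi>0 x0 y0 UNIV))" unfolding Q_def by blast
  have fin: "finite (\<Union>(ends ` Es))" using finEs Es2 by (metis (no_types, lifting) card.infinite finite_UN_I zero_neq_numeral)
  have bd: "n \<le> card (\<Union>(ends ` Es))" if q: "Q n" for n
  proof -
    obtain e \<phi> x y where c: "config Es ends k s \<mu> e \<phi> x y" "card (mgraph.clo (Es - {e}) ends k \<phi> x y UNIV) = n"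
      using q unfolding Q_def by blast
    interpret c: config Es ends k s \<mu> e \<phi> x y by (rule c(1))
    have ex: "x \<in> \<Union>(ends ` Es)" "y \<in> \<Union>(ends ` Es)" using c.eEs c.exy by blast+
    have "c.cl UNIV \<subseteq> \<Union>(ends ` Es)"
      by (rule c.clo_least[OF ex]) blast
    then show ?thesis using card_mono[OF fin] c(2) by blast
  qed
  obtain n where n: "Q n" "\<And>m. Q m \<Longrightarrow> m \<le> n"
    using GreatestI_nat[of Q, OF Q0 bd] Greatest_le_nat[of Q _ "card (\<Union>(ends ` Es))", OF _ bd] by blast
  obtain e \<phi> x y where c: "config Es ends k s \<mu> e \<phi> x y" "card (mgraph.clo (Es - {e}) ends k \<phi> x y UNIV) = n"
    using n(1) unfolding Q_def by blast
  interpret config Es ends k s \<mu> e \<phi> x y by (rule c(1))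
  interpret maxconfig Es ends k s \<mu> e \<phi> x y
  proof unfold_locales
    fix e' \<phi>' x' y' assume "config Es ends k s \<mu> e' \<phi>' x' y'"
    then have "Q (card (mgraph.clo (Es - {e'}) ends k \<phi>' x' y' UNIV))" unfolding Q_def by blast
    then show "card (mgraph.clo (Es - {e'}) ends k \<phi>' x' y' UNIV) \<le> card (cl UNIV)" using n(2) c(2) by simp
  qed
  show ?thesis
  proof (cases "\<exists>W \<psi>. tight W \<psi>")
    case True
    then obtain W' \<psi> where t: "tight W' \<psi>" by blast
    have "finite W'" using t by (simp add: tight_def)
    moreover have "W' \<subseteq> \<Union>(ends ` Es)"
    proof
      fix v assume v: "v \<in> W'"
      show "v \<in> \<Union>(ends ` Es)"
      proof (cases "v = x")
        case True then show ?thesis using eEs exy by blast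
      next
        case False then show ?thesis using tight_count(4)[OF t v] by blast
      qed
    qed
    ultimately show ?thesis using tight_count(1-3)[OF t] by blast
  next
    case False
    then have nt: "\<not> tight W' \<psi>" for W' \<psi> by blast
    obtain v where v: "good e \<phi> x y W v" using good_ex[OF nt] by blast
    have "steps s \<mu> k (card W)" unfolding steps_def
    proof (intro allI impI)
      fix f :: nat assume f: "2 \<le> f" "f + 1 \<le> card W * s" "2 * f + card W \<le> 2 * card W * s + 5"
      have "root_state f 0 (card W)" using f by (intro first_state) simp_all
      then show "\<exists>a. a 0 = card W \<and> (\<forall>j<f. grow s \<mu> f j (a j) (a (Suc j))) \<and> a f * s + 2 \<le> k"
        by (rule process[OF _ nt f(1,2)])
    qed
    then show ?thesis using s_less_\<mu> good_chain_3[OF v] good_chain_1[OF _ v] by blast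
  qed
qed

section \<open>Numerical estimates\<close>

text \<open>Least even \<open>d\<close> with \<open>g \<le> \<mu> * (d - 1)\<close>.\<close>

definition inc :: "nat \<Rightarrow> nat \<Rightarrow> nat" where
  "inc \<mu> g = (let d = (g + \<mu> - 1) div \<mu> + 1 in d + d mod 2)"

definition cstep :: "nat \<Rightarrow> nat \<Rightarrow> nat \<Rightarrow> nat \<Rightarrow> nat \<Rightarrow> nat" where
  "cstep s \<mu> \<epsilon> j a = a + inc \<mu> ((a - 1) * s + \<epsilon>)"

definition cit :: "nat \<Rightarrow> nat \<Rightarrow> nat \<Rightarrow> nat \<Rightarrow> nat \<Rightarrow> nat" where
  "cit s \<mu> \<epsilon> q a = fold (cstep s \<mu> \<epsilon>) [0..<q] a"

text \<open>The smallest next size that \<open>grow\<close> permits. For small \<open>s\<close> this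
  recurrence is evaluated exactly, because the exponential estimate loses too much there.\<close>

definition gstep :: "nat \<Rightarrow> nat \<Rightarrow> nat \<Rightarrow> nat \<Rightarrow> nat \<Rightarrow> nat" where
  "gstep s \<mu> f j n = n + inc \<mu> (n * s - (f + 2 * j))"

definition git :: "nat \<Rightarrow> nat \<Rightarrow> nat \<Rightarrow> nat \<Rightarrow> nat" where
  "git s \<mu> f n = fold (gstep s \<mu> f) [0..<f] n"

lemma round_even_mono: assumes "d \<le> d'" shows "d + d mod 2 \<le> d' + d' mod (2::nat)"
proof (cases "d = d'")
  case False
  have "d mod 2 < 2" by simp
  then show ?thesis using False assms by linarith
qed simp

lemma inc_mono: assumes "g \<le> g'" shows "inc \<mu> g \<le> inc \<mu> g'"
proof -
  have "g + \<mu> - 1 \<le> g' + \<mu> - 1" using assms by linarith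
  then have "(g + \<mu> - 1) div \<mu> \<le> (g' + \<mu> - 1) div \<mu>" by (rule div_le_mono)
  then have "(g + \<mu> - 1) div \<mu> + 1 \<le> (g' + \<mu> - 1) div \<mu> + 1" by (rule add_right_mono)
  then show ?thesis unfolding inc_def Let_def by (rule round_even_mono)
qed

lemma inc_le:
  assumes "odd a" "odd b" "a < b" "g \<le> \<mu> * (b - a - 1)" "0 < \<mu>" shows "a + inc \<mu> g \<le> b"
proof -
  obtain D where D: "b = a + D" "0 < D" using assms(3) by (metis less_imp_add_positive)
  have ev: "even D" using assms(1,2) D by simp
  have "g + \<mu> - 1 < \<mu> * D"
  proof -
    have "g \<le> \<mu> * (D - 1)" using assms(4) D by simp
    moreover have "\<mu> * (D - 1) + \<mu> = \<mu> * D" using D(2) by (cases D) simp_all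
    ultimately show ?thesis using assms(5) by linarith
  qed
  then have lt: "(g + \<mu> - 1) div \<mu> < D" by (intro less_mult_imp_div_less) (simp only: mult.commute)
  have "d + 1 + (d + 1) mod 2 \<le> D" if "d < D" for d
    using round_even_mono[of "d + 1" D] that ev by (simp add: even_iff_mod_2_eq_zero)
  from this[OF lt] show ?thesis unfolding inc_def Let_def D(1) by linarith
qed

section \<open>Consequences of the two recurrences\<close>

lemma chain_ge:
  assumes c: "chain s \<mu> \<epsilon> q a0 n" and \<mu>: "0 < \<mu>" shows "cit s \<mu> \<epsilon> q a0 \<le> n"
proof -
  obtain a where a: "a0 \<le> a 0" "\<forall>i\<le>q. odd (a i)"
    "\<forall>i<q. a i < a (Suc i) \<and> (a i - 1) * s + \<epsilon> \<le> \<mu> * (a (Suc i) - a i - 1)" "a q \<le> n"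
    using c unfolding chain_def by blast
  have "cit s \<mu> \<epsilon> i a0 \<le> a i" if "i \<le> q" for i
    using that
  proof (induction i)
    case 0 then show ?case using a(1) by (simp add: cit_def)
  next
    case (Suc i)
    let ?c = "cit s \<mu> \<epsilon> i a0"
    have IH: "?c \<le> a i" using Suc by simp
    have "cit s \<mu> \<epsilon> (Suc i) a0 = ?c + inc \<mu> ((?c - 1) * s + \<epsilon>)" by (simp add: cit_def cstep_def)
    also have "\<dots> \<le> a i + inc \<mu> ((a i - 1) * s + \<epsilon>)"
      using IH by (intro add_mono inc_mono mult_le_mono diff_le_mono) simp_all
    also have "\<dots> \<le> a (Suc i)" 
    proof (rule inc_le[OF _ _ _ _ \<mu>])
      show "odd (a i)" "odd (a (Suc i))" using a(2) Suc.prems by simp_all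
      show "a i < a (Suc i)" "(a i - 1) * s + \<epsilon> \<le> \<mu> * (a (Suc i) - a i - 1)" using a(3) Suc.prems by simp_all
    qed
    finally show ?case .
  qed
  then show ?thesis using a(4) le_trans by blast
qed

lemma chain_ge_linear:
  assumes "chain s \<mu> \<epsilon> q a0 n" shows "a0 + 2 * q \<le> n"
proof -
  obtain a where a: "a0 \<le> a 0" "\<forall>i\<le>q. odd (a i)" "\<forall>i<q. a i < a (Suc i)" "a q \<le> n"
    using assms unfolding chain_def by blast
  have "a0 + 2 * i \<le> a i" if "i \<le> q" for i
    using that
  proof (induction i)
    case (Suc i)
    have "a i + 2 \<le> a (Suc i)" by (rule odd_gap) (use a(2,3) Suc.prems in simp_all)
    then show ?case using Suc by simp
  qed (use a in simp)
  then show ?thesis using a(4) le_trans by blast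
qed

text \<open>Apart from rounding, \<open>a i - 1\<close> is multiplied by at least
  \<open>1 + s/\<mu>\<close> in each step, starting from at least 2.\<close>

lemma chain_ge_exp:
  assumes "chain s \<mu> \<epsilon> q 3 n" "0 < \<mu>" shows "2 * (1 + real s / real \<mu>) ^ q + 1 \<le> real n"
proof -
  obtain a where a: "3 \<le> a 0" "\<forall>i\<le>q. odd (a i)"
    "\<forall>i<q. a i < a (Suc i) \<and> (a i - 1) * s + \<epsilon> \<le> \<mu> * (a (Suc i) - a i - 1)" "a q \<le> n"
    using assms(1) unfolding chain_def by blast
  let ?z = "real s / real \<mu>"
  have "2 * (1 + ?z) ^ i + 1 \<le> real (a i)" if "i \<le> q" for i
    using that
  proof (induction i)
    case (Suc i)
    then have lt: "a i < a (Suc i)" and st: "(a i - 1) * s + \<epsilon> \<le> \<mu> * (a (Suc i) - a i - 1)" using a(3) by auto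
    have "odd (a i)" using a(2) Suc.prems by simp
    then have o: "1 \<le> a i" by (cases "a i") simp_all
    have IH: "2 * (1 + ?z) ^ i + 1 \<le> real (a i)" using Suc by simp
    have "(a i - 1) * s \<le> \<mu> * (a (Suc i) - a i)" by (rule le_trans[OF add_leD1[OF st] mult_le_mono2[OF diff_le_self]])
    then have "real ((a i - 1) * s) \<le> real (\<mu> * (a (Suc i) - a i))" by (simp only: of_nat_le_iff)
    then have "(real (a i) - 1) * real s \<le> real \<mu> * (real (a (Suc i)) - real (a i))" using o lt by (simp add: of_nat_diff)
    then have "(real (a i) - 1) * ?z \<le> real (a (Suc i)) - real (a i)"
      using assms(2) by (simp add: field_simps)
    then have 1: "(real (a i) - 1) * (1 + ?z) + 1 \<le> real (a (Suc i))" by (simp add: algebra_simps)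
    have "2 * (1 + ?z) ^ i * (1 + ?z) \<le> (real (a i) - 1) * (1 + ?z)" using IH by (intro mult_right_mono) simp_all
    then show ?case using 1 by (simp add: mult_ac)
  qed (use a in simp)
  from this[OF order_refl] have "2 * (1 + ?z) ^ q + 1 \<le> real (a q)" .
  moreover have "real (a q) \<le> real n" using a(4) by (simp only: of_nat_le_iff)
  ultimately show ?thesis by linarith
qed

text \<open>Since \<open>s \<ge> 1\<close>, the side conditions on \<open>f\<close> persist when
  \<open>n\<close> grows, so checking them at a lower bound \<open>n0\<close> is enough.\<close>

lemma stepsE:
  assumes "steps s \<mu> k n" "n0 \<le> n" "1 \<le> s" "2 \<le> f" "f + 1 \<le> n0 * s" "2 * f + n0 \<le> 2 * n0 * s + 5"
  obtains a where "a 0 = n" "\<forall>j<f. grow s \<mu> f j (a j) (a (Suc j))" "a f * s + 2 \<le> k"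
proof -
  obtain d where d: "n = n0 + d" using assms(2) le_Suc_ex by blast
  have "d * 1 \<le> d * s" by (rule mult_le_mono2[OF assms(3)])
  moreover have "2 * n * s = 2 * n0 * s + 2 * (d * s)" unfolding d by (simp add: algebra_simps)
  ultimately have "2 * f + n \<le> 2 * n * s + 5" using assms(6) d by linarith
  moreover have "f + 1 \<le> n * s" using assms(2,5) mult_le_mono1 le_trans by blast
  ultimately show ?thesis using assms(1,4) that unfolding steps_def by blast
qed

lemma git_le:
  assumes "n0 \<le> a 0" "\<forall>j<f. grow s \<mu> f j (a j) (a (Suc j))" "0 < \<mu>" shows "git s \<mu> f n0 \<le> a f"
proof -
  have "fold (gstep s \<mu> f) [0..<m] n0 \<le> a m" if "m \<le> f" for m
    using that
  proof (induction m)
    case (Suc m)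
    let ?c = "fold (gstep s \<mu> f) [0..<m] n0"
    have IH: "?c \<le> a m" using Suc by simp
    have g: "grow s \<mu> f m (a m) (a (Suc m))" using assms(2) Suc.prems by simp
    have "?c + inc \<mu> (?c * s - (f + 2 * m)) \<le> a m + inc \<mu> (a m * s - (f + 2 * m))"
      using IH by (intro add_mono inc_mono diff_le_mono mult_le_mono1)
    also have "\<dots> \<le> a (Suc m)"
      by (rule inc_le) (use g assms(3) in \<open>auto simp: grow_def\<close>)
    finally have "gstep s \<mu> f m ?c \<le> a (Suc m)" unfolding gstep_def .
    then show ?case by simp
  qed (use assms in simp)
  then show ?thesis unfolding git_def by blast
qed

lemma grow_linear:
  assumes "n0 \<le> a 0" "\<forall>j<f. grow s \<mu> f j (a j) (a (Suc j))" shows "n0 + 2 * f \<le> a f"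
proof -
  have "n0 + 2 * m \<le> a m" if "m \<le> f" for m
    using that
  proof (induction m)
    case (Suc m)
    have g: "grow s \<mu> f m (a m) (a (Suc m))" using assms(2) Suc.prems by simp
    have "a m + 2 \<le> a (Suc m)" by (rule odd_gap) (use g in \<open>auto simp: grow_def\<close>)
    then show ?case using Suc by simp
  qed (use assms in simp)
  then show ?thesis by blast
qed

text \<open>The reserved colours are absorbed in \<open>m j = a j * s - f - 2 * j\<close>, for which
  \<open>m (Suc j)\<close> is at least \<open>(1 + s/\<mu>) * m j + (s - 2)\<close>; hence the
  condition \<open>2 \<le> s\<close>.\<close>

lemma grow_exp:
  assumes a: "\<forall>j<f. grow s \<mu> f j (a j) (a (Suc j))" and \<mu>: "0 < \<mu>" "2 \<le> s" and m0: "M \<le> real (a 0) * real s - real f"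
  shows "M * (1 + real s / real \<mu>) ^ f \<le> real (a f) * real s - 3 * real f"
proof -
  let ?z = "real s / real \<mu>"
  define m where "m j = real (a j) * real s - real f - 2 * real j" for j
  have "M * (1 + ?z) ^ j \<le> m j" if "j \<le> f" for j
    using that
  proof (induction j)
    case (Suc j)
    have g: "a j < a (Suc j)" "a j * s + 2 \<le> f + 2 * j + 2 + \<mu> * (a (Suc j) - a j - 1)"
      using a Suc.prems by (simp_all add: grow_def)
    obtain D where D: "a (Suc j) = a j + 1 + D" using g(1) by (auto simp: less_iff_Suc_add)
    have "a j * s + 2 \<le> f + 2 * j + 2 + \<mu> * D" using g(2) D by simp
    then have "real (a j * s + 2) \<le> real (f + 2 * j + 2 + \<mu> * D)" by (simp only: of_nat_le_iff)
    then have "m j \<le> real \<mu> * (real (a (Suc j)) - real (a j) - 1)" by (simp add: m_def D)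
    then have "m j / real \<mu> \<le> real (a (Suc j)) - real (a j) - 1" using \<mu>(1) by (simp add: field_simps)
    then have "m j / real \<mu> * real s \<le> (real (a (Suc j)) - real (a j) - 1) * real s" by (intro mult_right_mono) simp_all
    moreover have "m (Suc j) = m j + (real (a (Suc j)) - real (a j) - 1) * real s + (real s - 2)" by (simp add: m_def algebra_simps)
    ultimately have "m j * (1 + ?z) \<le> m (Suc j)" using \<mu>(2) by (simp add: algebra_simps)
    moreover have "M * (1 + ?z) ^ j * (1 + ?z) \<le> m j * (1 + ?z)" using Suc by (intro mult_right_mono) simp_all
    ultimately show ?case by (simp add: mult_ac)
  qed (use m0 in \<open>simp add: m_def\<close>)
  from this[OF order_refl] show ?thesis by (simp add: m_def)
qed

text \<open>Both sides agree at 0, and the difference has derivative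
  \<open>t^2 / ((1 + t) * (2 + t)^2)\<close>.\<close>

lemma ln_add_one_ge:
  fixes z :: real assumes "0 \<le> z" shows "2 * z / (2 + z) \<le> ln (1 + z)"
proof -
  have "ln (1 + 0) - 2 * 0 / (2 + 0) \<le> ln (1 + z) - 2 * z / (2 + z)"
  proof (rule DERIV_nonneg_imp_nondecreasing[OF assms])
    fix t :: real assume t: "0 \<le> t" "t \<le> z"
    have "((\<lambda>t. ln (1 + t) - 2 * t / (2 + t)) has_real_derivative 1 / (1 + t) - (2 * (2 + t) - 2 * t) / ((2 + t) * (2 + t))) (at t)"
      using t by (auto intro!: derivative_eq_intros)
    moreover have "0 \<le> 1 / (1 + t) - (2 * (2 + t) - 2 * t) / ((2 + t) * (2 + t))"
    proof -
      have "(2 * (2 + t) - 2 * t) * (1 + t) \<le> (2 + t) * (2 + t)" by (simp add: algebra_simps)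
      then have "(2 * (2 + t) - 2 * t) / ((2 + t) * (2 + t)) \<le> 1 / (1 + t)" using t by (simp add: divide_simps)
      then show ?thesis by simp
    qed
    ultimately show "\<exists>y. ((\<lambda>t. ln (1 + t) - 2 * t / (2 + t)) has_real_derivative y) (at t) \<and> 0 \<le> y" by blast
  qed
  then show ?thesis by simp
qed

text \<open>The fraction is 2.72. A rational bound this close turns comparisons with logarithms into
  inequalities between natural numbers.\<close>

lemma exp_1_less: "exp 1 < (68 / 25 :: real)"
proof -
  obtain t :: real where t: "\<bar>t\<bar> \<le> \<bar>1\<bar>" "exp 1 = (\<Sum>m<7. 1 ^ m / fact m) + exp t / fact 7 * 1 ^ 7"
    using Maclaurin_exp_le[of 1 7] by blast
  have "exp t \<le> exp 1" using t(1) by simp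
  then have "exp t \<le> 3" using exp_le by linarith
  moreover have "exp 1 = (\<Sum>m<7. 1 / fact m) + exp t / 5040" using t(2) by (simp add: fact_numeral)
  moreover have "(\<Sum>m<7. 1 / fact m) = (1957 / 720 :: real)" by (simp add: eval_nat_numeral)
  ultimately show ?thesis by simp
qed

text \<open>The arithmetic condition says that 2.72 to the power \<open>P\<close> is at most
  \<open>(D / 2) ^ \<mu>0\<close>, cleared of denominators; \<open>e\<close> being smaller than
  2.72, logarithms give the claim.\<close>

lemma bound_explicit:
  assumes "D \<le> \<Delta>" "2 \<le> D" "\<mu>0 \<le> \<mu>" "0 < P" "2 ^ \<mu>0 * 68 ^ P \<le> D ^ \<mu>0 * (25::nat) ^ P"
  shows "real P < real \<mu> * ln (real \<Delta> / 2)"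
proof -
  have D: "1 \<le> real D / 2" using assms(2) by simp
  have "exp (real P) = exp 1 ^ P" by (simp add: exp_of_nat_mult[symmetric])
  also have "\<dots> < (68 / 25) ^ P" using exp_1_less assms(4) by (intro power_strict_mono) simp_all
  also have "\<dots> \<le> (real D / 2) ^ \<mu>0"
  proof -
    have "real (2 ^ \<mu>0 * 68 ^ P) \<le> real (D ^ \<mu>0 * 25 ^ P)" using assms(5) by (simp only: of_nat_le_iff)
    then have "2 ^ \<mu>0 * 68 ^ P \<le> real D ^ \<mu>0 * 25 ^ P" by simp
    then have "68 ^ P \<le> real D ^ \<mu>0 * 25 ^ P / 2 ^ \<mu>0" by (subst pos_le_divide_eq) (simp_all only: mult.commute zero_less_power zero_less_numeral)
    then have "68 ^ P \<le> real D ^ \<mu>0 / 2 ^ \<mu>0 * 25 ^ P" by simp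
    then show ?thesis unfolding power_divide by (subst pos_divide_le_eq) (simp_all only: zero_less_power zero_less_numeral)
  qed
  finally have lt: "exp (real P) < (real D / 2) ^ \<mu>0" .
  then have pX: "0 < (real D / 2) ^ \<mu>0" using exp_gt_zero less_trans by blast
  have "ln (exp (real P)) < ln ((real D / 2) ^ \<mu>0)" using lt by (simp only: ln_less_cancel_iff[OF exp_gt_zero pX])
  then have "real P < ln ((real D / 2) ^ \<mu>0)" by simp
  also have "\<dots> = real \<mu>0 * ln (real D / 2)" using D by (simp add: ln_realpow)
  also have "\<dots> \<le> real \<mu> * ln (real \<Delta> / 2)"
    using assms(1-3) D by (intro mult_mono ln_mono) simp_all
  finally show ?thesis .
qed

lemma steps_explicit:
  assumes st: "steps s \<mu> (\<Delta> + s) n" "n0 \<le> n" "1 \<le> s" "2 \<le> f" "f + 1 \<le> n0 * s" "2 * f + n0 \<le> 2 * n0 * s + 5"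
    and \<mu>: "0 < \<mu>" and D: "D + s \<le> git s \<mu> f n0 * s + 2" "2 \<le> D" and P: "0 < P" "2 ^ \<mu> * 68 ^ P \<le> D ^ \<mu> * (25::nat) ^ P"
  shows "real P < real \<mu> * ln (real \<Delta> / 2)"
proof -
  obtain a where a: "a 0 = n" "\<forall>j<f. grow s \<mu> f j (a j) (a (Suc j))" "a f * s + 2 \<le> \<Delta> + s"
    by (rule stepsE[OF st])
  have "git s \<mu> f n0 * s \<le> a f * s" using git_le[OF _ a(2) \<mu>] a(1) st(2) by (intro mult_le_mono1) simp
  then have "D \<le> \<Delta>" using D a(3) by linarith
  then show ?thesis by (rule bound_explicit[OF _ D(2) order_refl P])
qed

lemma steps_linear:
  assumes st: "steps s \<mu> (\<Delta> + s) n" "n0 \<le> n" "1 \<le> s" "2 \<le> f" "f + 1 \<le> n0 * s" "2 * f + n0 \<le> 2 * n0 * s + 5"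
    and \<mu>: "\<mu>0 \<le> \<mu>" and D: "D + s \<le> (n0 + 2 * f) * s + 2" "2 \<le> D" and P: "0 < P" "2 ^ \<mu>0 * 68 ^ P \<le> D ^ \<mu>0 * (25::nat) ^ P"
  shows "real P < real \<mu> * ln (real \<Delta> / 2)"
proof -
  obtain a where a: "a 0 = n" "\<forall>j<f. grow s \<mu> f j (a j) (a (Suc j))" "a f * s + 2 \<le> \<Delta> + s"
    by (rule stepsE[OF st])
  have "(n0 + 2 * f) * s \<le> a f * s" using grow_linear[OF _ a(2)] a(1) st(2) by (intro mult_le_mono1) simp
  then have "D \<le> \<Delta>" using D a(3) by linarith
  then show ?thesis by (rule bound_explicit[OF _ D(2) \<mu> P])
qed

lemma steps_exp:
  assumes st: "steps s \<mu> (\<Delta> + s) n" "2 * s + 3 \<le> n" and s: "3 \<le> s" and \<mu>: "0 < \<mu>"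
    and c: "(s + 1) ^ 3 * (2 * \<mu> + s) \<le> 2 * (2 * s ^ 2 + 2 * s + 1) * s * \<mu>"
  shows "real ((s + 1) ^ 3) < real \<mu> * ln (real \<Delta> / 2)"
proof -
  \<comment> \<open>The largest value that the supply of free colours allows for
    \<open>n = 2 * s + 3\<close>.\<close>
  define f where "f = 2 * s ^ 2 + 2 * s + 1"
  have f: "2 \<le> f" "f + 1 \<le> (2 * s + 3) * s" "2 * f + (2 * s + 3) \<le> 2 * (2 * s + 3) * s + 5"
    using s by (simp_all add: f_def power2_eq_square algebra_simps)
  obtain a where a: "a 0 = n" "\<forall>j<f. grow s \<mu> f j (a j) (a (Suc j))" "a f * s + 2 \<le> \<Delta> + s"
    by (rule stepsE[OF st _ f]) (use s in simp)
  let ?z = "real s / real \<mu>"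
  have "real ((2 * s + 3) * s) \<le> real (n * s)" using st(2) by (simp only: of_nat_le_iff mult_le_mono1)
  then have m0: "real s - 1 \<le> real (a 0) * real s - real f"
    unfolding a(1) f_def by (simp add: power2_eq_square algebra_simps)
  have "(real s - 1) * (1 + ?z) ^ f \<le> real (a f) * real s - 3 * real f"
    by (rule grow_exp[OF a(2) \<mu> _ m0]) (use s in simp_all)
  moreover have "real (a f * s + 2) \<le> real (\<Delta> + s)" using a(3) by (simp only: of_nat_le_iff)
  moreover have "real s \<le> 3 * real f" unfolding f_def by simp
  ultimately have "(real s - 1) * (1 + ?z) ^ f + 2 \<le> real \<Delta>" by simp
  \<comment> \<open>The start value \<open>s - 1 \<ge> 2\<close> of the growth pays for the division
    of \<open>\<Delta>\<close> by 2.\<close>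
  moreover have "2 * (1 + ?z) ^ f \<le> (real s - 1) * (1 + ?z) ^ f" using s by (intro mult_right_mono) simp_all
  ultimately have d: "(1 + ?z) ^ f < real \<Delta> / 2" by simp
  have z: "0 < ?z" using s \<mu> by simp
  have pz: "0 < (1 + ?z) ^ f" using z by (intro zero_less_power) simp
  have p\<Delta>: "0 < real \<Delta> / 2" using pz d by linarith
  have "real f * (2 * ?z / (2 + ?z)) \<le> real f * ln (1 + ?z)" using ln_add_one_ge[of ?z] z by (intro mult_left_mono) simp_all
  also have "\<dots> = ln ((1 + ?z) ^ f)" using z by (simp add: ln_realpow)
  also have "\<dots> < ln (real \<Delta> / 2)" using d by (simp only: ln_less_cancel_iff[OF pz p\<Delta>])
  finally have "real f * (2 * ?z / (2 + ?z)) < ln (real \<Delta> / 2)" .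
  then have l: "real \<mu> * (real f * (2 * ?z / (2 + ?z))) < real \<mu> * ln (real \<Delta> / 2)"
    by (rule mult_strict_left_mono) (use \<mu> in simp)
  have "real ((s + 1) ^ 3 * (2 * \<mu> + s)) \<le> real (2 * f * s * \<mu>)" using c unfolding f_def by (simp only: of_nat_le_iff)
  then have "real ((s + 1) ^ 3) * (2 * real \<mu> + real s) \<le> real f * 2 * real s * real \<mu>" by simp
  moreover have "0 < 2 * real \<mu> + real s" using \<mu> by simp
  ultimately have "real ((s + 1) ^ 3) \<le> real f * 2 * real s * real \<mu> / (2 * real \<mu> + real s)"
    by (simp only: pos_le_divide_eq)
  also have "\<dots> = real \<mu> * (real f * (2 * ?z / (2 + ?z)))" using \<mu> by (simp add: field_simps)
  finally show ?thesis using l by simp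
qed

text \<open>At \<open>\<mu> = s + 1\<close> the difference of the two sides is
  \<open>(s + 1) * (s^3 - 4 * s^2 - 5 * s - 2)\<close>, positive from \<open>s = 6\<close> on but
  negative at \<open>s = 5\<close>. This is the origin of the finite list of cases in
  \<open>numeric_cube\<close>.\<close>

lemma exp_condition:
  assumes "6 \<le> s" "s < \<mu>"
  shows "(s + 1) ^ 3 * (2 * \<mu> + s) \<le> 2 * (2 * s ^ 2 + 2 * s + 1) * s * (\<mu>::nat)"
proof -
  obtain t where t: "s = 6 + t" using assms(1) le_Suc_ex by blast
  obtain u where u: "\<mu> = s + 1 + u" using assms(2) by (metis Suc_eq_plus1 less_eq_Suc_le le_Suc_ex)
  show ?thesis unfolding u t by (simp add: power2_eq_square power3_eq_cube algebra_simps)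
qed

lemma numeric_cube:
  assumes st: "steps s \<mu> (\<Delta> + s) n" and s: "1 \<le> s" and \<mu>: "s < \<mu>"
    and ch: "chain s \<mu> 1 (s + 1) 3 n \<or> chain s \<mu> 2 s 3 n"
    and ch1: "s = 1 \<Longrightarrow> chain 1 \<mu> 1 2 3 n \<or> chain 1 \<mu> 2 1 (if \<mu> = 2 then 7 else 5) n"
  shows "real ((s + 1) ^ 3) < real \<mu> * ln (real \<Delta> / 2)"
proof -
  have \<mu>0: "0 < \<mu>" using \<mu> by simp
  have n23: "2 * s + 3 \<le> n" using ch chain_ge_linear[of s \<mu> 1 "s + 1" 3 n] chain_ge_linear[of s \<mu> 2 s 3 n] by auto
  have nc: "N \<le> n" if "N \<le> cit s \<mu> 1 (s + 1) 3" "N \<le> cit s \<mu> 2 s 3" for N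
    using ch chain_ge[of s \<mu> 1 "s + 1" 3 n] chain_ge[of s \<mu> 2 s 3 n] \<mu>0 that by auto
  note ev = git_def cit_def gstep_def cstep_def inc_def Let_def upt_rec
  consider "s = 1" | "s = 2" | "s = 3" | "s = 4" | "s = 5" | "6 \<le> s" using s by linarith
  then show ?thesis
  proof cases
    case 1
    have P: "(s + 1) ^ 3 = 8" by (simp add: 1 power3_eq_cube)
    have nc1: "N \<le> n" if "N \<le> cit 1 \<mu> 1 2 3" "N \<le> cit 1 \<mu> 2 1 (if \<mu> = 2 then 7 else 5)" for N
      using ch1[OF 1] chain_ge[of 1 \<mu> 1 2 3 n] chain_ge[of 1 \<mu> 2 1 "if \<mu> = 2 then 7 else 5" n] \<mu>0 that by auto
    consider "\<mu> = 2" | "\<mu> = 3" | "\<mu> = 4" | "5 \<le> \<mu>" using \<mu> 1 by linarith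
    then show ?thesis
    proof cases
      case 1
      \<comment> \<open>The tightest case: for \<open>n = 13\<close> the value \<open>f = 9\<close>
        exhausts the supply of free colours.\<close>
      have "13 \<le> n" by (rule nc1) (simp_all add: ev 1)
      then show ?thesis unfolding P by (rule steps_explicit[OF st, where f = 9 and D = 154]) (simp_all add: ev 1 \<open>s = 1\<close>)
    next
      case 2
      have "9 \<le> n" by (rule nc1) (simp_all add: ev 2)
      then show ?thesis unfolding P by (rule steps_explicit[OF st, where f = 5 and D = 34]) (simp_all add: ev 2 \<open>s = 1\<close>)
    next
      case 3
      have "9 \<le> n" by (rule nc1) (simp_all add: ev 3)
      then show ?thesis unfolding P by (rule steps_explicit[OF st, where f = 5 and D = 20]) (simp_all add: ev 3 \<open>s = 1\<close>)
    next
      case 4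
      \<comment> \<open>For large \<open>\<mu>\<close> the parity gain of two vertices per round
        suffices, since the required degree falls with \<open>\<mu>\<close>.\<close>
      have "7 \<le> n" using ch1[OF 1] chain_ge_linear[of 1 \<mu> 1 2 3 n] chain_ge_linear[of 1 \<mu> 2 1 5 n] 4 by auto
      then show ?thesis unfolding P by (rule steps_linear[OF st, where f = 5 and D = 18 and ?\<mu>0.0 = 5]) (simp_all add: 4 \<open>s = 1\<close>)
    qed
  next
    case 2
    have P: "(s + 1) ^ 3 = 27" by (simp add: 2 power3_eq_cube)
    consider "\<mu> = 3" | "\<mu> = 4" | "\<mu> = 5" | "\<mu> = 6" | "\<mu> = 7" | "8 \<le> \<mu>" using \<mu> 2 by linarith
    then show ?thesis
    proof cases
      case 1
      have "13 \<le> n" by (rule nc) (simp_all add: ev 1 2)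
      then show ?thesis unfolding P by (rule steps_explicit[OF st, where f = 22 and D = 622550]) (simp_all add: ev 1 \<open>s = 2\<close>)
    next
      case 2
      have "13 \<le> n" by (rule nc) (simp_all add: ev 2 \<open>s = 2\<close>)
      then show ?thesis unfolding P by (rule steps_explicit[OF st, where f = 22 and D = 44118]) (simp_all add: ev 2 \<open>s = 2\<close>)
    next
      case 3
      have "11 \<le> n" by (rule nc) (simp_all add: ev 3 \<open>s = 2\<close>)
      then show ?thesis unfolding P by (rule steps_explicit[OF st, where f = 15 and D = 1898]) (simp_all add: ev 3 \<open>s = 2\<close>)
    next
      case 4
      show ?thesis unfolding P by (rule steps_explicit[OF st n23, where f = 13 and D = 278]) (simp_all add: ev 4 \<open>s = 2\<close>)
    next
      case 5
      show ?thesis unfolding P by (rule steps_explicit[OF st n23, where f = 13 and D = 190]) (simp_all add: ev 5 \<open>s = 2\<close>)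
    next
      case 6
      show ?thesis unfolding P by (rule steps_linear[OF st n23, where f = 13 and D = 66 and ?\<mu>0.0 = 8]) (simp_all add: 6 \<open>s = 2\<close>)
    qed
  next
    case 3
    have P: "(s + 1) ^ 3 = 64" by (simp add: 3 power3_eq_cube)
    consider "\<mu> = 4" | "\<mu> = 5" | "\<mu> = 6" | "\<mu> = 7" | "\<mu> = 8" | "9 \<le> \<mu>" using \<mu> 3 by linarith
    then show ?thesis
    proof cases
      case 1
      have "25 \<le> n" by (rule nc) (simp_all add: ev 1 \<open>s = 3\<close>)
      then show ?thesis unfolding P by (rule steps_explicit[OF st, where f = 40 and D = 204356542358]) (simp_all add: ev 1 \<open>s = 3\<close>)
    next
      case 2
      show ?thesis unfolding P by (rule steps_explicit[OF st n23, where f = 25 and D = 1170698]) (simp_all add: ev 2 \<open>s = 3\<close>)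
    next
      case 3
      show ?thesis unfolding P by (rule steps_explicit[OF st n23, where f = 25 and D = 223832]) (simp_all add: ev 3 \<open>s = 3\<close>)
    next
      case 4
      show ?thesis unfolding P by (rule steps_explicit[OF st n23, where f = 25 and D = 69260]) (simp_all add: ev 4 \<open>s = 3\<close>)
    next
      case 5
      show ?thesis unfolding P by (rule steps_explicit[OF st n23, where f = 25 and D = 32690]) (simp_all add: ev 5 \<open>s = 3\<close>)
    next
      case 6
      show ?thesis by (rule steps_exp[OF st n23 _ \<mu>0]) (use 6 \<open>s = 3\<close> in simp_all)
    qed
  next
    case 4
    have P: "(s + 1) ^ 3 = 125" by (simp add: 4 power3_eq_cube)
    consider "\<mu> = 5" | "\<mu> = 6" | "7 \<le> \<mu>" using \<mu> 4 by linarith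
    then show ?thesis
    proof cases
      case 1
      show ?thesis unfolding P by (rule steps_explicit[OF st n23, where f = 41 and D = 246225434330]) (simp_all add: ev 1 \<open>s = 4\<close>)
    next
      case 2
      show ?thesis unfolding P by (rule steps_explicit[OF st n23, where f = 41 and D = 15004631746]) (simp_all add: ev 2 \<open>s = 4\<close>)
    next
      case 3
      show ?thesis by (rule steps_exp[OF st n23 _ \<mu>0]) (use 3 \<open>s = 4\<close> in simp_all)
    qed
  next
    case 5
    have P: "(s + 1) ^ 3 = 216" by (simp add: 5 power3_eq_cube)
    consider "\<mu> = 6" | "7 \<le> \<mu>" using \<mu> 5 by linarith
    then show ?thesis
    proof cases
      case 1
      show ?thesis unfolding P by (rule steps_explicit[OF st n23, where f = 61 and D = 129449809846893202]) (simp_all add: ev 1 \<open>s = 5\<close>)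
    next
      case 2
      show ?thesis by (rule steps_exp[OF st n23 _ \<mu>0]) (use 2 \<open>s = 5\<close> in simp_all)
    qed
  next
    case 6
    show ?thesis by (rule steps_exp[OF st n23 _ \<mu>0 exp_condition[OF 6 \<mu>]]) (use 6 in simp)
  qed
qed

text \<open>With \<open>n\<close> exponential in \<open>s^2/\<mu>\<close>, the number of rounds
  \<open>f\<close> is at least \<open>s * (1 + s/\<mu>) ^ s\<close>, and \<open>\<Delta>/2\<close>
  exceeds \<open>(1 + s/\<mu>) ^ f\<close>. The bound on \<open>\<Delta>\<close> is thus doubly
  exponential, which is what the iterated logarithm needs.\<close>

lemma steps_double_exp:
  assumes st: "steps s \<mu> (\<Delta> + s) n" and s: "2 \<le> s" and \<mu>: "s < \<mu>" and n: "2 * (1 + real s / real \<mu>) ^ s + 1 \<le> real n"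
  shows "0 < ln (real \<Delta> / 2)" "exp ((real s + 1)\<^sup>2 / (4 * real \<mu>)) < 2 * real \<mu> * ln (real \<Delta> / 2)"
proof -
  let ?z = "real s / real \<mu>"
  have z: "0 < ?z" "?z \<le> 1" using s \<mu> by simp_all
  have p1: "1 \<le> (1 + ?z) ^ s" using z by (intro one_le_power) simp
  have n3: "3 \<le> n" using n p1 by linarith
  \<comment> \<open>Taking half of \<open>n * s\<close> meets all side conditions and leaves a start
    value of at least 2 for \<open>grow_exp\<close>.\<close>
  define f where "f = (n * s) div 2"
  have ns: "6 \<le> n * s" "n \<le> n * s" using mult_le_mono[OF n3 s] s by simp_all
  have f2: "2 * f \<le> n * s" "n * s \<le> 2 * f + 1" by (simp_all add: f_def)
  have "2 * n * s = 2 * (n * s)" by simp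
  then have f: "2 \<le> f" "f + 1 \<le> n * s" "2 * f + n \<le> 2 * n * s + 5" "n * s \<le> 2 * f + 1" using ns f2 by linarith+
  obtain a where a: "a 0 = n" "\<forall>j<f. grow s \<mu> f j (a j) (a (Suc j))" "a f * s + 2 \<le> \<Delta> + s"
    by (rule stepsE[OF st order_refl _ f(1-3)]) (use s in simp)
  have "real (2 * f) \<le> real (n * s)" by (simp only: of_nat_le_iff) (simp add: f_def)
  moreover have "6 \<le> real (n * s)" using ns(1) by linarith
  ultimately have m0: "2 \<le> real (a 0) * real s - real f" using a(1) by simp
  have g: "2 * (1 + ?z) ^ f \<le> real (a f) * real s - 3 * real f"
    by (rule grow_exp[OF a(2) _ s m0]) (use \<mu> in simp)
  have "real (a f * s + 2) \<le> real (\<Delta> + s)" using a(3) by (simp only: of_nat_le_iff)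
  moreover have "s \<le> 3 * f"
  proof -
    have "3 * s \<le> n * s" using n3 by (rule mult_le_mono1)
    then show ?thesis using f(4) s by linarith
  qed
  ultimately have d: "(1 + ?z) ^ f < real \<Delta> / 2" using g by simp
  have pz: "0 < (1 + ?z) ^ f" using z by (intro zero_less_power) simp
  have p\<Delta>: "0 < real \<Delta> / 2" using pz d by linarith
  have lnz: "2 * ?z / 3 \<le> ln (1 + ?z)"
  proof -
    have "2 * ?z / 3 \<le> 2 * ?z / (2 + ?z)" using z by (intro divide_left_mono) simp_all
    then show ?thesis using ln_add_one_ge[of ?z] z by linarith
  qed
  have "real s * (1 + ?z) ^ s \<le> real f"
  proof -
    have "(2 * (1 + ?z) ^ s + 1) * real s \<le> real n * real s" using n by (intro mult_right_mono) simp_all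
    moreover have "real (n * s) \<le> real (2 * f + 1)" using f(4) by (simp only: of_nat_le_iff)
    moreover have "1 \<le> real s" using s by simp
    ultimately show ?thesis by (simp add: algebra_simps)
  qed
  then have "real s * (1 + ?z) ^ s * (2 * ?z / 3) \<le> real f * ln (1 + ?z)" using lnz z by (intro mult_mono) simp_all
  also have "\<dots> = ln ((1 + ?z) ^ f)" using z by (simp add: ln_realpow)
  also have "\<dots> < ln (real \<Delta> / 2)" using d by (simp only: ln_less_cancel_iff[OF pz p\<Delta>])
  finally have L: "real s * (1 + ?z) ^ s * (2 * ?z / 3) < ln (real \<Delta> / 2)" .
  have "0 < real s * (1 + ?z) ^ s * (2 * ?z / 3)"
  proof -
    have "0 < real s" "0 < (1 + ?z) ^ s" using s p1 by linarith+
    moreover have "0 < 2 * ?z / 3" by (intro divide_pos_pos mult_pos_pos z(1)) simp_all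
    ultimately show ?thesis by (intro mult_pos_pos)
  qed
  then show "0 < ln (real \<Delta> / 2)" using L by linarith
  have "2 * real \<mu> * (real s * (1 + ?z) ^ s * (2 * ?z / 3)) < 2 * real \<mu> * ln (real \<Delta> / 2)"
    using L by (rule mult_strict_left_mono) (use \<mu> in simp)
  moreover have "2 * real \<mu> * (real s * (1 + ?z) ^ s * (2 * ?z / 3)) = 4 / 3 * real s ^ 2 * (1 + ?z) ^ s"
    using \<mu> by (simp add: power2_eq_square)
  ultimately have 1: "4 / 3 * real s ^ 2 * (1 + ?z) ^ s < 2 * real \<mu> * ln (real \<Delta> / 2)" by simp
  have "exp (real s * (2 * ?z / 3)) \<le> exp (real s * ln (1 + ?z))" using lnz by (simp only: exp_le_cancel_iff) (intro mult_left_mono, simp_all)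
  also have "\<dots> = (1 + ?z) ^ s"
  proof -
    have "0 < 1 + ?z" using z by simp
    then show ?thesis by (simp only: exp_of_nat_mult exp_ln)
  qed
  finally have 2: "exp (real s * (2 * ?z / 3)) \<le> (1 + ?z) ^ s" .
  \<comment> \<open>This amounts to \<open>3 * (s + 1)^2 \<le> 8 * s^2\<close>, true for
    \<open>s \<ge> 2\<close> only; \<open>numeric_bound\<close> settles \<open>s = 1\<close> by the
    cube estimate.\<close>
  have "(real s + 1)\<^sup>2 / (4 * real \<mu>) \<le> real s * (2 * ?z / 3)"
  proof -
    have "3 * (real s + 1)\<^sup>2 \<le> 8 * (real s)\<^sup>2"
    proof -
      have "2 * real s \<le> real s * real s" using s by (intro mult_right_mono) simp_all
      moreover have "2 \<le> real s" using s by simp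
      moreover have "3 * (real s + 1)\<^sup>2 = 3 * (real s * real s) + 6 * real s + 3" by (simp add: power2_eq_square algebra_simps)
      ultimately show ?thesis unfolding power2_eq_square[of "real s"] by linarith
    qed
    then have "(real s + 1)\<^sup>2 / 4 / real \<mu> \<le> 2 * (real s)\<^sup>2 / 3 / real \<mu>" by (intro divide_right_mono) simp_all
    then show ?thesis by (simp add: power2_eq_square)
  qed
  then have "exp ((real s + 1)\<^sup>2 / (4 * real \<mu>)) \<le> (1 + ?z) ^ s" using 2 by (meson exp_le_cancel_iff order_trans)
  also have "\<dots> \<le> 4 / 3 * real s ^ 2 * (1 + ?z) ^ s"
  proof -
    have "1 \<le> real s ^ 2" using s by (intro one_le_power) simp
    then have "1 * (1 + ?z) ^ s \<le> 4 / 3 * real s ^ 2 * (1 + ?z) ^ s" using p1 by (intro mult_right_mono) simp_all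
    then show ?thesis by simp
  qed
  also note 1
  finally show "exp ((real s + 1)\<^sup>2 / (4 * real \<mu>)) < 2 * real \<mu> * ln (real \<Delta> / 2)" .
qed

text \<open>The square root term is reached by taking logarithms in
  \<open>exp ((s + 1)^2 / (4 * \<mu>)) < 2 * \<mu> * L\<close> with
  \<open>L = ln (\<Delta> / 2)\<close>, the cube root term from \<open>numeric_cube\<close>. As
  \<open>s + 1\<close> is the excess of the chromatic index over \<open>\<Delta>\<close>, this
  contradicts the hypothesis of the theorem.\<close>

lemma numeric_bound:
  assumes st: "steps s \<mu> (\<Delta> + s) n" and s: "1 \<le> s" and \<mu>: "s < \<mu>"
    and ch: "chain s \<mu> 1 (s + 1) 3 n \<or> chain s \<mu> 2 s 3 n"
    and ch1: "s = 1 \<Longrightarrow> chain 1 \<mu> 1 2 3 n \<or> chain 1 \<mu> 2 1 (if \<mu> = 2 then 7 else 5) n"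
  shows "real s + 1 < min (2 * sqrt (real \<mu> * (ln (ln (real \<Delta> / 2)) + ln (2 * real \<mu>))))
    (root 3 (real \<mu> * ln (real \<Delta> / 2)))"
proof -
  define L where "L = ln (real \<Delta> / 2)"
  have \<mu>0: "0 < real \<mu>" using \<mu> by simp
  have cube: "(real s + 1) ^ 3 < real \<mu> * L"
  proof -
    have "real ((s + 1) ^ 3) < real \<mu> * L" unfolding L_def by (rule numeric_cube[OF assms])
    moreover have "real ((s + 1) ^ 3) = (real s + 1) ^ 3" by (simp add: add.commute)
    ultimately show ?thesis by linarith
  qed
  have "root 3 ((real s + 1) ^ 3) < root 3 (real \<mu> * L)" using cube by (intro real_root_less_mono) simp_all
  then have r: "real s + 1 < root 3 (real \<mu> * L)" using real_root_power_cancel[of 3 "real s + 1"] by simp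
  have "0 < L \<and> exp ((real s + 1)\<^sup>2 / (4 * real \<mu>)) < 2 * real \<mu> * L"
  proof (cases "s = 1")
    case True
    \<comment> \<open>For \<open>s = 1\<close> the exponential is at most \<open>e\<close>, while
      the cube estimate makes the right-hand side larger than 16.\<close>
    have 8: "8 < real \<mu> * L" using cube True by simp
    have L0: "0 < L"
    proof (rule ccontr)
      assume "\<not> 0 < L"
      then have "real \<mu> * L \<le> 0" using \<mu>0 by (intro mult_nonneg_nonpos) linarith+
      then show False using 8 by linarith
    qed
    have "(real s + 1)\<^sup>2 = 4" unfolding True by (simp add: power2_eq_square)
    moreover have "4 / (4 * real \<mu>) \<le> 1" using \<mu>0 \<mu> by (subst pos_divide_le_eq) simp_all
    ultimately have "exp ((real s + 1)\<^sup>2 / (4 * real \<mu>)) \<le> exp 1" by (simp only: exp_le_cancel_iff)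
    then show ?thesis using 8 L0 exp_le by linarith
  next
    case False
    then have s2: "2 \<le> s" using s by simp
    have "2 * (1 + real s / real \<mu>) ^ s + 1 \<le> real n"
      using ch
    proof
      assume "chain s \<mu> 2 s 3 n" then show ?thesis by (rule chain_ge_exp) (use \<mu> in simp)
    next
      assume "chain s \<mu> 1 (s + 1) 3 n"
      then have "2 * (1 + real s / real \<mu>) ^ (s + 1) + 1 \<le> real n" by (rule chain_ge_exp) (use \<mu> in simp)
      moreover have "(1 + real s / real \<mu>) ^ s \<le> (1 + real s / real \<mu>) ^ (s + 1)" by (intro power_increasing) simp_all
      ultimately show ?thesis by linarith
    qed
    then show ?thesis using steps_double_exp[OF st s2 \<mu>] unfolding L_def by blast
  qed
  then have L: "0 < L" "exp ((real s + 1)\<^sup>2 / (4 * real \<mu>)) < 2 * real \<mu> * L" by blast+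
  have pos: "0 < 2 * real \<mu> * L" by (intro mult_pos_pos L(1) \<mu>0) simp
  have "(real s + 1)\<^sup>2 / (4 * real \<mu>) < ln (2 * real \<mu> * L)"
  proof -
    have "ln (exp ((real s + 1)\<^sup>2 / (4 * real \<mu>))) < ln (2 * real \<mu> * L)"
      by (rule iffD2[OF ln_less_cancel_iff[OF exp_gt_zero pos] L(2)])
    then show ?thesis by (simp only: ln_exp)
  qed
  also have "\<dots> = ln (2 * real \<mu>) + ln L" by (rule ln_mult_pos) (use L(1) \<mu>0 in linarith)+
  finally have "(real s + 1)\<^sup>2 / (4 * real \<mu>) < ln L + ln (2 * real \<mu>)" by (simp only: add.commute)
  then have "(real s + 1)\<^sup>2 < (ln L + ln (2 * real \<mu>)) * (4 * real \<mu>)" using \<mu>0 by (subst (asm) pos_divide_less_eq) simp_all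
  moreover have "(ln L + ln (2 * real \<mu>)) * (4 * real \<mu>) = 4 * (real \<mu> * (ln L + ln (2 * real \<mu>)))" by (simp only: mult_ac)
  moreover have "((real s + 1) / 2)\<^sup>2 = (real s + 1)\<^sup>2 / 4" by (simp add: power_divide)
  ultimately have "((real s + 1) / 2)\<^sup>2 < real \<mu> * (ln L + ln (2 * real \<mu>))" by linarith
  then have "(real s + 1) / 2 < sqrt (real \<mu> * (ln L + ln (2 * real \<mu>)))" by (rule real_less_rsqrt)
  then show ?thesis using r by (simp add: L_def)
qed

section \<open>Density and the final argument\<close>

lemma matching_card_le:
  assumes "finite W" "finite F" "\<And>e. e \<in> F \<Longrightarrow> ends e \<subseteq> W" "\<And>e. e \<in> F \<Longrightarrow> card (ends e) = 2"
    "\<And>e f. e \<in> F \<Longrightarrow> f \<in> F \<Longrightarrow> e \<noteq> f \<Longrightarrow> ends e \<inter> ends f = {}"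
  shows "card F \<le> card W div 2"
proof -
  have "card (\<Union>e\<in>F. ends e) = (\<Sum>e\<in>F. card (ends e))"
  proof (rule card_UN_disjoint)
    show "finite F" by (rule assms(2))
    show "\<forall>e\<in>F. finite (ends e)"
    proof
      fix e assume "e \<in> F"
      then have "card (ends e) = 2" by (rule assms(4))
      then show "finite (ends e)" by (intro card_ge_0_finite) simp
    qed
    show "\<forall>e\<in>F. \<forall>f\<in>F. e \<noteq> f \<longrightarrow> ends e \<inter> ends f = {}" using assms(5) by blast
  qed
  also have "\<dots> = 2 * card F" using assms(4) by simp
  finally have "2 * card F = card (\<Union>e\<in>F. ends e)" by simp
  also have "\<dots> \<le> card W" by (rule card_mono[OF assms(1)]) (use assms(3) in blast)
  finally show ?thesis by simp
qed

lemma colour_classes_le: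
  assumes c: "proper_edge_colouring E ends q c" and G: "multigraph V E ends"
    and W: "W \<subseteq> V" "F \<subseteq> E" "\<forall>e\<in>F. ends e \<subseteq> W"
  shows "card F \<le> q * (card W div 2)"
proof -
  have finVE: "finite V" "finite E" using G by (simp_all add: multigraph_def)
  have fin: "finite W" "finite F" using finite_subset[OF W(1) finVE(1)] finite_subset[OF W(2) finVE(2)] by simp_all
  have "c e < q" if "e \<in> F" for e using c subsetD[OF W(2) that] by (simp add: proper_edge_colouring_def)
  then have "F = (\<Union>i<q. {e\<in>F. c e = i})" by blast
  then have "card F = card (\<Union>i<q. {e\<in>F. c e = i})" by (rule arg_cong)
  also have "\<dots> \<le> (\<Sum>i<q. card {e\<in>F. c e = i})" by (rule card_UN_le) simp
  also have "\<dots> \<le> (\<Sum>i<q. card W div 2)"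
  proof (rule sum_mono)
    fix i
    show "card {e\<in>F. c e = i} \<le> card W div 2"
    proof (rule matching_card_le[where ends = ends])
      show "ends e \<inter> ends f = {}" if ef: "e \<in> {e\<in>F. c e = i}" "f \<in> {e\<in>F. c e = i}" "e \<noteq> f" for e f
      proof (rule ccontr)
        assume "ends e \<inter> ends f \<noteq> {}"
        moreover have "e \<in> E" "f \<in> E" using ef W(2) by blast+
        ultimately have "c e \<noteq> c f" using c ef(3) unfolding proper_edge_colouring_def by blast
        then show False using ef(1,2) by simp
      qed
      show "card (ends e) = 2" if "e \<in> {e\<in>F. c e = i}" for e
      proof -
        have "e \<in> E" using that W(2) by blast
        then show ?thesis using G by (simp add: multigraph_def)
      qed
      show "finite W" "finite {e\<in>F. c e = i}" using fin by simp_all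
      show "ends e \<subseteq> W" if "e \<in> {e\<in>F. c e = i}" for e using that W(3) by simp
    qed
  qed
  finally show ?thesis by simp
qed

text \<open>Colour classes are matchings, so no quotient exceeds \<open>q\<close>; the set
  \<open>W\<close> has more edges than \<open>q - 1\<close> matchings can hold, so after rounding up
  its quotient reaches \<open>q\<close>.\<close>

lemma density_eqI:
  assumes G: "multigraph V E ends" and c: "proper_edge_colouring E ends q c"
    and W: "W \<subseteq> V" "2 \<le> card W" and d: "(q - 1) * (card W div 2) + 1 \<le> card {e\<in>E. ends e \<subseteq> W}" and q: "1 \<le> q"
  shows "density V E ends = int q"
proof -
  let ?S = "{\<lceil>real (card F) / real (card W div 2)\<rceil> | W F.
            W \<subseteq> V \<and> F \<subseteq> E \<and> (\<forall>e\<in>F. ends e \<subseteq> W) \<and> card W \<ge> 2}"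
  have fin: "finite V" "finite E" using G by (simp_all add: multigraph_def)
  have "?S \<subseteq> (\<lambda>(W, F). \<lceil>real (card F) / real (card W div 2)\<rceil>) ` (Pow V \<times> Pow E)" by auto
  then have fS: "finite ?S" by (rule finite_subset) (use fin in simp)
  have ub: "z \<le> int q" if zS: "z \<in> ?S" for z
  proof -
    obtain W F where z: "z = \<lceil>real (card F) / real (card W div 2)\<rceil>" "W \<subseteq> V" "F \<subseteq> E" "\<forall>e\<in>F. ends e \<subseteq> W" "2 \<le> card W"
      using zS unfolding mem_Collect_eq by (elim exE conjE) (rule that)
    have "card F \<le> q * (card W div 2)" by (rule colour_classes_le[OF c G z(2-4)])
    then have "real (card F) \<le> real (q * (card W div 2))" by (simp only: of_nat_le_iff)
    moreover have "0 < real (card W div 2)" using z(5) by simp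
    ultimately have "real (card F) / real (card W div 2) \<le> real q" by (simp add: pos_divide_le_eq)
    then show ?thesis unfolding z(1) by (simp add: ceiling_le_iff)
  qed
  let ?F = "{e\<in>E. ends e \<subseteq> W}"
  have in_S: "\<lceil>real (card ?F) / real (card W div 2)\<rceil> \<in> ?S" using W by blast
  have "real ((q - 1) * (card W div 2) + 1) \<le> real (card ?F)" using d by (simp only: of_nat_le_iff)
  moreover have pos: "0 < real (card W div 2)" using W(2) by simp
  ultimately have "real (q - 1) < real (card ?F) / real (card W div 2)" by (simp add: pos_less_divide_eq)
  then have "int (q - 1) < \<lceil>real (card ?F) / real (card W div 2)\<rceil>" by (simp add: less_ceiling_iff)
  then have "int q \<le> \<lceil>real (card ?F) / real (card W div 2)\<rceil>" using q by simp
  then have "\<lceil>real (card ?F) / real (card W div 2)\<rceil> = int q" using ub[OF in_S] by simp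
  then have "int q \<in> ?S" using in_S by simp
  then show ?thesis unfolding density_def by (intro Max_eqI fS ub)
qed

lemma chromatic_index_colouring:
  fixes E :: "'e set"
  assumes "finite E" shows "\<exists>c. proper_edge_colouring E ends (chromatic_index E ends) c"
proof -
  obtain h :: "'e \<Rightarrow> nat" where h: "bij_betw h E {0..<card E}" using ex_bij_betw_finite_nat[OF assms] by blast
  have "proper_edge_colouring E ends (card E) h"
    unfolding proper_edge_colouring_def
  proof (intro conjI ballI impI)
    fix e assume "e \<in> E" then show "h e < card E" using bij_betwE[OF h] by simp
  next
    fix e f assume "e \<in> E" "f \<in> E" "e \<noteq> f \<and> ends e \<inter> ends f \<noteq> {}"
    then show "h e \<noteq> h f" using inj_onD[OF bij_betw_imp_inj_on[OF h]] by blast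
  qed
  then have "\<exists>q c. proper_edge_colouring E ends q c" by blast
  then show ?thesis unfolding chromatic_index_def by (rule LeastI_ex)
qed

theorem theorem6:
  fixes V :: "'a set" and E :: "'e set" and ends :: "'e \<Rightarrow> 'a set"
  assumes G: "multigraph V E ends"
    and big: "chromatic_index E ends > max_degree V E ends + 1"
    and bound:
      "real (chromatic_index E ends) \<ge>
         real (max_degree V E ends) +
         min (2 * sqrt (real (multiplicity V E ends) *
                  (ln (ln (real (max_degree V E ends) / 2)) +
                   ln (2 * real (multiplicity V E ends)))))
             (root 3 (real (multiplicity V E ends) * ln (real (max_degree V E ends) / 2)))"
  shows "elementary V E ends"
proof -
  define q where "q = chromatic_index E ends"
  define \<Delta> where "\<Delta> = max_degree V E ends"
  define \<mu> where "\<mu> = multiplicity V E ends"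
  define s where "s = q - 1 - \<Delta>"
  have s: "1 \<le> s" "q = \<Delta> + s + 1" using big by (simp_all add: s_def q_def \<Delta>_def)
  have fin: "finite V" "finite E" and e2: "\<And>e. e \<in> E \<Longrightarrow> ends e \<subseteq> V \<and> card (ends e) = 2" using G by (simp_all add: multigraph_def)
  obtain c where c: "proper_edge_colouring E ends q c" using chromatic_index_colouring[OF fin(2), of ends] q_def by blast
  have nE: "\<not> (\<exists>c. proper_edge_colouring E ends (\<Delta> + s) c)"
    using not_less_Least[of "\<Delta> + s" "\<lambda>k. \<exists>c. proper_edge_colouring E ends k c"] s(2) by (simp add: q_def chromatic_index_def)
  define B where "B E' \<longleftrightarrow> E' \<subseteq> E \<and> \<not> (\<exists>c. proper_edge_colouring E' ends (\<Delta> + s) c)" for E'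
  have "B E" using nE by (simp add: B_def)
  then obtain Es where Es: "B Es" "\<And>E'. B E' \<Longrightarrow> card Es \<le> card E'"
    using ex_has_least_nat[of B E card] by blast
  have EsE: "Es \<subseteq> E" and nEs: "\<not> (\<exists>c. proper_edge_colouring Es ends (\<Delta> + s) c)" using Es(1) by (simp_all add: B_def)
  have fEs: "finite Es" using EsE fin(2) finite_subset by blast
  have "Es \<noteq> {}" using nEs by (auto simp: proper_edge_colouring_def)
  then obtain e0 where e0: "e0 \<in> Es" by blast
  have "\<exists>c. proper_edge_colouring (Es - {e0}) ends (\<Delta> + s) c"
  proof (rule ccontr)
    assume "\<not> ?thesis"
    then have "B (Es - {e0})" using EsE by (auto simp: B_def)
    then have "card Es \<le> card (Es - {e0})" by (rule Es(2))
    then show False using card_Diff1_less[OF fEs e0] by simp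
  qed
  then obtain \<phi>0 where \<phi>0: "proper_edge_colouring (Es - {e0}) ends (\<Delta> + s) \<phi>0" by blast
  have deg: "card {e\<in>Es. v \<in> ends e} \<le> \<Delta>" for v
  proof (cases "v \<in> V")
    case True
    have "card {e\<in>Es. v \<in> ends e} \<le> degree E ends v" unfolding degree_def using fin(2) EsE by (intro card_mono) auto
    also have "\<dots> \<le> \<Delta>" unfolding \<Delta>_def max_degree_def using fin(1) True by (intro Max_ge) auto
    finally show ?thesis .
  next
    case False
    then have "{e\<in>Es. v \<in> ends e} = {}" using e2 EsE by blast
    then show ?thesis by (simp only: card.empty)
  qed
  have mu: "card {e\<in>Es. ends e = {u, v}} \<le> \<mu>" if "u \<noteq> v" for u v
  proof (cases "u \<in> V \<and> v \<in> V")
    case True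
    let ?M = "{card {e\<in>E. ends e = {u, v}} | u v. u \<in> V \<and> v \<in> V \<and> u \<noteq> v}"
    have "?M \<subseteq> (\<lambda>(u, v). card {e\<in>E. ends e = {u, v}}) ` (V \<times> V)" by auto
    then have "finite ?M" by (rule finite_subset) (use fin in simp)
    moreover have "card {e\<in>E. ends e = {u, v}} \<in> ?M" using True that by blast
    ultimately have "card {e\<in>E. ends e = {u, v}} \<le> \<mu>" unfolding \<mu>_def multiplicity_def by (intro Max_ge) auto
    moreover have "card {e\<in>Es. ends e = {u, v}} \<le> card {e\<in>E. ends e = {u, v}}" using fin(2) EsE by (intro card_mono) auto
    ultimately show ?thesis by simp
  next
    case False
    then have "{e\<in>Es. ends e = {u, v}} = {}" using e2 EsE by blast
    then show ?thesis by (simp only: card.empty)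
  qed
  interpret dgraph Es ends "\<Delta> + s" s \<mu>
  proof unfold_locales
    show "card (ends e) = 2" if "e \<in> Es" for e using e2 EsE that by blast
    show "\<not> proper_edge_colouring Es ends (\<Delta> + s) \<phi>" for \<phi> using nEs by blast
    show "card {e\<in>Es. v \<in> ends e} + s \<le> \<Delta> + s" for v using deg[of v] by simp
  qed (use fEs s(1) mu in auto)
  consider W where "W \<subseteq> \<Union>(ends ` Es)" "odd (card W)" "3 \<le> card W" "(\<Delta> + s) * (card W div 2) + 1 \<le> card {g\<in>Es. ends g \<subseteq> W}"
    | n where "s < \<mu>" "steps s \<mu> (\<Delta> + s) n" "chain s \<mu> 1 (s + 1) 3 n \<or> chain s \<mu> 2 s 3 n"
       "s = 1 \<longrightarrow> chain 1 \<mu> 1 2 3 n \<or> chain 1 \<mu> 2 1 (if \<mu> = 2 then 7 else 5) n"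
    using dichotomy[OF e0 \<phi>0] by blast
  then show ?thesis
  proof cases
    case 1
    have WV: "W \<subseteq> V" using 1(1) e2 EsE by blast
    have "card {g\<in>Es. ends g \<subseteq> W} \<le> card {g\<in>E. ends g \<subseteq> W}" using fin(2) EsE by (intro card_mono) auto
    then have "(q - 1) * (card W div 2) + 1 \<le> card {g\<in>E. ends g \<subseteq> W}" using 1(4) s(2) by simp
    then have "density V E ends = int q" using 1(3) s(2) by (intro density_eqI[OF G c WV]) simp_all
    then show ?thesis by (simp add: elementary_def q_def)
  next
    case 2
    have "real s + 1 < min (2 * sqrt (real \<mu> * (ln (ln (real \<Delta> / 2)) + ln (2 * real \<mu>)))) (root 3 (real \<mu> * ln (real \<Delta> / 2)))"
      using numeric_bound[OF 2(2) s(1) 2(1,3)] 2(4) by blast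
    moreover have "real q \<ge> real \<Delta> + min (2 * sqrt (real \<mu> * (ln (ln (real \<Delta> / 2)) + ln (2 * real \<mu>)))) (root 3 (real \<mu> * ln (real \<Delta> / 2)))"
      using bound by (simp only: q_def \<Delta>_def \<mu>_def)
    moreover have "real q = real \<Delta> + (real s + 1)" using s(2) by simp
    ultimately show ?thesis by linarith
  qed
qed

end
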